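(* Let $s\in(0,1)$, $\mathsf d\in(0,\pi)$, $k>0$ and let $N^-,N^+$ be positive integers. Suppose $\theta\in\widetilde H^s(D)$ and $\eta\in\widetilde H^\delta(D)$ with $\delta\in(s,2-s]$. Then $$\begin{aligned}|a(\eta,\theta)-a^k(\eta,\theta)|\le{}&\frac{2c(\mathsf d)}{\delta-s}\left(\frac{2}{e^{2\pi\mathsf d/k}-1}+e^{(s-\delta)N^+k/2}\right)\|\eta\|_{\widetilde H^\delta(D)}\|\theta\|_{\widetilde H^s(D)}\\&+\frac{c(\mathsf d)}{s}\left(\frac{2}{e^{2\pi\mathsf d/k}-1}+e^{-sN^-k}\right)\|\eta\|_{L^2(D)}\|\theta\|_{L^2(D)},\end{aligned}$$ where $c(\mathsf d):=\dfrac{1}{\sqrt{(1+\cos\mathsf d)/2}}$.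
   Context: $D\subset\mathbb R^d$ is a bounded polygonal domain with Lipschitz boundary; $\widetilde\eta$ denotes the extension by zero to $\mathbb R^d$ of a function $\eta$ on $D$; $(\cdot,\cdot)_D$ is the $L^2(D)$ inner product. $\mathcal F$ is the unitary Fourier transform, $\mathcal F((-\Delta)^\sigma f)(\zeta)=|\zeta|^{2\sigma}\mathcal F(f)(\zeta)$, and $H^r(\mathbb R^d)$ has norm $\big(\int(1+|\zeta|^2)^r|\mathcal F f(\zeta)|^2d\zeta\big)^{1/2}$. For $r\in(0,2)$, $\widetilde H^r(D)$ is the set of functions on $D$ whose extension by zero is in $H^r(\mathbb R^d)$. For $r\in[1,2)$ its norm is $\|\phi\|_{\widetilde H^r(D)}=\|\widetilde\phi\|_{H^r(\mathbb R^d)}$; for $r\in(0,1)$ its norm is $$\|\phi\|_{\widetilde H^r(D)}=\Big(\frac{c_{d,r}}2\int_{\mathbb R^d}\int_{\mathbb R^d}\frac{(\widetilde\phi(x)-\widetilde\phi(y))^2}{|x-y|^{d+2r}}\,dx\,dy\Big)^{1/2}=\|(-\Delta)^{r/2}\widetilde\phi\|_{L^2(\mathbb R^d)},$$ where $c_{d,r}$ is the normalization constant in $(-\Delta)^r\eta(x)=c_{d,r}\,\mathrm{PV}\!\int_{\mathbb R^d}\frac{\eta(x)-\eta(y)}{|x-y|^{d+2r}}dy$ for Schwartz functions $\eta$. The bilinear form is $a(\eta,\theta)=\int_{\mathbb R^d}[(-\Delta)^{s/2}\widetilde\eta][(-\Delta)^{s/2}\widetilde\theta]\,dx$ for $\eta,\theta\in\widetilde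 H^s(D)$. For $\psi\in L^2(\mathbb R^d)$ and $t>0$, $w(\psi,t):=-t^2\Delta(I-t^2\Delta)^{-1}\psi$. With $c_s=2\sin(\pi s)/\pi$, $y_j=jk$ and $t_j=e^{-y_j/2}$, the sinc quadrature approximation is $$a^k(\eta,\theta):=\frac{c_sk}{2}\sum_{j=-N^-}^{N^+}e^{sy_j}(w(\widetilde\eta,t_j),\theta)_D.$$ *)

theory Defs
  imports "HOL-Analysis.Analysis"
begin

text \<open>
  The space is an arbitrary Euclidean space \<^typ>\<open>'a::euclidean_space\<close> of dimension
  \<open>DIM('a)\<close>. Functions in the Sobolev spaces are real-valued; complex values occur only on
  the Fourier side. Elements of $L^2$ are Lebesgue measurable functions, taken modulo equality
  almost everywhere.
\<close>

section \<open>Domains\<close>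

text \<open>
  Near each boundary point, in coordinates split into the direction \<open>u\<close> and its orthogonal
  complement, the set is the strict epigraph of a Lipschitz function \<open>g\<close>.
\<close>

definition lipschitz_boundary :: "'a::euclidean_space set \<Rightarrow> bool" where
  "lipschitz_boundary D \<longleftrightarrow>
     (\<forall>p\<in>frontier D. \<exists>u L g U. norm u = 1 \<and> L-lipschitz_on {v. u \<bullet> v = 0} (g :: 'a \<Rightarrow> real) \<and>
        open U \<and> p \<in> U \<and> D \<inter> U = {x\<in>U. g (x - (x \<bullet> u) *\<^sub>R u) < x \<bullet> u})"

definition polygonal_lipschitz_domain :: "'a::euclidean_space set \<Rightarrow> bool" where
  "polygonal_lipschitz_domain D \<longleftrightarrow>
     open D \<and> connected D \<and> D \<noteq> {} \<and> bounded D \<and>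
     (\<exists>P. finite P \<and> (\<forall>p\<in>P. polytope p) \<and> closure D = \<Union>P) \<and>
     lipschitz_boundary D"

section \<open>Fourier transform and fractional Laplacian\<close>

definition square_integrable :: "('a::euclidean_space \<Rightarrow> 'b::real_normed_vector) \<Rightarrow> bool" where
  "square_integrable f \<longleftrightarrow>
     f \<in> borel_measurable lebesgue \<and> integrable lebesgue (\<lambda>x. (norm (f x))\<^sup>2)"

definition fourier_integral :: "('a::euclidean_space \<Rightarrow> complex) \<Rightarrow> 'a \<Rightarrow> complex" where
  "fourier_integral f \<zeta> =
     (2 * pi) powr (- real DIM('a) / 2) *\<^sub>R (LINT x|lebesgue. f x * cis (- (x \<bullet> \<zeta>)))"

text \<open>
  The unitary transform on $L^2$: the $L^2$ limit of the Fourier integrals over balls. The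
  limit is stated with the nonnegative integral, so that the difference being square integrable
  in the limit is part of the condition.
\<close>

definition is_fourier_transform ::
    "('a::euclidean_space \<Rightarrow> complex) \<Rightarrow> ('a \<Rightarrow> complex) \<Rightarrow> bool" where
  "is_fourier_transform f g \<longleftrightarrow> square_integrable g \<and>
     (\<lambda>n::nat. \<integral>\<^sup>+ \<zeta>. ennreal ((norm (g \<zeta> -
          fourier_integral (\<lambda>x. if norm x \<le> real n then f x else 0) \<zeta>))\<^sup>2) \<partial>lebesgue)
       \<longlonglongrightarrow> 0"

definition fourier :: "('a::euclidean_space \<Rightarrow> complex) \<Rightarrow> 'a \<Rightarrow> complex" where
  "fourier f = (SOME g. is_fourier_transform f g)"

abbreviation fourier_of_real :: "('a::euclidean_space \<Rightarrow> real) \<Rightarrow> 'a \<Rightarrow> complex" where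
  "fourier_of_real f \<equiv> fourier (\<lambda>x. complex_of_real (f x))"

text \<open>The operator $(-\Delta)^\sigma$; its value is determined up to a null set.\<close>

definition frac_laplacian :: "real \<Rightarrow> ('a::euclidean_space \<Rightarrow> real) \<Rightarrow> 'a \<Rightarrow> real" where
  "frac_laplacian \<sigma> f =
     (SOME g. square_integrable g \<and>
        (AE \<zeta> in lebesgue. fourier_of_real g \<zeta> =
            complex_of_real (norm \<zeta> powr (2 * \<sigma>)) * fourier_of_real f \<zeta>))"

section \<open>Sobolev spaces\<close>

definition sobolev :: "real \<Rightarrow> ('a::euclidean_space \<Rightarrow> real) set" where
  "sobolev r = {f. square_integrable f \<and>
     integrable lebesgue (\<lambda>\<zeta>. (1 + (norm \<zeta>)\<^sup>2) powr r * (norm (fourier_of_real f \<zeta>))\<^sup>2)}"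

definition sobolev_norm :: "real \<Rightarrow> ('a::euclidean_space \<Rightarrow> real) \<Rightarrow> real" where
  "sobolev_norm r f =
     sqrt (LINT \<zeta>|lebesgue. (1 + (norm \<zeta>)\<^sup>2) powr r * (norm (fourier_of_real f \<zeta>))\<^sup>2)"

text \<open>
  A function on \<open>D\<close> is represented by a total function whose values outside \<open>D\<close> are irrelevant.
\<close>

definition zero_ext :: "'a set \<Rightarrow> ('a \<Rightarrow> real) \<Rightarrow> 'a \<Rightarrow> real" where
  "zero_ext D f x = (if x \<in> D then f x else 0)"

definition inner_on :: "'a::euclidean_space set \<Rightarrow> ('a \<Rightarrow> real) \<Rightarrow> ('a \<Rightarrow> real) \<Rightarrow> real" where
  "inner_on D f g = (LINT x:D|lebesgue. f x * g x)"

definition norm_on :: "'a::euclidean_space set \<Rightarrow> ('a \<Rightarrow> real) \<Rightarrow> real" where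
  "norm_on D f = sqrt (inner_on D f f)"

text \<open>
  Schwartz functions: all iterated partial derivatives exist, are differentiable and decay
  faster than any power.
\<close>

definition partial_derivs :: "'a::euclidean_space list \<Rightarrow> ('a \<Rightarrow> real) \<Rightarrow> 'a \<Rightarrow> real" where
  "partial_derivs bs f = foldr (\<lambda>b g x. frechet_derivative g (at x) b) bs f"

definition schwartz :: "('a::euclidean_space \<Rightarrow> real) \<Rightarrow> bool" where
  "schwartz f \<longleftrightarrow> (\<forall>bs\<in>lists Basis.
     (\<forall>x. partial_derivs bs f differentiable (at x)) \<and>
     (\<forall>N::nat. bounded (range (\<lambda>x. norm x ^ N * partial_derivs bs f x))))"

text \<open>
  The constant $c_{d,r}$ for which $(-\Delta)^r\eta$ is $c_{d,r}$ times the principal value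
  integral. Equality holds almost everywhere because \<^const>\<open>frac_laplacian\<close> is determined only
  up to a null set. The type argument carries the dimension.
\<close>

definition frac_laplacian_const :: "'a::euclidean_space itself \<Rightarrow> real \<Rightarrow> real" where
  "frac_laplacian_const _ r =
     (THE c. \<forall>\<eta> :: 'a \<Rightarrow> real. schwartz \<eta> \<longrightarrow>
        (AE x in lebesgue. \<exists>pv.
           ((\<lambda>\<epsilon>. LINT y:{y. \<epsilon> < dist x y}|lebesgue.
               (\<eta> x - \<eta> y) / dist x y powr (real DIM('a) + 2 * r)) \<longlongrightarrow> pv) (at_right 0) \<and>
           frac_laplacian r \<eta> x = c * pv))"

definition tilde_sobolev :: "'a::euclidean_space set \<Rightarrow> real \<Rightarrow> ('a \<Rightarrow> real) set" where
  "tilde_sobolev D r = {\<phi>. zero_ext D \<phi> \<in> sobolev r}"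

definition tilde_sobolev_norm :: "'a::euclidean_space set \<Rightarrow> real \<Rightarrow> ('a \<Rightarrow> real) \<Rightarrow> real" where
  "tilde_sobolev_norm D r \<phi> =
     (if r < 1 then
        sqrt (frac_laplacian_const TYPE('a) r / 2 *
          (LINT y|lebesgue. LINT x|lebesgue.
             (zero_ext D \<phi> x - zero_ext D \<phi> y)\<^sup>2 / dist x y powr (real DIM('a) + 2 * r)))
      else sobolev_norm r (zero_ext D \<phi>))"

section \<open>The bilinear form and its sinc quadrature approximation\<close>

definition bilinear_form ::
    "'a::euclidean_space set \<Rightarrow> real \<Rightarrow> ('a \<Rightarrow> real) \<Rightarrow> ('a \<Rightarrow> real) \<Rightarrow> real" where
  "bilinear_form D s \<eta> \<theta> =
     (LINT x|lebesgue. frac_laplacian (s / 2) (zero_ext D \<eta>) x *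
                       frac_laplacian (s / 2) (zero_ext D \<theta>) x)"

text \<open>Here $-\Delta$ is \<^term>\<open>frac_laplacian 1\<close>, with domain $H^2$.\<close>

definition resolvent :: "real \<Rightarrow> ('a::euclidean_space \<Rightarrow> real) \<Rightarrow> 'a \<Rightarrow> real" where
  "resolvent t \<psi> =
     (SOME v. v \<in> sobolev 2 \<and> (AE x in lebesgue. v x + t\<^sup>2 * frac_laplacian 1 v x = \<psi> x))"

definition w_fun :: "('a::euclidean_space \<Rightarrow> real) \<Rightarrow> real \<Rightarrow> 'a \<Rightarrow> real" where
  "w_fun \<psi> t x = t\<^sup>2 * frac_laplacian 1 (resolvent t \<psi>) x"

definition sinc_form ::
    "'a::euclidean_space set \<Rightarrow> real \<Rightarrow> real \<Rightarrow> nat \<Rightarrow> nat \<Rightarrow> ('a \<Rightarrow> real) \<Rightarrow> ('a \<Rightarrow> real) \<Rightarrow> real"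
  where
  "sinc_form D s k Nm Np \<eta> \<theta> =
     (let c\<^sub>s = 2 * sin (pi * s) / pi in
      c\<^sub>s * k / 2 *
        (\<Sum>j = - int Nm..int Np.
           let y = real_of_int j * k; t = exp (- y / 2)
           in exp (s * y) * inner_on D (w_fun (zero_ext D \<eta>) t) \<theta>))"

definition strip_const :: "real \<Rightarrow> real" where
  "strip_const \<dd> = 1 / sqrt ((1 + cos \<dd>) / 2)"

end

theory Submission
  imports Defs "HOL-Probability.Probability" "HOL-Complex_Analysis.Complex_Analysis" "HOL-Real_Asymp.Real_Asymp"
begin

text \<open>
  By Plancherel's theorem both forms become integrals of \<open>Re (\<F>\<eta> \<cdot> cnj (\<F>\<theta>))\<close> against a multiplier.
  With \<open>l = |\<zeta>|\<^sup>2\<close>, Balakrishnan's formula writes \<open>l powr s\<close> as \<open>sin (\<pi> s) / \<pi>\<close> times the integral over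
  the real line of \<open>exp (s y) \<cdot> l / (exp y + l)\<close>, and the multiplier of the approximation is the
  truncated trapezoidal sum of the same integral. The integrand is holomorphic in the strip
  \<open>|Im y| < \<pi>\<close>; integration against a cotangent along the boundary of a narrower strip bounds the
  error of the infinite sum, and the truncated tails are geometric. Splitting the integrand at
  \<open>y = 0\<close> yields an error of the multiplier of at most \<open>B\<^sub>1 |\<zeta>| powr (s + \<delta>) + B\<^sub>2\<close>, and the Cauchy--Schwarz
  inequality gives the claim.

  For orders below \<open>1\<close> the norm is a Gagliardo seminorm. Its identification with the Fourier norm
  needs the normalization constant of the fractional Laplacian, whose existence and uniqueness
  are obtained by computing the principal value integral of Schwartz functions on the Fourier side.
\<close>

section \<open>Gaussian integrals\<close>

text \<open>The two lines of the bound come from two estimates of the integrand. With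
  \<open>l = |\<zeta>|\<^sup>2\<close> it is at most \<open>exp (s * y)\<close>, which bounds the
  left tail by a multiple of \<open>1 / s\<close>, and at most \<open>l powr ((s + \<delta>) / 2) *
  exp (- ((\<delta> - s) / 2 * y))\<close>, which bounds the right tail; the exponent
  \<open>(s + \<delta>) / 2\<close> must not exceed 1, the origin of
  \<open>\<delta> \<le> 2 - s\<close>. The untruncated sum errs by a multiple of
  \<open>l powr s\<close>, which lies below \<open>1 + l powr ((s + \<delta>) / 2)\<close>, so the
  same exponential term enters both brackets. The powers of \<open>|\<zeta>|\<close> stay
  homogeneous because the norms of order below 1 are homogeneous; every constant term is left to the
  \<open>L2\<close> norms.

  The definitions select the transform, the fractional Laplacian and the resolvent by Hilbert
  choice. Nothing can be said about a choice before a candidate exists, so Plancherel's identity,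
  the inversion of the transform and the reality of inverse transforms of Hermitian functions have
  to come first, and every identity for a chosen function holds only almost everywhere.\<close>

lemma borel_measurable_cis [measurable (raw)]:
  "f \<in> borel_measurable M \<Longrightarrow> (\<lambda>x. cis (f x)) \<in> borel_measurable M"
  by (rule borel_measurable_continuous_on[of cis]) (intro continuous_intros)

text \<open>Lebesgue measure on \<open>'a\<close> is the image of a product of real Lebesgue
  measures indexed by \<open>Basis\<close>, so integrals of products of one-variable functions
  factorize. This reduces the Gaussian integrals to dimension one.\<close>

lemma
  fixes h :: "'a::euclidean_space \<Rightarrow> real \<Rightarrow> complex"
  assumes h: "\<And>b. b \<in> Basis \<Longrightarrow> integrable lborel (h b)"
  shows integrable_prod_Basis: "integrable lborel (\<lambda>x::'a. \<Prod>b\<in>Basis. h b (x \<bullet> b))"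
    and integral_prod_Basis:
      "(LINT x|lborel. (\<Prod>b\<in>Basis. h b (x \<bullet> b))) = (\<Prod>b\<in>Basis. (LINT z|lborel. h b z))"
proof -
  interpret product_sigma_finite "\<lambda>_::'a. lborel::real measure" ..
  have m[measurable]: "h b \<in> borel_measurable borel" if "b \<in> Basis" for b
    using h[OF that] by (simp add: integrable_iff_bounded)
  have meas: "(\<lambda>x::'a. \<Prod>b\<in>Basis. h b (x \<bullet> b)) \<in> borel_measurable borel"
    by (intro borel_measurable_prod measurable_compose[OF _ m]) auto
  have meas2: "(\<lambda>f. \<Sum>b\<in>Basis. f b *\<^sub>R b) \<in> (\<Pi>\<^sub>M b\<in>Basis. lborel) \<rightarrow>\<^sub>M (borel :: 'a measure)"
    by measurable
  have eq: "(\<Prod>b\<in>Basis. h b ((\<Sum>b\<in>Basis. f b *\<^sub>R b) \<bullet> b)) = (\<Prod>b\<in>Basis. h b (f b))" for f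
    by (intro prod.cong refl) (simp add: inner_sum_left_Basis)
  show "integrable lborel (\<lambda>x::'a. \<Prod>b\<in>Basis. h b (x \<bullet> b))"
    unfolding lborel_eq[where 'a='a]
    by (subst integrable_distr_eq[OF meas2 meas]) (simp add: eq product_integrable_prod h)
  show "(LINT x|lborel. (\<Prod>b\<in>Basis. h b (x \<bullet> b))) = (\<Prod>b\<in>Basis. (LINT z|lborel. h b z))"
    unfolding lborel_eq[where 'a='a]
    by (subst integral_distr[OF meas2 meas]) (simp add: eq product_integral_prod h)
qed

text \<open>After rescaling by \<open>sqrt e\<close> this is the characteristic function of the
  standard normal distribution, which is known to be \<open>exp (- t\<^sup>2 / 2)\<close>.\<close>

lemma
  fixes e y :: real
  assumes e: "0 < e"
  shows integrable_gauss_cis_real: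
      "integrable lborel (\<lambda>z. complex_of_real (exp (- (e * z\<^sup>2 / 2))) * cis (y * z))"
    and integral_gauss_cis_real:
      "(LINT z|lborel. complex_of_real (exp (- (e * z\<^sup>2 / 2))) * cis (y * z))
        = complex_of_real (sqrt (2 * pi / e) * exp (- (y\<^sup>2 / (2 * e))))"
proof -
  define F where "F t z = complex_of_real (std_normal_density z) * cis (t * z)" for t z :: real
  have iF: "integrable lborel (F t)" for t
    unfolding F_def
    by (rule Bochner_Integration.integrable_bound[OF integrable_normal_density[of 1 0]])
       (auto simp: norm_mult)
  have F: "(LINT z|lborel. F t z) = exp (- t\<^sup>2 / 2)" for t
  proof -
    have "(LINT z|lborel. F t z) = char std_normal_distribution t"
      unfolding char_def F_def
      by (subst integral_density)
         (auto simp: scaleR_conv_of_real cis_conv_exp mult_ac intro!: Bochner_Integration.integral_cong)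
    then show ?thesis by (simp add: char_std_normal_distribution exp_of_real)
  qed
  have eq: "complex_of_real (exp (- (e * z\<^sup>2 / 2))) * cis (y * z)
      = sqrt (2 * pi) * F (y / sqrt e) (0 + sqrt e * z)" for z
  proof -
    have "(sqrt e * z)\<^sup>2 = e * z\<^sup>2" using e by (simp add: power_mult_distrib)
    then show ?thesis using e unfolding F_def std_normal_density_def by simp
  qed
  have se: "sqrt e \<noteq> 0" using e by simp
  show "integrable lborel (\<lambda>z. complex_of_real (exp (- (e * z\<^sup>2 / 2))) * cis (y * z))"
    unfolding eq using lborel_integrable_real_affine[OF iF[of "y / sqrt e"] se, of 0] by simp
  have "(LINT z|lborel. F (y / sqrt e) z) = sqrt e *\<^sub>R (LINT z|lborel. F (y / sqrt e) (0 + sqrt e * z))"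
    using lborel_integral_real_affine[OF se, of "F (y / sqrt e)" 0] e by simp
  then have "(LINT z|lborel. F (y / sqrt e) (0 + sqrt e * z)) = exp (- (y / sqrt e)\<^sup>2 / 2) / sqrt e"
    using e by (simp add: F scaleR_conv_of_real field_simps)
  then show "(LINT z|lborel. complex_of_real (exp (- (e * z\<^sup>2 / 2))) * cis (y * z))
        = complex_of_real (sqrt (2 * pi / e) * exp (- (y\<^sup>2 / (2 * e))))"
    unfolding eq using e
    by (simp add: real_sqrt_divide power_divide real_sqrt_mult mult_ac exp_of_real[symmetric])
qed

lemma prod_cis: "finite A \<Longrightarrow> (\<Prod>i\<in>A. cis (f i)) = cis (\<Sum>i\<in>A. f i)"
  by (induct A rule: finite_induct) (auto simp: cis_mult)

lemma norm_power2_eq_sum_Basis: "(norm (x::'a::euclidean_space))\<^sup>2 = (\<Sum>b\<in>Basis. (x \<bullet> b)\<^sup>2)"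
  by (subst power2_norm_eq_inner, subst euclidean_inner) (simp add: power2_eq_square)

lemma
  fixes y :: "'a::euclidean_space" and e :: real
  assumes e: "0 < e"
  shows integrable_gauss_cis:
      "integrable lborel (\<lambda>z::'a. complex_of_real (exp (- (e * (norm z)\<^sup>2 / 2))) * cis (y \<bullet> z))"
    and integral_gauss_cis:
      "(LINT z|lborel. complex_of_real (exp (- (e * (norm (z::'a))\<^sup>2 / 2))) * cis (y \<bullet> z))
        = complex_of_real (sqrt (2 * pi / e) ^ DIM('a) * exp (- ((norm y)\<^sup>2 / (2 * e))))"
proof -
  let ?h = "\<lambda>b z. complex_of_real (exp (- (e * z\<^sup>2 / 2))) * cis ((y \<bullet> b) * z)"
  have eq: "complex_of_real (exp (- (e * (norm z)\<^sup>2 / 2))) * cis (y \<bullet> z) = (\<Prod>b\<in>Basis. ?h b (z \<bullet> b))"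
    for z :: 'a
  proof -
    have "exp (- (e * (norm z)\<^sup>2 / 2)) = (\<Prod>b\<in>Basis. exp (- (e * (z \<bullet> b)\<^sup>2 / 2)))"
      by (simp add: norm_power2_eq_sum_Basis exp_sum[symmetric] sum_negf sum_divide_distrib sum_distrib_left)
    moreover have "cis (y \<bullet> z) = (\<Prod>b\<in>Basis. cis ((y \<bullet> b) * (z \<bullet> b)))"
      by (simp add: prod_cis euclidean_inner[of y z])
    ultimately show ?thesis by (simp add: prod.distrib)
  qed
  show "integrable lborel (\<lambda>z::'a. complex_of_real (exp (- (e * (norm z)\<^sup>2 / 2))) * cis (y \<bullet> z))"
    unfolding eq by (rule integrable_prod_Basis) (rule integrable_gauss_cis_real[OF e])
  have "(\<Prod>b\<in>Basis. sqrt (2 * pi / e) * exp (- ((y \<bullet> b)\<^sup>2 / (2 * e))))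
      = sqrt (2 * pi / e) ^ DIM('a) * exp (- ((norm y)\<^sup>2 / (2 * e)))"
    by (simp add: prod.distrib norm_power2_eq_sum_Basis exp_sum[symmetric] sum_negf sum_divide_distrib)
  then show "(LINT z|lborel. complex_of_real (exp (- (e * (norm (z::'a))\<^sup>2 / 2))) * cis (y \<bullet> z))
        = complex_of_real (sqrt (2 * pi / e) ^ DIM('a) * exp (- ((norm y)\<^sup>2 / (2 * e))))"
    unfolding eq
    by (subst integral_prod_Basis) (simp_all only: integrable_gauss_cis_real[OF e] integral_gauss_cis_real[OF
      e] flip: of_real_prod)
qed

lemma
  fixes e :: real
  assumes e: "0 < e"
  shows integrable_gauss: "integrable lborel (\<lambda>z::'a::euclidean_space. exp (- (e * (norm z)\<^sup>2 / 2)))"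
    and integral_gauss: "(LINT z|lborel. exp (- (e * (norm (z::'a))\<^sup>2 / 2))) = sqrt (2 * pi / e) ^ DIM('a)"
    and nn_integral_gauss: "(\<integral>\<^sup>+z. ennreal (exp (- (e * (norm (z::'a))\<^sup>2 / 2))) \<partial>lborel)
      = ennreal (sqrt (2 * pi / e) ^ DIM('a))"
proof -
  show i: "integrable lborel (\<lambda>z::'a. exp (- (e * (norm z)\<^sup>2 / 2)))"
    using integrable_Re[OF integrable_gauss_cis[OF e, of "0::'a"]] by simp
  have "complex_of_real (LINT z|lborel. exp (- (e * (norm (z::'a))\<^sup>2 / 2)))
    = complex_of_real (sqrt (2 * pi / e) ^ DIM('a))"
    using integral_gauss_cis[OF e, of "0::'a"] by (simp flip: integral_complex_of_real)
  then show j: "(LINT z|lborel. exp (- (e * (norm (z::'a))\<^sup>2 / 2))) = sqrt (2 * pi / e) ^ DIM('a)"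
    using of_real_eq_iff by blast
  show "(\<integral>\<^sup>+z. ennreal (exp (- (e * (norm (z::'a))\<^sup>2 / 2))) \<partial>lborel) = ennreal (sqrt (2 * pi / e) ^ DIM('a))"
    using nn_integral_eq_integral[OF i] j by simp
qed

section \<open>Square integrable functions\<close>

text \<open>The measure is a parameter because \<open>square_integrable\<close> speaks of
  \<open>lebesgue\<close>, whereas Tonelli's theorem is applied over \<open>lborel\<close>.\<close>

definition l2 :: "'a measure \<Rightarrow> ('a \<Rightarrow> 'b::real_normed_vector) \<Rightarrow> bool" where
  "l2 M f \<longleftrightarrow> f \<in> borel_measurable M \<and> integrable M (\<lambda>x. (norm (f x))\<^sup>2)"

definition nsq :: "'a measure \<Rightarrow> ('a \<Rightarrow> 'b::real_normed_vector) \<Rightarrow> real" where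
  "nsq M f = (LINT x|M. (norm (f x))\<^sup>2)"

lemma l2_measurable [measurable_dest]: "l2 M f \<Longrightarrow> f \<in> borel_measurable M"
  by (simp add: l2_def)

lemma nsq_nonneg [simp]: "0 \<le> nsq M f"
  by (simp add: nsq_def)

lemma l2I_nn_integral:
  assumes [measurable]: "f \<in> borel_measurable M"
    and "(\<integral>\<^sup>+x. ennreal ((norm (f x))\<^sup>2) \<partial>M) < \<infinity>"
  shows "l2 M f"
  using assms unfolding l2_def by (simp add: integrable_iff_bounded)

lemma nn_integral_nsq: "l2 M f \<Longrightarrow> (\<integral>\<^sup>+x. ennreal ((norm (f x))\<^sup>2) \<partial>M) = ennreal (nsq M f)"
  unfolding l2_def nsq_def by (intro nn_integral_eq_integral) auto

lemma norm_add_power2_le: "(norm (a + b))\<^sup>2 \<le> 2 * (norm a)\<^sup>2 + 2 * (norm b)\<^sup>2"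
  for a b :: "'b::real_normed_vector"
proof -
  have "(norm (a + b))\<^sup>2 \<le> (norm a + norm b)\<^sup>2"
    by (intro power_mono norm_triangle_ineq) auto
  also have "\<dots> \<le> 2 * (norm a)\<^sup>2 + 2 * (norm b)\<^sup>2"
    using sum_squares_ge_zero[of "norm a - norm b" 0] by (simp add: power2_eq_square algebra_simps)
  finally show ?thesis .
qed

lemma norm_diff_power2_le: "(norm (a - b))\<^sup>2 \<le> 2 * (norm a)\<^sup>2 + 2 * (norm b)\<^sup>2"
  for a b :: "'b::real_normed_vector"
  using norm_add_power2_le[of a "- b"] by simp

lemma l2_bound:
  fixes f :: "'a \<Rightarrow> 'b::real_normed_vector" and g :: "'a \<Rightarrow> 'c::real_normed_vector"
  assumes g: "l2 M g" and [measurable]: "f \<in> borel_measurable M"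
    and le: "AE x in M. norm (f x) \<le> norm (g x)"
  shows "l2 M f"
proof -
  have "integrable M (\<lambda>x. (norm (f x))\<^sup>2)"
    by (rule Bochner_Integration.integrable_bound[of M "\<lambda>x. (norm (g x))\<^sup>2"])
       (use g le in \<open>auto simp: l2_def power_mono elim!: eventually_mono\<close>)
  then show ?thesis by (simp add: l2_def)
qed

lemma l2_zero [simp]: "l2 M (\<lambda>x. 0)"
  by (simp add: l2_def)

lemma l2_cnj: "l2 M f \<Longrightarrow> l2 M (\<lambda>x. cnj (f x))"
  unfolding l2_def by (auto intro: borel_measurable_continuous_on[of cnj] continuous_intros)

lemma l2_scale: "l2 M f \<Longrightarrow> l2 M (\<lambda>x. c * f x)"
  for f :: "'a \<Rightarrow> 'b::{real_normed_field, second_countable_topology}"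
  unfolding l2_def by (auto simp: norm_mult power_mult_distrib)

lemma nsq_scale: "nsq M (\<lambda>x. c * f x) = (norm c)\<^sup>2 * nsq M f"
  for f :: "'a \<Rightarrow> 'b::{real_normed_field, second_countable_topology}"
  unfolding nsq_def by (simp add: norm_mult power_mult_distrib)

context
  fixes f g :: "'a \<Rightarrow> 'b::{real_normed_vector, second_countable_topology}" and M
  assumes f: "l2 M f" and g: "l2 M g"
begin

lemma l2_add: "l2 M (\<lambda>x. f x + g x)"
proof -
  have [measurable]: "f \<in> borel_measurable M" "g \<in> borel_measurable M" using f g by (auto simp: l2_def)
  have "integrable M (\<lambda>x. (norm (f x + g x))\<^sup>2)"
    by (rule Bochner_Integration.integrable_bound[of M "\<lambda>x. 2 * (norm (f x))\<^sup>2 + 2 * (norm (g x))\<^sup>2"])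
       (use f g in \<open>auto simp: l2_def norm_add_power2_le\<close>)
  then show ?thesis by (simp add: l2_def)
qed

lemma l2_diff: "l2 M (\<lambda>x. f x - g x)"
proof -
  have [measurable]: "f \<in> borel_measurable M" "g \<in> borel_measurable M" using f g by (auto simp: l2_def)
  have "integrable M (\<lambda>x. (norm (f x - g x))\<^sup>2)"
    by (rule Bochner_Integration.integrable_bound[of M "\<lambda>x. 2 * (norm (f x))\<^sup>2 + 2 * (norm (g x))\<^sup>2"])
       (use f g in \<open>auto simp: l2_def norm_diff_power2_le\<close>)
  then show ?thesis by (simp add: l2_def)
qed

lemma nsq_add_le: "nsq M (\<lambda>x. f x + g x) \<le> 2 * nsq M f + 2 * nsq M g"
proof -
  have "nsq M (\<lambda>x. f x + g x) \<le> (LINT x|M. 2 * (norm (f x))\<^sup>2 + 2 * (norm (g x))\<^sup>2)"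
    unfolding nsq_def
    by (intro integral_mono norm_add_power2_le) (use f g l2_add in \<open>auto simp: l2_def\<close>)
  also have "\<dots> = 2 * nsq M f + 2 * nsq M g"
    using f g by (simp add: l2_def nsq_def)
  finally show ?thesis .
qed

lemma nsq_diff_le: "nsq M (\<lambda>x. f x - g x) \<le> 2 * nsq M f + 2 * nsq M g"
proof -
  have "nsq M (\<lambda>x. f x - g x) \<le> (LINT x|M. 2 * (norm (f x))\<^sup>2 + 2 * (norm (g x))\<^sup>2)"
    unfolding nsq_def
    by (intro integral_mono norm_diff_power2_le) (use f g l2_diff in \<open>auto simp: l2_def\<close>)
  also have "\<dots> = 2 * nsq M f + 2 * nsq M g"
    using f g by (simp add: l2_def nsq_def)
  finally show ?thesis .
qed

end

context
  fixes f g :: "'a \<Rightarrow> 'b::{real_normed_field, banach, second_countable_topology}" and M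
  assumes f: "l2 M f" and g: "l2 M g"
begin

lemma integrable_l2_mult: "integrable M (\<lambda>x. f x * g x)"
proof -
  have [measurable]: "f \<in> borel_measurable M" "g \<in> borel_measurable M" using f g by (auto simp: l2_def)
  have le: "norm (a * b) \<le> (norm a)\<^sup>2 + (norm b)\<^sup>2" for a b :: 'b
    using sum_squares_bound[of "norm a" "norm b"] mult_nonneg_nonneg[of "norm a" "norm b", OF norm_ge_zero
      norm_ge_zero]
    unfolding norm_mult by linarith
  show ?thesis
    by (rule Bochner_Integration.integrable_bound[of M "\<lambda>x. (norm (f x))\<^sup>2 + (norm (g x))\<^sup>2"])
       (use f g le in \<open>auto simp: l2_def\<close>)
qed

lemma integral_norm_mult_le: "(LINT x|M. norm (f x) * norm (g x)) \<le> sqrt (nsq M f) * sqrt (nsq M g)"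
proof -
  have [measurable]: "f \<in> borel_measurable M" "g \<in> borel_measurable M" using f g by (auto simp: l2_def)
  have i: "integrable M (\<lambda>x. norm (f x) * norm (g x))"
    using integrable_norm[OF integrable_l2_mult] by (simp add: norm_mult)
  have "(\<integral>\<^sup>+x. ennreal (norm (f x)) * ennreal (norm (g x)) \<partial>M)\<^sup>2
      \<le> (\<integral>\<^sup>+x. ennreal (norm (f x)) ^ 2 \<partial>M) * (\<integral>\<^sup>+x. ennreal (norm (g x)) ^ 2 \<partial>M)"
    by (rule Cauchy_Schwarz_nn_integral) auto
  also have "(\<integral>\<^sup>+x. ennreal (norm (f x)) * ennreal (norm (g x)) \<partial>M)
    = ennreal (LINT x|M. norm (f x) * norm (g x))"
    using i by (subst nn_integral_eq_integral[symmetric]) (auto simp: ennreal_mult)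
  finally have "ennreal ((LINT x|M. norm (f x) * norm (g x))\<^sup>2) \<le> ennreal (nsq M f * nsq M g)"
    using f g by (simp add: ennreal_power nn_integral_nsq ennreal_mult integral_nonneg_AE)
  then have "(LINT x|M. norm (f x) * norm (g x))\<^sup>2 \<le> nsq M f * nsq M g"
    by (subst (asm) ennreal_le_iff) auto
  then show ?thesis
    by (metis real_sqrt_le_mono real_sqrt_mult real_sqrt_abs abs_le_D1)
qed

end

lemma nsq_parallelogram:
  fixes f g :: "'a \<Rightarrow> complex"
  assumes f: "l2 M f" and g: "l2 M g"
  shows "nsq M (\<lambda>x. f x + g x) + nsq M (\<lambda>x. f x - g x) = 2 * nsq M f + 2 * nsq M g"
proof -
  have "nsq M (\<lambda>x. f x + g x) + nsq M (\<lambda>x. f x - g x)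
      = (LINT x|M. (norm (f x + g x))\<^sup>2 + (norm (f x - g x))\<^sup>2)"
    using l2_add[OF f g] l2_diff[OF f g] by (simp add: l2_def nsq_def)
  also have "\<dots> = (LINT x|M. 2 * (norm (f x))\<^sup>2 + 2 * (norm (g x))\<^sup>2)"
    by (intro Bochner_Integration.integral_cong refl) (simp add: cmod_power2, simp add: power2_eq_square
      algebra_simps)
  also have "\<dots> = 2 * nsq M f + 2 * nsq M g"
    using f g by (simp add: l2_def nsq_def)
  finally show ?thesis .
qed

lemma nsq_cong_AE:
  assumes "f \<in> borel_measurable M" "g \<in> borel_measurable M" "AE x in M. f x = g x"
  shows "nsq M f = nsq M g"
  unfolding nsq_def using assms by (intro integral_cong_AE) auto

lemma nsq_eq_0_iff: "l2 M f \<Longrightarrow> nsq M f = 0 \<longleftrightarrow> (AE x in M. f x = 0)"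
  unfolding nsq_def l2_def by (subst integral_nonneg_eq_0_iff_AE) auto

lemma LIMSEQ_sqrt_mult_0:
  assumes "X \<longlonglongrightarrow> 0"
  shows "(\<lambda>n. sqrt (X n) * c) \<longlonglongrightarrow> 0"
  using tendsto_mult[OF tendsto_real_sqrt[OF assms] tendsto_const[of c]] by simp

lemma tendsto_integral_l2_mult:
  fixes f g :: "'a \<Rightarrow> 'b::{real_normed_field, banach, second_countable_topology}"
  assumes fn: "\<And>n::nat. l2 M (F n)" and f: "l2 M f" and g: "l2 M g"
    and lim: "(\<lambda>n. nsq M (\<lambda>x. F n x - f x)) \<longlonglongrightarrow> 0"
  shows "(\<lambda>n. LINT x|M. F n x * g x) \<longlonglongrightarrow> (LINT x|M. f x * g x)"
proof (rule Lim_null[THEN iffD2], rule Lim_null_comparison)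
  show "\<forall>\<^sub>F n in sequentially. norm ((LINT x|M. F n x * g x) - (LINT x|M. f x * g x))
      \<le> sqrt (nsq M (\<lambda>x. F n x - f x)) * sqrt (nsq M g)"
  proof (intro always_eventually allI)
    fix n
    have "norm ((LINT x|M. F n x * g x) - (LINT x|M. f x * g x)) = norm (LINT x|M. (F n x - f x) * g x)"
      by (simp add: integrable_l2_mult fn f g left_diff_distrib)
    also have "\<dots> \<le> (LINT x|M. norm (F n x - f x) * norm (g x))"
      using integral_norm_bound[of M "\<lambda>x. (F n x - f x) * g x"] by (simp add: norm_mult)
    also have "\<dots> \<le> sqrt (nsq M (\<lambda>x. F n x - f x)) * sqrt (nsq M g)"
      by (intro integral_norm_mult_le l2_diff fn f g)
    finally show "norm ((LINT x|M. F n x * g x) - (LINT x|M. f x * g x))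
      \<le> sqrt (nsq M (\<lambda>x. F n x - f x)) * sqrt (nsq M g)" .
  qed
  show "(\<lambda>n. sqrt (nsq M (\<lambda>x. F n x - f x)) * sqrt (nsq M g)) \<longlonglongrightarrow> 0"
    by (rule LIMSEQ_sqrt_mult_0[OF lim])
qed

lemma sqrt_nsq_triangle:
  fixes f g :: "'a \<Rightarrow> complex"
  assumes f: "l2 M f" and g: "l2 M g"
  shows "sqrt (nsq M (\<lambda>x. f x + g x)) \<le> sqrt (nsq M f) + sqrt (nsq M g)"
proof (rule real_le_lsqrt)
  have i: "integrable M (\<lambda>x. (norm (f x))\<^sup>2)" "integrable M (\<lambda>x. (norm (g x))\<^sup>2)"
    "integrable M (\<lambda>x. norm (f x) * norm (g x))"
    using f g integrable_norm[OF integrable_l2_mult[OF f g]] by (auto simp: l2_def norm_mult)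
  have "nsq M (\<lambda>x. f x + g x) \<le> (LINT x|M. (norm (f x))\<^sup>2 + (norm (g x))\<^sup>2 + 2 * (norm (f x) * norm (g x)))"
    unfolding nsq_def
  proof (intro integral_mono)
    show "(cmod (f x + g x))\<^sup>2 \<le> (cmod (f x))\<^sup>2 + (cmod (g x))\<^sup>2 + 2 * (cmod (f x) * cmod (g x))" for x
      using power_mono[OF norm_triangle_ineq[of "f x" "g x"] norm_ge_zero, of 2]
      by (simp add: power2_sum mult_ac)
  qed (use l2_add[OF f g] i in \<open>auto simp: l2_def\<close>)
  also have "\<dots> = nsq M f + nsq M g + 2 * (LINT x|M. norm (f x) * norm (g x))"
    using i by (simp add: nsq_def)
  also have "\<dots> \<le> nsq M f + nsq M g + 2 * (sqrt (nsq M f) * sqrt (nsq M g))"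
    using integral_norm_mult_le[OF f g] by simp
  also have "\<dots> = (sqrt (nsq M f) + sqrt (nsq M g))\<^sup>2"
    by (simp add: power2_sum)
  finally show "nsq M (\<lambda>x. f x + g x) \<le> (sqrt (nsq M f) + sqrt (nsq M g))\<^sup>2" .
qed auto

lemma tendsto_nsq:
  fixes f :: "'a \<Rightarrow> complex"
  assumes fn: "\<And>n::nat. l2 M (F n)" and f: "l2 M f"
    and lim: "(\<lambda>n. nsq M (\<lambda>x. F n x - f x)) \<longlonglongrightarrow> 0"
  shows "(\<lambda>n. nsq M (F n)) \<longlonglongrightarrow> nsq M f"
proof -
  have "(\<lambda>n. sqrt (nsq M (F n))) \<longlonglongrightarrow> sqrt (nsq M f)"
  proof (rule Lim_null[THEN iffD2], rule Lim_null_comparison)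
    show "\<forall>\<^sub>F n in sequentially. norm (sqrt (nsq M (F n)) - sqrt (nsq M f)) \<le> sqrt (nsq M (\<lambda>x. F n x - f x))"
    proof (intro always_eventually allI)
      fix n
      have "sqrt (nsq M (F n)) \<le> sqrt (nsq M f) + sqrt (nsq M (\<lambda>x. F n x - f x))"
        using sqrt_nsq_triangle[OF f l2_diff[OF fn f], of n] by simp
      moreover have "sqrt (nsq M f) \<le> sqrt (nsq M (F n)) + sqrt (nsq M (\<lambda>x. f x - F n x))"
        using sqrt_nsq_triangle[OF fn l2_diff[OF f fn], of n n] by simp
      ultimately show "norm (sqrt (nsq M (F n)) - sqrt (nsq M f)) \<le> sqrt (nsq M (\<lambda>x. F n x - f x))"
        by (simp add: nsq_def norm_minus_commute)
    qed
    show "(\<lambda>n. sqrt (nsq M (\<lambda>x. F n x - f x))) \<longlonglongrightarrow> 0"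
      using LIMSEQ_sqrt_mult_0[OF lim, of 1] by simp
  qed
  from tendsto_power[OF this, of 2] show ?thesis by simp
qed

lemma nsq_tendsto_0_dominated:
  fixes f :: "'a \<Rightarrow> complex"
  assumes g: "l2 M (g :: 'a \<Rightarrow> complex)" and [measurable]: "\<And>n::nat. F n \<in> borel_measurable M"
    and le: "\<And>n. AE x in M. norm (F n x) \<le> norm (g x)"
    and lim: "AE x in M. (\<lambda>n. F n x) \<longlonglongrightarrow> 0"
  shows "(\<lambda>n. nsq M (F n)) \<longlonglongrightarrow> 0"
proof -
  have "(\<lambda>n. LINT x|M. (norm (F n x))\<^sup>2) \<longlonglongrightarrow> (LINT x|M. 0)"
  proof (rule integral_dominated_convergence[where w="\<lambda>x. (norm (g x))\<^sup>2"])
    show "AE x in M. (\<lambda>n. (norm (F n x))\<^sup>2) \<longlonglongrightarrow> 0"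
      using lim by eventually_elim (auto intro: tendsto_eq_intros)
    show "AE x in M. norm ((norm (F n x))\<^sup>2) \<le> (norm (g x))\<^sup>2" for n
      using le[of n] by eventually_elim (auto intro: power_mono)
  qed (use g in \<open>auto simp: l2_def\<close>)
  then show ?thesis by (simp add: nsq_def)
qed

section \<open>Completeness of the space of square integrable functions\<close>

text \<open>
  Riesz--Fischer for a rapidly converging sequence: the weights \<open>2 ^ n\<close> make the increments
  pointwise summable almost everywhere.
\<close>

lemma l2_complete_fast:
  fixes F :: "nat \<Rightarrow> 'a \<Rightarrow> complex"
  assumes F: "\<And>n. l2 M (F n)"
    and fast: "\<And>n m. n \<le> m \<Longrightarrow> nsq M (\<lambda>x. F m x - F n x) \<le> (1/4) ^ n"
  obtains f where "l2 M f" "\<And>n. nsq M (\<lambda>x. F n x - f x) \<le> (1/4) ^ n"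
proof -
  have [measurable]: "F n \<in> borel_measurable M" for n using F by (simp add: l2_def)
  let ?d = "\<lambda>n x. (norm (F (Suc n) x - F n x))\<^sup>2"
  have "(\<integral>\<^sup>+x. (\<Sum>n. ennreal (2 ^ n * ?d n x)) \<partial>M) = (\<Sum>n. \<integral>\<^sup>+x. ennreal (2 ^ n * ?d n x) \<partial>M)"
    by (rule nn_integral_suminf) auto
  also have "\<dots> = (\<Sum>n. ennreal (2 ^ n * nsq M (\<lambda>x. F (Suc n) x - F n x)))"
    by (simp add: ennreal_mult nn_integral_cmult nn_integral_nsq[OF l2_diff[OF F F]])
  also have "\<dots> \<le> (\<Sum>n. ennreal ((1/2) ^ n))"
  proof (intro suminf_le ennreal_leI)
    fix n
    have "2 ^ n * nsq M (\<lambda>x. F (Suc n) x - F n x) \<le> 2 ^ n * (1/4) ^ n"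
      using fast[of n "Suc n"] by (intro mult_left_mono) auto
    also have "\<dots> = (1/2) ^ n" by (simp add: power_mult_distrib[symmetric])
    finally show "2 ^ n * nsq M (\<lambda>x. F (Suc n) x - F n x) \<le> (1/2) ^ n" .
  qed auto
  also have "\<dots> < \<infinity>"
    using summable_geometric[of "1/2::real"] by (simp add: suminf_ennreal2 less_top[symmetric])
  finally have "AE x in M. (\<Sum>n. ennreal (2 ^ n * ?d n x)) \<noteq> \<infinity>"
    by (intro nn_integral_PInf_AE) auto
  then have conv: "AE x in M. convergent (\<lambda>n. F n x)"
  proof eventually_elim
    case (elim x)
    have sm: "summable (\<lambda>n. 2 ^ n * ?d n x)"
      using elim by (intro summable_suminf_not_top) auto
    have "summable (\<lambda>n. norm (F (Suc n) x - F n x))"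
    proof (rule summable_comparison_test')
      show "summable (\<lambda>n. 2 ^ n * ?d n x + (1/2) ^ n)"
        by (intro summable_add sm summable_geometric) auto
      fix n :: nat
      let ?a = "norm (F (Suc n) x - F n x)"
      \<comment> \<open>The arithmetic-geometric mean inequality trades the weighted square for the
        increment itself: the weight \<open>2 ^ n\<close> and the remainder \<open>(1/2) ^ n\<close>
        multiply to 1.\<close>
      have "0 \<le> (sqrt (2 ^ n) * ?a - sqrt ((1/2) ^ n))\<^sup>2" by simp
      also have "\<dots> = 2 ^ n * ?a\<^sup>2 + (1/2)^n - 2 * ?a * (sqrt (2 ^ n) * sqrt ((1/2)^n))"
        by (simp add: power2_diff power_mult_distrib)
      also have "sqrt (2 ^ n) * sqrt ((1/2)^n) = (1::real)"
        by (simp add: real_sqrt_mult[symmetric] power_mult_distrib[symmetric])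
      finally have "2 * ?a \<le> 2 ^ n * ?a\<^sup>2 + (1/2) ^ n" by simp
      then show "norm (norm (F (Suc n) x - F n x)) \<le> 2 ^ n * ?d n x + (1/2) ^ n"
        using norm_ge_zero[of "F (Suc n) x - F n x"] unfolding real_norm_def abs_norm_cancel by linarith
    qed
    then have "summable (\<lambda>n. F (Suc n) x - F n x)"
      by (rule summable_norm_cancel)
    then have "convergent (\<lambda>n. \<Sum>i<n. F (Suc i) x - F i x)"
      by (simp add: summable_iff_convergent)
    then have "convergent (\<lambda>n. F n x - F 0 x)"
      by (simp only: sum_lessThan_telescope[of "\<lambda>n. F n x"])
    then show "convergent (\<lambda>n. F n x)"
      using convergent_diff_const_right_iff by blast
  qed
  define f where "f x = lim (\<lambda>n. F n x)" for x
  have [measurable]: "f \<in> borel_measurable M" unfolding f_def by measurable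
  have lim: "AE x in M. (\<lambda>n. F n x) \<longlonglongrightarrow> f x"
    using conv by eventually_elim (simp add: f_def convergent_LIMSEQ_iff)
  \<comment> \<open>Fatou's lemma: the distance of \<open>F n\<close> to the pointwise limit is at
    most the lower limit of its distances to the later terms.\<close>
  have le: "(\<integral>\<^sup>+x. ennreal ((norm (F n x - f x))\<^sup>2) \<partial>M) \<le> ennreal ((1/4)^n)" for n
  proof -
    have "(\<integral>\<^sup>+x. ennreal ((norm (F n x - f x))\<^sup>2) \<partial>M)
        = (\<integral>\<^sup>+x. liminf (\<lambda>m. ennreal ((norm (F n x - F m x))\<^sup>2)) \<partial>M)"
    proof (intro nn_integral_cong_AE)
      show "AE x in M. ennreal ((norm (F n x - f x))\<^sup>2) = liminf (\<lambda>m. ennreal ((norm (F n x - F m x))\<^sup>2))"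
        using lim
      proof eventually_elim
        case (elim x)
        have "(\<lambda>m. ennreal ((norm (F n x - F m x))\<^sup>2)) \<longlonglongrightarrow> ennreal ((norm (F n x - f x))\<^sup>2)"
          by (intro tendsto_intros tendsto_ennrealI elim)
        from lim_imp_Liminf[OF _ this] show ?case by (simp only: trivial_limit_sequentially simp_thms)
      qed
    qed
    also have "\<dots> \<le> liminf (\<lambda>m. \<integral>\<^sup>+x. ennreal ((norm (F n x - F m x))\<^sup>2) \<partial>M)"
      by (rule nn_integral_liminf) auto
    also have "\<dots> \<le> ennreal ((1/4)^n)"
    proof (rule Liminf_le)
      show "\<forall>\<^sub>F m in sequentially. (\<integral>\<^sup>+x. ennreal ((norm (F n x - F m x))\<^sup>2) \<partial>M) \<le> ennreal ((1/4)^n)"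
        using eventually_ge_at_top[of n]
      proof eventually_elim
        case (elim m)
        then show ?case
          using fast[OF elim] by (simp add: nn_integral_nsq[OF l2_diff[OF F F]] nsq_def norm_minus_commute
            ennreal_leI)
      qed
    qed auto
    finally show ?thesis .
  qed
  have d: "l2 M (\<lambda>x. F n x - f x)" for n
    by (rule l2I_nn_integral) (use le[of n] in \<open>auto intro: le_less_trans\<close>)
  have "l2 M f" using l2_diff[OF F d, of 0 0] by simp
  moreover have "nsq M (\<lambda>x. F n x - f x) \<le> (1/4) ^ n" for n
    using le[of n] by (simp add: nn_integral_nsq[OF d])
  ultimately show thesis by (rule that)
qed

text \<open>A Cauchy sequence has a rapidly converging subsequence, and the limit of the subsequence
  attracts the whole sequence because beyond index \<open>K k\<close> all terms stay close to
  \<open>F (K k)\<close>.\<close>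

lemma l2_complete:
  fixes F :: "nat \<Rightarrow> 'a \<Rightarrow> complex"
  assumes F: "\<And>n. l2 M (F n)"
    and cauchy: "\<And>e. e > 0 \<Longrightarrow> \<exists>N. \<forall>n\<ge>N. \<forall>m\<ge>n. nsq M (\<lambda>x. F m x - F n x) \<le> e"
  obtains f where "l2 M f" "(\<lambda>n. nsq M (\<lambda>x. F n x - f x)) \<longlonglongrightarrow> 0"
proof -
  have "\<forall>k. \<exists>N. \<forall>n\<ge>N. \<forall>m\<ge>n. nsq M (\<lambda>x. F m x - F n x) \<le> (1/4) ^ k"
    using cauchy by simp
  then obtain N where N: "\<And>k n m. N k \<le> n \<Longrightarrow> n \<le> m \<Longrightarrow> nsq M (\<lambda>x. F m x - F n x) \<le> (1/4) ^ k"
    by metis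
  \<comment> \<open>The running maximum makes the indices monotone in \<open>k\<close> while keeping
    the rate that \<open>N k\<close> guarantees.\<close>
  define K where "K k = Max (N ` {..k})" for k
  have K: "N k \<le> K k" "j \<le> k \<Longrightarrow> K j \<le> K k" for j k
    unfolding K_def by (auto intro!: Max_mono)
  obtain f where f: "l2 M f" and lim: "\<And>k. nsq M (\<lambda>x. F (K k) x - f x) \<le> (1/4) ^ k"
    using l2_complete_fast[of M "\<lambda>k. F (K k)"] F N K by metis
  have "(\<lambda>n. nsq M (\<lambda>x. F n x - f x)) \<longlonglongrightarrow> 0"
  proof (rule LIMSEQ_I)
    fix r :: real assume "0 < r"
    then obtain k where k: "(1/4) ^ k < r / 4" using real_arch_pow_inv[of "r/4" "1/4"] by auto
    show "\<exists>no. \<forall>n\<ge>no. norm (nsq M (\<lambda>x. F n x - f x) - 0) < r"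
    proof (intro exI allI impI)
      fix n assume n: "K k \<le> n"
      have "nsq M (\<lambda>x. (F n x - F (K k) x) + (F (K k) x - f x))
          \<le> 2 * nsq M (\<lambda>x. F n x - F (K k) x) + 2 * nsq M (\<lambda>x. F (K k) x - f x)"
        by (intro nsq_add_le l2_diff F f)
      also have "\<dots> \<le> 2 * (1/4) ^ k + 2 * (1/4) ^ k"
        using N[OF K(1) n] lim[of k] by (intro add_mono mult_left_mono) auto
      finally show "norm (nsq M (\<lambda>x. F n x - f x) - 0) < r"
        using k by simp
    qed
  qed
  with f show thesis by (rule that)
qed

section \<open>The Fourier integral of an integrable function\<close>

abbreviation fconst :: "'a::euclidean_space itself \<Rightarrow> real" where
  "fconst _ \<equiv> (2 * pi) powr (- real DIM('a) / 2)"

lemma powr_half_nat: "0 < x \<Longrightarrow> x powr (real n / 2) = sqrt x ^ n"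
  by (simp add: powr_half_sqrt[symmetric] powr_powr powr_realpow[symmetric])

lemma fconst_eq: "fconst TYPE('a::euclidean_space) = 1 / sqrt (2 * pi) ^ DIM('a)"
proof -
  have "- real DIM('a) / 2 = - (real DIM('a) / 2)" by simp
  then have "fconst TYPE('a) = 1 / (2 * pi) powr (real DIM('a) / 2)"
    by (simp only: powr_minus_divide)
  also have "\<dots> = 1 / sqrt (2 * pi) ^ DIM('a)"
    by (subst powr_half_nat) simp_all
  finally show ?thesis .
qed

lemma fourier_integral_lborel:
  fixes f :: "'a::euclidean_space \<Rightarrow> complex"
  assumes [measurable]: "f \<in> borel_measurable borel"
  shows "fourier_integral f \<zeta> = fconst TYPE('a) *\<^sub>R (LINT x|lborel. f x * cis (- (x \<bullet> \<zeta>)))"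
  unfolding fourier_integral_def by (subst integral_completion) auto

lemma fourier_integral_measurable:
  fixes f :: "'a::euclidean_space \<Rightarrow> complex"
  assumes [measurable]: "f \<in> borel_measurable borel"
  shows "fourier_integral f \<in> borel_measurable borel"
proof -
  have "(\<lambda>\<zeta>. LINT x|lborel. f x * cis (- (x \<bullet> \<zeta>))) \<in> borel_measurable (borel :: 'a measure)"
    by (intro lborel.borel_measurable_lebesgue_integral) measurable
  then show ?thesis
    unfolding fourier_integral_lborel[OF assms, abs_def] by measurable
qed

lemma integrable_mult_cis:
  fixes f :: "'a::euclidean_space \<Rightarrow> complex"
  assumes "integrable M f" and [measurable]: "g \<in> borel_measurable M"
  shows "integrable M (\<lambda>x. f x * cis (g x))"
  by (rule Bochner_Integration.integrable_bound[OF assms(1)])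
     (use borel_measurable_integrable[OF assms(1)] in \<open>auto simp: norm_mult\<close>)

lemma fourier_integral_add:
  fixes f g :: "'a::euclidean_space \<Rightarrow> complex"
  assumes f: "integrable lborel f" and g: "integrable lborel g"
  shows "fourier_integral (\<lambda>x. f x + g x) \<zeta> = fourier_integral f \<zeta> + fourier_integral g \<zeta>"
proof -
  have [measurable]: "f \<in> borel_measurable borel" "g \<in> borel_measurable borel" using f g by auto
  show ?thesis
    by (simp add: fourier_integral_lborel distrib_right scaleR_add_right integrable_mult_cis f g)
qed

lemma fourier_integral_diff:
  fixes f g :: "'a::euclidean_space \<Rightarrow> complex"
  assumes f: "integrable lborel f" and g: "integrable lborel g"
  shows "fourier_integral (\<lambda>x. f x - g x) \<zeta> = fourier_integral f \<zeta> - fourier_integral g \<zeta>"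
proof -
  have [measurable]: "f \<in> borel_measurable borel" "g \<in> borel_measurable borel" using f g by auto
  show ?thesis
    by (simp add: fourier_integral_lborel left_diff_distrib scaleR_diff_right integrable_mult_cis f g)
qed

lemma fourier_integral_scale:
  "fourier_integral (\<lambda>x. c * f x) \<zeta> = c * fourier_integral f \<zeta>"
  by (simp add: fourier_integral_def mult.assoc)

lemma fourier_integral_cnj:
  "cnj (fourier_integral f \<zeta>) = fourier_integral (\<lambda>x. cnj (f x)) (- \<zeta>)"
proof -
  have "cnj (f x * cis (- (x \<bullet> \<zeta>))) = cnj (f x) * cis (- (x \<bullet> - \<zeta>))" for x
    by (simp add: cis_cnj)
  then show ?thesis
    unfolding fourier_integral_def complex_cnj_scaleR Bochner_Integration.integral_cnj[symmetric]
      by presburger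
qed

lemma norm_fourier_integral_le:
  fixes f :: "'a::euclidean_space \<Rightarrow> complex"
  assumes f: "integrable lborel f"
  shows "norm (fourier_integral f \<zeta>) \<le> fconst TYPE('a) * (LINT x|lborel. norm (f x))"
proof -
  have [measurable]: "f \<in> borel_measurable borel" using f by auto
  have "norm (LINT x|lborel. f x * cis (- (x \<bullet> \<zeta>))) \<le> (LINT x|lborel. norm (f x))"
    using integral_norm_bound[of lborel "\<lambda>x. f x * cis (- (x \<bullet> \<zeta>))"] by (simp add: norm_mult)
  then show ?thesis by (simp add: fourier_integral_lborel mult_left_mono)
qed

lemma integrable_mult_fourier_integral:
  fixes f k :: "'a::euclidean_space \<Rightarrow> complex"
  assumes f: "integrable lborel f" and k: "integrable lborel k"
  shows "integrable lborel (\<lambda>x. k x * fourier_integral f x)"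
proof -
  have [measurable]: "f \<in> borel_measurable borel" "k \<in> borel_measurable borel" using f k by auto
  have [measurable]: "fourier_integral f \<in> borel_measurable borel" by (rule fourier_integral_measurable) auto
  show ?thesis
    by (rule Bochner_Integration.integrable_bound[of _ "\<lambda>x. norm (k x) * (fconst TYPE('a)
      * (LINT x|lborel. norm (f x)))"])
       (use k norm_fourier_integral_le[OF f] in \<open>auto simp: norm_mult intro!: mult_left_mono abs_ge_self[THEN
         order_trans[rotated]]\<close>)
qed

text \<open>The kernel \<open>cis (- (x \<bullet> y))\<close> is symmetric in its two arguments, so
  Fubini moves the transform from one factor to the other. The \<open>L2\<close> theory grows out of
  this identity and the explicit transform of a Gaussian.\<close>

lemma fourier_integral_multiplication:
  fixes f k :: "'a::euclidean_space \<Rightarrow> complex"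
  assumes f: "integrable lborel f" and k: "integrable lborel k"
  shows "(LINT x|lborel. fourier_integral f x * k x) = (LINT x|lborel. f x * fourier_integral k x)"
proof -
  have [measurable]: "f \<in> borel_measurable borel" "k \<in> borel_measurable borel" using f k by auto
  have int: "integrable (lborel \<Otimes>\<^sub>M lborel) (\<lambda>(x, y). f x * k y * cis (- (x \<bullet> y)))"
  proof (rule lborel_pair.Fubini_integrable)
    have "norm (f x * k y * cis (- (x \<bullet> y))) = norm (f x) * norm (k y)" for x y
      by (simp add: norm_mult)
    then show "integrable lborel (\<lambda>x. LINT y|lborel. norm (case (x, y) of (x, y) \<Rightarrow> f x * k y
      * cis (- (x \<bullet> y))))"
      using f k by simp
    show "AE x in lborel. integrable lborel (\<lambda>y. case (x, y) of (x, y) \<Rightarrow> f x * k y * cis (- (x \<bullet> y)))"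
      using integrable_mult_cis[OF k] by (auto simp: mult.assoc intro!: integrable_mult_right)
  qed measurable
  have "(LINT y|lborel. fourier_integral f y * k y)
      = fconst TYPE('a) *\<^sub>R (LINT y|lborel. LINT x|lborel. f x * k y * cis (- (x \<bullet> y)))"
    by (simp add: fourier_integral_lborel flip: integral_scaleR_right integral_mult_left_zero)
       (simp add: mult_ac)
  also have "\<dots> = fconst TYPE('a) *\<^sub>R (LINT x|lborel. LINT y|lborel. f x * k y * cis (- (x \<bullet> y)))"
    using lborel_pair.Fubini_integral[OF int] by simp
  also have "\<dots> = (LINT x|lborel. f x * fourier_integral k x)"
    by (simp add: fourier_integral_lborel flip: integral_scaleR_right integral_mult_right_zero)
       (simp add: mult_ac inner_commute)
  finally show ?thesis .
qed

text \<open>The heat kernel at time \<open>e / 2\<close>: a centred normal density with variance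
  \<open>e\<close> in each coordinate. Up to normalization it is the Fourier transform of the weight
  \<open>exp (- (e * (norm \<zeta>)\<^sup>2 / 2))\<close>.\<close>

definition gauss_kernel :: "real \<Rightarrow> 'a::euclidean_space \<Rightarrow> real" where
  "gauss_kernel e h = exp (- ((norm h)\<^sup>2 / (2 * e))) / (2 * pi * e) powr (real DIM('a) / 2)"

lemma gauss_kernel_eq:
  "0 < e \<Longrightarrow> gauss_kernel e h = exp (- ((norm h)\<^sup>2 / (2 * e))) / sqrt (2 * pi * e) ^ DIM('a)"
  for h :: "'a::euclidean_space"
  unfolding gauss_kernel_def by (subst powr_half_nat) auto

lemma gauss_kernel_nonneg [simp]: "0 \<le> gauss_kernel e h"
  by (simp add: gauss_kernel_def)

lemma gauss_kernel_measurable [measurable]: "gauss_kernel e \<in> borel_measurable borel"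
  unfolding gauss_kernel_def by measurable

lemma gauss_kernel_minus: "gauss_kernel e (x - y) = gauss_kernel e (y - x)"
  by (simp add: gauss_kernel_def norm_minus_commute)

lemma nn_integral_gauss_kernel:
  assumes e: "0 < e"
  shows "(\<integral>\<^sup>+h. ennreal (gauss_kernel e (h :: 'a::euclidean_space)) \<partial>lborel) = 1"
proof -
  have *: "gauss_kernel e h = exp (- ((1/e) * (norm h)\<^sup>2 / 2)) * (1 / sqrt (2 * pi
    / (1/e)) ^ DIM('a))" for h :: 'a
    using e by (simp add: gauss_kernel_eq field_simps)
  have e': "0 < 1/e" using e by simp
  show "(\<integral>\<^sup>+h. ennreal (gauss_kernel e (h :: 'a)) \<partial>lborel) = 1"
    unfolding * using e
    by (subst ennreal_mult, simp, simp, subst nn_integral_multc, simp, subst nn_integral_gauss[OF e'])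
       (simp_all flip: ennreal_mult)
qed

lemma gauss_kernel_le:
  assumes "0 < e"
  shows "gauss_kernel e (h :: 'a) \<le> 1 / sqrt (2 * pi * e) ^ DIM('a::euclidean_space)"
  unfolding gauss_kernel_eq[OF assms] using assms by (intro divide_right_mono) auto

lemma nn_integral_lborel_translate:
  fixes f :: "'a::euclidean_space \<Rightarrow> ennreal"
  assumes [measurable]: "f \<in> borel_measurable borel"
  shows "(\<integral>\<^sup>+x. f (c + x) \<partial>lborel) = (\<integral>\<^sup>+x. f x \<partial>lborel)"
  by (subst (2) lborel_distr_plus[symmetric, of c]) (simp add: nn_integral_distr)

lemma nn_integral_lborel_uminus:
  fixes f :: "'a::euclidean_space \<Rightarrow> ennreal"
  assumes [measurable]: "f \<in> borel_measurable borel"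
  shows "(\<integral>\<^sup>+x. f (- x) \<partial>lborel) = (\<integral>\<^sup>+x. f x \<partial>lborel)"
  by (subst (2) lborel_affine[of "-1" 0]) (simp_all add: nn_integral_density nn_integral_distr)

lemma nn_integral_gauss_kernel_diff:
  assumes e: "0 < e"
  shows "(\<integral>\<^sup>+y. ennreal (gauss_kernel e (x - y :: 'a::euclidean_space)) \<partial>lborel) = 1"
    and "(\<integral>\<^sup>+x. ennreal (gauss_kernel e (x - y :: 'a::euclidean_space)) \<partial>lborel) = 1"
proof -
  show *: "(\<integral>\<^sup>+x. ennreal (gauss_kernel e (x - y :: 'a::euclidean_space)) \<partial>lborel) = 1" for y
    using nn_integral_lborel_translate[of "\<lambda>x. ennreal (gauss_kernel e x)" "- y"] nn_integral_gauss_kernel[OF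
      e, where 'a='a]
    by simp
  show "(\<integral>\<^sup>+y. ennreal (gauss_kernel e (x - y :: 'a::euclidean_space)) \<partial>lborel) = 1"
    by (subst gauss_kernel_minus) (rule *)
qed

text \<open>
  Gaussian regularization of \<open>\<integral> \<bar>\<F> f\<bar>\<^sup>2\<close>: the Fourier transform turns the Gaussian weight into
  convolution with an approximate identity.
\<close>

lemma
  fixes f :: "'a::euclidean_space \<Rightarrow> complex"
  assumes f: "integrable lborel f" and e: "0 < e"
  defines "K \<equiv> \<lambda>x. LINT y|lborel. f y * gauss_kernel e (x - y)"
  shows integral_gauss_fourier_integral:
     "(LINT \<zeta>|lborel. complex_of_real (exp (- (e * (norm \<zeta>)\<^sup>2 / 2)) * (norm (fourier_integral f \<zeta>))\<^sup>2))
        = (LINT x|lborel. f x * cnj (K x))" (is ?th1)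
    and integrable_gauss_fourier_integral:
     "integrable lborel (\<lambda>\<zeta>. exp (- (e * (norm \<zeta>)\<^sup>2 / 2)) * (norm (fourier_integral f \<zeta>))\<^sup>2)" (is ?th2)
proof -
  have fm[measurable]: "f \<in> borel_measurable borel" using f by auto
  have [measurable]: "fourier_integral f \<in> borel_measurable borel" by (rule fourier_integral_measurable) auto
  let ?C = "fconst TYPE('a)"
  let ?G = "\<lambda>\<zeta>::'a. complex_of_real (exp (- (e * (norm \<zeta>)\<^sup>2 / 2)))"
  have intG: "integrable lborel ?G" using integrable_gauss[OF e, where 'a='a] by simp
  have intGF: "integrable lborel (\<lambda>\<zeta>. ?G \<zeta> * fourier_integral f \<zeta>)"
    by (rule integrable_mult_fourier_integral[OF f intG])
  \<comment> \<open>The weight and the conjugate transform together form an integrable function, so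
    the multiplication formula turns the integral of \<open>fourier_integral f * k\<close> into that
    of \<open>f * fourier_integral k\<close>.\<close>
  define k where "k \<zeta> = ?G \<zeta> * cnj (fourier_integral f \<zeta>)" for \<zeta>
  have k: "integrable lborel k"
  proof -
    have "k = (\<lambda>\<zeta>. cnj (?G \<zeta> * fourier_integral f \<zeta>))" by (simp add: k_def fun_eq_iff)
    then show ?thesis using integrable_cnj[OF intGF] by (simp only:)
  qed
  have Ck: "?C * (?C * (sqrt (2 * pi / e) ^ DIM('a) * exp (- ((norm h)\<^sup>2 / (2 * e)))))
    = gauss_kernel e h" for h :: 'a
  proof -
    have a: "sqrt (2 * pi * e) = sqrt (2 * pi) * sqrt e" "sqrt (2 * pi / e) = sqrt (2 * pi) / sqrt e"
      by (simp_all only: real_sqrt_mult real_sqrt_divide)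
    have b: "S \<noteq> 0 \<Longrightarrow> 1 / S * (1 / S * (S / T * g)) = g / (S * T)" for S T g :: real
      by (simp add: field_simps)
    show ?thesis unfolding fconst_eq gauss_kernel_eq[OF e] a power_divide power_mult_distrib
      by (rule b) simp
  qed
  have inner: "fourier_integral (\<lambda>\<zeta>. ?G \<zeta> * cis (x \<bullet> \<zeta>)) y
      = ?C *\<^sub>R complex_of_real (sqrt (2 * pi / e) ^ DIM('a) * exp (- ((norm (x - y))\<^sup>2 / (2 * e))))" for x y
  proof -
    have "?G \<zeta> * cis (x \<bullet> \<zeta>) * cis (- (\<zeta> \<bullet> y)) = ?G \<zeta> * cis ((x - y) \<bullet> \<zeta>)" for \<zeta>
      by (simp add: mult.assoc cis_mult inner_diff_left inner_diff_right inner_commute)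
    then show ?thesis
      unfolding integral_gauss_cis[OF e, symmetric]
      by (subst fourier_integral_lborel) (measurable, simp only:)
  qed
  \<comment> \<open>A second use of the multiplication formula: \<open>fourier_integral k\<close> is
    \<open>f\<close> integrated against the transform of a modulated Gaussian, and \<open>Ck\<close>
    combines all constants into the normalized kernel.\<close>
  have Fk: "fourier_integral k x = cnj (K x)" for x
  proof -
    have km: "k \<in> borel_measurable borel" using k by auto
    have "k \<zeta> * cis (- (\<zeta> \<bullet> x)) = cnj (fourier_integral f \<zeta> * (?G \<zeta> * cis (x \<bullet> \<zeta>)))" for \<zeta>
      by (simp add: k_def cis_cnj inner_commute)
    then have "fourier_integral k x = ?C *\<^sub>R cnj (LINT \<zeta>|lborel. fourier_integral f \<zeta> * (?G \<zeta> * cis (x \<bullet> \<zeta>)))"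
      by (simp only: fourier_integral_lborel[OF km] Bochner_Integration.integral_cnj)
    also have "(LINT \<zeta>|lborel. fourier_integral f \<zeta> * (?G \<zeta> * cis (x \<bullet> \<zeta>)))
        = (LINT y|lborel. f y * fourier_integral (\<lambda>\<zeta>. ?G \<zeta> * cis (x \<bullet> \<zeta>)) y)"
      by (rule fourier_integral_multiplication[OF f integrable_mult_cis[OF intG]]) measurable
    also have "?C *\<^sub>R cnj \<dots> = cnj (?C *\<^sub>R \<dots>)" by simp
    also have "?C *\<^sub>R (LINT y|lborel. f y * fourier_integral (\<lambda>\<zeta>. ?G \<zeta> * cis (x \<bullet> \<zeta>)) y)
        = (LINT y|lborel. f y * (?C * (?C * (sqrt (2 * pi / e) ^ DIM('a) * exp (- ((norm (x - y))\<^sup>2 / (2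
          * e)))))))"
      by (subst integral_scaleR_right[symmetric])
         (intro Bochner_Integration.integral_cong refl, simp add: inner scaleR_conv_of_real)
    also have "\<dots> = K x" unfolding Ck K_def ..
    finally show ?thesis .
  qed
  have eq: "complex_of_real (exp (- (e * (norm \<zeta>)\<^sup>2 / 2)) * (norm (fourier_integral f \<zeta>))\<^sup>2)
    = fourier_integral f \<zeta> * k \<zeta>" for \<zeta>
    unfolding k_def by (simp add: complex_norm_square[symmetric] mult_ac)
  show ?th1
    unfolding eq fourier_integral_multiplication[OF f k] Fk ..
  have "integrable lborel (\<lambda>\<zeta>. complex_of_real (exp (- (e * (norm \<zeta>)\<^sup>2 / 2))
    * (norm (fourier_integral f \<zeta>))\<^sup>2))"
    unfolding eq using integrable_mult_fourier_integral[OF f k] by (simp add: mult.commute)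
  then show ?th2 by (simp only: complex_of_real_integrable_eq)
qed

text \<open>Regularization produces a quadratic form in \<open>f\<close> with a probability kernel.
  Bounding \<open>|f x| * |f y|\<close> by the mean of the squares and integrating out the other
  variable leaves the square norm of \<open>f\<close>, uniformly in \<open>e\<close>.\<close>

lemma nn_integral_gauss_fourier_integral_le:
  fixes f :: "'a::euclidean_space \<Rightarrow> complex"
  assumes f: "integrable lborel f" and e: "0 < e"
  shows "(\<integral>\<^sup>+\<zeta>. ennreal (exp (- (e * (norm \<zeta>)\<^sup>2 / 2)) * (norm (fourier_integral f \<zeta>))\<^sup>2) \<partial>lborel)
      \<le> (\<integral>\<^sup>+x. ennreal ((norm (f x))\<^sup>2) \<partial>lborel)" (is "?L \<le> ?R")
proof -
  have fm[measurable]: "f \<in> borel_measurable borel" using f by auto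
  define K where "K x = (LINT y|lborel. f y * gauss_kernel e (x - y))" for x
  have [measurable]: "K \<in> borel_measurable borel"
    unfolding K_def by measurable
  let ?I = "LINT \<zeta>|lborel. exp (- (e * (norm \<zeta>)\<^sup>2 / 2)) * (norm (fourier_integral f \<zeta>))\<^sup>2"
  have i: "complex_of_real ?I = (LINT x|lborel. f x * cnj (K x))"
    using integral_gauss_fourier_integral[OF f e] unfolding K_def integral_complex_of_real .
  have "?L = ennreal ?I"
    by (rule nn_integral_eq_integral[OF integrable_gauss_fourier_integral[OF f e]]) auto
  also have "\<dots> \<le> ennreal (norm (LINT x|lborel. f x * cnj (K x)))"
    unfolding i[symmetric] by (intro ennreal_leI) auto
  also have "\<dots> \<le> (\<integral>\<^sup>+x. ennreal (norm (f x * cnj (K x))) \<partial>lborel)"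
    by (cases "integrable lborel (\<lambda>x. f x * cnj (K x))")
       (auto intro: integral_norm_bound_ennreal simp: not_integrable_integral_eq)
  also have "\<dots> \<le> (\<integral>\<^sup>+x. ennreal (norm (f x)) * (\<integral>\<^sup>+y. ennreal (norm (f y) * gauss_kernel e (x
    - y)) \<partial>lborel) \<partial>lborel)"
  proof (intro nn_integral_mono)
    fix x
    have "ennreal (norm (K x)) \<le> (\<integral>\<^sup>+y. ennreal (norm (f y * gauss_kernel e (x - y))) \<partial>lborel)"
      unfolding K_def
      by (cases "integrable lborel (\<lambda>y. f y * gauss_kernel e (x - y))")
         (auto intro: integral_norm_bound_ennreal simp: not_integrable_integral_eq)
    then show "ennreal (norm (f x * cnj (K x)))
        \<le> ennreal (norm (f x)) * (\<integral>\<^sup>+y. ennreal (norm (f y) * gauss_kernel e (x - y)) \<partial>lborel)"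
      by (simp add: norm_mult ennreal_mult mult_left_mono)
  qed
  also have "\<dots> = (\<integral>\<^sup>+x. (\<integral>\<^sup>+y. ennreal (norm (f x) * (norm (f y) * gauss_kernel e (x - y))) \<partial>lborel) \<partial>lborel)"
    by (simp add: nn_integral_cmult[symmetric] ennreal_mult)
  also have "\<dots> \<le> (\<integral>\<^sup>+x. (\<integral>\<^sup>+y. ennreal (1/2) * (ennreal ((norm (f x))\<^sup>2) * ennreal (gauss_kernel e (x - y))
       + ennreal ((norm (f y))\<^sup>2) * ennreal (gauss_kernel e (x - y))) \<partial>lborel) \<partial>lborel)"
  proof (intro nn_integral_mono)
    fix x y
    have "norm (f x) * norm (f y) \<le> 1/2 * ((norm (f x))\<^sup>2 + (norm (f y))\<^sup>2)"
      using sum_squares_bound[of "norm (f x)" "norm (f y)"] by simp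
    then have "norm (f x) * norm (f y) * gauss_kernel e (x - y)
      \<le> 1/2 * ((norm (f x))\<^sup>2 + (norm (f y))\<^sup>2) * gauss_kernel e (x - y)"
      by (intro mult_right_mono) auto
    then have "ennreal (norm (f x) * (norm (f y) * gauss_kernel e (x - y)))
        \<le> ennreal (1/2 * ((norm (f x))\<^sup>2 * gauss_kernel e (x - y) + (norm (f y))\<^sup>2 * gauss_kernel e (x - y)))"
      by (intro ennreal_leI) (simp add: algebra_simps)
    then show "ennreal (norm (f x) * (norm (f y) * gauss_kernel e (x - y)))
      \<le> ennreal (1/2) * (ennreal ((norm (f x))\<^sup>2) * ennreal (gauss_kernel e (x - y))
       + ennreal ((norm (f y))\<^sup>2) * ennreal (gauss_kernel e (x - y)))"
      by (subst (asm) ennreal_mult, simp, simp, subst (asm) ennreal_plus, simp, simp) (simp add: ennreal_mult)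
  qed
  also have "\<dots> = ennreal (1/2) * ((\<integral>\<^sup>+x. (\<integral>\<^sup>+y. ennreal ((norm (f x))\<^sup>2) * ennreal (gauss_kernel e (x
    - y)) \<partial>lborel) \<partial>lborel)
       + (\<integral>\<^sup>+x. (\<integral>\<^sup>+y. ennreal ((norm (f y))\<^sup>2) * ennreal (gauss_kernel e (x - y)) \<partial>lborel) \<partial>lborel))"
    by (simp add: nn_integral_cmult nn_integral_add)
  also have "(\<integral>\<^sup>+x. (\<integral>\<^sup>+y. ennreal ((norm (f x))\<^sup>2) * ennreal (gauss_kernel e (x - y)) \<partial>lborel) \<partial>lborel) = ?R"
    by (simp add: nn_integral_cmult nn_integral_gauss_kernel_diff[OF e])
  also have "(\<integral>\<^sup>+x. (\<integral>\<^sup>+y. ennreal ((norm (f y))\<^sup>2) * ennreal (gauss_kernel e (x - y)) \<partial>lborel) \<partial>lborel) = ?R"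
    by (subst lborel_pair.Fubini') (simp_all add: nn_integral_cmult nn_integral_gauss_kernel_diff[OF e])
  also have "ennreal (1/2) * (?R + ?R) = ?R"
  proof -
    have "?R + ?R = 2 * ?R" by (simp add: mult_2)
    moreover have "ennreal (1/2) * 2 = 1"
      by (metis ennreal_1 ennreal_mult ennreal_numeral half_gt_zero_iff less_eq_real_def nonzero_eq_divide_eq
        zero_le_numeral zero_neq_numeral zero_less_one)
    ultimately show ?thesis by (simp add: mult.assoc[symmetric])
  qed
  finally show ?thesis .
qed

text \<open>Fatou's lemma removes the Gaussian weight but gives only one half of Plancherel's
  identity. The other half calls for lower semicontinuity on the side of \<open>f\<close>.\<close>

lemma nn_integral_fourier_integral_le:
  fixes f :: "'a::euclidean_space \<Rightarrow> complex"
  assumes f: "integrable lborel f"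
  shows "(\<integral>\<^sup>+\<zeta>. ennreal ((norm (fourier_integral f \<zeta>))\<^sup>2) \<partial>lborel) \<le> (\<integral>\<^sup>+x. ennreal ((norm (f x))\<^sup>2) \<partial>lborel)"
proof -
  have fm[measurable]: "f \<in> borel_measurable borel" using f by auto
  have [measurable]: "fourier_integral f \<in> borel_measurable borel" by (rule fourier_integral_measurable) auto
  let ?u = "\<lambda>n \<zeta>. ennreal (exp (- ((1 / real (Suc n)) * (norm \<zeta>)\<^sup>2 / 2)) * (norm (fourier_integral f \<zeta>))\<^sup>2)"
  have lim: "liminf (\<lambda>n. ?u n \<zeta>) = ennreal ((norm (fourier_integral f \<zeta>))\<^sup>2)" for \<zeta>
  proof (rule lim_imp_Liminf)
    have "(\<lambda>n. exp (- ((1 / real (Suc n)) * (norm \<zeta>)\<^sup>2 / 2))) \<longlonglongrightarrow> exp (- (0 * (norm \<zeta>)\<^sup>2 / 2))"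
      using LIMSEQ_inverse_real_of_nat by (intro tendsto_intros) (auto simp: inverse_eq_divide)
    from tendsto_mult_right[OF this, of "(norm (fourier_integral f \<zeta>))\<^sup>2"]
    show "(\<lambda>n. ?u n \<zeta>) \<longlonglongrightarrow> ennreal ((norm (fourier_integral f \<zeta>))\<^sup>2)"
      by (intro tendsto_ennrealI) simp
  qed simp
  have "(\<integral>\<^sup>+\<zeta>. ennreal ((norm (fourier_integral f \<zeta>))\<^sup>2) \<partial>lborel) = (\<integral>\<^sup>+\<zeta>. liminf (\<lambda>n. ?u n \<zeta>) \<partial>lborel)"
    unfolding lim ..
  also have "\<dots> \<le> liminf (\<lambda>n. \<integral>\<^sup>+\<zeta>. ?u n \<zeta> \<partial>lborel)"
    by (rule nn_integral_liminf) measurable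
  also have "\<dots> \<le> (\<integral>\<^sup>+x. ennreal ((norm (f x))\<^sup>2) \<partial>lborel)"
    by (intro Liminf_le always_eventually allI nn_integral_gauss_fourier_integral_le[OF f]) auto
  finally show ?thesis .
qed

section \<open>The Plancherel identity\<close>

lemma nn_integral_lborel_affine:
  fixes f :: "'a::euclidean_space \<Rightarrow> ennreal"
  assumes [measurable]: "f \<in> borel_measurable borel" and r: "0 < r"
  shows "(\<integral>\<^sup>+y. f y \<partial>lborel) = (\<integral>\<^sup>+h. ennreal (r ^ DIM('a)) * f (x + r *\<^sub>R h) \<partial>lborel)"
  by (subst lborel_affine[of r x]) (use r in \<open>simp_all add: nn_integral_density nn_integral_distr
    ennreal_power\<close>)

text \<open>The indicator of an open set is lower semicontinuous: for \<open>x\<close> in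
  \<open>U\<close> and any \<open>h\<close>, the point \<open>x + r *\<^sub>R h\<close> lies in
  \<open>U\<close> for small \<open>r\<close>. Fatou's lemma, applied in \<open>h\<close> and then
  in \<open>x\<close>, yields the inequality opposite to
  \<open>nn_integral_fourier_integral_le\<close>.\<close>

lemma emeasure_le_nn_integral_fourier_integral_open:
  fixes U :: "'a::euclidean_space set"
  assumes U: "open U" and fin: "emeasure lborel U < \<infinity>"
  shows "emeasure lborel U \<le> (\<integral>\<^sup>+\<zeta>. ennreal ((norm (fourier_integral (indicator U) \<zeta>))\<^sup>2) \<partial>lborel)" (is "_
    \<le> ?R")
proof -
  have [measurable]: "U \<in> sets borel" using U by auto
  let ?f = "indicator U :: 'a \<Rightarrow> complex"
  have fr: "integrable lborel (indicator U :: 'a \<Rightarrow> real)" using fin by auto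
  have "?f = (\<lambda>x. complex_of_real (indicator U x))" by (auto simp: indicator_def)
  then have f: "integrable lborel ?f" using integrable_of_real[OF fr, where 'a=complex] by simp
  have le: "(\<integral>\<^sup>+x. indicator U x * (\<integral>\<^sup>+h. indicator U (x + r *\<^sub>R h)
    * ennreal (gauss_kernel 1 h) \<partial>lborel) \<partial>lborel) \<le> ?R"
    if r: "0 < r" for r :: real
  proof -
    \<comment> \<open>With variance \<open>r\<^sup>2\<close> the substitution
      \<open>y = x + r *\<^sub>R h\<close> turns the kernel into \<open>gauss_kernel 1\<close>, so
      that the measure in \<open>h\<close> is fixed and only the argument of the indicator depends
      on \<open>r\<close>.\<close>
    define e where "e = r\<^sup>2"
    have e: "0 < e" "sqrt e = r" using r by (auto simp: e_def)
    define k where "k x = (LINT y|lborel. indicator U y * gauss_kernel e (x - y))" for x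
    have [measurable]: "k \<in> borel_measurable borel" unfolding k_def by measurable
    define c where "c = 1 / sqrt (2 * pi * e) ^ DIM('a)"
    have c: "gauss_kernel e h \<le> \<bar>c\<bar>" for h :: 'a
      using order_trans[OF gauss_kernel_le[OF e(1)] abs_ge_self] unfolding c_def .
    have ki: "integrable lborel (\<lambda>y. indicator U y * gauss_kernel e (x - y))" for x
      by (rule Bochner_Integration.integrable_bound[OF integrable_mult_left[OF fr, of c]])
         (use c in \<open>auto simp: indicator_def\<close>)
    have kn: "ennreal (k x) = (\<integral>\<^sup>+h. indicator U (x + r *\<^sub>R h) * ennreal (gauss_kernel 1 h) \<partial>lborel)" for x
    proof -
      have "ennreal (k x) = (\<integral>\<^sup>+y. ennreal (indicator U y * gauss_kernel e (x - y)) \<partial>lborel)"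
        unfolding k_def by (rule nn_integral_eq_integral[OF ki, symmetric]) auto
      also have "\<dots> = (\<integral>\<^sup>+h. ennreal (r ^ DIM('a)) * ennreal (indicator U (x + r *\<^sub>R h) * gauss_kernel e (x
        - (x + r *\<^sub>R h))) \<partial>lborel)"
        by (rule nn_integral_lborel_affine[OF _ r]) measurable
      also have "\<dots> = (\<integral>\<^sup>+h. indicator U (x + r *\<^sub>R h) * ennreal (gauss_kernel 1 h) \<partial>lborel)"
      proof (intro nn_integral_cong)
        fix h :: 'a
        have "r ^ DIM('a) * gauss_kernel e (x - (x + r *\<^sub>R h)) = gauss_kernel 1 h"
          using r e unfolding gauss_kernel_eq[OF e(1)] gauss_kernel_eq[OF zero_less_one]
          by (simp add: real_sqrt_mult power_mult_distrib, simp add: e_def)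
        then show "ennreal (r ^ DIM('a)) * ennreal (indicator U (x + r *\<^sub>R h) * gauss_kernel e (x - (x
          + r *\<^sub>R h)))
            = indicator U (x + r *\<^sub>R h) * ennreal (gauss_kernel 1 h)"
          using r by (auto simp: indicator_def ennreal_mult[symmetric])
      qed
      finally show ?thesis .
    qed
    have k0: "0 \<le> k x" for x unfolding k_def by (intro integral_nonneg_AE) auto
    have kc: "(LINT y|lborel. ?f y * complex_of_real (gauss_kernel e (x - y))) = complex_of_real (k x)" for x
      unfolding k_def by (subst integral_complex_of_real[symmetric]) (auto simp: indicator_def intro!:
        Bochner_Integration.integral_cong)
    let ?I = "LINT \<zeta>|lborel. exp (- (e * (norm \<zeta>)\<^sup>2 / 2)) * (norm (fourier_integral ?f \<zeta>))\<^sup>2"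
    have "complex_of_real ?I = (LINT x|lborel. ?f x * cnj (complex_of_real (k x)))"
      using integral_gauss_fourier_integral[OF f e(1)] unfolding kc integral_complex_of_real .
    also have "\<dots> = complex_of_real (LINT x|lborel. indicator U x * k x)"
      by (subst integral_complex_of_real[symmetric]) (auto simp: indicator_def intro!:
        Bochner_Integration.integral_cong)
    finally have I: "?I = (LINT x|lborel. indicator U x * k x)" using of_real_eq_iff by blast
    have kb: "k x \<le> 1" for x
    proof -
      have "ennreal (k x) \<le> (\<integral>\<^sup>+h. ennreal (gauss_kernel 1 (h::'a)) \<partial>lborel)"
        unfolding kn by (intro nn_integral_mono) (auto simp: indicator_def)
      then show ?thesis by (simp add: nn_integral_gauss_kernel flip: ennreal_1)
    qed
    have "(\<integral>\<^sup>+x. indicator U x * (\<integral>\<^sup>+h. indicator U (x + r *\<^sub>R h)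
      * ennreal (gauss_kernel 1 h) \<partial>lborel) \<partial>lborel)
        = (\<integral>\<^sup>+x. ennreal (indicator U x * k x) \<partial>lborel)"
      unfolding kn[symmetric] by (intro nn_integral_cong) (auto simp: indicator_def)
    also have "\<dots> = ennreal ?I"
      unfolding I
    proof (rule nn_integral_eq_integral)
      show "integrable lborel (\<lambda>x. indicator U x * k x)"
        by (rule Bochner_Integration.integrable_bound[OF fr]) (use k0 kb in \<open>auto simp: indicator_def\<close>)
    qed (use k0 in auto)
    also have "\<dots> = (\<integral>\<^sup>+\<zeta>. ennreal (exp (- (e * (norm \<zeta>)\<^sup>2 / 2)) * (norm (fourier_integral ?f \<zeta>))\<^sup>2) \<partial>lborel)"
      by (rule nn_integral_eq_integral[OF integrable_gauss_fourier_integral[OF f e(1)], symmetric]) auto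
    also have "\<dots> \<le> ?R"
      using e by (intro nn_integral_mono ennreal_leI mult_left_le_one_le) auto
    finally show ?thesis .
  qed
  let ?u = "\<lambda>n x h. indicator U x * (indicator U (x + (1 / real (Suc n)) *\<^sub>R h) * ennreal (gauss_kernel 1 h))"
  have lim: "liminf (\<lambda>n. ?u n x h) = indicator U x * ennreal (gauss_kernel 1 h)" for x h
  proof (cases "x \<in> U")
    case True
    have "(\<lambda>n. x + (1 / real (Suc n)) *\<^sub>R h) \<longlonglongrightarrow> x + 0 *\<^sub>R h"
      using LIMSEQ_inverse_real_of_nat by (intro tendsto_intros) (auto simp: inverse_eq_divide)
    then have "\<forall>\<^sub>F n in sequentially. x + (1 / real (Suc n)) *\<^sub>R h \<in> U"
      using U True by (intro topological_tendstoD) auto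
    then have "\<forall>\<^sub>F n in sequentially. ?u n x h = indicator U x * ennreal (gauss_kernel 1 h)"
      by eventually_elim (simp add: True)
    then show ?thesis by (intro lim_imp_Liminf tendsto_eventually) auto
  qed (simp add: Liminf_const)
  have "emeasure lborel U = (\<integral>\<^sup>+x. indicator U x * (\<integral>\<^sup>+h. ennreal (gauss_kernel 1 (h::'a)) \<partial>lborel) \<partial>lborel)"
    by (simp add: nn_integral_gauss_kernel)
  also have "\<dots> = (\<integral>\<^sup>+x. (\<integral>\<^sup>+h. liminf (\<lambda>n. ?u n x h) \<partial>lborel) \<partial>lborel)"
    unfolding lim by (simp add: nn_integral_cmult)
  also have "\<dots> \<le> (\<integral>\<^sup>+x. liminf (\<lambda>n. \<integral>\<^sup>+h. ?u n x h \<partial>lborel) \<partial>lborel)"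
    by (intro nn_integral_mono nn_integral_liminf) measurable
  also have "\<dots> \<le> liminf (\<lambda>n. \<integral>\<^sup>+x. (\<integral>\<^sup>+h. ?u n x h \<partial>lborel) \<partial>lborel)"
    by (intro nn_integral_liminf) measurable
  also have "\<dots> \<le> ?R"
  proof (intro Liminf_le always_eventually allI)
    fix n
    show "(\<integral>\<^sup>+x. (\<integral>\<^sup>+h. ?u n x h \<partial>lborel) \<partial>lborel) \<le> ?R"
      using le[of "1 / real (Suc n)"] by (simp add: nn_integral_cmult)
  qed auto
  finally show ?thesis .
qed

text \<open>On this class the transform is an honest integral with finite square norm. It contains
  the truncations of every square integrable function and is therefore dense.\<close>

definition l12 :: "('a::euclidean_space \<Rightarrow> complex) \<Rightarrow> bool" where
  "l12 f \<longleftrightarrow> integrable lborel f \<and> l2 lborel f"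

lemma l12_add: "l12 f \<Longrightarrow> l12 g \<Longrightarrow> l12 (\<lambda>x. f x + g x)"
  and l12_diff: "l12 f \<Longrightarrow> l12 g \<Longrightarrow> l12 (\<lambda>x. f x - g x)"
  and l12_scale: "l12 f \<Longrightarrow> l12 (\<lambda>x. c * f x)"
  by (auto simp: l12_def l2_add l2_diff l2_scale)

lemma l12_bound:
  assumes g: "l12 g" and [measurable]: "f \<in> borel_measurable borel"
    and le: "\<And>x. norm (f x) \<le> norm (g x)"
  shows "l12 f"
  unfolding l12_def
proof
  show "integrable lborel f"
    by (rule Bochner_Integration.integrable_bound[of lborel g]) (use g le in \<open>auto simp: l12_def\<close>)
  show "l2 lborel f"
    by (rule l2_bound[of lborel g]) (use g le in \<open>auto simp: l12_def\<close>)
qed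

lemma
  assumes f: "l12 f"
  shows l2_fourier_integral: "l2 lborel (fourier_integral f)"
    and nsq_fourier_integral_le: "nsq lborel (fourier_integral f) \<le> nsq lborel f"
proof -
  have i: "integrable lborel f" and l: "l2 lborel f" using f by (auto simp: l12_def)
  have le: "(\<integral>\<^sup>+\<zeta>. ennreal ((norm (fourier_integral f \<zeta>))\<^sup>2) \<partial>lborel) \<le> ennreal (nsq lborel f)"
    using nn_integral_fourier_integral_le[OF i] unfolding nn_integral_nsq[OF l] .
  show *: "l2 lborel (fourier_integral f)"
    using le i by (intro l2I_nn_integral) (auto intro: le_less_trans fourier_integral_measurable)
  show "nsq lborel (fourier_integral f) \<le> nsq lborel f"
    using le unfolding nn_integral_nsq[OF *] by simp
qed

text \<open>
  The defect in the Plancherel identity is a nonnegative quadratic form bounded by the square norm.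
  It therefore vanishes everywhere once it vanishes on a dense subspace, which reduces the
  identity to indicators and then, by outer regularity, to indicators of open sets.
\<close>

definition fdefect :: "('a::euclidean_space \<Rightarrow> complex) \<Rightarrow> real" where
  "fdefect f = nsq lborel f - nsq lborel (fourier_integral f)"

lemma fdefect_nonneg: "l12 f \<Longrightarrow> 0 \<le> fdefect f"
  using nsq_fourier_integral_le by (auto simp: fdefect_def)

lemma fdefect_le: "fdefect f \<le> nsq lborel f"
  by (simp add: fdefect_def)

text \<open>Both square norms satisfy the parallelogram law, hence so does their difference;
  discarding the nonnegative defect of \<open>f - g\<close> leaves the bound.\<close>

lemma fdefect_add_le:
  assumes f: "l12 f" and g: "l12 g"
  shows "fdefect (\<lambda>x. f x + g x) \<le> 2 * fdefect f + 2 * fdefect g"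
proof -
  have i: "integrable lborel f" "integrable lborel g" and l: "l2 lborel f" "l2 lborel g"
    using f g by (auto simp: l12_def)
  have a: "fourier_integral (\<lambda>x. f x + g x) = (\<lambda>x. fourier_integral f x + fourier_integral g x)"
    by (simp add: fourier_integral_add[OF i] fun_eq_iff)
  have b: "fourier_integral (\<lambda>x. f x - g x) = (\<lambda>x. fourier_integral f x - fourier_integral g x)"
    by (simp add: fourier_integral_diff[OF i] fun_eq_iff)
  have "fdefect (\<lambda>x. f x + g x) + fdefect (\<lambda>x. f x - g x) = 2 * fdefect f + 2 * fdefect g"
    using nsq_parallelogram[OF l] nsq_parallelogram[OF l2_fourier_integral[OF f] l2_fourier_integral[OF g]]
    unfolding fdefect_def a b by simp
  then show ?thesis using fdefect_nonneg[OF l12_diff[OF f g]] by simp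
qed

lemma fdefect_scale: "fdefect (\<lambda>x. c * f x) = (norm c)\<^sup>2 * fdefect f"
proof -
  have "fourier_integral (\<lambda>x. c * f x) = (\<lambda>x. c * fourier_integral f x)"
    by (simp add: fourier_integral_scale fun_eq_iff)
  then show ?thesis by (simp add: fdefect_def nsq_scale right_diff_distrib)
qed

lemma
  assumes [measurable]: "A \<in> sets borel" and fin: "emeasure lborel A < \<infinity>"
  shows l12_indicator: "l12 (indicator A)"
    and nsq_indicator: "nsq lborel (indicator A :: 'a::euclidean_space \<Rightarrow> complex) = measure lborel A"
proof -
  have eq: "(norm (indicator A x :: complex))\<^sup>2 = indicator A x" for x :: 'a
    by (auto simp: indicator_def)
  have [simp]: "integrable lborel (indicator A :: 'a \<Rightarrow> real)" using fin by simp
  have c: "(indicator A :: 'a \<Rightarrow> complex) = (\<lambda>x. complex_of_real (indicator A x))"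
    by (auto simp: indicator_def)
  have "integrable lborel (indicator A :: 'a \<Rightarrow> complex)"
    unfolding c by simp
  then show "l12 (indicator A)" by (simp add: l12_def l2_def eq)
  show "nsq lborel (indicator A :: 'a \<Rightarrow> complex) = measure lborel A"
    unfolding nsq_def eq by simp
qed

text \<open>Outer regularity writes \<open>A\<close> as an open set minus a set of small measure.
  The open set has no defect, and the defect of the remainder is at most its measure.\<close>

lemma fdefect_indicator:
  assumes [measurable]: "A \<in> sets borel" and fin: "emeasure lborel A < \<infinity>"
  shows "fdefect (indicator A :: 'a::euclidean_space \<Rightarrow> complex) = 0"
proof (rule antisym)
  show "0 \<le> fdefect (indicator A :: 'a \<Rightarrow> complex)" by (rule fdefect_nonneg[OF l12_indicator[OF assms]])
  show "fdefect (indicator A :: 'a \<Rightarrow> complex) \<le> 0"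
  proof (rule field_le_epsilon)
    fix r :: real assume "0 < r"
    then obtain U where U: "open U" "A \<subseteq> U" "emeasure lborel (U - A) < ennreal (r / 2)"
      using outer_regular_lborel[OF assms(1), of "r / 2"] by auto
    have [measurable]: "U \<in> sets borel" using U by auto
    have "emeasure lborel U \<le> emeasure lborel A + emeasure lborel (U - A)"
      by (subst plus_emeasure) (use U in \<open>auto simp: Un_absorb1\<close>)
    also have "\<dots> < \<infinity>" using fin U(3) by (auto simp: ennreal_add_less_top intro: less_trans)
    finally have Uf: "emeasure lborel U < \<infinity>" .
    have Df: "emeasure lborel (U - A) < \<infinity>" using U(3) by (auto intro: less_trans)
    let ?U = "indicator U :: 'a \<Rightarrow> complex" and ?D = "indicator (U - A) :: 'a \<Rightarrow> complex"
    have "ennreal (nsq lborel ?U) \<le> ennreal (nsq lborel (fourier_integral ?U))"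
      using emeasure_le_nn_integral_fourier_integral_open[OF U(1) Uf] Uf
      unfolding nn_integral_nsq[OF l2_fourier_integral[OF l12_indicator[OF _ Uf, simplified]]]
      by (simp add: nsq_indicator emeasure_eq_ennreal_measure)
    then have U0: "fdefect ?U \<le> 0" by (simp add: fdefect_def)
    have "(indicator A :: 'a \<Rightarrow> complex) = (\<lambda>x. ?U x + (-1) * ?D x)"
      using U(2) by (auto simp: indicator_def fun_eq_iff)
    then have "fdefect (indicator A :: 'a \<Rightarrow> complex) \<le> 2 * fdefect ?U + 2 * fdefect (\<lambda>x. (-1) * ?D x)"
      using fdefect_add_le[of ?U "\<lambda>x. (-1) * ?D x"] l12_indicator[OF _ Uf] l12_scale[OF l12_indicator[OF _
        Df], of "-1"]
      by (auto simp del: mult_minus1)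
    also have "\<dots> \<le> 2 * nsq lborel ?D"
      using U0 fdefect_le[of ?D] unfolding fdefect_scale by simp
    also have "\<dots> = 2 * measure lborel (U - A)" by (subst nsq_indicator[OF _ Df]) auto
    also have "\<dots> \<le> r"
    proof -
      have "ennreal (measure lborel (U - A)) \<le> ennreal (r / 2)"
        using U(3) Df by (simp add: emeasure_eq_ennreal_measure less_imp_le)
      then show ?thesis using \<open>0 < r\<close> by simp
    qed
    finally show "fdefect (indicator A :: 'a \<Rightarrow> complex) \<le> 0 + r" by simp
  qed
qed

lemma fdefect_sum:
  assumes "finite I" "\<And>i. i \<in> I \<Longrightarrow> l12 (f i)" "\<And>i. i \<in> I \<Longrightarrow> fdefect (f i) = 0"
  shows "l12 (\<lambda>x. \<Sum>i\<in>I. f i x) \<and> fdefect (\<lambda>x. \<Sum>i\<in>I. f i x) = 0"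
  using assms
proof (induct I rule: finite_induct)
  case empty
  then show ?case
    using fdefect_scale[of 0 "\<lambda>_. 0"] by (simp add: l12_def)
next
  case (insert i I)
  then show ?case
    using fdefect_add_le[of "f i" "\<lambda>x. \<Sum>i\<in>I. f i x"] fdefect_nonneg[OF l12_add, of "f i" "\<lambda>x. \<Sum>i\<in>I. f i x"]
    by (auto intro: l12_add)
qed

text \<open>Simple functions dominated by \<open>2 * norm (f x)\<close> have no defect, so
  \<open>fdefect_add_le\<close> bounds the defect of \<open>f\<close> by twice the square norm of
  \<open>f - s i\<close>, which tends to zero.\<close>

lemma nsq_fourier_integral:
  fixes f :: "'a::euclidean_space \<Rightarrow> complex"
  assumes f: "l12 f"
  shows "nsq lborel (fourier_integral f) = nsq lborel f"
proof -
  have [measurable]: "f \<in> borel_measurable borel" using f by (auto simp: l12_def)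
  obtain s where s: "\<And>i. simple_function lborel (s i)" "\<And>x. (\<lambda>i. s i x) \<longlonglongrightarrow> f x"
    "\<And>i x. norm (s i x) \<le> 2 * norm (f x)"
    using borel_measurable_implies_sequence_metric[of f lborel 0] by auto
  have [measurable]: "s i \<in> borel_measurable borel" for i
    using borel_measurable_simple_function[OF s(1)] by simp
  have sl: "l12 (s i)" for i
    by (rule l12_bound[OF l12_scale[OF f, of 2]]) (use s(3) in \<open>auto simp: norm_mult\<close>)
  have s0: "fdefect (s i) = 0" for i
  proof -
    have m[measurable]: "s i -` {y} \<in> sets borel" for y
      using measurable_sets_borel[of "s i" borel "{y}"] by simp
    \<comment> \<open>Markov's inequality, available for nonzero values only; the level set of zero
      may have infinite measure, but it is multiplied by zero.\<close>
    have fin: "emeasure lborel (s i -` {y}) < \<infinity>" if "y \<noteq> 0" for y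
    proof -
      have "ennreal (norm y) * emeasure lborel (s i -` {y})
        = (\<integral>\<^sup>+x. ennreal (norm y) * indicator (s i -` {y}) x \<partial>lborel)"
        by (subst nn_integral_cmult_indicator) auto
      also have "\<dots> \<le> (\<integral>\<^sup>+x. ennreal (norm (s i x)) \<partial>lborel)"
        by (intro nn_integral_mono) (auto simp: indicator_def)
      also have "\<dots> < \<infinity>" using sl[of i] by (auto simp: l12_def integrable_iff_bounded)
      finally show ?thesis using that by (auto simp: ennreal_mult_less_top)
    qed
    have "s i x = (\<Sum>y\<in>s i ` UNIV. y * indicator (s i -` {y}) x)" for x
    proof -
      have "s i x = (\<Sum>y\<in>s i ` UNIV. indicat_real (s i -` {y}) x *\<^sub>R y)"
        by (rule simple_function_indicator_representation_banach[OF s(1), of x i,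
              unfolded space_lborel space_borel Int_UNIV_right, OF UNIV_I])
      also have "\<dots> = (\<Sum>y\<in>s i ` UNIV. y * indicator (s i -` {y}) x)"
        by (intro sum.cong refl) (simp split: split_indicator)
      finally show ?thesis .
    qed
    then have "s i = (\<lambda>x. \<Sum>y\<in>s i ` UNIV. y * indicator (s i -` {y}) x)"
      by (rule ext)
    then have "fdefect (s i) = fdefect (\<lambda>x. \<Sum>y\<in>s i ` UNIV. y * indicator (s i -` {y}) x)"
      by (rule arg_cong)
    moreover have "l12 (\<lambda>x. y * indicator (s i -` {y}) x) \<and> fdefect (\<lambda>x. y * indicator (s i -` {y}) x)
      = 0" for y
    proof (cases "y = 0")
      case True
      then show ?thesis using fdefect_scale[of 0 "\<lambda>_. 0"] by (simp add: l12_def)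
    next
      case False
      show ?thesis using l12_scale[OF l12_indicator[OF m fin[OF False]]] fdefect_indicator[OF m fin[OF False]]
        by (simp add: fdefect_scale)
    qed
    moreover have "finite (s i ` UNIV)" using s(1)[of i] by (simp add: simple_function_def)
    ultimately show ?thesis
      using fdefect_sum[of "s i ` UNIV" "\<lambda>y x. y * indicator (s i -` {y}) x"] by presburger
  qed
  have "(\<lambda>i. nsq lborel (\<lambda>x. f x - s i x)) \<longlonglongrightarrow> 0"
  proof (rule nsq_tendsto_0_dominated[where g="\<lambda>x. 3 * f x"])
    show "AE x in lborel. norm (f x - s n x) \<le> norm (3 * f x)" for n
    proof (intro always_eventually allI)
      fix x show "norm (f x - s n x) \<le> norm (3 * f x)"
        using norm_triangle_ineq4[of "f x" "s n x"] s(3)[of n x] by (simp add: norm_mult)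
    qed
    show "AE x in lborel. (\<lambda>n. f x - s n x) \<longlonglongrightarrow> 0"
      using s(2) by (auto intro!: always_eventually tendsto_eq_intros)
  qed (use f in \<open>auto simp: l12_def l2_scale\<close>)
  from tendsto_mult_left[OF this, of 2]
  have lim: "(\<lambda>i. 2 * nsq lborel (\<lambda>x. f x - s i x)) \<longlonglongrightarrow> 0" by (simp only: mult_zero_right)
  have "fdefect f \<le> 2 * nsq lborel (\<lambda>x. f x - s i x)" for i
    using fdefect_add_le[OF sl[of i] l12_diff[OF f sl[of i]]] fdefect_le[of "\<lambda>x. f x - s i x"] s0[of i]
      by simp
  then have "fdefect f \<le> 0" by (intro LIMSEQ_le_const[OF lim] exI allI impI)
  then show ?thesis using fdefect_nonneg[OF f] by (simp add: fdefect_def)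
qed

section \<open>The Fourier transform on square integrable functions\<close>

lemma l2_lebesgue:
  "f \<in> borel_measurable borel \<Longrightarrow> l2 lebesgue f \<longleftrightarrow> l2 lborel f"
  for f :: "'a::euclidean_space \<Rightarrow> 'b::{real_normed_vector, second_countable_topology}"
  unfolding l2_def by (simp add: integrable_completion measurable_completion)

lemma nsq_lebesgue:
  "f \<in> borel_measurable borel \<Longrightarrow> nsq lebesgue f = nsq lborel f"
  for f :: "'a::euclidean_space \<Rightarrow> 'b::{real_normed_vector, second_countable_topology}"
  unfolding nsq_def by (simp add: integral_completion)

lemma square_integrable_l2: "square_integrable f \<longleftrightarrow> l2 lebesgue f"
  by (simp add: square_integrable_def l2_def)

lemma ex_borel_rep_complex:
  fixes f :: "'a::euclidean_space \<Rightarrow> complex"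
  assumes [measurable]: "f \<in> borel_measurable lebesgue"
  obtains g where "g \<in> borel_measurable borel" "AE x in lebesgue. f x = g x"
proof -
  have "(\<lambda>x. Re (f x)) \<in> borel_measurable lebesgue" "(\<lambda>x. Im (f x)) \<in> borel_measurable lebesgue"
    by measurable
  from this[THEN completion_ex_borel_measurable_real]
  obtain a b where [measurable]: "a \<in> borel_measurable borel" "b \<in> borel_measurable borel"
    and ae: "AE x in lborel. Re (f x) = a x" "AE x in lborel. Im (f x) = b x"
    by auto
  have "AE x in lborel. f x = Complex (a x) (b x)"
    using ae by eventually_elim (simp add: complex_eq_iff)
  moreover have "(\<lambda>x. Complex (a x) (b x)) \<in> borel_measurable borel"
    by (simp add: borel_measurable_complex_iff)
  ultimately show thesis using that AE_completion by metis
qed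

lemma fourier_integral_cong_AE:
  assumes "f \<in> borel_measurable lebesgue" "g \<in> borel_measurable lebesgue" "AE x in lebesgue. f x = g x"
  shows "fourier_integral f \<zeta> = fourier_integral g \<zeta>"
proof -
  have [measurable]: "(\<lambda>x. cis (- (x \<bullet> \<zeta>))) \<in> borel_measurable lebesgue"
    by (rule measurable_completion) measurable
  show ?thesis
    unfolding fourier_integral_def
    by (intro arg_cong[where f="\<lambda>x. _ *\<^sub>R x"] integral_cong_AE) (use assms in \<open>auto elim: eventually_mono\<close>)
qed

definition truncate :: "nat \<Rightarrow> ('a::euclidean_space \<Rightarrow> complex) \<Rightarrow> 'a \<Rightarrow> complex" where
  "truncate n f = (\<lambda>x. if norm x \<le> real n then f x else 0)"

lemma truncate_measurable [measurable (raw)]: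
  assumes [measurable]: "f \<in> borel_measurable borel"
  shows "truncate n f \<in> borel_measurable borel"
  unfolding truncate_def by measurable

lemma truncate_measurable_lebesgue:
  assumes [measurable]: "f \<in> borel_measurable lebesgue"
  shows "truncate n f \<in> borel_measurable lebesgue"
proof -
  have [measurable]: "cball 0 (real n) \<in> sets lebesgue"
    by (metis closed_cball borel_closed sets_completionI_sets sets_lborel)
  have "truncate n f = (\<lambda>x. indicator (cball 0 (real n)) x * f x)"
    by (auto simp: truncate_def indicator_def fun_eq_iff)
  then show ?thesis by simp
qed

lemma fourier_cong_AE:
  fixes f :: "'a::euclidean_space \<Rightarrow> complex"
  assumes [measurable]: "f \<in> borel_measurable lebesgue" "g \<in> borel_measurable lebesgue"
    and ae: "AE x in lebesgue. f x = g x"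
  shows "fourier f = fourier g"
proof -
  have "fourier_integral (truncate n f) \<zeta> = fourier_integral (truncate n g) \<zeta>" for n \<zeta>
    by (rule fourier_integral_cong_AE[OF truncate_measurable_lebesgue truncate_measurable_lebesgue])
       (use ae in \<open>auto simp: truncate_def elim: eventually_mono\<close>)
  then have "is_fourier_transform f h = is_fourier_transform g h" for h
    unfolding is_fourier_transform_def truncate_def by simp
  then have "is_fourier_transform f = is_fourier_transform g" by (rule ext)
  then show ?thesis unfolding fourier_def by (rule arg_cong)
qed

lemma l12_truncate:
  assumes f: "l2 lborel f"
  shows "l12 (truncate n f)"
  unfolding l12_def
proof
  have [measurable]: "f \<in> borel_measurable borel" using f by (simp add: l2_def)
  show "l2 lborel (truncate n f)"
    by (rule l2_bound[OF f]) (auto simp: truncate_def)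
  have i: "integrable lborel (indicator (cball 0 (real n)) :: 'a \<Rightarrow> real)"
    using emeasure_lborel_cball_finite[of "0::'a" "real n"] by auto
  have le: "norm (truncate n f x) \<le> norm (indicator (cball 0 (real n)) x + (norm (f x))\<^sup>2)" for x
    using zero_le_power2[of "norm (f x) - 1/2"]
    by (auto simp: truncate_def power2_eq_square algebra_simps)
  show "integrable lborel (truncate n f)"
    by (rule Bochner_Integration.integrable_bound[of lborel "\<lambda>x. indicator (cball 0 (real n)) x
      + (norm (f x))\<^sup>2"])
       (use f i le in \<open>auto simp: l2_def\<close>)
qed

lemma nsq_truncate_tendsto:
  assumes f: "l2 lborel f"
  shows "(\<lambda>n. nsq lborel (\<lambda>x. truncate n f x - f x)) \<longlonglongrightarrow> 0"
proof (rule nsq_tendsto_0_dominated[OF f])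
  have [measurable]: "f \<in> borel_measurable borel" using f by (simp add: l2_def)
  show "(\<lambda>x. truncate n f x - f x) \<in> borel_measurable lborel" for n by measurable
  show "AE x in lborel. cmod (truncate n f x - f x) \<le> cmod (f x)" for n
    by (auto simp: truncate_def)
  have "(\<lambda>n. truncate n f x - f x) \<longlonglongrightarrow> 0" for x
  proof (rule tendsto_eventually)
    obtain N :: nat where "norm x \<le> real N" using real_arch_simple by blast
    then show "\<forall>\<^sub>F n in sequentially. truncate n f x - f x = 0"
      by (intro eventually_sequentiallyI[of N]) (auto simp: truncate_def)
  qed
  then show "AE x in lborel. (\<lambda>n. truncate n f x - f x) \<longlonglongrightarrow> 0" by simp
qed

lemma nsq_fourier_integral_diff:
  assumes f: "l12 f" and g: "l12 g"
  shows "nsq lborel (\<lambda>x. fourier_integral f x - fourier_integral g x) = nsq lborel (\<lambda>x. f x - g x)"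
proof -
  have "fourier_integral (\<lambda>x. f x - g x) = (\<lambda>x. fourier_integral f x - fourier_integral g x)"
    using f g by (auto simp: fourier_integral_diff l12_def fun_eq_iff)
  then show ?thesis using nsq_fourier_integral[OF l12_diff[OF f g]] by simp
qed

text \<open>
  Everything is done with a Borel representative of the transform, so that Tonelli's theorem
  applies directly.
\<close>

definition bfourier :: "('a::euclidean_space \<Rightarrow> complex) \<Rightarrow> 'a \<Rightarrow> complex" where
  "bfourier f = (SOME g. g \<in> borel_measurable borel \<and> (AE x in lebesgue. fourier f x = g x))"

text \<open>The truncations are Cauchy in \<open>L2\<close>, and by Plancherel so are their Fourier
  integrals. Completeness supplies a limit, which shows that the \<open>SOME\<close> in
  \<open>fourier\<close> is satisfied; passing to a Borel version changes the limit only on a null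
  set.\<close>

lemma
  fixes f :: "'a::euclidean_space \<Rightarrow> complex"
  assumes f: "l2 lborel f"
  shows l2_bfourier: "l2 lborel (bfourier f)"
    and bfourier_limit: "(\<lambda>n. nsq lborel (\<lambda>x. bfourier f x - fourier_integral (truncate n f) x)) \<longlonglongrightarrow> 0"
    and fourier_eq_bfourier: "AE x in lebesgue. fourier f x = bfourier f x"
    and l2_fourier: "l2 lebesgue (fourier f)"
proof -
  have [measurable]: "f \<in> borel_measurable borel" using f by (simp add: l2_def)
  let ?T = "\<lambda>n. fourier_integral (truncate n f)"
  have T: "l2 lborel (?T n)" for n by (rule l2_fourier_integral[OF l12_truncate[OF f]])
  have Tm[measurable]: "?T n \<in> borel_measurable borel" for n using T by (simp add: l2_def)
  have Tl: "l2 lebesgue (?T n)" for n using T by (simp add: l2_lebesgue)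
  obtain g where g: "l2 lborel g" "(\<lambda>n. nsq lborel (\<lambda>x. ?T n x - g x)) \<longlonglongrightarrow> 0"
  proof (rule l2_complete[OF T])
    fix e :: real assume "e > 0"
    then obtain N where N: "\<And>n. n \<ge> N \<Longrightarrow> nsq lborel (\<lambda>x. truncate n f x - f x) < e"
      using LIMSEQ_D[OF nsq_truncate_tendsto[OF f]] by fastforce
    show "\<exists>N. \<forall>n\<ge>N. \<forall>m\<ge>n. nsq lborel (\<lambda>x. ?T m x - ?T n x) \<le> e"
    proof (intro exI allI impI)
      fix n m assume "N \<le> n" "n \<le> m"
      have "nsq lborel (\<lambda>x. ?T m x - ?T n x) = nsq lborel (\<lambda>x. truncate m f x - truncate n f x)"
        by (intro nsq_fourier_integral_diff l12_truncate f)
      also have "\<dots> \<le> nsq lborel (\<lambda>x. truncate n f x - f x)"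
        unfolding nsq_def
      proof (intro integral_mono)
        show "(cmod (truncate m f x - truncate n f x))\<^sup>2 \<le> (cmod (truncate n f x - f x))\<^sup>2" for x
          using \<open>n \<le> m\<close> by (auto simp: truncate_def)
      qed (use f l2_diff[of lborel "truncate m f" "truncate n f"] l2_diff[of lborel "truncate n f" f]
        l12_truncate[OF f] in \<open>auto simp: l2_def l12_def\<close>)
      also have "\<dots> \<le> e" using N[OF \<open>N \<le> n\<close>] by simp
      finally show "nsq lborel (\<lambda>x. ?T m x - ?T n x) \<le> e" .
    qed
  qed
  \<comment> \<open>For square integrable \<open>h\<close> the nonnegative integral in
    \<open>is_fourier_transform\<close> is finite and equals the square norm of the difference, so
    the defining limit can be read in the reals.\<close>
  have iff: "is_fourier_transform f h \<longleftrightarrow> l2 lebesgue h \<and> (\<lambda>n. nsq lebesgue (\<lambda>x. h x - ?T n x)) \<longlonglongrightarrow> 0" for h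
  proof (cases "l2 lebesgue h")
    case True
    have "(\<integral>\<^sup>+ \<zeta>. ennreal ((norm (h \<zeta> - ?T n \<zeta>))\<^sup>2) \<partial>lebesgue)
      = ennreal (nsq lebesgue (\<lambda>x. h x - ?T n x))" for n
      using nn_integral_nsq[OF l2_diff[OF True Tl]] .
    then show ?thesis
      using True unfolding is_fourier_transform_def square_integrable_l2 truncate_def[symmetric]
      by (simp add: tendsto_ennreal_iff[of _ _ 0, simplified])
  qed (simp add: is_fourier_transform_def square_integrable_l2)
  have [measurable]: "g \<in> borel_measurable borel" using g by (simp add: l2_def)
  have "nsq lebesgue (\<lambda>x. g x - ?T n x) = nsq lborel (\<lambda>x. ?T n x - g x)" for n
    by (subst nsq_lebesgue) (simp_all add: nsq_def norm_minus_commute)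
  then have "is_fourier_transform f g" using g by (simp add: iff l2_lebesgue)
  then have "is_fourier_transform f (fourier f)" unfolding fourier_def
    by (rule someI[of "is_fourier_transform f"])
  then have F: "l2 lebesgue (fourier f)" "(\<lambda>n. nsq lebesgue (\<lambda>x. fourier f x - ?T n x)) \<longlonglongrightarrow> 0"
    by (auto simp: iff)
  show "l2 lebesgue (fourier f)" by fact
  have "\<exists>g. g \<in> borel_measurable borel \<and> (AE x in lebesgue. fourier f x = g x)"
    using ex_borel_rep_complex[of "fourier f"] F(1) unfolding l2_def by metis
  then have b: "bfourier f \<in> borel_measurable borel \<and> (AE x in lebesgue. fourier f x = bfourier f x)"
    unfolding bfourier_def by (rule someI_ex)
  then show ae: "AE x in lebesgue. fourier f x = bfourier f x" by simp
  have [measurable]: "bfourier f \<in> borel_measurable borel" using b by simp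
  have fm[measurable]: "fourier f \<in> borel_measurable lebesgue" using F by (simp add: l2_def)
  have bm[measurable]: "bfourier f \<in> borel_measurable lebesgue" by (rule measurable_completion) simp
  have "l2 lebesgue (bfourier f)"
    by (rule l2_bound[OF F(1)]) (use ae in \<open>auto elim: eventually_mono\<close>)
  then show "l2 lborel (bfourier f)" by (simp add: l2_lebesgue)
  have [measurable]: "?T n \<in> borel_measurable lebesgue" for n by (rule measurable_completion) simp
  have "nsq lebesgue (\<lambda>x. fourier f x - ?T n x) = nsq lborel (\<lambda>x. bfourier f x - ?T n x)" for n
  proof -
    have "nsq lebesgue (\<lambda>x. fourier f x - ?T n x) = nsq lebesgue (\<lambda>x. bfourier f x - ?T n x)"
      by (rule nsq_cong_AE) (use ae in \<open>auto elim: eventually_mono\<close>)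
    then show ?thesis by (simp add: nsq_lebesgue)
  qed
  with F(2) show "(\<lambda>n. nsq lborel (\<lambda>x. bfourier f x - ?T n x)) \<longlonglongrightarrow> 0" by simp
qed

lemma bfourier_measurable: "l2 lborel f \<Longrightarrow> bfourier f \<in> borel_measurable borel"
  using l2_bfourier by (force simp: l2_def)

lemma nsq_limit_unique:
  fixes g h :: "'a \<Rightarrow> complex"
  assumes g: "l2 M g" and h: "l2 M h" and F: "\<And>n::nat. l2 M (F n)"
    and "(\<lambda>n. nsq M (\<lambda>x. F n x - g x)) \<longlonglongrightarrow> 0" "(\<lambda>n. nsq M (\<lambda>x. F n x - h x)) \<longlonglongrightarrow> 0"
  shows "AE x in M. g x = h x"
proof -
  have "(\<lambda>n. 2 * nsq M (\<lambda>x. F n x - h x) + 2 * nsq M (\<lambda>x. F n x - g x)) \<longlonglongrightarrow> 2 * 0 + 2 * 0"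
    by (intro tendsto_intros assms)
  then have "nsq M (\<lambda>x. g x - h x) \<le> 2 * 0 + 2 * 0"
  proof (rule LIMSEQ_le_const, intro exI allI impI)
    fix n
    show "nsq M (\<lambda>x. g x - h x) \<le> 2 * nsq M (\<lambda>x. F n x - h x) + 2 * nsq M (\<lambda>x. F n x - g x)"
      using nsq_diff_le[OF l2_diff[OF F h] l2_diff[OF F g], of n n] by simp
  qed
  then have "nsq M (\<lambda>x. g x - h x) = 0" using nsq_nonneg[of M "\<lambda>x. g x - h x"] by simp
  then show ?thesis using nsq_eq_0_iff[OF l2_diff[OF g h]] by simp
qed

text \<open>Any \<open>l12\<close> approximation of \<open>f\<close> computes its transform, since
  the Fourier integral is isometric on \<open>l12\<close> and the transforms of two approximations
  have the same limit. The rules for sums, multiples, conjugates and translates follow by applying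
  the operation to the truncations.\<close>

lemma bfourier_unique:
  fixes f g :: "'a::euclidean_space \<Rightarrow> complex"
  assumes f: "l2 lborel f" and g: "l2 lborel g" and F: "\<And>n::nat. l12 (F n)"
    and lim: "(\<lambda>n. nsq lborel (\<lambda>x. F n x - f x)) \<longlonglongrightarrow> 0"
    and limg: "(\<lambda>n. nsq lborel (\<lambda>x. fourier_integral (F n) x - g x)) \<longlonglongrightarrow> 0"
  shows "AE x in lborel. bfourier f x = g x"
proof (rule nsq_limit_unique[OF l2_bfourier[OF f] g l2_fourier_integral[OF F] _ limg])
  let ?T = "\<lambda>n. truncate n f"
  have T: "l12 (?T n)" for n by (rule l12_truncate[OF f])
  have l: "l2 lborel (F n)" "l2 lborel (?T n)" for n using F T by (auto simp: l12_def)
  have "(\<lambda>n. 2 * (2 * nsq lborel (\<lambda>x. F n x - f x) + 2 * nsq lborel (\<lambda>x. ?T n x - f x))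
     + 2 * nsq lborel (\<lambda>x. bfourier f x - fourier_integral (?T n) x)) \<longlonglongrightarrow> 2 * (2 * 0 + 2 * 0) + 2 * 0"
    by (intro tendsto_intros lim nsq_truncate_tendsto bfourier_limit f)
  then have z: "(\<lambda>n. 2 * (2 * nsq lborel (\<lambda>x. F n x - f x) + 2 * nsq lborel (\<lambda>x. ?T n x - f x))
     + 2 * nsq lborel (\<lambda>x. bfourier f x - fourier_integral (?T n) x)) \<longlonglongrightarrow> 0" by simp
  have le: "nsq lborel (\<lambda>x. fourier_integral (F n) x - bfourier f x)
     \<le> 2 * (2 * nsq lborel (\<lambda>x. F n x - f x) + 2 * nsq lborel (\<lambda>x. ?T n x - f x))
     + 2 * nsq lborel (\<lambda>x. bfourier f x - fourier_integral (?T n) x)" for n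
  proof -
    have a: "nsq lborel (\<lambda>x. fourier_integral (F n) x - bfourier f x)
       \<le> 2 * nsq lborel (\<lambda>x. fourier_integral (F n) x - fourier_integral (?T n) x)
         + 2 * nsq lborel (\<lambda>x. bfourier f x - fourier_integral (?T n) x)"
      using nsq_diff_le[OF l2_diff[OF l2_fourier_integral[OF F] l2_fourier_integral[OF T]] l2_diff[OF
        l2_bfourier[OF f] l2_fourier_integral[OF T]], of n n n]
      by simp
    have b: "nsq lborel (\<lambda>x. fourier_integral (F n) x - fourier_integral (?T n) x)
       \<le> 2 * nsq lborel (\<lambda>x. F n x - f x) + 2 * nsq lborel (\<lambda>x. ?T n x - f x)"
      unfolding nsq_fourier_integral_diff[OF F T]
      using nsq_diff_le[OF l2_diff[OF l(1) f] l2_diff[OF l(2) f], of n n] by simp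
    show ?thesis
      by (rule order_trans[OF a], intro add_mono mult_left_mono b order_refl) simp
  qed
  show "(\<lambda>n. nsq lborel (\<lambda>x. fourier_integral (F n) x - bfourier f x)) \<longlonglongrightarrow> 0"
    by (rule Lim_null_comparison[OF _ z]) (use le in \<open>auto intro!: always_eventually\<close>)
qed

lemma bfourier_l12:
  assumes f: "l12 f"
  shows "AE x in lborel. bfourier f x = fourier_integral f x"
  by (rule bfourier_unique[where F="\<lambda>_. f"])
     (use f l2_fourier_integral[OF f] in \<open>auto simp: l12_def nsq_def\<close>)

lemma nsq_truncate_diff_tendsto:
  assumes "l2 lborel f"
  shows "(\<lambda>n. nsq lborel (\<lambda>x. fourier_integral (truncate n f) x - bfourier f x)) \<longlonglongrightarrow> 0"
  using bfourier_limit[OF assms] by (simp add: nsq_def norm_minus_commute)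

lemma nsq_bfourier:
  assumes f: "l2 lborel f"
  shows "nsq lborel (bfourier f) = nsq lborel f"
proof -
  have "(\<lambda>n. nsq lborel (fourier_integral (truncate n f))) \<longlonglongrightarrow> nsq lborel (bfourier f)"
    by (intro tendsto_nsq l2_fourier_integral l12_truncate f l2_bfourier nsq_truncate_diff_tendsto)
  moreover have "(\<lambda>n. nsq lborel (truncate n f)) \<longlonglongrightarrow> nsq lborel f"
    using l12_truncate[OF f] by (intro tendsto_nsq nsq_truncate_tendsto f) (auto simp: l12_def)
  ultimately show ?thesis
    by (simp add: nsq_fourier_integral[OF l12_truncate[OF f]] LIMSEQ_unique)
qed

lemma bfourier_add:
  assumes f: "l2 lborel f" and g: "l2 lborel g"
  shows "AE x in lborel. bfourier (\<lambda>x. f x + g x) x = bfourier f x + bfourier g x"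
proof (rule bfourier_unique[where F="\<lambda>n x. truncate n f x + truncate n g x"])
  let ?F = "\<lambda>n x. truncate n f x + truncate n g x"
  have i: "integrable lborel (truncate n f)" "integrable lborel (truncate n g)" for n
    using l12_truncate[OF f] l12_truncate[OF g] by (auto simp: l12_def)
  have eq: "?F n = truncate n (\<lambda>x. f x + g x)" for n
    by (auto simp: truncate_def fun_eq_iff)
  show "(\<lambda>n. nsq lborel (\<lambda>x. ?F n x - (f x + g x))) \<longlonglongrightarrow> 0"
    using nsq_truncate_tendsto[OF l2_add[OF f g]] unfolding eq[symmetric] .
  show "(\<lambda>n. nsq lborel (\<lambda>x. fourier_integral (?F n) x - (bfourier f x + bfourier g x))) \<longlonglongrightarrow> 0"
  proof (rule Lim_null_comparison)
    have "(\<lambda>n. 2 * nsq lborel (\<lambda>x. fourier_integral (truncate n f) x - bfourier f x)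
        + 2 * nsq lborel (\<lambda>x. fourier_integral (truncate n g) x - bfourier g x)) \<longlonglongrightarrow> 2 * 0 + 2 * 0"
      by (intro tendsto_intros nsq_truncate_diff_tendsto f g)
    then show "(\<lambda>n. 2 * nsq lborel (\<lambda>x. fourier_integral (truncate n f) x - bfourier f x)
        + 2 * nsq lborel (\<lambda>x. fourier_integral (truncate n g) x - bfourier g x)) \<longlonglongrightarrow> 0" by simp
    have "nsq lborel (\<lambda>x. fourier_integral (?F n) x - (bfourier f x + bfourier g x))
      \<le> 2 * nsq lborel (\<lambda>x. fourier_integral (truncate n f) x - bfourier f x)
        + 2 * nsq lborel (\<lambda>x. fourier_integral (truncate n g) x - bfourier g x)" for n
      using nsq_add_le[OF l2_diff[OF l2_fourier_integral[OF l12_truncate[OF f]] l2_bfourier[OF f]]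
          l2_diff[OF l2_fourier_integral[OF l12_truncate[OF g]] l2_bfourier[OF g]], of n n]
      by (simp add: fourier_integral_add[OF i] add_diff_add)
    then show "\<forall>\<^sub>F n in sequentially. norm (nsq lborel (\<lambda>x. fourier_integral (?F n) x - (bfourier f x
      + bfourier g x)))
      \<le> 2 * nsq lborel (\<lambda>x. fourier_integral (truncate n f) x - bfourier f x)
        + 2 * nsq lborel (\<lambda>x. fourier_integral (truncate n g) x - bfourier g x)"
      by simp
  qed
qed (rule l2_add[OF f g] l2_add[OF l2_bfourier[OF f] l2_bfourier[OF g]]
    l12_add[OF l12_truncate[OF f] l12_truncate[OF g]])+

lemma bfourier_scale:
  assumes f: "l2 lborel f"
  shows "AE x in lborel. bfourier (\<lambda>x. c * f x) x = c * bfourier f x"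
proof (rule bfourier_unique[where F="\<lambda>n x. c * truncate n f x"])
  have eq: "c * truncate n f x - c * f x = c * (truncate n f x - f x)" for n x
    by (simp add: right_diff_distrib)
  show "(\<lambda>n. nsq lborel (\<lambda>x. c * truncate n f x - c * f x)) \<longlonglongrightarrow> 0"
    unfolding eq nsq_scale using tendsto_mult_right_zero[OF nsq_truncate_tendsto[OF f]] .
  have eq: "fourier_integral (\<lambda>x. c * truncate n f x) x - c * bfourier f x
     = c * (fourier_integral (truncate n f) x - bfourier f x)" for n x
    by (simp add: right_diff_distrib fourier_integral_scale)
  show "(\<lambda>n. nsq lborel (\<lambda>x. fourier_integral (\<lambda>x. c * truncate n f x) x - c * bfourier f x)) \<longlonglongrightarrow> 0"
    unfolding eq nsq_scale using tendsto_mult_right_zero[OF nsq_truncate_diff_tendsto[OF f]] .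
qed (rule l2_scale[OF f] l2_scale[OF l2_bfourier[OF f]] l12_scale[OF l12_truncate[OF f]])+

section \<open>Conjugation, inversion and Parseval's identity\<close>

lemma nsq_uminus:
  fixes f :: "'a::euclidean_space \<Rightarrow> complex"
  assumes [measurable]: "f \<in> borel_measurable borel"
  shows "nsq lborel (\<lambda>x. f (- x)) = nsq lborel f"
proof -
  have nn: "nsq lborel g = enn2real (\<integral>\<^sup>+x. ennreal ((cmod (g x))\<^sup>2) \<partial>lborel)"
    if [measurable]: "g \<in> borel_measurable borel" for g :: "'a \<Rightarrow> complex"
    unfolding nsq_def by (rule integral_eq_nn_integral) auto
  have "(\<lambda>x. f (- x)) \<in> borel_measurable borel" by measurable
  then show ?thesis
    using nn_integral_lborel_uminus[of "\<lambda>x. ennreal ((cmod (f x))\<^sup>2)"]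
    by (simp add: nn del: borel_measurable_uminus_eq)
qed

lemma l2_uminus:
  fixes f :: "'a::euclidean_space \<Rightarrow> complex"
  assumes f: "l2 lborel f"
  shows "l2 lborel (\<lambda>x. f (- x))"
proof -
  have [measurable]: "f \<in> borel_measurable borel" using f by (simp add: l2_def)
  show ?thesis
  proof (rule l2I_nn_integral)
    show "(\<integral>\<^sup>+x. ennreal ((cmod (f (- x)))\<^sup>2) \<partial>lborel) < \<infinity>"
      using nn_integral_nsq[OF f] nn_integral_lborel_uminus[of "\<lambda>x. ennreal ((cmod (f x))\<^sup>2)"] by simp
  qed measurable
qed

lemma bfourier_cnj:
  assumes f: "l2 lborel f"
  shows "AE x in lborel. bfourier (\<lambda>x. cnj (f x)) x = cnj (bfourier f (- x))"
proof (rule bfourier_unique[where F="\<lambda>n x. cnj (truncate n f x)"])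
  have [measurable]: "bfourier f \<in> borel_measurable borel" by (rule bfourier_measurable[OF f])
  have [measurable]: "fourier_integral (truncate n f) \<in> borel_measurable borel" for n
    using l2_fourier_integral[OF l12_truncate[OF f]] by (simp add: l2_def)
  show "l12 (\<lambda>x. cnj (truncate n f x))" for n
    using l12_truncate[OF f, of n] by (auto simp: l12_def l2_cnj)
  show "l2 lborel (\<lambda>x. cnj (bfourier f (- x)))" by (intro l2_cnj l2_uminus l2_bfourier f)
  have "norm (cnj (truncate n f x) - cnj (f x)) = norm (truncate n f x - f x)" for n x
    by (metis complex_cnj_diff complex_mod_cnj)
  then show "(\<lambda>n. nsq lborel (\<lambda>x. cnj (truncate n f x) - cnj (f x))) \<longlonglongrightarrow> 0"
    using nsq_truncate_tendsto[OF f] by (simp add: nsq_def)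
  have eq: "fourier_integral (\<lambda>x. cnj (truncate n f x)) x - cnj (bfourier f (- x))
     = cnj (fourier_integral (truncate n f) (- x) - bfourier f (- x))" for n x
    using fourier_integral_cnj[of "truncate n f" "- x"] by simp
  have "nsq lborel (\<lambda>x. fourier_integral (\<lambda>x. cnj (truncate n f x)) x - cnj (bfourier f (- x)))
      = nsq lborel (\<lambda>x. fourier_integral (truncate n f) x - bfourier f x)" for n
  proof -
    have "nsq lborel (\<lambda>x. fourier_integral (\<lambda>x. cnj (truncate n f x)) x - cnj (bfourier f (- x)))
      = nsq lborel (\<lambda>x. fourier_integral (truncate n f) (- x) - bfourier f (- x))"
      unfolding eq nsq_def complex_mod_cnj ..
    also have "\<dots> = nsq lborel (\<lambda>x. fourier_integral (truncate n f) x - bfourier f x)"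
      by (rule nsq_uminus) measurable
    finally show ?thesis .
  qed
  then show "(\<lambda>n. nsq lborel (\<lambda>x. fourier_integral (\<lambda>x. cnj (truncate n f x)) x
    - cnj (bfourier f (- x)))) \<longlonglongrightarrow> 0"
    using nsq_truncate_diff_tendsto[OF f] by simp
qed (rule l2_cnj[OF f])

text \<open>The pairing is continuous in each factor, so the identity for truncations passes to the
  limit first in \<open>f\<close> and then in \<open>k\<close>.\<close>

lemma bfourier_multiplication:
  assumes f: "l2 lborel f" and k: "l2 lborel k"
  shows "(LINT x|lborel. bfourier f x * k x) = (LINT x|lborel. f x * bfourier k x)"
proof -
  have T: "integrable lborel (truncate n f)" "integrable lborel (truncate n k)"
     "l2 lborel (truncate n f)" "l2 lborel (truncate n k)" for n
    using l12_truncate[OF f] l12_truncate[OF k] by (auto simp: l12_def)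
  have 1: "(LINT x|lborel. bfourier f x * truncate m k x)
    = (LINT x|lborel. f x * fourier_integral (truncate m k) x)" for m
  proof (rule LIMSEQ_unique)
    show "(\<lambda>n. LINT x|lborel. fourier_integral (truncate n f) x
      * truncate m k x) \<longlonglongrightarrow> (LINT x|lborel. bfourier f x * truncate m k x)"
      by (intro tendsto_integral_l2_mult l2_fourier_integral l12_truncate l2_bfourier
        nsq_truncate_diff_tendsto f T)
    show "(\<lambda>n. LINT x|lborel. fourier_integral (truncate n f) x * truncate m k x) \<longlonglongrightarrow> (LINT x|lborel. f x
      * fourier_integral (truncate m k) x)"
      unfolding fourier_integral_multiplication[OF T(1,2)]
      by (intro tendsto_integral_l2_mult l2_fourier_integral l12_truncate nsq_truncate_tendsto f k T)
  qed
  show ?thesis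
  proof (rule LIMSEQ_unique)
    show "(\<lambda>m. LINT x|lborel. bfourier f x * truncate m k x) \<longlonglongrightarrow> (LINT x|lborel. bfourier f x * k x)"
      unfolding mult.commute[of "bfourier f _"]
      by (intro tendsto_integral_l2_mult nsq_truncate_tendsto l2_bfourier f k T)
    show "(\<lambda>m. LINT x|lborel. bfourier f x * truncate m k x) \<longlonglongrightarrow> (LINT x|lborel. f x * bfourier k x)"
      unfolding 1 mult.commute[of "f _"]
      by (intro tendsto_integral_l2_mult l2_fourier_integral l12_truncate nsq_truncate_diff_tendsto
        l2_bfourier f k)
  qed
qed

lemma nsq_diff_eq:
  assumes f: "l2 M f" and g: "l2 M g"
  shows "nsq M (\<lambda>x. f x - g x) = nsq M f + nsq M g - 2 * Re (LINT x|M. f x * cnj (g x))"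
proof -
  have i: "integrable M (\<lambda>x. f x * cnj (g x))" by (intro integrable_l2_mult f l2_cnj g)
  have "nsq M (\<lambda>x. f x - g x) = (LINT x|M. (norm (f x))\<^sup>2 + (norm (g x))\<^sup>2 - 2 * Re (f x * cnj (g x)))"
    unfolding nsq_def
    by (intro Bochner_Integration.integral_cong refl) (simp add: cmod_power2, simp add: power2_eq_square
      algebra_simps)
  also have "\<dots> = nsq M f + nsq M g - 2 * (LINT x|M. Re (f x * cnj (g x)))"
    unfolding nsq_def using f g integrable_Re[OF i] by (simp add: l2_def del: times_complex.sel)
  finally show ?thesis using integral_Re[OF i] by simp
qed

text \<open>The inverse transform is the conjugate of the transform of the conjugate. By the
  multiplication formula the inner product of \<open>bfourier ?f\<close> with \<open>h\<close>
  equals the square norm that both share, so the square norm of their difference is zero.\<close>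

lemma bfourier_inverse:
  assumes h: "l2 lborel h"
  shows "l2 lborel (\<lambda>x. cnj (bfourier (\<lambda>x. cnj (h x)) x))"
    and "AE x in lborel. bfourier (\<lambda>x. cnj (bfourier (\<lambda>x. cnj (h x)) x)) x = h x"
proof -
  let ?u = "bfourier (\<lambda>x. cnj (h x))" and ?f = "\<lambda>x. cnj (bfourier (\<lambda>x. cnj (h x)) x)"
  have ch: "l2 lborel (\<lambda>x. cnj (h x))" by (rule l2_cnj[OF h])
  have u: "l2 lborel ?u" by (rule l2_bfourier[OF ch])
  show f: "l2 lborel ?f" by (rule l2_cnj[OF u])
  have n: "nsq lborel ?f = nsq lborel h" "nsq lborel ?u = nsq lborel h"
    using nsq_bfourier[OF ch] by (simp_all add: nsq_def)
  have "(LINT x|lborel. bfourier ?f x * cnj (h x)) = (LINT x|lborel. ?f x * ?u x)"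
    by (rule bfourier_multiplication[OF f ch])
  also have "\<dots> = (LINT x|lborel. complex_of_real ((norm (?u x))\<^sup>2))"
    by (intro Bochner_Integration.integral_cong refl) (metis complex_norm_square mult.commute)
  also have "\<dots> = complex_of_real (nsq lborel h)"
    using n(2) by (simp only: integral_complex_of_real nsq_def)
  finally have "nsq lborel (\<lambda>x. bfourier ?f x - h x) = 0"
    using nsq_diff_eq[OF l2_bfourier[OF f] h] nsq_bfourier[OF f] n by simp
  then show "AE x in lborel. bfourier ?f x = h x"
    using nsq_eq_0_iff[OF l2_diff[OF l2_bfourier[OF f] h]] by simp
qed

lemma bfourier_cong_AE:
  assumes f: "l2 lborel f" and g: "l2 lborel g" and ae: "AE x in lborel. f x = g x"
  shows "bfourier f = bfourier g"
proof -
  have "fourier f = fourier g"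
    using f g ae by (intro fourier_cong_AE) (auto simp: l2_def measurable_completion AE_completion)
  then show ?thesis unfolding bfourier_def by simp
qed

lemma bfourier_diff:
  assumes f: "l2 lborel f" and g: "l2 lborel g"
  shows "AE x in lborel. bfourier (\<lambda>x. f x - g x) x = bfourier f x - bfourier g x"
  using bfourier_add[OF f l2_scale[OF g, of "-1"]] bfourier_scale[OF g, of "-1"]
  by eventually_elim simp

text \<open>This is the multiplication formula with \<open>cnj (bfourier g x)\<close> as second
  factor, whose own transform is \<open>cnj (g x)\<close> by
  \<open>bfourier_inverse\<close>.\<close>

lemma bfourier_parseval:
  assumes f: "l2 lborel f" and g: "l2 lborel g"
  shows "(LINT x|lborel. bfourier f x * cnj (bfourier g x)) = (LINT x|lborel. f x * cnj (g x))"
proof -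
  let ?k = "\<lambda>x. cnj (bfourier g x)"
  have k: "l2 lborel ?k" and ae: "AE x in lborel. bfourier ?k x = cnj (g x)"
    using bfourier_inverse[OF l2_cnj[OF g]] by simp_all
  have [measurable]: "f \<in> borel_measurable borel" "g \<in> borel_measurable borel" "bfourier ?k \<in> borel_measurable
    borel"
    using f g l2_bfourier[OF k] by (auto simp: l2_def)
  have "(LINT x|lborel. bfourier f x * ?k x) = (LINT x|lborel. f x * bfourier ?k x)"
    by (rule bfourier_multiplication[OF f k])
  also have "\<dots> = (LINT x|lborel. f x * cnj (g x))"
    using ae l2_cnj[OF g] f by (intro integral_cong_AE borel_measurable_times) (auto simp: l2_def elim:
      eventually_mono)
  finally show ?thesis .
qed

lemma bfourier_inj:
  assumes f: "l2 lborel f" and g: "l2 lborel g" and ae: "AE x in lborel. bfourier f x = bfourier g x"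
  shows "AE x in lborel. f x = g x"
proof -
  have "AE x in lborel. bfourier (\<lambda>x. f x - g x) x = 0"
    using bfourier_diff[OF f g] ae by eventually_elim simp
  then have "nsq lborel (bfourier (\<lambda>x. f x - g x)) = 0"
    using nsq_eq_0_iff[OF l2_bfourier[OF l2_diff[OF f g]]] by simp
  then show ?thesis
    using nsq_eq_0_iff[OF l2_diff[OF f g]] by (simp add: nsq_bfourier[OF l2_diff[OF f g]])
qed

lemma AE_lborel_uminus:
  fixes P :: "'a::euclidean_space \<Rightarrow> bool"
  assumes [measurable]: "Measurable.pred borel P" and ae: "AE x in lborel. P x"
  shows "AE x in lborel. P (- x)"
proof -
  have "(\<integral>\<^sup>+x. indicator {x. \<not> P x} (- x) \<partial>lborel) = (\<integral>\<^sup>+x. indicator {x. \<not> P x} (x::'a) \<partial>lborel)"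
    by (rule nn_integral_lborel_uminus) measurable
  also have "\<dots> = 0" using ae by (subst nn_integral_0_iff_AE) (auto simp: indicator_def elim: eventually_mono)
  finally have "AE x in lborel. indicator {x. \<not> P x} (- x) = (0::ennreal)"
    by (subst (asm) nn_integral_0_iff_AE) auto
  then show ?thesis by eventually_elim (auto simp: indicator_def split: if_splits)
qed

text \<open>Hermitian symmetry of \<open>h\<close> says that the inverse transform and its conjugate
  have the same transform, so injectivity makes it real. The real-valued witnesses for
  \<open>frac_laplacian\<close> and \<open>resolvent\<close> are obtained from this.\<close>

lemma bfourier_inverse_real:
  assumes h: "l2 lborel h" and sym: "AE x in lborel. h (- x) = cnj (h x)"
  obtains v where "l2 lborel v" "AE x in lborel. bfourier (\<lambda>x. complex_of_real (v x)) x = h x"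
proof -
  let ?f = "\<lambda>x. cnj (bfourier (\<lambda>x. cnj (h x)) x)"
  have f: "l2 lborel ?f" and ae: "AE x in lborel. bfourier ?f x = h x"
    using bfourier_inverse[OF h] by simp_all
  have [measurable]: "h \<in> borel_measurable borel" "bfourier ?f \<in> borel_measurable borel" "?f \<in>
    borel_measurable borel"
    using h l2_bfourier[OF f] f by (auto simp: l2_def)
  have "AE x in lborel. bfourier ?f (- x) = h (- x)"
    using ae by (intro AE_lborel_uminus) measurable
  with bfourier_cnj[OF f] sym ae have "AE x in lborel. bfourier (\<lambda>x. cnj (?f x)) x = bfourier ?f x"
    by eventually_elim simp
  then have real: "AE x in lborel. cnj (?f x) = ?f x"
    by (rule bfourier_inj[OF l2_cnj[OF f] f])
  define v where "v x = Re (?f x)" for x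
  have [measurable]: "v \<in> borel_measurable borel" unfolding v_def by measurable
  have v: "l2 lborel v"
    by (rule l2_bound[OF f]) (auto simp: v_def abs_Re_le_cmod[of "cnj z" for z, simplified])
  have vc: "l2 lborel (\<lambda>x. complex_of_real (v x))"
    by (rule l2_bound[OF v]) auto
  have "AE x in lborel. complex_of_real (v x) = ?f x"
    using real by eventually_elim (simp add: v_def complex_eq_iff)
  then have "bfourier (\<lambda>x. complex_of_real (v x)) = bfourier ?f"
    by (rule bfourier_cong_AE[OF vc f])
  with v ae show thesis by (auto intro: that)
qed

section \<open>Transforms of real-valued functions\<close>

definition borel_rep :: "('a::euclidean_space \<Rightarrow> real) \<Rightarrow> 'a \<Rightarrow> real" where
  "borel_rep v = (SOME g. g \<in> borel_measurable borel \<and> (AE x in lebesgue. v x = g x))"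

text \<open>\<open>fourier_of_real v\<close> is in general only Lebesgue measurable. This version
  agrees with it almost everywhere, is Borel, and is the one on which all multipliers are
  computed.\<close>

definition rfourier :: "('a::euclidean_space \<Rightarrow> real) \<Rightarrow> 'a \<Rightarrow> complex" where
  "rfourier v = bfourier (\<lambda>x. complex_of_real (borel_rep v x))"

lemma borel_rep:
  assumes "v \<in> borel_measurable lebesgue"
  shows "borel_rep v \<in> borel_measurable borel" "AE x in lebesgue. v x = borel_rep v x"
proof -
  have "\<exists>g. g \<in> borel_measurable borel \<and> (AE x in lebesgue. v x = g x)"
    using completion_ex_borel_measurable_real[OF assms] AE_completion by auto
  then have "borel_rep v \<in> borel_measurable borel \<and> (AE x in lebesgue. v x = borel_rep v x)"
    unfolding borel_rep_def by (rule someI_ex)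
  then show "borel_rep v \<in> borel_measurable borel" "AE x in lebesgue. v x = borel_rep v x" by auto
qed

context
  fixes v :: "'a::euclidean_space \<Rightarrow> real"
  assumes v: "square_integrable v"
begin

lemma square_integrable_measurable: "v \<in> borel_measurable lebesgue"
  using v by (simp add: square_integrable_def)

lemma l2_borel_rep: "l2 lborel (borel_rep v)"
proof -
  have [measurable]: "v \<in> borel_measurable lebesgue" by (rule square_integrable_measurable)
  note r = borel_rep[OF square_integrable_measurable]
  have "l2 lebesgue (borel_rep v)"
    by (rule l2_bound[OF v[unfolded square_integrable_l2]])
       (use r in \<open>auto simp: measurable_completion elim: eventually_mono\<close>)
  then show ?thesis using r by (simp add: l2_lebesgue)
qed

lemma l2_borel_rep_complex: "l2 lborel (\<lambda>x. complex_of_real (borel_rep v x))"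
  by (rule l2_bound[OF l2_borel_rep]) (use l2_borel_rep in \<open>auto simp: l2_def\<close>)

lemma l2_rfourier: "l2 lborel (rfourier v)"
  unfolding rfourier_def by (rule l2_bfourier[OF l2_borel_rep_complex])

lemma rfourier_measurable: "rfourier v \<in> borel_measurable borel"
  using l2_rfourier by (simp add: l2_def)

lemma fourier_eq_rfourier: "AE x in lebesgue. fourier_of_real v x = rfourier v x"
proof -
  have [measurable]: "v \<in> borel_measurable lebesgue" by (rule square_integrable_measurable)
  note r = borel_rep[OF square_integrable_measurable]
  have [measurable]: "borel_rep v \<in> borel_measurable lebesgue" using r by (auto intro: measurable_completion)
  have "fourier_of_real v = fourier_of_real (borel_rep v)"
    by (rule fourier_cong_AE) (use r in \<open>auto elim: eventually_mono\<close>)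
  then show ?thesis
    using fourier_eq_bfourier[OF l2_borel_rep_complex] unfolding rfourier_def by simp
qed

lemma rfourier_uminus: "AE x in lborel. rfourier v (- x) = cnj (rfourier v x)"
proof -
  have "AE x in lborel. rfourier v x = cnj (rfourier v (- x))"
    using bfourier_cnj[OF l2_borel_rep_complex] unfolding rfourier_def by simp
  then show ?thesis by eventually_elim (metis complex_cnj_cnj)
qed

lemma nsq_borel_rep: "nsq lborel (borel_rep v) = nsq lebesgue v"
proof -
  have [measurable]: "v \<in> borel_measurable lebesgue" by (rule square_integrable_measurable)
  note r = borel_rep[OF square_integrable_measurable]
  have "nsq lebesgue v = nsq lebesgue (borel_rep v)"
    by (rule nsq_cong_AE) (use r in \<open>auto intro: measurable_completion\<close>)
  then show ?thesis using r by (simp add: nsq_lebesgue)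
qed

lemma nsq_rfourier: "nsq lborel (rfourier v) = nsq lebesgue v"
  unfolding rfourier_def nsq_bfourier[OF l2_borel_rep_complex] nsq_borel_rep[symmetric]
  by (simp add: nsq_def)

end

lemma rfourier_borel:
  assumes v: "l2 lborel v"
  shows "square_integrable v" "rfourier v = bfourier (\<lambda>x. complex_of_real (v x))"
proof -
  have m: "v \<in> borel_measurable borel" using v by (simp add: l2_def)
  show s: "square_integrable v" using v m by (simp add: square_integrable_l2 l2_lebesgue)
  have "AE x in lborel. v x = borel_rep v x"
    using borel_rep[OF square_integrable_measurable[OF s]] by (simp add: AE_completion_iff)
  then show "rfourier v = bfourier (\<lambda>x. complex_of_real (v x))"
    unfolding rfourier_def
    by (intro bfourier_cong_AE l2_borel_rep_complex s l2_bound[OF v])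
       (use m in \<open>auto elim: eventually_mono\<close>)
qed

lemma rfourier_inverse:
  assumes h: "l2 lborel h" and sym: "AE x in lborel. h (- x) = cnj (h x)"
  obtains v where "square_integrable v" "AE x in lborel. rfourier v x = h x"
  using bfourier_inverse_real[OF assms] rfourier_borel by metis

context
  fixes v w :: "'a::euclidean_space \<Rightarrow> real"
  assumes v: "square_integrable v" and w: "square_integrable w"
begin

text \<open>The left side is real, so only the real part of Parseval's integrand contributes.
  Keeping it inside makes the integrands real, ready to be compared pointwise.\<close>

lemma integral_square_integrable_mult:
  "(LINT x|lebesgue. v x * w x) = (LINT x|lborel. Re (rfourier v x * cnj (rfourier w x)))"
proof -
  have [measurable]: "v \<in> borel_measurable lebesgue" "w \<in> borel_measurable lebesgue"
    using v w by (auto intro: square_integrable_measurable)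
  note rv = borel_rep[OF square_integrable_measurable[OF v]]
  note rw = borel_rep[OF square_integrable_measurable[OF w]]
  have i: "integrable lborel (\<lambda>x. rfourier v x * cnj (rfourier w x))"
    by (intro integrable_l2_mult l2_cnj l2_rfourier v w)
  have [measurable]: "borel_rep v \<in> borel_measurable lebesgue" "borel_rep w \<in> borel_measurable lebesgue"
    using rv rw by (auto intro: measurable_completion)
  have "(LINT x|lebesgue. v x * w x) = (LINT x|lebesgue. borel_rep v x * borel_rep w x)"
    using rv(2) rw(2) by (intro integral_cong_AE) (auto elim: eventually_elim2)
  also have "\<dots> = (LINT x|lborel. borel_rep v x * borel_rep w x)"
    using rv rw by (intro integral_completion) auto
  finally have "complex_of_real (LINT x|lebesgue. v x * w x)
      = (LINT x|lborel. complex_of_real (borel_rep v x) * cnj (complex_of_real (borel_rep w x)))"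
    by (simp flip: integral_complex_of_real)
  also have "\<dots> = (LINT x|lborel. rfourier v x * cnj (rfourier w x))"
    unfolding rfourier_def by (rule bfourier_parseval[OF l2_borel_rep_complex[OF v] l2_borel_rep_complex[OF
      w], symmetric])
  finally have "(LINT x|lebesgue. v x * w x) = Re (LINT x|lborel. rfourier v x * cnj (rfourier w x))"
    by (metis Re_complex_of_real)
  also have "\<dots> = (LINT x|lborel. Re (rfourier v x * cnj (rfourier w x)))"
    using integral_Re[OF i] by simp
  finally show ?thesis .
qed

lemma rfourier_inj:
  assumes "AE x in lborel. rfourier v x = rfourier w x"
  shows "AE x in lebesgue. v x = w x"
proof -
  have "AE x in lborel. complex_of_real (borel_rep v x) = complex_of_real (borel_rep w x)"
    by (rule bfourier_inj) (use assms v w in \<open>auto simp: l2_borel_rep_complex rfourier_def\<close>)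
  then have "AE x in lebesgue. borel_rep v x = borel_rep w x"
    by (simp add: AE_completion)
  with borel_rep(2)[OF square_integrable_measurable[OF v]] borel_rep(2)[OF square_integrable_measurable[OF w]]
  show ?thesis by eventually_elim simp
qed

lemma rfourier_cong:
  assumes "AE x in lebesgue. v x = w x"
  shows "rfourier v = rfourier w"
proof -
  have "AE x in lebesgue. complex_of_real (borel_rep v x) = complex_of_real (borel_rep w x)"
    using assms borel_rep(2)[OF square_integrable_measurable[OF v]] borel_rep(2)[OF
      square_integrable_measurable[OF w]]
    by eventually_elim simp
  then show ?thesis unfolding rfourier_def
    by (intro bfourier_cong_AE l2_borel_rep_complex v w) (simp add: AE_completion_iff)
qed

lemma square_integrable_add: "square_integrable (\<lambda>x. v x + c * w x)"
  using l2_add[of lebesgue v "\<lambda>x. c * w x"] l2_scale[of lebesgue w c] v w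
  by (simp add: square_integrable_l2)

lemma rfourier_add:
  "AE x in lborel. rfourier (\<lambda>x. v x + c * w x) x = rfourier v x + complex_of_real c * rfourier w x"
proof -
  let ?v = "borel_rep v" and ?w = "borel_rep w"
  note rv = borel_rep[OF square_integrable_measurable[OF v]]
  note rw = borel_rep[OF square_integrable_measurable[OF w]]
  have l: "l2 lborel (\<lambda>x. ?v x + c * ?w x)"
    by (intro l2_add l2_scale l2_borel_rep v w)
  have ae: "AE x in lebesgue. v x + c * w x = ?v x + c * ?w x"
    using rv(2) rw(2) by eventually_elim simp
  have "rfourier (\<lambda>x. v x + c * w x) = rfourier (\<lambda>x. ?v x + c * ?w x)"
  proof -
    have "AE x in lebesgue. complex_of_real (borel_rep (\<lambda>x. v x + c * w x) x)
      = complex_of_real (?v x + c * ?w x)"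
      using ae borel_rep(2)[OF square_integrable_measurable[OF square_integrable_add[of c]]]
      by eventually_elim simp
    then show ?thesis unfolding rfourier_borel(2)[OF l] unfolding rfourier_def
      by (intro bfourier_cong_AE l2_borel_rep_complex square_integrable_add l2_bound[OF l])
         (use rv rw in \<open>auto simp: AE_completion_iff simp del: of_real_add of_real_mult\<close>)
  qed
  also have "\<dots> = bfourier (\<lambda>x. complex_of_real (?v x) + complex_of_real c * complex_of_real (?w x))"
    unfolding rfourier_borel(2)[OF l] by simp
  finally show ?thesis
    using bfourier_add[OF l2_borel_rep_complex[OF v] l2_scale[OF l2_borel_rep_complex[OF w], of
      "complex_of_real c"]]
      bfourier_scale[OF l2_borel_rep_complex[OF w], of "complex_of_real c"]
    unfolding rfourier_def by auto
qed

end

section \<open>Fractional Laplacian, Sobolev spaces and bilinear forms on the Fourier side\<close>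

lemma borel_measurable_cnj [measurable (raw)]:
  "f \<in> borel_measurable M \<Longrightarrow> (\<lambda>x. cnj (f x)) \<in> borel_measurable M"
  by (rule borel_measurable_continuous_on[of cnj]) (intro continuous_intros)

lemma fourier_of_real_borel_rep:
  assumes "square_integrable v"
  shows "fourier_of_real v = fourier_of_real (borel_rep v)"
proof -
  have [measurable]: "v \<in> borel_measurable lebesgue" by (rule square_integrable_measurable[OF assms])
  note r = borel_rep[OF square_integrable_measurable[OF assms]]
  have [measurable]: "borel_rep v \<in> borel_measurable lebesgue" using r by (auto intro: measurable_completion)
  show ?thesis
    by (rule fourier_cong_AE) (use r in \<open>auto elim: eventually_mono\<close>)
qed

lemma fourier_of_real_measurable:
  assumes "square_integrable v"
  shows "fourier_of_real v \<in> borel_measurable lebesgue"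
  unfolding fourier_of_real_borel_rep[OF assms]
  using l2_fourier[OF l2_borel_rep_complex[OF assms]] by (simp add: l2_def)

text \<open>The \<open>SOME\<close> in \<open>frac_laplacian\<close> requires a real square
  integrable candidate. The symbol is real and even, so multiplication by it preserves Hermitian
  symmetry, and \<open>rfourier_inverse\<close> provides the candidate.\<close>

lemma
  assumes v: "square_integrable v" and h: "l2 lborel (\<lambda>\<zeta>. complex_of_real (norm \<zeta> powr (2 * \<sigma>))
    * rfourier v \<zeta>)"
  shows square_integrable_frac_laplacian: "square_integrable (frac_laplacian \<sigma> v)"
    and rfourier_frac_laplacian:
      "AE \<zeta> in lborel. rfourier (frac_laplacian \<sigma> v) \<zeta> = complex_of_real (norm \<zeta> powr (2 * \<sigma>)) * rfourier v \<zeta>"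
proof -
  let ?P = "\<lambda>g. square_integrable g \<and> (AE \<zeta> in lebesgue. fourier_of_real g \<zeta> =
            complex_of_real (norm \<zeta> powr (2 * \<sigma>)) * fourier_of_real v \<zeta>)"
  have sym: "AE \<zeta> in lborel. complex_of_real (norm (- \<zeta>) powr (2 * \<sigma>)) * rfourier v (- \<zeta>)
      = cnj (complex_of_real (norm \<zeta> powr (2 * \<sigma>)) * rfourier v \<zeta>)"
    using rfourier_uminus[OF v] by eventually_elim simp
  obtain g where g: "square_integrable g"
    "AE \<zeta> in lborel. rfourier g \<zeta> = complex_of_real (norm \<zeta> powr (2 * \<sigma>)) * rfourier v \<zeta>"
    by (rule rfourier_inverse[OF h sym])
  have "AE \<zeta> in lebesgue. fourier_of_real g \<zeta> = complex_of_real (norm \<zeta> powr (2 * \<sigma>)) * fourier_of_real v \<zeta>"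
    using fourier_eq_rfourier[OF g(1)] fourier_eq_rfourier[OF v] AE_completion[OF g(2)]
    by eventually_elim simp
  with g(1) have "?P (frac_laplacian \<sigma> v)"
    unfolding frac_laplacian_def by (intro someI[of ?P]) simp
  then have f: "square_integrable (frac_laplacian \<sigma> v)" and
    ae: "AE \<zeta> in lebesgue. fourier_of_real (frac_laplacian \<sigma> v) \<zeta>
      = complex_of_real (norm \<zeta> powr (2 * \<sigma>)) * fourier_of_real v \<zeta>"
    by auto
  show "square_integrable (frac_laplacian \<sigma> v)" by fact
  have "AE \<zeta> in lebesgue. rfourier (frac_laplacian \<sigma> v) \<zeta>
    = complex_of_real (norm \<zeta> powr (2 * \<sigma>)) * rfourier v \<zeta>"
    using fourier_eq_rfourier[OF f] fourier_eq_rfourier[OF v] ae by eventually_elim simp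
  then show "AE \<zeta> in lborel. rfourier (frac_laplacian \<sigma> v) \<zeta>
    = complex_of_real (norm \<zeta> powr (2 * \<sigma>)) * rfourier v \<zeta>"
    by (simp add: AE_completion_iff)
qed

lemma sobolev_weight_AE:
  assumes v: "square_integrable v"
  shows "AE \<zeta> in lebesgue. (1 + (norm \<zeta>)\<^sup>2) powr r * (norm (fourier_of_real v \<zeta>))\<^sup>2
    = (1 + (norm \<zeta>)\<^sup>2) powr r * (norm (rfourier v \<zeta>))\<^sup>2"
  using fourier_eq_rfourier[OF v] by eventually_elim simp

lemma sobolev_iff:
  fixes v :: "'a::euclidean_space \<Rightarrow> real"
  shows "v \<in> sobolev r \<longleftrightarrow> square_integrable v \<and>
     integrable lborel (\<lambda>\<zeta>. (1 + (norm \<zeta>)\<^sup>2) powr r * (norm (rfourier v \<zeta>))\<^sup>2)"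
proof (cases "square_integrable v")
  case True
  have [measurable]: "fourier_of_real v \<in> borel_measurable lebesgue"
    by (rule fourier_of_real_measurable[OF True])
  have m[measurable]: "rfourier v \<in> borel_measurable borel" by (rule rfourier_measurable[OF True])
  have [measurable]: "(\<lambda>\<zeta>::'a. (1 + (norm \<zeta>)\<^sup>2) powr r) \<in> borel_measurable lebesgue"
    "rfourier v \<in> borel_measurable lebesgue"
    by (rule measurable_completion, measurable)+
  have "integrable lebesgue (\<lambda>\<zeta>. (1 + (norm \<zeta>)\<^sup>2) powr r * (norm (fourier_of_real v \<zeta>))\<^sup>2)
    \<longleftrightarrow> integrable lebesgue (\<lambda>\<zeta>. (1 + (norm \<zeta>)\<^sup>2) powr r * (norm (rfourier v \<zeta>))\<^sup>2)"
    by (rule integrable_cong_AE[OF _ _ sobolev_weight_AE[OF True]]) measurable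
  also have "\<dots> \<longleftrightarrow> integrable lborel (\<lambda>\<zeta>. (1 + (norm \<zeta>)\<^sup>2) powr r * (norm (rfourier v \<zeta>))\<^sup>2)"
    by (rule integrable_completion) measurable
  finally show ?thesis using True by (simp add: sobolev_def)
qed (simp add: sobolev_def)

lemma sobolev_norm_eq:
  fixes v :: "'a::euclidean_space \<Rightarrow> real"
  assumes v: "square_integrable v"
  shows "sobolev_norm r v = sqrt (LINT \<zeta>|lborel. (1 + (norm \<zeta>)\<^sup>2) powr r * (norm (rfourier v \<zeta>))\<^sup>2)"
proof -
  have [measurable]: "fourier_of_real v \<in> borel_measurable lebesgue"
    by (rule fourier_of_real_measurable[OF v])
  have m[measurable]: "rfourier v \<in> borel_measurable borel" by (rule rfourier_measurable[OF v])
  have [measurable]: "(\<lambda>\<zeta>::'a. (1 + (norm \<zeta>)\<^sup>2) powr r) \<in> borel_measurable lebesgue"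
    "rfourier v \<in> borel_measurable lebesgue"
    by (rule measurable_completion, measurable)+
  have "(LINT \<zeta>|lebesgue. (1 + (norm \<zeta>)\<^sup>2) powr r * (norm (fourier_of_real v \<zeta>))\<^sup>2)
    = (LINT \<zeta>|lebesgue. (1 + (norm \<zeta>)\<^sup>2) powr r * (norm (rfourier v \<zeta>))\<^sup>2)"
    by (rule integral_cong_AE[OF _ _ sobolev_weight_AE[OF v]]) measurable
  also have "\<dots> = (LINT \<zeta>|lborel. (1 + (norm \<zeta>)\<^sup>2) powr r * (norm (rfourier v \<zeta>))\<^sup>2)"
    by (rule integral_completion) measurable
  finally show ?thesis by (simp add: sobolev_norm_def)
qed

lemma norm_powr_le:
  fixes \<zeta> :: "'a::euclidean_space"
  assumes "0 \<le> p" "p \<le> r"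
  shows "norm \<zeta> powr p \<le> (1 + (norm \<zeta>)\<^sup>2) powr (r / 2)"
proof -
  have "norm \<zeta> powr p = ((norm \<zeta>)\<^sup>2) powr (p / 2)"
    by (cases "\<zeta> = 0") (auto simp: powr_powr simp flip: powr_numeral)
  also have "\<dots> \<le> (1 + (norm \<zeta>)\<^sup>2) powr (p / 2)"
    using assms by (intro powr_mono2) auto
  also have "\<dots> \<le> (1 + (norm \<zeta>)\<^sup>2) powr (r / 2)"
    using assms by (intro powr_mono) auto
  finally show ?thesis .
qed

context
  fixes v :: "'a::euclidean_space \<Rightarrow> real" and r p :: real
  assumes v: "v \<in> sobolev r" and p: "0 \<le> p" "p \<le> r"
begin

lemma l2_sobolev_weight: "l2 lborel (\<lambda>\<zeta>. complex_of_real (norm \<zeta> powr p) * rfourier v \<zeta>)"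
proof -
  have [measurable]: "rfourier v \<in> borel_measurable borel"
    using v by (intro rfourier_measurable) (simp add: sobolev_iff)
  have "l2 lborel (\<lambda>\<zeta>. (1 + (norm \<zeta>)\<^sup>2) powr (r / 2) * norm (rfourier v \<zeta>))"
    unfolding l2_def using v
    by (simp add: sobolev_iff power_mult_distrib power2_eq_square[of "_ powr _"] powr_add[symmetric])
  then show ?thesis
    by (rule l2_bound) (auto simp: norm_mult abs_mult intro!: mult_right_mono norm_powr_le p)
qed

lemma integrable_sobolev_weight: "integrable lborel (\<lambda>\<zeta>. norm \<zeta> powr (2 * p) * (norm (rfourier v \<zeta>))\<^sup>2)"
proof -
  have "(norm (complex_of_real (norm \<zeta> powr p) * rfourier v \<zeta>))\<^sup>2
    = norm \<zeta> powr (2 * p) * (norm (rfourier v \<zeta>))\<^sup>2" for \<zeta> :: 'a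
    by (simp add: norm_mult power_mult_distrib powr_powr mult.commute power2_eq_square powr_add[symmetric])
  then show ?thesis using l2_sobolev_weight by (simp add: l2_def)
qed

end

section \<open>The resolvent and both forms as Fourier multipliers\<close>

lemma sobolev_square_integrable: "v \<in> sobolev r \<Longrightarrow> square_integrable v"
  by (simp add: sobolev_def)

text \<open>The candidate for \<open>resolvent\<close> has transform \<open>rfourier \<psi> \<zeta>
  / (1 + t\<^sup>2 * (norm \<zeta>)\<^sup>2)\<close> and lies in \<open>sobolev 2\<close>. Once a
  solution exists, the equation itself determines the transform of whichever solution the choice
  returns.\<close>

lemma
  fixes \<psi> :: "'a::euclidean_space \<Rightarrow> real"
  assumes \<psi>: "square_integrable \<psi>" and t: "0 < t"
  shows square_integrable_w_fun: "square_integrable (w_fun \<psi> t)"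
    and rfourier_w_fun: "AE \<zeta> in lborel. rfourier (w_fun \<psi> t) \<zeta>
        = complex_of_real (t\<^sup>2 * (norm \<zeta>)\<^sup>2 / (1 + t\<^sup>2 * (norm \<zeta>)\<^sup>2)) * rfourier \<psi> \<zeta>"
proof -
  let ?m = "\<lambda>\<zeta>::'a. 1 + t\<^sup>2 * (norm \<zeta>)\<^sup>2"
  have mpos: "1 \<le> ?m \<zeta>" for \<zeta> using t by simp
  have [measurable]: "rfourier \<psi> \<in> borel_measurable borel" by (rule rfourier_measurable[OF \<psi>])
  have lap: "square_integrable (frac_laplacian 1 v) \<and>
      (AE \<zeta> in lborel. rfourier (frac_laplacian 1 v) \<zeta> = complex_of_real ((norm \<zeta>)\<^sup>2) * rfourier v \<zeta>)"
    if "v \<in> sobolev 2" for v :: "'a \<Rightarrow> real"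
  proof -
    have v: "square_integrable v" using that by (rule sobolev_square_integrable)
    have l: "l2 lborel (\<lambda>\<zeta>. complex_of_real (norm \<zeta> powr (2 * 1)) * rfourier v \<zeta>)"
      using l2_sobolev_weight[OF that, of 2] by simp
    have eq: "norm \<zeta> powr (2 * 1) = (norm \<zeta>)\<^sup>2" for \<zeta> :: 'a
      by (cases "\<zeta> = 0") auto
    show ?thesis using square_integrable_frac_laplacian[OF v l] rfourier_frac_laplacian[OF v l] unfolding eq
      by simp
  qed
  have h: "l2 lborel (\<lambda>\<zeta>. rfourier \<psi> \<zeta> / complex_of_real (?m \<zeta>))"
  proof (rule l2_bound[OF l2_rfourier[OF \<psi>]])
    have "norm (rfourier \<psi> \<zeta> / complex_of_real (?m \<zeta>)) \<le> norm (rfourier \<psi> \<zeta>)" for \<zeta>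
    proof -
      have "norm (rfourier \<psi> \<zeta> / complex_of_real (?m \<zeta>)) = norm (rfourier \<psi> \<zeta>) / ?m \<zeta>"
        using mpos[of \<zeta>] by (simp only: norm_divide norm_of_real)
      also have "\<dots> \<le> norm (rfourier \<psi> \<zeta>) / 1"
        by (intro divide_left_mono mult_pos_pos mpos norm_ge_zero zero_less_one
            order_less_le_trans[OF zero_less_one mpos])
      finally show ?thesis by simp
    qed
    then show "AE \<zeta> in lborel. norm (rfourier \<psi> \<zeta> / complex_of_real (?m \<zeta>)) \<le> norm (rfourier \<psi> \<zeta>)" by simp
  qed measurable
  have sym: "AE \<zeta> in lborel. rfourier \<psi> (- \<zeta>) / complex_of_real (?m (- \<zeta>))
    = cnj (rfourier \<psi> \<zeta> / complex_of_real (?m \<zeta>))"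
    using rfourier_uminus[OF \<psi>] by eventually_elim simp
  obtain v0 where v0: "square_integrable v0" "AE \<zeta> in lborel. rfourier v0 \<zeta>
    = rfourier \<psi> \<zeta> / complex_of_real (?m \<zeta>)"
    by (rule rfourier_inverse[OF h sym])
  have [measurable]: "rfourier v0 \<in> borel_measurable borel" by (rule rfourier_measurable[OF v0(1)])
  have s0: "v0 \<in> sobolev 2"
  proof -
    \<comment> \<open>Chosen so that
      \<open>1 + (norm \<zeta>)\<^sup>2 \<le> ?c * ?m \<zeta>\<close>: the entry 1 covers the
      constant term and \<open>1 / t\<^sup>2\<close> the quadratic one.\<close>
    let ?c = "max 1 (1 / t\<^sup>2)"
    have "integrable lborel (\<lambda>\<zeta>. ?c\<^sup>2 * (norm (rfourier \<psi> \<zeta>))\<^sup>2)"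
      using l2_rfourier[OF \<psi>] by (simp add: l2_def)
    then have "integrable lborel (\<lambda>\<zeta>. (1 + (norm \<zeta>)\<^sup>2) powr 2 * (norm (rfourier v0 \<zeta>))\<^sup>2)"
    proof (rule Bochner_Integration.integrable_bound)
      show "AE \<zeta> in lborel. norm ((1 + (norm \<zeta>)\<^sup>2) powr 2 * (norm (rfourier v0 \<zeta>))\<^sup>2)
        \<le> norm (?c\<^sup>2 * (norm (rfourier \<psi> \<zeta>))\<^sup>2)"
        using v0(2)
      proof eventually_elim
        case (elim \<zeta>)
        have "1 + (norm \<zeta>)\<^sup>2 \<le> ?c * ?m \<zeta>"
        proof -
          have "?c * ?m \<zeta> = ?c + (?c * t\<^sup>2) * (norm \<zeta>)\<^sup>2" by (simp add: algebra_simps)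
          moreover have "1 \<le> ?c * t\<^sup>2"
          proof -
            have "1 = 1 / t\<^sup>2 * t\<^sup>2" using t by simp
            also have "\<dots> \<le> ?c * t\<^sup>2" by (intro mult_right_mono) auto
            finally show ?thesis .
          qed
          then have "1 * (norm \<zeta>)\<^sup>2 \<le> (?c * t\<^sup>2) * (norm \<zeta>)\<^sup>2" by (intro mult_right_mono) auto
          moreover have "1 \<le> ?c" by simp
          ultimately show ?thesis by linarith
        qed
        then have "(1 + (norm \<zeta>)\<^sup>2)\<^sup>2 \<le> (?c * ?m \<zeta>)\<^sup>2" by (intro power_mono) auto
        then have "(1 + (norm \<zeta>)\<^sup>2)\<^sup>2 * (norm (rfourier v0 \<zeta>))\<^sup>2 \<le> (?c * ?m \<zeta>)\<^sup>2 * (norm (rfourier v0 \<zeta>))\<^sup>2"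
          by (intro mult_right_mono) auto
        also have "(?c * ?m \<zeta>)\<^sup>2 * (norm (rfourier v0 \<zeta>))\<^sup>2 = ?c\<^sup>2 * (norm (rfourier \<psi> \<zeta>))\<^sup>2"
        proof -
          have "m \<noteq> 0 \<Longrightarrow> (c * m)\<^sup>2 * (a / m)\<^sup>2 = c\<^sup>2 * a\<^sup>2" for a c m :: real
            by (simp add: power_mult_distrib power_divide)
          moreover have "?m \<zeta> \<noteq> 0" using mpos[of \<zeta>] by linarith
          moreover have "norm (rfourier v0 \<zeta>) = norm (rfourier \<psi> \<zeta>) / ?m \<zeta>"
            using mpos[of \<zeta>] unfolding elim by (simp only: norm_divide norm_of_real)
          ultimately show ?thesis by (simp only:)
        qed
        finally have "(1 + (norm \<zeta>)\<^sup>2)\<^sup>2 * (norm (rfourier v0 \<zeta>))\<^sup>2 \<le> ?c\<^sup>2 * (norm (rfourier \<psi> \<zeta>))\<^sup>2" .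
        moreover have "(1 + (norm \<zeta>)\<^sup>2) powr 2 = (1 + (norm \<zeta>)\<^sup>2)\<^sup>2"
          by (rule powr_numeral) (simp add: add_nonneg_nonneg)
        ultimately show ?case by simp
      qed
    qed measurable
    then show ?thesis using v0(1) by (simp add: sobolev_iff)
  qed
  let ?P = "\<lambda>v. v \<in> sobolev 2 \<and> (AE x in lebesgue. v x + t\<^sup>2 * frac_laplacian 1 v x = \<psi> x)"
  have "?P v0"
  proof
    have "AE \<zeta> in lborel. rfourier (\<lambda>x. v0 x + t\<^sup>2 * frac_laplacian 1 v0 x) \<zeta> = rfourier \<psi> \<zeta>"
      using rfourier_add[OF v0(1) conjunct1[OF lap[OF s0]], of "t\<^sup>2"] conjunct2[OF lap[OF s0]] v0(2)
    proof eventually_elim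
      case (elim \<zeta>)
      have nz: "complex_of_real (?m \<zeta>) \<noteq> 0" using mpos[of \<zeta>] by (simp only: of_real_eq_0_iff)
      have "rfourier (\<lambda>x. v0 x + t\<^sup>2 * frac_laplacian 1 v0 x) \<zeta> = complex_of_real (?m \<zeta>) * rfourier v0 \<zeta>"
        unfolding elim(1,2) by (simp add: algebra_simps)
      then show ?case using nz unfolding elim(3) by (metis nonzero_mult_div_cancel_left times_divide_eq_right)
    qed
    then show "AE x in lebesgue. v0 x + t\<^sup>2 * frac_laplacian 1 v0 x = \<psi> x"
      by (rule rfourier_inj[OF square_integrable_add[OF v0(1) conjunct1[OF lap[OF s0]]] \<psi>])
  qed (rule s0)
  then have "?P (resolvent t \<psi>)" unfolding resolvent_def by (rule someI[of ?P])
  then have s: "resolvent t \<psi> \<in> sobolev 2"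
    and ae: "AE x in lebesgue. resolvent t \<psi> x + t\<^sup>2 * frac_laplacian 1 (resolvent t \<psi>) x = \<psi> x" by auto
  let ?v = "resolvent t \<psi>"
  have v: "square_integrable ?v" by (rule sobolev_square_integrable[OF s])
  note l = conjunct1[OF lap[OF s]] and fl = conjunct2[OF lap[OF s]]
  have z: "square_integrable (\<lambda>x. 0 :: real)" by (simp add: square_integrable_def)
  \<comment> \<open>The zero summand lets \<open>rfourier_add\<close> serve as the rule for real
    multiples.\<close>
  have w: "w_fun \<psi> t = (\<lambda>x. 0 + t\<^sup>2 * frac_laplacian 1 ?v x)"
    by (simp add: w_fun_def fun_eq_iff)
  show "square_integrable (w_fun \<psi> t)"
    unfolding w by (rule square_integrable_add[OF z l])
  have rw: "AE \<zeta> in lborel. rfourier (w_fun \<psi> t) \<zeta> = complex_of_real (t\<^sup>2) * rfourier (frac_laplacian 1 ?v) \<zeta>"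
  proof -
    have "AE \<zeta> in lborel. rfourier (\<lambda>x::'a. 0) \<zeta> = 0"
      using rfourier_add[OF z z, of "-1"] by eventually_elim simp
    with rfourier_add[OF z l, of "t\<^sup>2"] show ?thesis unfolding w by eventually_elim simp
  qed
  have R: "rfourier (\<lambda>x. ?v x + t\<^sup>2 * frac_laplacian 1 ?v x) = rfourier \<psi>"
    by (rule rfourier_cong[OF square_integrable_add[OF v l] \<psi> ae])
  from rfourier_add[OF v l, of "t\<^sup>2", unfolded R] rw fl
  show "AE \<zeta> in lborel. rfourier (w_fun \<psi> t) \<zeta>
        = complex_of_real (t\<^sup>2 * (norm \<zeta>)\<^sup>2 / (1 + t\<^sup>2 * (norm \<zeta>)\<^sup>2)) * rfourier \<psi> \<zeta>"
  proof (eventually_elim, goal_cases)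
    case (1 \<zeta>)
    have "rfourier \<psi> \<zeta> = complex_of_real (?m \<zeta>) * rfourier ?v \<zeta>"
      unfolding 1(1,3) by (simp add: algebra_simps)
    moreover have "m \<noteq> 0 \<Longrightarrow> complex_of_real (a / m) * (complex_of_real m * V)
      = complex_of_real a * V" for a m V
      by simp
    moreover have "?m \<zeta> \<noteq> 0" using mpos[of \<zeta>] by linarith
    ultimately have "complex_of_real (t\<^sup>2 * (norm \<zeta>)\<^sup>2 / ?m \<zeta>) * rfourier \<psi> \<zeta>
      = complex_of_real (t\<^sup>2 * (norm \<zeta>)\<^sup>2) * rfourier ?v \<zeta>"
      by (simp only:)
    then show ?case unfolding 1(2,3) by simp
  qed
qed

lemma bilinear_form_rfourier:
  fixes D :: "'a::euclidean_space set"
  assumes e: "zero_ext D \<eta> \<in> sobolev s" and t: "zero_ext D \<theta> \<in> sobolev s" and s: "0 < s"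
  shows "bilinear_form D s \<eta> \<theta> = (LINT \<zeta>|lborel. norm \<zeta> powr (2 * s) *
      Re (rfourier (zero_ext D \<eta>) \<zeta> * cnj (rfourier (zero_ext D \<theta>) \<zeta>)))"
proof -
  let ?L = "frac_laplacian (s / 2)"
  note se = sobolev_square_integrable[OF e] and st = sobolev_square_integrable[OF t]
  have le: "l2 lborel (\<lambda>\<zeta>. complex_of_real (norm \<zeta> powr (2 * (s/2))) * rfourier (zero_ext D \<eta>) \<zeta>)"
    and lt: "l2 lborel (\<lambda>\<zeta>. complex_of_real (norm \<zeta> powr (2 * (s/2))) * rfourier (zero_ext D \<theta>) \<zeta>)"
    using l2_sobolev_weight[OF e] l2_sobolev_weight[OF t] s by auto
  have me: "rfourier (zero_ext D \<eta>) \<in> borel_measurable borel" "rfourier (zero_ext D \<theta>) \<in> borel_measurable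
    borel"
    "rfourier (?L (zero_ext D \<eta>)) \<in> borel_measurable borel" "rfourier (?L (zero_ext D \<theta>)) \<in> borel_measurable
      borel"
    by (intro rfourier_measurable se st square_integrable_frac_laplacian le lt)+
  note [measurable] = me
  have "bilinear_form D s \<eta> \<theta> = (LINT \<zeta>|lborel. Re (rfourier (?L (zero_ext D \<eta>)) \<zeta>
    * cnj (rfourier (?L (zero_ext D \<theta>)) \<zeta>)))"
    unfolding bilinear_form_def
    by (rule integral_square_integrable_mult[OF square_integrable_frac_laplacian[OF se le]
      square_integrable_frac_laplacian[OF st lt]])
  also have "\<dots> = (LINT \<zeta>|lborel. norm \<zeta> powr (2 * s) *
      Re (rfourier (zero_ext D \<eta>) \<zeta> * cnj (rfourier (zero_ext D \<theta>) \<zeta>)))"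
  proof (rule integral_cong_AE)
    show "AE \<zeta> in lborel. Re (rfourier (?L (zero_ext D \<eta>)) \<zeta> * cnj (rfourier (?L (zero_ext D \<theta>)) \<zeta>))
      = norm \<zeta> powr (2 * s) * Re (rfourier (zero_ext D \<eta>) \<zeta> * cnj (rfourier (zero_ext D \<theta>) \<zeta>))"
      using rfourier_frac_laplacian[OF se le] rfourier_frac_laplacian[OF st lt]
    proof eventually_elim
      case (elim \<zeta>)
      have "norm \<zeta> powr (2 * s) = norm \<zeta> powr s * norm \<zeta> powr s"
        by (simp add: powr_add[symmetric])
      then show ?case unfolding elim by (simp add: algebra_simps)
    qed
  qed measurable
  finally show ?thesis .
qed

lemma inner_on_w_fun:
  fixes D :: "'a::euclidean_space set"
  assumes e: "square_integrable (zero_ext D \<eta>)" and th: "square_integrable (zero_ext D \<theta>)" and t: "0 < t"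
  shows "inner_on D (w_fun (zero_ext D \<eta>) t) \<theta> = (LINT \<zeta>|lborel.
      t\<^sup>2 * (norm \<zeta>)\<^sup>2 / (1 + t\<^sup>2 * (norm \<zeta>)\<^sup>2) *
      Re (rfourier (zero_ext D \<eta>) \<zeta> * cnj (rfourier (zero_ext D \<theta>) \<zeta>)))"
proof -
  let ?w = "w_fun (zero_ext D \<eta>) t"
  note sw = square_integrable_w_fun[OF e t]
  note [measurable] = rfourier_measurable[OF e] rfourier_measurable[OF th] rfourier_measurable[OF sw]
  have "inner_on D ?w \<theta> = (LINT x|lebesgue. ?w x * zero_ext D \<theta> x)"
    unfolding inner_on_def set_lebesgue_integral_def zero_ext_def
    by (intro Bochner_Integration.integral_cong refl) (auto simp: indicator_def)
  also have "\<dots> = (LINT \<zeta>|lborel. Re (rfourier ?w \<zeta> * cnj (rfourier (zero_ext D \<theta>) \<zeta>)))"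
    by (rule integral_square_integrable_mult[OF sw th])
  also have "\<dots> = (LINT \<zeta>|lborel. t\<^sup>2 * (norm \<zeta>)\<^sup>2 / (1 + t\<^sup>2 * (norm \<zeta>)\<^sup>2) *
      Re (rfourier (zero_ext D \<eta>) \<zeta> * cnj (rfourier (zero_ext D \<theta>) \<zeta>)))"
  proof (rule integral_cong_AE)
    show "AE \<zeta> in lborel. Re (rfourier ?w \<zeta> * cnj (rfourier (zero_ext D \<theta>) \<zeta>))
      = t\<^sup>2 * (norm \<zeta>)\<^sup>2 / (1 + t\<^sup>2 * (norm \<zeta>)\<^sup>2) * Re (rfourier (zero_ext D \<eta>) \<zeta>
        * cnj (rfourier (zero_ext D \<theta>) \<zeta>))"
      using rfourier_w_fun[OF e t]
    proof eventually_elim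
      case (elim \<zeta>)
      have r: "Re (complex_of_real a * b * c) = a * Re (b * c)" for a b c by (simp add: algebra_simps)
      show ?case unfolding elim r ..
    qed
  qed measurable
  finally show ?thesis .
qed

lemma norm_on_eq:
  assumes e: "square_integrable (zero_ext D \<eta>)"
  shows "norm_on D \<eta> = sqrt (nsq lborel (rfourier (zero_ext D \<eta>)))"
proof -
  have "inner_on D \<eta> \<eta> = nsq lebesgue (zero_ext D \<eta>)"
    unfolding inner_on_def set_lebesgue_integral_def zero_ext_def nsq_def
    by (intro Bochner_Integration.integral_cong refl) (auto simp: indicator_def power2_eq_square)
  then show ?thesis by (simp add: norm_on_def nsq_rfourier[OF e])
qed

section \<open>Sinc quadrature in a strip\<close>

lemma contour_integral_linepath_horizontal:
  fixes g :: "complex \<Rightarrow> complex"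
  assumes "a < b"
  shows "contour_integral (linepath (Complex a y) (Complex b y)) g = integral {a..b} (\<lambda>x. g (Complex x y))"
proof -
  have shift: "(g has_contour_integral I) (linepath (Complex a y) (Complex b y))
      \<longleftrightarrow> ((\<lambda>z. g (z + Complex 0 y)) has_contour_integral I) (linepath (of_real a) (of_real b))" for I
  proof -
    have "linepath (Complex a y) (Complex b y) x = linepath (of_real a) (of_real b) x + Complex 0 y" for x
      by (simp add: linepath_def complex_eq_iff algebra_simps)
    moreover have "Complex b y - Complex a y = of_real b - of_real a" by (simp add: complex_eq_iff)
    ultimately show ?thesis by (simp add: has_contour_integral_linepath)
  qed
  then have "contour_integral (linepath (Complex a y) (Complex b y)) g
      = contour_integral (linepath (of_real a) (of_real b)) (\<lambda>z. g (z + Complex 0 y))"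
    by (simp add: contour_integral_def contour_integrable_on_def)
  also have "\<dots> = integral {a..b} (\<lambda>x. g (of_real x + Complex 0 y))"
    using assms by (subst contour_integral_linepath_Reals_eq) auto
  also have "(\<lambda>x. g (of_real x + Complex 0 y)) = (\<lambda>x. g (Complex x y))"
    by (intro ext arg_cong[where f=g]) (simp add: complex_eq_iff)
  finally show ?thesis .
qed

text \<open>Horizontal sides become real integrals, while the vertical sides are kept as anonymous
  errors bounded by the supremum of \<open>g\<close> times the height. The residue argument and the
  shift of lines by Cauchy's theorem both use this decomposition.\<close>

lemma contour_integral_rectpath:
  fixes g :: "complex \<Rightarrow> complex"
  assumes x: "x0 < x1" and y: "y0 < y1"
    and cont: "continuous_on (path_image (rectpath (Complex x0 y0) (Complex x1 y1))) g"
  obtains V1 V2 where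
    "contour_integral (rectpath (Complex x0 y0) (Complex x1 y1)) g
      = integral {x0..x1} (\<lambda>x. g (Complex x y0)) + V1 - integral {x0..x1} (\<lambda>x. g (Complex x y1)) + V2"
    "\<And>B. (\<And>y. y0 \<le> y \<Longrightarrow> y \<le> y1 \<Longrightarrow> norm (g (Complex x1 y)) \<le> B) \<Longrightarrow> norm V1 \<le> B * (y1 - y0)"
    "\<And>B. (\<And>y. y0 \<le> y \<Longrightarrow> y \<le> y1 \<Longrightarrow> norm (g (Complex x0 y)) \<le> B) \<Longrightarrow> norm V2 \<le> B * (y1 - y0)"
proof -
  let ?a1 = "Complex x0 y0" and ?a2 = "Complex x1 y0" and ?a3 = "Complex x1 y1" and ?a4 = "Complex x0 y1"
  have sub: "closed_segment ?a1 ?a2 \<subseteq> path_image (rectpath ?a1 ?a3)" "closed_segment ?a2 ?a3 \<subseteq> path_image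
    (rectpath ?a1 ?a3)"
    "closed_segment ?a3 ?a4 \<subseteq> path_image (rectpath ?a1 ?a3)" "closed_segment ?a4 ?a1 \<subseteq> path_image (rectpath
      ?a1 ?a3)"
    by (auto simp: rectpath_def Let_def path_image_join)
  have ci: "g contour_integrable_on linepath ?a1 ?a2" "g contour_integrable_on linepath ?a2 ?a3"
    "g contour_integrable_on linepath ?a3 ?a4" "g contour_integrable_on linepath ?a4 ?a1"
    using sub by (auto intro!: contour_integrable_continuous_linepath intro: continuous_on_subset[OF cont])
  have "contour_integral (rectpath ?a1 ?a3) g = contour_integral (linepath ?a1 ?a2) g
    + contour_integral (linepath ?a2 ?a3) g
      + contour_integral (linepath ?a3 ?a4) g + contour_integral (linepath ?a4 ?a1) g"
    using ci by (simp add: rectpath_def Let_def contour_integrable_join valid_path_join)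
  moreover have "contour_integral (linepath ?a3 ?a4) g = - contour_integral (linepath ?a4 ?a3) g"
    by (rule contour_integral_reverse_linepath) (use sub cont in \<open>auto intro: continuous_on_subset simp:
      closed_segment_commute\<close>)
  ultimately have eq: "contour_integral (rectpath ?a1 ?a3) g = integral {x0..x1} (\<lambda>x. g (Complex x y0))
      + contour_integral (linepath ?a2 ?a3) g - integral {x0..x1} (\<lambda>x. g (Complex x y1))
        + contour_integral (linepath ?a4 ?a1) g"
    using x by (simp add: contour_integral_linepath_horizontal)
  have b1: "norm (contour_integral (linepath ?a2 ?a3) g) \<le> B * (y1 - y0)"
    if B: "\<And>y. y0 \<le> y \<Longrightarrow> y \<le> y1 \<Longrightarrow> norm (g (Complex x1 y)) \<le> B" for B
  proof -
    have "0 \<le> B" using order_trans[OF norm_ge_zero B[of y0]] y by simp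
    moreover have "norm (g z) \<le> B" if "z \<in> closed_segment ?a2 ?a3" for z
    proof -
      have "Re z = x1" "y0 \<le> Im z" "Im z \<le> y1"
        using that y by (auto simp: closed_segment_same_Re closed_segment_eq_real_ivl)
      then show ?thesis using B[of "Im z"] by (metis complex_surj)
    qed
    ultimately have "norm (contour_integral (linepath ?a2 ?a3) g) \<le> B * norm (?a3 - ?a2)"
      by (rule contour_integral_bound_linepath[OF ci(2)])
    also have "norm (?a3 - ?a2) = y1 - y0" using y by (simp add: cmod_def)
    finally show ?thesis .
  qed
  have b2: "norm (contour_integral (linepath ?a4 ?a1) g) \<le> B * (y1 - y0)"
    if B: "\<And>y. y0 \<le> y \<Longrightarrow> y \<le> y1 \<Longrightarrow> norm (g (Complex x0 y)) \<le> B" for B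
  proof -
    have "0 \<le> B" using order_trans[OF norm_ge_zero B[of y0]] y by simp
    moreover have "norm (g z) \<le> B" if "z \<in> closed_segment ?a4 ?a1" for z
    proof -
      have "Re z = x0" "y0 \<le> Im z" "Im z \<le> y1"
        using that y by (auto simp: closed_segment_same_Re closed_segment_eq_real_ivl)
      then show ?thesis using B[of "Im z"] by (metis complex_surj)
    qed
    ultimately have "norm (contour_integral (linepath ?a4 ?a1) g) \<le> B * norm (?a1 - ?a4)"
      by (rule contour_integral_bound_linepath[OF ci(4)])
    also have "norm (?a1 - ?a4) = y1 - y0" using y by (simp add: cmod_def)
    finally show ?thesis .
  qed
  show thesis by (rule that[OF eq b1 b2])
qed

lemma norm_sin_ge:
  fixes w :: complex
  shows "(exp \<bar>Im w\<bar> - exp (- \<bar>Im w\<bar>)) / 2 \<le> norm (sin w)"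
proof -
  have "norm (exp (\<i> * w)) = exp (- Im w)" "norm (exp (- (\<i> * w))) = exp (Im w)"
    by simp_all
  then have "\<bar>exp (- Im w) - exp (Im w)\<bar> \<le> norm (exp (\<i> * w) - exp (- (\<i> * w)))"
    using norm_triangle_ineq3[of "exp (\<i> * w)" "exp (- (\<i> * w))"] by simp
  moreover have "norm (sin w) = norm (exp (\<i> * w) - exp (- (\<i> * w))) / 2"
    by (simp add: sin_exp_eq norm_divide norm_mult)
  moreover have "exp \<bar>Im w\<bar> - exp (- \<bar>Im w\<bar>) \<le> \<bar>exp (- Im w) - exp (Im w)\<bar>"
    by (cases "0 \<le> Im w") auto
  ultimately show ?thesis by simp
qed

text \<open>\<open>cot w + \<i>\<close> is \<open>exp (\<i> * w) / sin w\<close>, a quotient of an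
  exponentially small and an exponentially large quantity above the real axis; the case below is its
  mirror image. With \<open>v = pi * \<dd> / k\<close> the bound is the exponential term of the
  theorem.\<close>

lemma norm_cot_pm_i_le:
  fixes w :: complex
  assumes v: "0 < v"
  shows "Im w = v \<Longrightarrow> norm (cos w / sin w + \<i>) \<le> 2 / (exp (2 * v) - 1)" (is "_ \<Longrightarrow> ?A")
    and "Im w = - v \<Longrightarrow> norm (cos w / sin w - \<i>) \<le> 2 / (exp (2 * v) - 1)" (is "_ \<Longrightarrow> ?B")
proof -
  have ev: "exp (- v) < exp v" using v by simp
  have *: "exp (- v) / ((exp v - exp (- v)) / 2) = 2 / (exp (2 * v) - 1)"
  proof -
    have "2 / (exp (2 * v) - 1) = (exp (- v) * 2) / (exp (- v) * (exp (2 * v) - 1))" by simp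
    also have "exp (- v) * (exp (2 * v) - 1) = exp v - exp (- v)"
      by (simp add: right_diff_distrib exp_add[symmetric])
    finally show ?thesis by simp
  qed
  have le: "norm (e / sin w) \<le> 2 / (exp (2 * v) - 1)" if "\<bar>Im w\<bar> = v" "norm e = exp (- v)" for e
  proof -
    have "norm (e / sin w) = exp (- v) / norm (sin w)" by (simp add: norm_divide that)
    also have "\<dots> \<le> exp (- v) / ((exp v - exp (- v)) / 2)"
      using norm_sin_ge[of w] ev that by (intro divide_left_mono mult_pos_pos) (auto intro:
        less_le_trans[rotated])
    finally show ?thesis unfolding * .
  qed
  have nz: "sin w \<noteq> 0" if "\<bar>Im w\<bar> = v"
    using norm_sin_ge[of w] ev that by auto
  show ?A if "Im w = v"
  proof -
    have "cos w / sin w + \<i> = exp (\<i> * w) / sin w"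
      using nz that v by (simp add: exp_Euler field_simps)
    then show ?thesis using le[of "exp (\<i> * w)"] that v by simp
  qed
  show ?B if "Im w = - v"
  proof -
    have "exp (- (\<i> * w)) = cos w - \<i> * sin w"
      using exp_Euler[of "- w"] by simp
    then have "cos w / sin w - \<i> = exp (- (\<i> * w)) / sin w"
      using nz that v by (simp add: field_simps)
    then show ?thesis using le[of "exp (- (\<i> * w))"] that v by simp
  qed
qed

text \<open>Where \<open>cos (Re w)\<close> vanishes the quotient has modulus
  \<open>|tanh (Im w)|\<close>. The vertical sides of the contour are therefore placed midway
  between two nodes, which explains the half in \<open>(N + 1/2) * k\<close>.\<close>

lemma norm_cot_half_odd_le:
  fixes w :: complex
  assumes "Re w = (of_int n + 1/2) * pi"
  shows "norm (cos w / sin w) \<le> 1" "sin w \<noteq> 0"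
proof -
  have "sin (of_int n * pi) = 0" using sin_zero_iff_int2 by blast
  then have c: "cos (Re w) = 0"
    unfolding assms by (simp add: distrib_right cos_add)
  then have s: "(sin (Re w))\<^sup>2 = 1" using sin_cos_squared_add[of "Re w"] by simp
  have "(norm (cos w))\<^sup>2 = (sinh (Im w))\<^sup>2" "(norm (sin w))\<^sup>2 = (cosh (Im w))\<^sup>2"
    using c s by (simp_all add: cmod_power2 Re_cos Im_cos Re_sin Im_sin power_mult_distrib power_divide
      cosh_def sinh_def power2_commute)
  then have n: "norm (cos w) = \<bar>sinh (Im w)\<bar>" "norm (sin w) = cosh (Im w)"
    by (metis real_sqrt_abs norm_ge_zero abs_of_nonneg, metis real_sqrt_abs norm_ge_zero abs_of_nonneg
      cosh_real_nonneg)
  have "\<bar>sinh (Im w)\<bar> \<le> cosh (Im w)"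
    using sinh_le_cosh_real[of "Im w"] sinh_le_cosh_real[of "- Im w"] by auto
  then show "norm (cos w / sin w) \<le> 1" unfolding norm_divide n using cosh_real_pos[of "Im w"] by simp
  show "sin w \<noteq> 0" using n(2) cosh_real_pos[of "Im w"] by auto
qed

text \<open>
  The integrand is multiplied by \<open>cot (\<pi> z / k)\<close>, whose residues at the nodes produce the quadrature
  sum. On the lines \<open>Im z = \<plusminus>d\<close> the cotangent differs from \<open>\<mp>\<i>\<close> only by an exponentially small
  amount, and the integrals of \<open>f\<close> along these lines are moved back to the real axis.
\<close>

lemma sinc_quadrature_bound:
  fixes f :: "complex \<Rightarrow> complex" and G :: "real \<Rightarrow> real" and N :: nat
  assumes k: "0 < k" and d: "0 < d" "d < p"
    and holo: "f holomorphic_on {z. \<bar>Im z\<bar> < p}"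
    and nz: "\<And>x::real. f (of_real x) \<noteq> 0"
    and bound: "\<And>z. \<bar>Im z\<bar> \<le> d \<Longrightarrow> norm (f z) \<le> G (Re z)"
    and contG: "continuous_on UNIV G"
  defines "R \<equiv> (real N + 1 / 2) * k"
  shows "norm (of_real k * (\<Sum>j = - int N..int N. f (of_real (of_int j * k)))
    - integral {- R..R} (\<lambda>x. f (of_real x)))
     \<le> 2 / (exp (2 * pi * d / k) - 1) * integral {- R..R} G + 2 * d * (G R + G (- R))"
proof -
  have R: "0 < R" using k by (simp add: R_def)
  define q where "q z = of_real (pi / k) * z" for z :: complex
  define h where "h z = (f z * cos (q z)) / sin (q z)" for z
  \<comment> \<open>Half a node spacing wider than the contour on each side. Being open, the box
    still excludes the nodes with index \<open>N + 1\<close> and \<open>- N - 1\<close>, so that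
    inside it the cotangent has no poles but \<open>pts\<close>.\<close>
  define S where "S = box (Complex (- ((real N + 1) * k)) (- p)) (Complex ((real N + 1) * k) p)"
  define pts where "pts = (\<lambda>j. complex_of_real (of_int j * k)) ` {- int N..int N}"
  let ?a = "Complex (- R) (- d)" and ?b = "Complex R d"
  have Sstrip: "S \<subseteq> {z. \<bar>Im z\<bar> < p}" by (auto simp: S_def in_box_complex_iff)
  have strip_open: "open {z. \<bar>Im z\<bar> < p}" by (intro open_Collect_less continuous_intros)
  have strip_convex: "convex {z. \<bar>Im z\<bar> < p}"
  proof -
    have "{z. \<bar>Im z\<bar> < p} = {z. Im z < p} \<inter> {z. Im z > - p}" by auto
    then show ?thesis by (simp add: convex_Int convex_halfspace_Im_lt convex_halfspace_Im_gt)
  qed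
  have holoS: "f holomorphic_on S" using holo Sstrip by (rule holomorphic_on_subset)
  have contf: "continuous_on {z. \<bar>Im z\<bar> < p} f" by (rule holomorphic_on_imp_continuous_on[OF holo])
  have zeros: "z \<in> pts" if zS: "z \<in> S" and sz: "sin (q z) = 0" for z
  proof -
    obtain n :: int where "q z = of_real (of_int n * pi)" using sz by (auto simp: sin_eq_0)
    then have z: "z = of_real (of_int n * k)" using k by (auto simp: q_def field_simps)
    then have "\<bar>of_int n * k\<bar> < (real N + 1) * k" using zS by (auto simp: S_def in_box_complex_iff)
    then have "\<bar>real_of_int n\<bar> < real N + 1" using k by (simp add: abs_mult)
    then have "n \<in> {- int N..int N}" by auto
    then show ?thesis unfolding pts_def z by blast
  qed
  have pts_sin: "sin (q z) = 0" if zp: "z \<in> pts" for z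
  proof -
    obtain j where "z = of_real (of_int j * k)" using zp by (auto simp: pts_def)
    then have "q z = of_real (of_int j * pi)" using k by (simp add: q_def)
    then show ?thesis using sin_eq_0[of "q z"] by blast
  qed
  have holoq: "(\<lambda>z. sin (q z)) holomorphic_on S" "(\<lambda>z. f z * cos (q z)) holomorphic_on S"
    unfolding q_def by (intro holomorphic_intros holoS)+
  have holoh: "h holomorphic_on S - pts"
    unfolding h_def using zeros
    by (intro holomorphic_intros holomorphic_on_subset[OF holoq(1)] holomorphic_on_subset[OF holoq(2)]) auto
  have pim: "path_image (rectpath ?a ?b) \<subseteq> S - pts"
  proof
    fix z assume z: "z \<in> path_image (rectpath ?a ?b)"
    then have cases: "(Re z = - R \<or> Re z = R) \<and> - d \<le> Im z \<and> Im z \<le> d \<or> (Im z = - d \<or> Im z = d) \<and> - R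
      \<le> Re z \<and> Re z \<le> R"
      using R d by (subst (asm) path_image_rectpath) auto
    have RN: "R < (real N + 1) * k" using k by (simp add: R_def)
    have "z \<in> S" using cases d RN R by (auto simp: S_def in_box_complex_iff)
    moreover have "z \<notin> pts"
    proof
      assume "z \<in> pts"
      then obtain j where j: "z = of_real (of_int j * k)" by (auto simp: pts_def)
      then have "of_int j * k = R \<or> of_int j * k = - R" using cases d by auto
      then have "(2 * real_of_int j) * k = (2 * real N + 1) * k \<or> (2 * real_of_int j) * k
        = (- 2 * real N - 1) * k"
        by (auto simp: R_def algebra_simps)
      then have "real_of_int (2 * j) = real_of_int (2 * int N + 1) \<or> real_of_int (2 * j)
        = real_of_int (- 2 * int N - 1)"
        using k by auto
      then have "2 * j = 2 * int N + 1 \<or> 2 * j = - 2 * int N - 1" by (simp only: of_int_eq_iff)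
      then show False by presburger
    qed
    ultimately show "z \<in> S - pts" by simp
  qed
  \<comment> \<open>The derivative of \<open>sin (q z)\<close> is
    \<open>cos (q z) * (pi / k)\<close>, so each node is a simple pole with residue
    \<open>f z * (k / pi)\<close>; the factor \<open>k\<close> of the trapezoidal rule comes from
    here. The residue rule asks for a nonvanishing numerator, whence the assumption
    \<open>nz\<close>.\<close>
  have CI: "contour_integral (rectpath ?a ?b) h = 2 * \<i> * (of_real k * (\<Sum>j
    = - int N..int N. f (of_real (of_int j * k))))"
  proof -
    have "contour_integral (rectpath ?a ?b) h = 2 * pi * \<i> * (\<Sum>z\<in>pts. winding_number (rectpath ?a ?b) z
      * residue h z)"
    proof (rule Residue_theorem[OF _ _ _ holoh])
      show "open S" "connected S" by (simp_all add: S_def open_box convex_connected convex_box)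
      show "finite pts" by (simp add: pts_def)
      show "\<forall>z. z \<notin> S \<longrightarrow> winding_number (rectpath ?a ?b) z = 0"
      proof (intro allI impI winding_number_rectpath_outside)
        fix z assume "z \<notin> S"
        moreover have "R < (real N + 1) * k" using k by (simp add: R_def)
        ultimately show "z \<notin> cbox ?a ?b" using d by (auto simp: S_def in_box_complex_iff in_cbox_complex_iff)
      qed (use R d in auto)
    qed (use pim in auto)
    also have "(\<Sum>z\<in>pts. winding_number (rectpath ?a ?b) z * residue h z) = (\<Sum>z\<in>pts. f z * of_real (k / pi))"
    proof (intro sum.cong refl)
      fix z assume z: "z \<in> pts"
      then obtain j where jN: "j \<in> {- int N..int N}" and j1: "z = of_real (of_int j * k)"
        unfolding pts_def by blast
      have "\<bar>real_of_int j\<bar> \<le> real N" using jN by auto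
      note j = j1 this
      have jk: "\<bar>of_int j * k\<bar> < R"
      proof -
        have "\<bar>of_int j * k\<bar> \<le> real N * k" using j(2) k by (simp add: abs_mult)
        also have "\<dots> < R" using k by (simp add: R_def)
        finally show ?thesis .
      qed
      then have "z \<in> box ?a ?b" using d by (auto simp: in_box_complex_iff j)
      then have w: "winding_number (rectpath ?a ?b) z = 1" by (rule winding_number_rectpath)
      have zS: "z \<in> S"
      proof -
        have "R < (real N + 1) * k" using k by (simp add: R_def)
        then show ?thesis using jk d by (auto simp: S_def in_box_complex_iff j)
      qed
      have "(sin (q z))\<^sup>2 + (cos (q z))\<^sup>2 = 1" by simp
      then have c: "cos (q z) \<noteq> 0" using pts_sin[OF z] by auto
      have "residue h z = f z * cos (q z) / (cos (q z) * of_real (pi / k))"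
        unfolding h_def
      proof (rule residue_simple_pole_deriv[OF holoq(2,1)])
        show "open S" "connected S" by (simp_all add: S_def open_box convex_connected convex_box)
        show "((\<lambda>z. sin (q z)) has_field_derivative cos (q z) * of_real (pi / k)) (at z)"
          unfolding q_def using k by (auto intro!: derivative_eq_intros)
        show "f z * cos (q z) \<noteq> 0" using c nz[of "of_int j * k"] unfolding j1 by simp
        show "cos (q z) * of_real (pi / k) \<noteq> 0" using c k by simp
      qed (use zS pts_sin[OF z] in auto)
      then show "winding_number (rectpath ?a ?b) z * residue h z = f z * of_real (k / pi)"
        using w c by simp
    qed
    also have "(\<Sum>z\<in>pts. f z * of_real (k / pi)) = (\<Sum>j
      = - int N..int N. f (of_real (of_int j * k)) * of_real (k / pi))"
      unfolding pts_def using k by (subst sum.reindex) (auto simp: inj_on_def)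
    also have "\<dots> = of_real (k / pi) * (\<Sum>j = - int N..int N. f (of_real (of_int j * k)))"
      by (simp add: sum_distrib_left mult.commute)
    finally show ?thesis by simp
  qed
  have Gpos: "0 \<le> G x" for x using order_trans[OF norm_ge_zero bound[of "of_real x"]] d by simp
  define M where "M = 2 / (exp (2 * pi * d / k) - 1)"
  have M: "0 \<le> M" using k d by (simp add: M_def)
  let ?H = "\<lambda>g y. integral {- R..R} (\<lambda>x. g (Complex x y))"
  have line: "continuous_on {- R..R} (\<lambda>x. Complex x y)" for y
    unfolding Complex_eq by (intro continuous_intros)
  have conth: "continuous_on (S - pts) h" by (rule holomorphic_on_imp_continuous_on[OF holoh])
  obtain V1 V2 where V: "contour_integral (rectpath ?a ?b) h = ?H h (- d) + V1 - ?H h d + V2"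
    and V1: "\<And>B. (\<And>y. - d \<le> y \<Longrightarrow> y \<le> d \<Longrightarrow> norm (h (Complex R y)) \<le> B) \<Longrightarrow> norm V1 \<le> B * (d - (- d))"
    and V2: "\<And>B. (\<And>y. - d \<le> y \<Longrightarrow> y \<le> d \<Longrightarrow> norm (h (Complex (- R) y)) \<le> B) \<Longrightarrow> norm V2 \<le> B * (d - (- d))"
    using contour_integral_rectpath[of "- R" R "- d" d h] R d continuous_on_subset[OF conth pim] by auto
  have hcot: "norm (h z) \<le> G (Re z)" if "\<bar>Im z\<bar> \<le> d" "Re z = R \<or> Re z = - R" for z
  proof -
    have "\<exists>n::int. Re (q z) = (of_int n + 1/2) * pi"
    proof (cases "Re z = R")
      case True
      then have "Re (q z) = (of_int (int N) + 1/2) * pi" using k by (simp add: q_def R_def)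
      then show ?thesis by blast
    next
      case False
      then have "Re z = - R" using that by simp
      then have "Re (q z) = - ((real N + 1 / 2) * pi)" using k by (simp add: q_def R_def)
      also have "\<dots> = (of_int (- int N - 1) + 1/2) * pi" by (simp add: algebra_simps)
      finally have "Re (q z) = (of_int (- int N - 1) + 1/2) * pi" .
      then show ?thesis by blast
    qed
    then have "norm (cos (q z) / sin (q z)) \<le> 1" using norm_cot_half_odd_le(1) by blast
    then have "norm (f z) * norm (cos (q z) / sin (q z)) \<le> G (Re z) * 1"
      using bound[OF that(1)] Gpos by (intro mult_mono) auto
    then show ?thesis by (simp add: h_def norm_mult norm_divide)
  qed
  have "norm V1 \<le> G R * (d - - d)" by (rule V1) (use hcot[of "Complex R _"] in auto)
  then have V1': "norm V1 \<le> G R * (2 * d)" by simp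
  have "norm V2 \<le> G (- R) * (d - - d)" by (rule V2) (use hcot[of "Complex (- R) _"] in auto)
  then have V2': "norm V2 \<le> G (- R) * (2 * d)" by simp
  have intG: "G integrable_on {- R..R}" by (intro integrable_continuous_real continuous_on_subset[OF contG])
    auto
  have intMG: "(\<lambda>x. M * G x) integrable_on {- R..R}"
    by (intro integrable_continuous_real continuous_intros continuous_on_subset[OF contG]) auto
  have segS: "(\<lambda>x. Complex x y) ` {- R..R} \<subseteq> S - pts" if "y = d \<or> y = - d" for y
  proof -
    have "(\<lambda>x. Complex x y) ` {- R..R} \<subseteq> path_image (rectpath ?a ?b)"
      using that R d by (subst path_image_rectpath) auto
    then show ?thesis using pim by blast
  qed
  have inth: "(\<lambda>x. h (Complex x y)) integrable_on {- R..R}" if "y = d \<or> y = - d" for y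
    by (intro integrable_continuous_real continuous_on_compose2[OF conth line segS[OF that]])
  have intf: "(\<lambda>x. f (Complex x y)) integrable_on {- R..R}" if "\<bar>y\<bar> \<le> d" for y
    by (intro integrable_continuous_real continuous_on_compose2[OF contf line]) (use that d in auto)
  have qz: "Im (q (Complex x y)) = pi * y / k" for x y by (simp add: q_def)
  have vpos: "0 < pi * d / k" using d k by simp
  have T: "norm (?H h d + \<i> * ?H f d) \<le> M * integral {- R..R} G"
  proof -
    have "?H h d + \<i> * ?H f d = integral {- R..R} (\<lambda>x. h (Complex x d) + \<i> * f (Complex x d))"
      using inth[of d] intf[of d] d by (subst integral_add) auto
    also have "norm \<dots> \<le> integral {- R..R} (\<lambda>x. M * G x)"
    proof (rule integral_norm_bound_integral)
      fix x
      let ?z = "Complex x d"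
      have "h ?z + \<i> * f ?z = f ?z * (cos (q ?z) / sin (q ?z) + \<i>)" by (simp add: h_def algebra_simps)
      moreover have "norm (cos (q ?z) / sin (q ?z) + \<i>) \<le> M"
        unfolding M_def using norm_cot_pm_i_le(1)[OF vpos, of "q ?z"] by (simp add: qz mult.assoc)
      ultimately show "norm (h ?z + \<i> * f ?z) \<le> M * G x"
        using bound[of ?z] d M Gpos by (simp add: norm_mult mult.commute[of M] mult_mono)
    qed (use inth[of d] intf[of d] intMG d in \<open>auto intro!: integrable_add\<close>)
    finally show ?thesis by simp
  qed
  have B: "norm (?H h (- d) - \<i> * ?H f (- d)) \<le> M * integral {- R..R} G"
  proof -
    have "?H h (- d) - \<i> * ?H f (- d) = integral {- R..R} (\<lambda>x. h (Complex x (- d)) - \<i> * f (Complex x (- d)))"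
      using inth[of "- d"] intf[of "- d"] d by (subst integral_diff) auto
    also have "norm \<dots> \<le> integral {- R..R} (\<lambda>x. M * G x)"
    proof (rule integral_norm_bound_integral)
      fix x
      let ?z = "Complex x (- d)"
      have "h ?z - \<i> * f ?z = f ?z * (cos (q ?z) / sin (q ?z) - \<i>)" by (simp add: h_def algebra_simps)
      moreover have "norm (cos (q ?z) / sin (q ?z) - \<i>) \<le> M"
        unfolding M_def using norm_cot_pm_i_le(2)[OF vpos, of "q ?z"] by (simp add: qz mult.assoc)
      ultimately show "norm (h ?z - \<i> * f ?z) \<le> M * G x"
        using bound[of ?z] d M Gpos by (simp add: norm_mult mult.commute[of M] mult_mono)
    qed (use inth[of "- d"] intf[of "- d"] intMG d in \<open>auto intro!: integrable_diff\<close>)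
    finally show ?thesis by simp
  qed
  have shift: "norm (?H f y0 - ?H f y1) \<le> (G R + G (- R)) * (y1 - y0)"
    if y: "y0 < y1" "- d \<le> y0" "y1 \<le> d" for y0 y1
  proof -
    let ?P = "rectpath (Complex (- R) y0) (Complex R y1)"
    have sub: "path_image ?P \<subseteq> {z. \<bar>Im z\<bar> < p}"
      using y R d by (subst path_image_rectpath) auto
    have "(f has_contour_integral 0) ?P"
      by (rule Cauchy_theorem_convex_simple[OF holo strip_convex _ sub]) auto
    then have 0: "contour_integral ?P f = 0" by (rule contour_integral_unique)
    obtain W1 W2 where W: "contour_integral ?P f = ?H f y0 + W1 - ?H f y1 + W2"
      and W1: "\<And>B. (\<And>y. y0 \<le> y \<Longrightarrow> y \<le> y1 \<Longrightarrow> norm (f (Complex R y)) \<le> B) \<Longrightarrow> norm W1 \<le> B * (y1 - y0)"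
      and W2: "\<And>B. (\<And>y. y0 \<le> y \<Longrightarrow> y \<le> y1 \<Longrightarrow> norm (f (Complex (- R) y)) \<le> B) \<Longrightarrow> norm W2 \<le> B * (y1 - y0)"
      using contour_integral_rectpath[of "- R" R y0 y1 f] R y continuous_on_subset[OF contf sub] by auto
    have "norm W1 \<le> G R * (y1 - y0)" by (rule W1) (use bound[of "Complex R _"] y in auto)
    moreover have "norm W2 \<le> G (- R) * (y1 - y0)" by (rule W2) (use bound[of "Complex (- R) _"] y in auto)
    moreover have "?H f y0 - ?H f y1 = - (W1 + W2)" using 0 W by (simp add: algebra_simps add_eq_0_iff)
    ultimately show ?thesis using norm_triangle_ineq[of W1 W2] by (simp only: norm_minus_cancel distrib_right)
  qed
  let ?F = "integral {- R..R} (\<lambda>x. f (of_real x))"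
  have F: "?F = ?H f 0" by (simp add: complex_of_real_def)
  have s1: "norm (?H f (- d) - ?F) \<le> (G R + G (- R)) * d" using shift[of "- d" 0] d by (simp add: F)
  have s2: "norm (?H f d - ?F) \<le> (G R + G (- R)) * d" using shift[of 0 d] d
    by (simp add: F norm_minus_commute)
  let ?X = "of_real k * (\<Sum>j = - int N..int N. f (of_real (of_int j * k)))"
  \<comment> \<open>Below the axis \<open>h\<close> is close to \<open>\<i> * f\<close>, above it to
    \<open>- \<i> * f\<close>. The rectangle runs through the upper side backwards, so the two
    contributions add up to \<open>2 * \<i>\<close> times the integral.\<close>
  have "2 * \<i> * (?X - ?F) = (?H h (- d) - \<i> * ?H f (- d)) + \<i> * (?H f (- d) - ?F)
      + (- (?H h d + \<i> * ?H f d)) + \<i> * (?H f d - ?F) + V1 + V2"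
    using CI unfolding V by (simp add: algebra_simps)
  then have "norm (2 * \<i> * (?X - ?F)) \<le> norm (?H h (- d) - \<i> * ?H f (- d)) + norm (\<i> * (?H f (- d) - ?F))
      + norm (- (?H h d + \<i> * ?H f d)) + norm (\<i> * (?H f d - ?F)) + norm V1 + norm V2"
    by (simp only:) (intro order_trans[OF norm_triangle_ineq] add_right_mono order_refl)
  \<comment> \<open>The values \<open>G R\<close> and \<open>G (- R)\<close> each occur with weight
    \<open>2 * d\<close> from the sides \<open>V1\<close>, \<open>V2\<close> and with weight
    \<open>2 * d\<close> from the two line shifts; halving the total gives the stated boundary
    term.\<close>
  also have "\<dots> \<le> M * integral {- R..R} G + (G R + G (- R)) * d + M * integral {- R..R} G
      + (G R + G (- R)) * d + G R * (2 * d) + G (- R) * (2 * d)"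
    using T B s1 s2 V1' V2' by (intro add_mono) (simp_all only: norm_minus_cancel norm_mult norm_ii mult_1)
  also have "\<dots> = 2 * (M * integral {- R..R} G + 2 * d * (G R + G (- R)))"
    by (simp add: algebra_simps)
  also have "norm (2 * \<i> * (?X - ?F)) = 2 * norm (?X - ?F)"
    by (simp only: norm_mult norm_ii norm_numeral mult_1_right)
  finally show ?thesis unfolding M_def by simp
qed

section \<open>The Balakrishnan integral\<close>

text \<open>With \<open>t = exp (- y / 2)\<close> and \<open>l = |\<zeta>|\<^sup>2\<close> this
  equals \<open>exp (s * y) * (t\<^sup>2 * l / (1 + t\<^sup>2 * l))\<close>, one term of the sinc
  sum on the Fourier side.\<close>

definition balakrishnan :: "real \<Rightarrow> real \<Rightarrow> real \<Rightarrow> real" where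
  "balakrishnan s l y = exp (s * y) * l / (exp y + l)"

lemma Beta_reflection_real:
  fixes s :: real
  shows "Beta s (1 - s) = pi / sin (pi * s)"
proof -
  have "Gamma (1 - complex_of_real s) = complex_of_real (Gamma (1 - s))"
    by (metis Gamma_complex_of_real of_real_1 of_real_diff)
  moreover have "sin (complex_of_real pi * complex_of_real s) = complex_of_real (sin (pi * s))"
    by (metis of_real_mult sin_of_real)
  ultimately have "complex_of_real (Gamma s * Gamma (1 - s)) = complex_of_real (pi / sin (pi * s))"
    using Gamma_reflection_complex[of "complex_of_real s"] by (simp add: Gamma_complex_of_real)
  then have "Gamma s * Gamma (1 - s) = pi / sin (pi * s)" using of_real_eq_iff by blast
  then show ?thesis by (simp add: Beta_def)
qed

context
  fixes s l :: real
  assumes s: "0 < s" "s < 1" and l: "0 < l"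
begin

lemma balakrishnan_pos: "0 < balakrishnan s l y"
  using l by (simp add: balakrishnan_def add_pos_pos)

lemma continuous_on_balakrishnan: "continuous_on A (balakrishnan s l)"
proof -
  have "exp y + l \<noteq> 0" for y using l exp_gt_zero[of y] by linarith
  then show ?thesis unfolding balakrishnan_def by (intro continuous_intros) auto
qed

text \<open>The substitution \<open>t = exp y / (exp y + l)\<close> maps the real line onto the open
  unit interval and turns the integrand into that of the Beta function at \<open>s\<close> and
  \<open>1 - s\<close>; the parameter \<open>l\<close> survives as the factor
  \<open>l powr s\<close> and in the end points.\<close>

lemma integral_balakrishnan:
  fixes a b :: real
  assumes ab: "a \<le> b"
  defines "T \<equiv> \<lambda>y. exp y / (exp y + l)"
  shows "integral {a..b} (balakrishnan s l) = l powr s * integral {T a..T b} (\<lambda>t. t powr (s - 1) * (1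
    - t) powr (- s))"
proof -
  have pos: "0 < exp y + l" for y using l exp_gt_zero[of y] by linarith
  have T01: "0 < T y" "T y < 1" for y using pos[of y] l by (auto simp: T_def field_simps)
  have mono: "T x \<le> T y" if "x \<le> y" for x y
  proof -
    have "l * exp x \<le> l * exp y" using that l by simp
    then show ?thesis using pos[of x] pos[of y] by (simp add: T_def divide_simps algebra_simps)
  qed
  have der: "(T has_field_derivative l * exp y / (exp y + l)\<^sup>2) (at y within A)" for y A
    unfolding T_def using pos[of y]
    by (auto intro!: derivative_eq_intros simp: power2_eq_square algebra_simps)
  have "((\<lambda>y. (l * exp y / (exp y + l)\<^sup>2) *\<^sub>R (T y powr (s - 1) * (1 - T y) powr (- s)))
     has_integral (integral {T a..T b} (\<lambda>t. t powr (s - 1) * (1 - t) powr (- s)))) {a..b}"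
  proof (rule has_integral_substitution[where c="T a" and d="T b"])
    show "continuous_on {T a..T b} (\<lambda>t. t powr (s - 1) * (1 - t) powr (- s))"
      using T01[of a] T01[of b] by (intro continuous_intros) auto
  qed (use ab mono der in auto)
  then have "((\<lambda>y. l powr s * ((l * exp y / (exp y + l)\<^sup>2) *\<^sub>R (T y powr (s - 1) * (1 - T y) powr (- s))))
     has_integral (l powr s * integral {T a..T b} (\<lambda>t. t powr (s - 1) * (1 - t) powr (- s)))) {a..b}"
    by (rule has_integral_mult_right)
  moreover have "l powr s * ((l * exp y / (exp y + l)\<^sup>2) *\<^sub>R (T y powr (s - 1) * (1 - T y) powr (- s)))
    = balakrishnan s l y" for y
  proof -
    have T1: "1 - T y = l / (exp y + l)" using pos[of y] by (simp add: T_def field_simps)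
    have e: "exp y powr (s - 1) = exp (s * y) / exp y"
      by (simp add: powr_def exp_diff left_diff_distrib)
    have p: "(exp y + l) powr (s - 1) * (exp y + l) powr (- s) = 1 / (exp y + l)"
    proof -
      have "(exp y + l) powr (s - 1) * (exp y + l) powr (- s) = (exp y + l) powr (s - 1 + - s)"
        by (rule powr_add[symmetric])
      also have "s - 1 + - s = - 1" by simp
      also have "(exp y + l) powr (- 1) = 1 / (exp y + l)" using pos[of y] by (simp add: powr_minus_divide)
      finally show ?thesis .
    qed
    have "T y powr (s - 1) * (1 - T y) powr (- s) = (exp (s * y) / exp y) * (l powr (- s)) / ((exp y
      + l) powr (s - 1) * (exp y + l) powr (- s))"
    proof -
      have "T y powr (s - 1) * (1 - T y) powr (- s)
        = (exp y / (exp y + l)) powr (s - 1) * (l / (exp y + l)) powr (- s)"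
        unfolding T1 by (simp only: T_def)
      also have "\<dots> = exp y powr (s - 1) / (exp y + l) powr (s - 1) * (l powr (- s) / (exp y + l) powr (- s))"
        using pos[of y] l by (simp only: powr_divide)
      finally show ?thesis unfolding e by (simp only: times_divide_times_eq)
    qed
    also have "\<dots> = exp (s * y) / exp y * l powr (- s) * (exp y + l)" unfolding p by simp
    finally have "T y powr (s - 1) * (1 - T y) powr (- s)
      = exp (s * y) / exp y * l powr (- s) * (exp y + l)" .
    moreover have "l powr s * l powr (- s) = 1" using l by (simp add: powr_minus)
    moreover have "A * (l * E / X\<^sup>2 * (S / E * B * X)) = S * l / X"
      if "A * B = 1" "0 < X" "0 < E" for A B X E S :: real
    proof -
      have "A * (l * E / X\<^sup>2 * (S / E * B * X)) = A * B * (S * l / X)"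
        using that(2,3) by (simp add: power2_eq_square)
      then show ?thesis using that(1) by simp
    qed
    ultimately show ?thesis
      using pos[of y] unfolding balakrishnan_def real_scaleR_def by (metis exp_gt_zero)
  qed
  ultimately have "(balakrishnan s l has_integral (l powr s * integral {T a..T b} (\<lambda>t. t powr (s - 1) * (1
    - t) powr (- s)))) {a..b}"
    by simp
  then show ?thesis by (rule integral_unique)
qed

lemma tendsto_integral_balakrishnan:
  assumes R: "filterlim R at_top sequentially"
  shows "(\<lambda>n::nat. integral {- R n..R n} (balakrishnan s l)) \<longlonglongrightarrow> l powr s * (pi / sin (pi * s))"
proof -
  define T where "T y = exp y / (exp y + l)" for y :: real
  let ?b = "\<lambda>t::real. t powr (s - 1) * (1 - t) powr (- s)"
  have pos: "0 < exp y + l" for y using l exp_gt_zero[of y] by linarith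
  have T01: "0 < T y" "T y < 1" for y using pos[of y] l by (auto simp: T_def field_simps)
  have beta: "(?b has_integral (pi / sin (pi * s))) {0..1}"
    using has_integral_Beta_real[of s "1 - s"] s by (simp add: Beta_reflection_real)
  then have bi: "?b integrable_on {0..1}" by blast
  \<comment> \<open>The Beta integrand may be singular at both ends, but its indefinite integral is
    continuous up to them, so the truncated integrals converge.\<close>
  define F where "F x = integral {0..x} ?b" for x
  have Fc: "continuous_on {0..1} F" unfolding F_def by (rule indefinite_integral_continuous_1[OF bi])
  have R': "filterlim (\<lambda>n. - R n) at_bot sequentially"
    using R by (simp add: filterlim_uminus_at_bot)
  have T1: "(\<lambda>n. T (R n)) \<longlonglongrightarrow> 1"
  proof -
    have "(T \<longlongrightarrow> 1) at_top" unfolding T_def using l by real_asymp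
    then show ?thesis using R by (rule filterlim_compose)
  qed
  have T0: "(\<lambda>n. T (- R n)) \<longlonglongrightarrow> 0"
  proof -
    have "(T \<longlongrightarrow> 0) at_bot" unfolding T_def using l by real_asymp
    then show ?thesis using R' by (rule filterlim_compose)
  qed
  have F1: "(\<lambda>n. F (T (R n))) \<longlonglongrightarrow> F 1"
    using T01 by (intro continuous_on_tendsto_compose[OF Fc T1]) (auto intro!: always_eventually less_imp_le)
  have F0: "(\<lambda>n. F (T (- R n))) \<longlonglongrightarrow> F 0"
    using T01 by (intro continuous_on_tendsto_compose[OF Fc T0]) (auto intro!: always_eventually less_imp_le)
  have "(\<lambda>n. l powr s * (F (T (R n)) - F (T (- R n)))) \<longlonglongrightarrow> l powr s * (F 1 - F 0)"
    by (intro tendsto_intros F1 F0)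
  moreover have "F 1 - F 0 = pi / sin (pi * s)"
    using integral_unique[OF beta] by (simp add: F_def)
  moreover have "\<forall>\<^sub>F n in sequentially. l powr s * (F (T (R n)) - F (T (- R n)))
    = integral {- R n..R n} (balakrishnan s l)"
    using R[unfolded filterlim_at_top, rule_format, of 0]
  proof eventually_elim
    case (elim n)
    have "T (- R n) \<le> T (R n)"
    proof -
      have "l * exp (- R n) \<le> l * exp (R n)" using elim l by simp
      then show ?thesis using pos[of "R n"] pos[of "- R n"] by (simp add: T_def divide_simps algebra_simps)
    qed
    then have "F (T (- R n)) + integral {T (- R n)..T (R n)} ?b = F (T (R n))"
      unfolding F_def using T01[of "- R n"] T01[of "R n"]
      by (intro Henstock_Kurzweil_Integration.integral_combine integrable_on_subinterval[OF bi]) auto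
    moreover have "integral {- R n..R n} (balakrishnan s l) = l powr s * integral {T (- R n)..T (R n)} ?b"
      unfolding T_def using elim by (intro integral_balakrishnan) auto
    ultimately show ?case by simp
  qed
  ultimately show ?thesis using Lim_transform_eventually by force
qed

end

section \<open>Bounds in the strip, truncation and the error of the multiplier\<close>

lemma strip_const_ge_1:
  assumes "0 < \<dd>" "\<dd> < pi"
  shows "1 \<le> strip_const \<dd>"
proof -
  have "cos pi < cos \<dd>" using assms by (intro cos_monotone_0_pi) auto
  then have "0 < (1 + cos \<dd>) / 2" by simp
  moreover have "(1 + cos \<dd>) / 2 \<le> 1" using cos_le_one[of \<dd>] by simp
  ultimately have "0 < sqrt ((1 + cos \<dd>) / 2)" "sqrt ((1 + cos \<dd>) / 2) \<le> 1" by auto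
  then show ?thesis unfolding strip_const_def by (simp only: le_divide_eq_1_pos)
qed

text \<open>With \<open>x = exp (Re z)\<close> the squared modulus is
  \<open>x\<^sup>2 + l\<^sup>2 + 2 * (x * l) * cos (Im z)\<close>. At \<open>Im z = \<dd>\<close> it
  exceeds \<open>(1 + cos \<dd>) / 2 * (x + l)\<^sup>2\<close> by
  \<open>(1 - cos \<dd>) / 2 * (x - l)\<^sup>2\<close>, which vanishes for \<open>x = l\<close>. The
  reciprocal of the factor is \<open>strip_const\<close>.\<close>

lemma norm_exp_add_ge:
  fixes z :: complex
  assumes l: "0 < l" and d: "\<bar>Im z\<bar> \<le> \<dd>" "\<dd> < pi"
  shows "sqrt ((1 + cos \<dd>) / 2) * (exp (Re z) + l) \<le> norm (exp z + of_real l)"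
proof -
  have c: "cos \<dd> \<le> cos (Im z)"
    using cos_monotone_0_pi_le[of "\<bar>Im z\<bar>" \<dd>] d by (simp add: cos_abs_real)
  let ?x = "exp (Re z)"
  have n: "(norm (exp z + of_real l))\<^sup>2 = ?x\<^sup>2 + l\<^sup>2 + 2 * (?x * l) * cos (Im z)"
  proof -
    have "(norm (exp z + of_real l))\<^sup>2 = (?x * cos (Im z) + l)\<^sup>2 + (?x * sin (Im z))\<^sup>2"
      by (simp add: cmod_power2 Re_exp Im_exp)
    also have "\<dots> = ?x\<^sup>2 + l\<^sup>2 + 2 * (?x * l) * cos (Im z)"
      by (simp add: power2_sum power_mult_distrib sin_squared_eq algebra_simps)
    finally show ?thesis .
  qed
  have "(1 + cos \<dd>) / 2 * (?x + l)\<^sup>2 \<le> ?x\<^sup>2 + l\<^sup>2 + 2 * (?x * l) * cos \<dd>"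
  proof -
    have "?x\<^sup>2 + l\<^sup>2 + 2 * (?x * l) * cos \<dd> - (1 + cos \<dd>) / 2 * (?x + l)\<^sup>2 = (1 - cos \<dd>) / 2 * (?x - l)\<^sup>2"
      by (simp add: power2_eq_square field_simps)
    moreover have "0 \<le> (1 - cos \<dd>) / 2 * (?x - l)\<^sup>2" by (intro mult_nonneg_nonneg) auto
    ultimately show ?thesis by linarith
  qed
  also have "\<dots> \<le> (norm (exp z + of_real l))\<^sup>2"
    unfolding n using c l by (intro add_left_mono mult_left_mono) auto
  finally have "sqrt ((1 + cos \<dd>) / 2 * (?x + l)\<^sup>2) \<le> norm (exp z + of_real l)"
    by (intro real_le_lsqrt[THEN order_trans] real_sqrt_le_mono[THEN order_trans]) auto
  moreover have "sqrt ((1 + cos \<dd>) / 2 * (?x + l)\<^sup>2) = sqrt ((1 + cos \<dd>) / 2) * (?x + l)"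
    using l by (subst real_sqrt_mult) (simp add: add_nonneg_nonneg)
  ultimately show ?thesis by simp
qed

text \<open>The right side is the integral of \<open>exp (- (a * y))\<close> from
  \<open>m * k\<close> to \<open>N * k\<close>, which telescopes in \<open>N\<close>; one step is
  \<open>a * k \<le> exp (a * k) - 1\<close>.\<close>

lemma exp_tail_sum_le:
  fixes a k :: real
  assumes a: "0 < a" and k: "0 < k" and "m \<le> N"
  shows "k * (\<Sum>j = Suc m..N. exp (- (a * (real j * k))))
    \<le> (exp (- (a * (real m * k))) - exp (- (a * (real N * k)))) / a"
  using \<open>m \<le> N\<close>
proof (induct N rule: dec_induct)
  case base
  then show ?case by simp
next
  case (step N)
  have "a * k \<le> exp (a * k) - 1" using exp_ge_add_one_self[of "a * k"] by linarith
  then have "exp (- (a * (real (Suc N) * k))) * (a * k)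
    \<le> exp (- (a * (real (Suc N) * k))) * (exp (a * k) - 1)"
    by (intro mult_left_mono) auto
  also have "\<dots> = exp (- (a * (real N * k))) - exp (- (a * (real (Suc N) * k)))"
    by (simp add: right_diff_distrib exp_add[symmetric] algebra_simps)
  finally have "k * exp (- (a * (real (Suc N) * k)))
    \<le> (exp (- (a * (real N * k))) - exp (- (a * (real (Suc N) * k)))) / a"
    using a by (simp add: pos_le_divide_eq mult_ac)
  then show ?case using step by (simp add: distrib_left diff_divide_distrib)
qed

lemma exp_tail_sum_le':
  fixes a k :: real
  assumes a: "0 < a" and k: "0 < k" and "m \<le> N"
  shows "k * (\<Sum>j = Suc m..N. exp (- (a * (real j * k)))) \<le> exp (- (a * (real m * k))) / a"
proof -
  have "(exp (- (a * (real m * k))) - exp (- (a * (real N * k)))) / a \<le> exp (- (a * (real m * k))) / a"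
    using a by (intro divide_right_mono) auto
  then show ?thesis using exp_tail_sum_le[OF assms] by linarith
qed

lemma sum_int_split:
  fixes g :: "int \<Rightarrow> real"
  assumes "Nm \<le> N" "Np \<le> N"
  shows "(\<Sum>j = - int N..int N. g j) = (\<Sum>j = Suc Nm..N. g (- int j)) + (\<Sum>j = - int Nm..int Np. g j) + (\<Sum>j
    = Suc Np..N. g (int j))"
proof -
  have U: "{- int N..int N} = ((\<lambda>j. - int j) ` {Suc Nm..N} \<union> {- int Nm..int Np}) \<union> int ` {Suc Np..N}"
  proof (intro set_eqI iffI)
    fix x assume x: "x \<in> {- int N..int N}"
    consider "x < - int Nm" | "- int Nm \<le> x" "x \<le> int Np" | "int Np < x" by linarith
    then show "x \<in> ((\<lambda>j. - int j) ` {Suc Nm..N} \<union> {- int Nm..int Np}) \<union> int ` {Suc Np..N}"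
    proof cases
      case 1
      then have "x = - int (nat (- x))" "nat (- x) \<in> {Suc Nm..N}" using x by auto
      then show ?thesis by blast
    next
      case 3
      then have "x = int (nat x)" "nat x \<in> {Suc Np..N}" using x by auto
      then show ?thesis by blast
    qed auto
  qed (use assms in auto)
  show ?thesis unfolding U
    by (subst sum.union_disjoint, simp, simp, force, subst sum.union_disjoint, simp, simp, force)
       (simp add: sum.reindex inj_on_def)
qed

context
  fixes s \<dd> k \<delta> l :: real and Nm Np :: nat
  assumes s: "0 < s" "s < 1" and d: "0 < \<dd>" "\<dd> < pi" and k: "0 < k"
    and \<delta>: "s < \<delta>" "\<delta> \<le> 2 - s" and l: "0 < l"
begin

text \<open>By \<open>norm_exp_add_ge\<close> the integrand on the closed strip is at most
  \<open>strip_const \<dd>\<close> times its value at the real part. Holomorphy holds in the larger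
  strip of half width \<open>pi\<close>, and positivity on the axis excludes zeros at the
  nodes.\<close>

lemma sinc_quadrature_balakrishnan:
  fixes N :: nat
  defines "R \<equiv> (real N + 1 / 2) * k" and "g \<equiv> balakrishnan s l"
  shows "\<bar>k * (\<Sum>j = - int N..int N. g (of_int j * k)) - integral {- R..R} g\<bar>
     \<le> 2 / (exp (2 * pi * \<dd> / k) - 1) * (strip_const \<dd> * integral {- R..R} g)
       + 2 * \<dd> * (strip_const \<dd> * g R + strip_const \<dd> * g (- R))"
proof -
  define f where "f z = exp (of_real s * z) * of_real l / (exp z + of_real l)" for z :: complex
  have fr: "f (of_real x) = of_real (g x)" for x
    by (simp add: f_def g_def balakrishnan_def exp_of_real flip: of_real_mult of_real_add of_real_divide)
  have cpos: "0 < sqrt ((1 + cos y) / 2)" if "0 \<le> y" "y < pi" for y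
  proof -
    have "cos pi < cos y" using that by (intro cos_monotone_0_pi) auto
    then show ?thesis by simp
  qed
  have ge: "0 < norm (exp z + of_real l)" if "\<bar>Im z\<bar> < pi" for z
  proof -
    have "0 < sqrt ((1 + cos \<bar>Im z\<bar>) / 2) * (exp (Re z) + l)"
      using that l by (intro mult_pos_pos cpos add_pos_pos) auto
    also have "\<dots> \<le> norm (exp z + of_real l)" using that by (intro norm_exp_add_ge l) auto
    finally show ?thesis .
  qed
  have "norm (of_real k * (\<Sum>j = - int N..int N. f (of_real (of_int j * k)))
    - integral {- R..R} (\<lambda>x. f (of_real x)))
     \<le> 2 / (exp (2 * pi * \<dd> / k) - 1) * integral {- R..R} (\<lambda>x. strip_const \<dd> * g x)
       + 2 * \<dd> * (strip_const \<dd> * g R + strip_const \<dd> * g (- R))"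
    unfolding R_def
  proof (rule sinc_quadrature_bound[OF k d])
    show "f holomorphic_on {z. \<bar>Im z\<bar> < pi}"
      unfolding f_def using ge by (intro holomorphic_intros) auto
    show "f (of_real x) \<noteq> 0" for x
      using balakrishnan_pos[OF s l, of x] by (simp add: fr g_def)
    show "continuous_on UNIV (\<lambda>x. strip_const \<dd> * g x)"
      unfolding g_def by (intro continuous_intros continuous_on_balakrishnan[OF s l])
    fix z :: complex assume z: "\<bar>Im z\<bar> \<le> \<dd>"
    have e: "0 < exp (Re z) + l" using l by (simp add: add_pos_pos)
    have c: "0 < sqrt ((1 + cos \<dd>) / 2)" using d by (intro cpos) auto
    have "norm (f z) = exp (s * Re z) * l / norm (exp z + of_real l)"
      using l by (simp add: f_def norm_divide norm_mult)
    also have "\<dots> \<le> exp (s * Re z) * l / (sqrt ((1 + cos \<dd>) / 2) * (exp (Re z) + l))"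
      using e c l by (intro divide_left_mono norm_exp_add_ge z d mult_pos_pos ge) (use z d in auto)
    also have "\<dots> = strip_const \<dd> * g (Re z)"
      by (simp add: strip_const_def g_def balakrishnan_def)
    finally show "norm (f z) \<le> strip_const \<dd> * g (Re z)" .
  qed
  moreover have "integral {- R..R} (\<lambda>x. complex_of_real (g x)) = complex_of_real (integral {- R..R} g)"
    unfolding g_def
    using integral_linear[OF integrable_continuous_real[OF continuous_on_balakrishnan[OF s l]]
      bounded_linear_of_real, of "- R" R]
    by (simp add: o_def)
  ultimately have "norm (complex_of_real (k * (\<Sum>j = - int N..int N. g (of_int j * k)) - integral {- R..R} g))
     \<le> 2 / (exp (2 * pi * \<dd> / k) - 1) * integral {- R..R} (\<lambda>x. strip_const \<dd> * g x)
       + 2 * \<dd> * (strip_const \<dd> * g R + strip_const \<dd> * g (- R))"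
    unfolding fr by (simp only: of_real_sum of_real_mult of_real_diff)
  then show ?thesis by (simp only: norm_of_real integral_mult_right)
qed

text \<open>The factor \<open>l / (exp y + l)\<close> is at most 1, hence at most its own power with
  exponent \<open>(s + \<delta>) / 2 \<le> 1\<close>, whose base is at most
  \<open>l / exp y\<close>. The exponent is the mean of \<open>s\<close> and \<open>\<delta>\<close>
  so that \<open>|\<zeta>| powr (s + \<delta>)\<close> results, one power for each norm.\<close>

lemma balakrishnan_le:
  shows "balakrishnan s l y \<le> exp (s * y)"
    and "balakrishnan s l y \<le> l powr ((s + \<delta>) / 2) * exp (- ((\<delta> - s) / 2 * y))"
proof -
  have pos: "0 < exp y + l" using l by (simp add: add_pos_pos)
  have le1: "l / (exp y + l) \<le> 1" unfolding divide_le_eq_1_pos[OF pos] by simp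
  have eq: "balakrishnan s l y = exp (s * y) * (l / (exp y + l))" by (simp add: balakrishnan_def)
  show "balakrishnan s l y \<le> exp (s * y)"
    unfolding eq using mult_left_mono[OF le1, of "exp (s * y)"] by simp
  let ?p = "(s + \<delta>) / 2"
  have p: "0 < ?p" "?p \<le> 1" using s \<delta> by auto
  have "l / (exp y + l) = (l / (exp y + l)) powr 1" using l pos by simp
  also have "\<dots> \<le> (l / (exp y + l)) powr ?p"
    using p l pos le1 by (intro powr_mono') auto
  also have "\<dots> \<le> (l / exp y) powr ?p"
    using p l by (intro powr_mono2 divide_left_mono) (auto simp: add_pos_pos)
  also have "\<dots> = l powr ?p * exp (- (?p * y))"
  proof -
    have "(l / exp y) powr ?p = l powr ?p / exp y powr ?p" using l by (simp add: powr_divide)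
    also have "exp y powr ?p = exp (?p * y)" by (simp add: powr_def)
    finally show ?thesis by (simp only: exp_minus divide_inverse)
  qed
  finally have "exp (s * y) * (l / (exp y + l)) \<le> exp (s * y) * (l powr ?p * exp (- (?p * y)))"
    by (intro mult_left_mono) auto
  also have "\<dots> = l powr ?p * (exp (s * y) * exp (- (?p * y)))" by simp
  also have "exp (s * y) * exp (- (?p * y)) = exp (- ((\<delta> - s) / 2 * y))"
  proof -
    have "s * y + - (?p * y) = - ((\<delta> - s) / 2 * y)" by (simp add: field_simps)
    then show ?thesis by (simp only: exp_add[symmetric])
  qed
  finally show "balakrishnan s l y \<le> l powr ?p * exp (- ((\<delta> - s) / 2 * y))" unfolding eq .
qed

text \<open>A symmetric sum up to \<open>N\<close> is compared with the integral, and
  \<open>N\<close> tends to infinity: the boundary terms vanish and the integral becomes the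
  Balakrishnan value. The nodes beyond \<open>Nm\<close> and \<open>Np\<close> form two nonnegative
  tails, bounded by the two estimates of \<open>balakrishnan_le\<close>.\<close>

lemma balakrishnan_sum_error:
  defines "M \<equiv> 2 / (exp (2 * pi * \<dd> / k) - 1)" and "g \<equiv> balakrishnan s l"
  shows "\<bar>l powr s * (pi / sin (pi * s)) - k * (\<Sum>j = - int Nm..int Np. g (of_int j * k))\<bar>
    \<le> M * (strip_const \<dd> * (l powr s * (pi / sin (pi * s))))
      + exp (- (s * (real Nm * k))) / s + l powr ((s + \<delta>) / 2) * (exp (- ((\<delta> - s) / 2 * (real Np * k))) / ((\<delta>
        - s) / 2))"
proof -
  let ?R = "\<lambda>N::nat. (real N + 1 / 2) * k"
  let ?L = "l powr s * (pi / sin (pi * s))" and ?S = "k * (\<Sum>j = - int Nm..int Np. g (of_int j * k))"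
  let ?c = "strip_const \<dd>"
  define t where "t = exp (- (s * (real Nm * k))) / s + l powr ((s + \<delta>) / 2) * (exp (- ((\<delta> - s) / 2 * (real Np
    * k))) / ((\<delta> - s) / 2))"
  have R: "filterlim ?R at_top sequentially" using k by real_asymp
  have R': "filterlim (\<lambda>N. - ?R N) at_bot sequentially" using R
    by (simp only: filterlim_uminus_at_bot minus_minus)
  have I: "(\<lambda>N. integral {- ?R N..?R N} g) \<longlonglongrightarrow> ?L"
    unfolding g_def by (rule tendsto_integral_balakrishnan[OF s l R])
  have gt: "(g \<longlongrightarrow> 0) at_top"
  proof (rule tendsto_sandwich[OF _ _ tendsto_const])
    show "\<forall>\<^sub>F y in at_top. 0 \<le> g y" using balakrishnan_pos[OF s l] by (auto simp: g_def less_imp_le)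
    show "\<forall>\<^sub>F y in at_top. g y \<le> l powr ((s + \<delta>) / 2) * exp (- ((\<delta> - s) / 2 * y))"
      using balakrishnan_le(2) by (simp add: g_def)
    have lim: "((\<lambda>y. b * exp (- (a * y))) \<longlongrightarrow> 0) at_top" if "0 < a" for a b :: real
      using that by real_asymp
    show "((\<lambda>y. l powr ((s + \<delta>) / 2) * exp (- ((\<delta> - s) / 2 * y))) \<longlongrightarrow> 0) at_top"
      by (rule lim) (use \<delta> in simp)
  qed
  have gb: "(g \<longlongrightarrow> 0) at_bot"
  proof (rule tendsto_sandwich[OF _ _ tendsto_const])
    show "\<forall>\<^sub>F y in at_bot. 0 \<le> g y" using balakrishnan_pos[OF s l] by (auto simp: g_def less_imp_le)
    show "\<forall>\<^sub>F y in at_bot. g y \<le> exp (s * y)"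
      using balakrishnan_le(1) by (simp add: g_def)
    show "((\<lambda>y. exp (s * y)) \<longlongrightarrow> 0) at_bot" using s by real_asymp
  qed
  have "(\<lambda>N. \<bar>integral {- ?R N..?R N} g - ?S\<bar>) \<longlonglongrightarrow> \<bar>?L - ?S\<bar>"
    by (intro tendsto_intros I)
  moreover have "(\<lambda>N. M * (?c * integral {- ?R N..?R N} g) + 2 * \<dd> * (?c * g (?R N) + ?c * g (- ?R N)) + t)
      \<longlonglongrightarrow> M * (?c * ?L) + 2 * \<dd> * (?c * 0 + ?c * 0) + t"
    by (intro tendsto_intros I filterlim_compose[OF gt R] filterlim_compose[OF gb R'])
  ultimately have "\<bar>?L - ?S\<bar> \<le> M * (?c * ?L) + 2 * \<dd> * (?c * 0 + ?c * 0) + t"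
  proof (rule LIMSEQ_le, intro exI allI impI)
    fix N assume N: "max Nm Np \<le> N"
    let ?T1 = "k * (\<Sum>j = Suc Nm..N. g (of_int (- int j) * k))"
    let ?T2 = "k * (\<Sum>j = Suc Np..N. g (of_int (int j) * k))"
    let ?F = "k * (\<Sum>j = - int N..int N. g (of_int j * k))"
    have split: "?F = ?T1 + ?S + ?T2"
      using sum_int_split[of Nm N Np "\<lambda>j. g (of_int j * k)"] N by (simp add: distrib_left)
    have "?T1 \<le> k * (\<Sum>j = Suc Nm..N. exp (- (s * (real j * k))))"
    proof (intro mult_left_mono sum_mono)
      fix j show "g (of_int (- int j) * k) \<le> exp (- (s * (real j * k)))"
        using balakrishnan_le(1)[of "- (real j * k)"] by (simp add: g_def)
    qed (use k in simp)
    also have "\<dots> \<le> exp (- (s * (real Nm * k))) / s"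
      using N by (intro exp_tail_sum_le' s k) auto
    finally have T1: "?T1 \<le> exp (- (s * (real Nm * k))) / s" .
    have "?T2 \<le> k * (\<Sum>j = Suc Np..N. l powr ((s + \<delta>) / 2) * exp (- ((\<delta> - s) / 2 * (real j * k))))"
    proof (intro mult_left_mono sum_mono)
      fix j show "g (of_int (int j) * k) \<le> l powr ((s + \<delta>) / 2) * exp (- ((\<delta> - s) / 2 * (real j * k)))"
        using balakrishnan_le(2)[of "real j * k"] by (simp add: g_def)
    qed (use k in simp)
    also have "\<dots> = l powr ((s + \<delta>) / 2) * (k * (\<Sum>j = Suc Np..N. exp (- ((\<delta> - s) / 2 * (real j * k)))))"
      by (simp add: sum_distrib_left mult_ac)
    also have "\<dots> \<le> l powr ((s + \<delta>) / 2) * (exp (- ((\<delta> - s) / 2 * (real Np * k))) / ((\<delta> - s) / 2))"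
      using N \<delta> by (intro mult_left_mono exp_tail_sum_le' k) auto
    finally have T2: "?T2 \<le> l powr ((s + \<delta>) / 2) * (exp (- ((\<delta> - s) / 2 * (real Np * k))) / ((\<delta> - s) / 2))" .
    have T0: "0 \<le> ?T1" "0 \<le> ?T2"
      using k unfolding g_def
      by (auto intro!: mult_nonneg_nonneg sum_nonneg less_imp_le[OF balakrishnan_pos[OF s l]])
    have "\<bar>?F - integral {- ?R N..?R N} g\<bar> \<le> M * (?c * integral {- ?R N..?R N} g) + 2 * \<dd> * (?c * g (?R N)
      + ?c * g (- ?R N))"
      unfolding g_def M_def by (rule sinc_quadrature_balakrishnan)
    then show "\<bar>integral {- ?R N..?R N} g - ?S\<bar> \<le> M * (?c * integral {- ?R N..?R N} g) + 2 * \<dd> * (?c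
      * g (?R N) + ?c * g (- ?R N)) + t"
      using T0 T1 T2 split unfolding t_def by linarith
  qed
  then show ?thesis by (simp add: t_def)
qed

text \<open>The quadrature error is proportional to \<open>l powr s\<close>, a weight that occurs in
  neither part of the bound. It is distributed by
  \<open>l powr s \<le> 1 + l powr ((s + \<delta>) / 2)\<close>, using 1 for
  \<open>l \<le> 1\<close> and the larger exponent otherwise.\<close>

lemma symbol_error:
  defines "M \<equiv> 2 / (exp (2 * pi * \<dd> / k) - 1)"
  shows "\<bar>l powr s - sin (pi * s) / pi * (k * (\<Sum>j = - int Nm..int Np. balakrishnan s l (of_int j * k)))\<bar>
    \<le> 2 * strip_const \<dd> / (\<delta> - s) * (M + exp ((s - \<delta>) * real Np * k / 2)) * l powr ((s + \<delta>) / 2)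
      + strip_const \<dd> / s * (M + exp (- s * real Nm * k))"
proof -
  let ?c = "strip_const \<dd>" and ?q = "sin (pi * s) / pi"
  let ?S = "k * (\<Sum>j = - int Nm..int Np. balakrishnan s l (of_int j * k))"
  define e1 where "e1 = exp (- (s * (real Nm * k))) / s"
  define e2 where "e2 = exp (- ((\<delta> - s) / 2 * (real Np * k))) / ((\<delta> - s) / 2)"
  define p where "p = l powr ((s + \<delta>) / 2)"
  have c1: "1 \<le> ?c" using d by (rule strip_const_ge_1)
  have M: "0 \<le> M" using k d by (simp add: M_def)
  have sin: "0 < sin (pi * s)" using s by (intro sin_gt_zero) (auto simp: pi_gt_zero)
  have "sin (pi * s) \<le> pi" using sin_le_one[of "pi * s"] pi_gt3 by linarith
  then have q: "0 < ?q" "?q \<le> 1" using sin by auto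
  have e: "0 \<le> e1" "0 \<le> e2" "0 \<le> p" using s \<delta> by (auto simp: e1_def e2_def p_def)
  have eq: "l powr s - ?q * ?S = ?q * (l powr s * (pi / sin (pi * s)) - ?S)"
    using sin by (simp add: right_diff_distrib)
  have "\<bar>l powr s - ?q * ?S\<bar> = ?q * \<bar>l powr s * (pi / sin (pi * s)) - ?S\<bar>"
    unfolding eq abs_mult abs_of_pos[OF q(1)] ..
  also have "\<dots> \<le> ?q * (M * (?c * (l powr s * (pi / sin (pi * s)))) + e1 + p * e2)"
    using balakrishnan_sum_error q unfolding M_def e1_def e2_def p_def by (intro mult_left_mono) auto
  also have "\<dots> = M * ?c * l powr s + ?q * (e1 + p * e2)"
    using sin by (simp add: field_simps)
  \<comment> \<open>The tails carry a factor \<open>?q \<le> 1\<close> and lack the factor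
    \<open>?c \<ge> 1\<close>. Enlarging both, and inserting \<open>1 / s\<close> and
    \<open>2 / (\<delta> - s)\<close>, which are at least 1, brings all terms into two brackets of
    the same shape.\<close>
  also have "\<dots> \<le> M * ?c * l powr s + 1 * (e1 + p * e2)"
    using q e by (intro add_left_mono mult_right_mono) auto
  also have "\<dots> \<le> M * ?c * (1 / s + 2 / (\<delta> - s) * p) + 1 * (e1 + p * e2)"
  proof (intro add_right_mono mult_left_mono)
    have "l powr s \<le> 1 + p"
    proof (cases "l \<le> 1")
      case True
      then have "l powr s \<le> 1" using l s by (intro powr_le1) auto
      then show ?thesis using e by simp
    next
      case False
      then have "l powr s \<le> p" unfolding p_def using \<delta> by (intro powr_mono) auto
      then show ?thesis by simp
    qed
    also have "\<dots> \<le> 1 / s + 2 / (\<delta> - s) * p"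
    proof (rule add_mono)
      show "1 \<le> 1 / s" using s by simp
      have "1 \<le> 2 / (\<delta> - s)" using s \<delta> by (simp add: le_divide_eq)
      then show "p \<le> 2 / (\<delta> - s) * p" using mult_right_mono[of 1 "2 / (\<delta> - s)" p] e by simp
    qed
    finally show "l powr s \<le> 1 / s + 2 / (\<delta> - s) * p" .
  qed (use M c1 in auto)
  also have "\<dots> \<le> M * ?c * (1 / s + 2 / (\<delta> - s) * p) + ?c * (e1 + p * e2)"
    using c1 e by (intro add_left_mono mult_right_mono) auto
  also have "\<dots> = 2 * ?c / (\<delta> - s) * (M + exp ((s - \<delta>) * real Np * k / 2)) * p + ?c / s * (M + exp (- s
    * real Nm * k))"
  proof -
    have e1: "e1 = exp (- s * real Nm * k) / s" by (simp add: e1_def mult.assoc)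
    have e2: "e2 = 2 / (\<delta> - s) * exp ((s - \<delta>) * real Np * k / 2)"
    proof -
      have "- ((\<delta> - s) / 2 * (real Np * k)) = (s - \<delta>) * real Np * k / 2" by (simp add: field_simps)
      then show ?thesis unfolding e2_def by simp
    qed
    show ?thesis unfolding e1 e2 by (simp add: algebra_simps add_divide_distrib)
  qed
  finally show ?thesis unfolding p_def .
qed

end

section \<open>The singular kernel\<close>

lemma nn_integral_powr_exp:
  assumes a: "0 < a" and x: "0 < x"
  shows "(\<integral>\<^sup>+t. ennreal (t powr (a - 1) * exp (- (x * t))) * indicator {0<..} t \<partial>lborel)
    = ennreal (Gamma a * x powr (- a))"
proof -
  let ?g = "\<lambda>t. ennreal (t powr (a - 1) / exp t) * indicator {0<..} t"
  have m: "?g \<in> borel_measurable borel" by measurable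
  have "(\<integral>\<^sup>+t. ennreal (t powr (a - 1) / exp t) * indicator {0..} t \<partial>lborel) = ennreal (Gamma a)"
    by (rule nn_integral_has_integral_lebesgue'[OF _ Gamma_integral_real[OF a]]) auto
  moreover have "(\<integral>\<^sup>+t. ennreal (t powr (a - 1) / exp t) * indicator {0..} t \<partial>lborel) = (\<integral>\<^sup>+t. ?g t \<partial>lborel)"
    by (rule nn_integral_cong_AE, rule AE_mp[OF AE_lborel_singleton[of 0]]) (auto simp: indicator_def)
  ultimately have "ennreal (Gamma a) = ennreal x * (\<integral>\<^sup>+t. ?g (0 + x * t) \<partial>lborel)"
    using nn_integral_real_affine[OF m, of x 0] x by simp
  also have "(\<integral>\<^sup>+t. ?g (0 + x * t) \<partial>lborel)
      = (\<integral>\<^sup>+t. ennreal (x powr (a - 1)) * (ennreal (t powr (a - 1) * exp (- (x * t)))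
        * indicator {0<..} t) \<partial>lborel)"
    using x by (intro nn_integral_cong)
      (auto simp: indicator_def zero_less_mult_iff powr_mult exp_minus divide_inverse mult_ac simp flip:
        ennreal_mult)
  also have "\<dots> = ennreal (x powr (a - 1)) * (\<integral>\<^sup>+t. ennreal (t powr (a - 1) * exp (- (x * t)))
    * indicator {0<..} t \<partial>lborel)"
    by (rule nn_integral_cmult) measurable
  finally have "ennreal (Gamma a) = ennreal (x * x powr (a - 1)) * (\<integral>\<^sup>+t. ennreal (t powr (a - 1) * exp (- (x
    * t))) * indicator {0<..} t \<partial>lborel)"
    using x by (simp add: ennreal_mult mult.assoc)
  also have "x * x powr (a - 1) = x powr a" using x by (simp add: powr_diff)
  finally have eq: "ennreal (Gamma a) = ennreal (x powr a) * (\<integral>\<^sup>+t. ennreal (t powr (a - 1) * exp (- (x * t)))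
    * indicator {0<..} t \<partial>lborel)" .
  have "ennreal (x powr (- a)) * ennreal (x powr a) = 1"
    using x by (simp add: ennreal_mult[symmetric] powr_minus)
  then have "ennreal (x powr (- a)) * ennreal (Gamma a)
    = (\<integral>\<^sup>+t. ennreal (t powr (a - 1) * exp (- (x * t))) * indicator {0<..} t \<partial>lborel)"
    unfolding eq by (simp add: mult.assoc[symmetric])
  then show ?thesis by (simp add: ennreal_mult'' mult.commute)
qed

text \<open>
  Writing \<open>|h|\<close> to a negative power as a superposition of Gaussians reduces all integrals against
  the kernel to one-dimensional ones.
\<close>

lemma nn_integral_kernel_subordination:
  fixes u :: "'a::euclidean_space \<Rightarrow> real"
  assumes [measurable]: "u \<in> borel_measurable borel" and u: "\<And>h. 0 \<le> u h" and p: "0 < p"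
  shows "(\<integral>\<^sup>+h. ennreal (u h / norm h powr p) \<partial>lborel)
    = ennreal (1 / Gamma (p / 2)) * (\<integral>\<^sup>+t. ennreal (t powr (p / 2 - 1)) *
        (\<integral>\<^sup>+h. ennreal (u h * exp (- (t * (norm h)\<^sup>2))) \<partial>lborel) * indicator {0<..} t \<partial>lborel)"
proof -
  have G: "0 < Gamma (p / 2)" using p by (intro Gamma_real_pos) auto
  have "(\<integral>\<^sup>+h. ennreal (u h / norm h powr p) \<partial>lborel)
    = (\<integral>\<^sup>+h. ennreal (1 / Gamma (p / 2)) * (ennreal (u h) * (\<integral>\<^sup>+t. ennreal (t powr (p / 2 - 1)
      * exp (- ((norm h)\<^sup>2 * t))) * indicator {0<..} t \<partial>lborel)) \<partial>lborel)"
  proof (rule nn_integral_cong_AE, rule AE_mp[OF AE_lborel_singleton[of 0]], intro AE_I2 impI)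
    fix h :: 'a assume h: "h \<noteq> 0"
    have e: "((norm h)\<^sup>2) powr (- (p / 2)) = 1 / norm h powr p"
      using h by (simp add: powr_powr powr_minus_divide flip: powr_numeral)
    have "(\<integral>\<^sup>+t. ennreal (t powr (p / 2 - 1) * exp (- ((norm h)\<^sup>2 * t))) * indicator {0<..} t \<partial>lborel)
      = ennreal (Gamma (p / 2) * (1 / norm h powr p))"
      using nn_integral_powr_exp[of "p / 2" "(norm h)\<^sup>2"] p h unfolding e by simp
    then show "ennreal (u h / norm h powr p) = ennreal (1 / Gamma (p / 2)) * (ennreal (u h) *
        (\<integral>\<^sup>+t. ennreal (t powr (p / 2 - 1) * exp (- ((norm h)\<^sup>2 * t))) * indicator {0<..} t \<partial>lborel))"
      using G u[of h] by (simp add: ennreal_mult[symmetric])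
  qed
  also have "\<dots> = ennreal (1 / Gamma (p / 2)) * (\<integral>\<^sup>+h. (\<integral>\<^sup>+t. ennreal (u h) *
      (ennreal (t powr (p / 2 - 1) * exp (- ((norm h)\<^sup>2 * t))) * indicator {0<..} t) \<partial>lborel) \<partial>lborel)"
    by (simp add: nn_integral_cmult)
  also have "(\<integral>\<^sup>+h. (\<integral>\<^sup>+t. ennreal (u h) *
      (ennreal (t powr (p / 2 - 1) * exp (- ((norm h)\<^sup>2 * t))) * indicator {0<..} t) \<partial>lborel) \<partial>lborel)
    = (\<integral>\<^sup>+t. (\<integral>\<^sup>+h. ennreal (u h) *
      (ennreal (t powr (p / 2 - 1) * exp (- ((norm h)\<^sup>2 * t))) * indicator {0<..} t) \<partial>lborel) \<partial>lborel)"
    by (rule lborel_pair.Fubini') measurable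
  also have "\<dots> = (\<integral>\<^sup>+t. ennreal (t powr (p / 2 - 1)) *
        (\<integral>\<^sup>+h. ennreal (u h * exp (- (t * (norm h)\<^sup>2))) \<partial>lborel) * indicator {0<..} t \<partial>lborel)"
  proof (intro nn_integral_cong)
    fix t :: real
    have "ennreal (u h) * (ennreal (t powr (p / 2 - 1) * exp (- ((norm h)\<^sup>2 * t))) * indicator {0<..} t)
       = (ennreal (t powr (p / 2 - 1)) * indicator {0<..} t) * ennreal (u h * exp (- (t * (norm h)\<^sup>2)))" for h
      using u[of h] by (simp add: ennreal_mult mult_ac)
    then show "(\<integral>\<^sup>+h. ennreal (u h) * (ennreal (t powr (p / 2 - 1) * exp (- ((norm h)\<^sup>2 * t)))
      * indicator {0<..} t) \<partial>lborel)
      = ennreal (t powr (p / 2 - 1)) * (\<integral>\<^sup>+h. ennreal (u h * exp (- (t * (norm h)\<^sup>2))) \<partial>lborel)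
        * indicator {0<..} t"
      by (simp add: nn_integral_cmult mult_ac)
  qed
  finally show ?thesis .
qed

text \<open>The two bounds on \<open>r\<close> act at opposite ends: \<open>t powr (r - 1)\<close>
  is integrable near zero because \<open>0 < r\<close>, and \<open>t powr (r - 2)\<close> near
  infinity because \<open>r < 1\<close>.\<close>

lemma nn_integral_powr_min_finite:
  fixes r b :: real
  assumes r: "0 < r" "r < 1" and b: "0 \<le> b"
  shows "(\<integral>\<^sup>+t. ennreal (t powr (r - 1) * min 1 (b / t)) * indicator {0<..} t \<partial>lborel) < \<infinity>"
proof -
  have "(\<integral>\<^sup>+t. ennreal (t powr (r - 1) * min 1 (b / t)) * indicator {0<..} t \<partial>lborel)
    \<le> (\<integral>\<^sup>+t. ennreal (t powr (r - 1)) * indicator {0..1} t + ennreal b * (ennreal (t powr (r - 2))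
      * indicator {1..} t) \<partial>lborel)"
  proof (intro nn_integral_mono)
    fix t :: real
    show "ennreal (t powr (r - 1) * min 1 (b / t)) * indicator {0<..} t
      \<le> ennreal (t powr (r - 1)) * indicator {0..1} t + ennreal b * (ennreal (t powr (r - 2))
        * indicator {1..} t)"
    proof (cases "0 < t")
      case True
      show ?thesis
      proof (cases "t \<le> 1")
        case le: True
        have "ennreal (t powr (r - 1) * min 1 (b / t)) \<le> ennreal (t powr (r - 1))"
          by (intro ennreal_leI mult_left_le) auto
        then have "ennreal (t powr (r - 1) * min 1 (b / t)) \<le> ennreal (t powr (r - 1)) + x" for x
          by (rule order_trans) (simp add: add_increasing2)
        then show ?thesis using True le by simp
      next
        case False
        have "t powr (r - 1) * min 1 (b / t) \<le> t powr (r - 1) * (b / t)" by (intro mult_left_mono) auto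
        also have "\<dots> = b * (t powr (r - 1) * t powr (- 1))" using True by (simp add: powr_minus_divide)
        also have "t powr (r - 1) * t powr (- 1) = t powr (r - 2)"
        proof -
          have "r - 1 + - 1 = r - 2" by simp
          then show ?thesis by (simp only: powr_add[symmetric])
        qed
        finally have "ennreal (t powr (r - 1) * min 1 (b / t)) \<le> ennreal b * ennreal (t powr (r - 2))"
          using b by (simp add: ennreal_mult[symmetric] ennreal_leI)
        then show ?thesis using True False by (simp add: indicator_def)
      qed
    qed simp
  qed
  also have "\<dots> = (\<integral>\<^sup>+t. ennreal (t powr (r - 1)) * indicator {0..1} t \<partial>lborel)
      + ennreal b * (\<integral>\<^sup>+t. ennreal (t powr (r - 2)) * indicator {1..} t \<partial>lborel)"
    by (subst nn_integral_add) (auto simp: nn_integral_cmult)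
  also have "(\<integral>\<^sup>+t. ennreal (t powr (r - 1)) * indicator {0..1} t \<partial>lborel)
    = ennreal (1 powr (r - 1 + 1) / (r - 1 + 1))"
    using r by (intro nn_integral_has_integral_lebesgue' has_integral_powr_from_0) auto
  also have "(\<integral>\<^sup>+t. ennreal (t powr (r - 2)) * indicator {1..} t \<partial>lborel)
    = ennreal (- (1 powr (r - 2 + 1)) / (r - 2 + 1))"
    using r by (intro nn_integral_has_integral_lebesgue' has_integral_powr_to_inf) auto
  finally show ?thesis by (auto simp: ennreal_mult_less_top intro: le_less_trans)
qed

lemma
  fixes t :: real
  assumes t: "0 < t"
  shows integrable_gauss': "integrable lborel (\<lambda>h::'a::euclidean_space. exp (- (t * (norm h)\<^sup>2)))"
    and integral_gauss': "(LINT h|lborel. exp (- (t * (norm (h::'a))\<^sup>2))) = sqrt (pi / t) ^ DIM('a)"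
proof -
  have "2 * t * x / 2 = t * x" "2 * pi / (2 * t) = pi / t" for x by simp_all
  then show "integrable lborel (\<lambda>h::'a. exp (- (t * (norm h)\<^sup>2)))"
    "(LINT h|lborel. exp (- (t * (norm (h::'a))\<^sup>2))) = sqrt (pi / t) ^ DIM('a)"
    using integrable_gauss[of "2 * t", where 'a='a] integral_gauss[of "2 * t", where 'a='a] t by simp_all
qed

text \<open>The first value is the real part of the Gaussian transform. The second integral is a
  difference of two Gaussian normalizations, which Bernoulli's inequality shows to be smaller by a
  factor of order \<open>1 / t\<close> for large \<open>t\<close>; this gain makes the superposition
  in \<open>t\<close> converge.\<close>

lemma
  fixes t :: real
  assumes t: "0 < t"
  shows nn_integral_one_minus_cos_gauss: "(\<integral>\<^sup>+h. ennreal ((1 - cos (h \<bullet> \<zeta>)) * exp (- (t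
    * (norm (h::'a::euclidean_space))\<^sup>2))) \<partial>lborel)
      = ennreal (sqrt (pi / t) ^ DIM('a) * (1 - exp (- ((norm \<zeta>)\<^sup>2 / (4 * t)))))" (is ?th1)
    and nn_integral_one_minus_gauss_le: "(\<integral>\<^sup>+h. ennreal ((1 - exp (- ((norm h)\<^sup>2 / 2))) * exp (- (t
      * (norm (h::'a))\<^sup>2))) \<partial>lborel)
      \<le> ennreal (sqrt (pi / t) ^ DIM('a) * min 1 (real DIM('a) / (2 * t)))" (is ?th2)
proof -
  have e: "0 < 2 * t" "0 < t + 1/2" using t by auto
  note i1 = integrable_gauss'[OF t, where 'a='a] and v1 = integral_gauss'[OF t, where 'a='a]
  note i2 = integrable_gauss'[OF e(2), where 'a='a] and v2 = integral_gauss'[OF e(2), where 'a='a]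
  have c: "complex_of_real (exp (- (2 * t * (norm h)\<^sup>2 / 2))) * cis (\<zeta> \<bullet> h)
    = complex_of_real (exp (- (t * (norm h)\<^sup>2))) * cis (\<zeta> \<bullet> h)" for h
    by simp
  note ic = integrable_gauss_cis[OF e(1), of \<zeta>, unfolded c] and vc
    = integral_gauss_cis[OF e(1), of \<zeta>, unfolded c]
  have r: "Re (complex_of_real (exp (- (t * (norm h)\<^sup>2))) * cis (\<zeta> \<bullet> h))
    = cos (h \<bullet> \<zeta>) * exp (- (t * (norm h)\<^sup>2))" for h
    by (simp add: inner_commute mult.commute)
  have i3: "integrable lborel (\<lambda>h. cos (h \<bullet> \<zeta>) * exp (- (t * (norm h)\<^sup>2)))"
    using integrable_Re[OF ic] unfolding r .
  have "(LINT h|lborel. cos (h \<bullet> \<zeta>) * exp (- (t * (norm h)\<^sup>2)))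
    = Re (complex_of_real (sqrt (2 * pi / (2 * t)) ^ DIM('a) * exp (- ((norm \<zeta>)\<^sup>2 / (2 * (2 * t))))))"
    unfolding vc[symmetric] r[symmetric] by (rule integral_Re[OF ic])
  also have "\<dots> = sqrt (pi / t) ^ DIM('a) * exp (- ((norm \<zeta>)\<^sup>2 / (4 * t)))"
    by (simp only: Re_complex_of_real) simp
  finally have v3: "(LINT h|lborel. cos (h \<bullet> \<zeta>) * exp (- (t * (norm h)\<^sup>2)))
    = sqrt (pi / t) ^ DIM('a) * exp (- ((norm \<zeta>)\<^sup>2 / (4 * t)))" .
  have "(\<integral>\<^sup>+h. ennreal ((1 - cos (h \<bullet> \<zeta>)) * exp (- (t * (norm h)\<^sup>2))) \<partial>lborel)
      = ennreal (LINT h|lborel. exp (- (t * (norm h)\<^sup>2)) - cos (h \<bullet> \<zeta>) * exp (- (t * (norm h)\<^sup>2)))"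
    using i1 i3 by (subst nn_integral_eq_integral[symmetric]) (auto simp: left_diff_distrib
      mult_left_le_one_le)
  then show ?th1 using i1 i3 by (simp add: v1 v3 right_diff_distrib)
  have ee: "exp (- ((norm h)\<^sup>2 / 2)) * exp (- (t * (norm h)\<^sup>2))
    = exp (- ((t + 1/2) * (norm h)\<^sup>2))" for h :: 'a
    by (simp add: exp_add[symmetric] algebra_simps)
  have "(\<integral>\<^sup>+h. ennreal ((1 - exp (- ((norm h)\<^sup>2 / 2))) * exp (- (t * (norm (h::'a))\<^sup>2))) \<partial>lborel)
      = ennreal (LINT h|lborel. exp (- (t * (norm (h::'a))\<^sup>2)) - exp (- ((t + 1/2) * (norm h)\<^sup>2)))"
    using i1 i2 by (subst nn_integral_eq_integral[symmetric]) (auto simp: left_diff_distrib ee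
      mult_right_mono)
  also have "\<dots> = ennreal (sqrt (pi / t) ^ DIM('a) - sqrt (pi / (t + 1/2)) ^ DIM('a))"
    using i1 i2 by (simp add: v1 v2)
  also have "\<dots> \<le> ennreal (sqrt (pi / t) ^ DIM('a) * min 1 (real DIM('a) / (2 * t)))"
  proof (rule ennreal_leI)
    let ?x = "t / (t + 1/2)"
    have x: "0 \<le> ?x" "?x \<le> 1" using t by auto
    \<comment> \<open>Passing from \<open>sqrt ?x\<close> to the smaller \<open>?x\<close> lets
      Bernoulli's inequality act on a rational function of \<open>t\<close>.\<close>
    have "y \<le> sqrt y" if "0 \<le> y" "y \<le> 1" for y :: real
      using that by (intro real_le_rsqrt) (simp add: power2_eq_square mult_left_le)
    then have s: "?x \<le> sqrt ?x" using x by blast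
    have "1 - real DIM('a) / (2 * t) \<le> 1 + real DIM('a) * (?x - 1)"
    proof -
      have "1 - ?x = (1/2) / (t + 1/2)" using t by (simp add: field_simps)
      also have "\<dots> \<le> (1/2) / t" using t by (intro divide_left_mono) auto
      finally have "real DIM('a) * (1 - ?x) \<le> real DIM('a) * ((1/2) / t)" by (intro mult_left_mono) auto
      then show ?thesis by (simp add: algebra_simps)
    qed
    also have "\<dots> \<le> (1 + (?x - 1)) ^ DIM('a)" using x by (intro Bernoulli_inequality) auto
    also have "\<dots> \<le> sqrt ?x ^ DIM('a)" using s x by (intro power_mono) auto
    finally have B: "1 - sqrt ?x ^ DIM('a) \<le> min 1 (real DIM('a) / (2 * t))" using x by simp
    have "sqrt (pi / (t + 1/2)) = sqrt (pi / t) * sqrt ?x"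
      using t by (simp add: real_sqrt_mult[symmetric])
    then have "sqrt (pi / t) ^ DIM('a) - sqrt (pi / (t + 1/2)) ^ DIM('a)
      = sqrt (pi / t) ^ DIM('a) * (1 - sqrt ?x ^ DIM('a))"
      by (simp add: power_mult_distrib right_diff_distrib)
    also have "\<dots> \<le> sqrt (pi / t) ^ DIM('a) * min 1 (real DIM('a) / (2 * t))"
      using B t by (intro mult_left_mono) auto
    finally show "sqrt (pi / t) ^ DIM('a) - sqrt (pi / (t + 1/2)) ^ DIM('a)
      \<le> sqrt (pi / t) ^ DIM('a) * min 1 (real DIM('a) / (2 * t))" .
  qed
  finally show ?th2 .
qed

text \<open>The dimension cancels: the Gaussian normalization removes \<open>d / 2\<close> from the
  exponent of the superposition, and \<open>t powr (r - 1)\<close> remains.\<close>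

lemma powr_sqrt_combine:
  assumes "0 < t"
  shows "t powr ((real d + 2 * r) / 2 - 1) * (sqrt (pi / t) ^ d * m) = sqrt pi ^ d * (t powr (r - 1) * m)"
proof -
  have "sqrt t ^ d = t powr (real d / 2)" using assms by (simp add: powr_half_nat)
  moreover have "t powr ((real d + 2 * r) / 2 - 1) = t powr (real d / 2) * t powr (r - 1)"
  proof -
    have "(real d + 2 * r) / 2 - 1 = real d / 2 + (r - 1)" by (simp add: field_simps)
    then show ?thesis by (simp only: powr_add)
  qed
  ultimately show ?thesis using assms by (simp add: real_sqrt_divide power_divide)
qed

text \<open>The numerator is comparable to \<open>1 - exp (- ((norm h)\<^sup>2 / 2))\<close>, whose
  integrals against Gaussians are explicit. Subordination thus takes the place of polar
  coordinates.\<close>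

lemma kernel_min_finite:
  fixes r :: real
  assumes r: "0 < r" "r < 1"
  shows "(\<integral>\<^sup>+h. ennreal (min 1 ((norm (h::'a::euclidean_space))\<^sup>2) / norm h powr (real DIM('a) + 2
    * r)) \<partial>lborel) < \<infinity>"
proof -
  let ?p = "real DIM('a) + 2 * r"
  have p: "0 < ?p" using r by (simp add: add_nonneg_pos)
  have G: "0 < Gamma (?p / 2)" using p by (intro Gamma_real_pos) auto
  \<comment> \<open>From \<open>exp (- (x / 2)) \<le> 1 / (1 + x / 2)\<close> it remains to see
    \<open>min 1 x \<le> 3 * x / (2 + x)\<close>, where both sides equal 1 at \<open>x = 1\<close>;
    hence the constant 3.\<close>
  have le: "min 1 x \<le> 3 * (1 - exp (- (x / 2)))" if "0 \<le> x" for x :: real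
  proof -
    have "exp (- (x / 2)) = 1 / exp (x / 2)" by (simp only: exp_minus inverse_eq_divide)
    also have "\<dots> \<le> 1 / (1 + x / 2)" using that exp_ge_add_one_self[of "x / 2"]
      by (intro divide_left_mono) auto
    finally have a: "1 - 1 / (1 + x / 2) \<le> 1 - exp (- (x / 2))" by simp
    have b: "min 1 x \<le> 3 * (1 - 1 / (1 + x / 2))"
    proof -
      have "1 - 1 / (1 + x / 2) = x / (2 + x)" using that by (simp add: field_simps)
      moreover have "min 1 x * (2 + x) \<le> 3 * x"
      proof (cases "x \<le> 1")
        case True
        then have "x * x \<le> x" using that by (simp add: mult_left_le)
        then show ?thesis using True by (simp add: min_def distrib_left)
      qed (simp add: min_def)
      ultimately show ?thesis using that by (simp add: pos_le_divide_eq)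
    qed
    show ?thesis by (rule order_trans[OF b mult_left_mono[OF a]]) simp
  qed
  have "(\<integral>\<^sup>+h. ennreal (min 1 ((norm (h::'a))\<^sup>2) / norm h powr ?p) \<partial>lborel)
    \<le> (\<integral>\<^sup>+h. 3 * ennreal ((1 - exp (- ((norm (h::'a))\<^sup>2 / 2))) / norm h powr ?p) \<partial>lborel)"
  proof (intro nn_integral_mono)
    fix h :: 'a
    have "min 1 ((norm h)\<^sup>2) / norm h powr ?p \<le> 3 * (1 - exp (- ((norm h)\<^sup>2 / 2))) / norm h powr ?p"
      by (intro divide_right_mono le) auto
    then have "ennreal (min 1 ((norm h)\<^sup>2) / norm h powr ?p)
      \<le> ennreal (3 * ((1 - exp (- ((norm h)\<^sup>2 / 2))) / norm h powr ?p))"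
      by (intro ennreal_leI) simp
    also have "\<dots> = 3 * ennreal ((1 - exp (- ((norm h)\<^sup>2 / 2))) / norm h powr ?p)"
      by (subst ennreal_mult) auto
    finally show "ennreal (min 1 ((norm h)\<^sup>2) / norm h powr ?p)
      \<le> 3 * ennreal ((1 - exp (- ((norm h)\<^sup>2 / 2))) / norm h powr ?p)" .
  qed
  also have "\<dots> = 3 * (\<integral>\<^sup>+h. ennreal ((1 - exp (- ((norm (h::'a))\<^sup>2 / 2))) / norm h powr ?p) \<partial>lborel)"
    by (rule nn_integral_cmult) measurable
  also have "(\<integral>\<^sup>+h. ennreal ((1 - exp (- ((norm (h::'a))\<^sup>2 / 2))) / norm h powr ?p) \<partial>lborel)
     = ennreal (1 / Gamma (?p / 2)) * (\<integral>\<^sup>+t. ennreal (t powr (?p / 2 - 1)) *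
        (\<integral>\<^sup>+h. ennreal ((1 - exp (- ((norm h)\<^sup>2 / 2))) * exp (- (t * (norm (h::'a))\<^sup>2))) \<partial>lborel)
          * indicator {0<..} t \<partial>lborel)"
    by (rule nn_integral_kernel_subordination[OF _ _ p]) auto
  also have "(\<integral>\<^sup>+t. ennreal (t powr (?p / 2 - 1)) *
        (\<integral>\<^sup>+h. ennreal ((1 - exp (- ((norm h)\<^sup>2 / 2))) * exp (- (t * (norm (h::'a))\<^sup>2))) \<partial>lborel)
          * indicator {0<..} t \<partial>lborel)
     \<le> (\<integral>\<^sup>+t. ennreal (sqrt pi ^ DIM('a)) * (ennreal (t powr (r - 1) * min 1 (real DIM('a) / 2 / t))
       * indicator {0<..} t) \<partial>lborel)"
  proof (intro nn_integral_mono)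
    fix t :: real
    show "ennreal (t powr (?p / 2 - 1)) *
        (\<integral>\<^sup>+h. ennreal ((1 - exp (- ((norm h)\<^sup>2 / 2))) * exp (- (t * (norm (h::'a))\<^sup>2))) \<partial>lborel)
          * indicator {0<..} t
      \<le> ennreal (sqrt pi ^ DIM('a)) * (ennreal (t powr (r - 1) * min 1 (real DIM('a) / 2 / t))
        * indicator {0<..} t)"
    proof (cases "0 < t")
      case True
      have "ennreal (t powr (?p / 2 - 1)) * (\<integral>\<^sup>+h. ennreal ((1 - exp (- ((norm h)\<^sup>2 / 2))) * exp (- (t
        * (norm (h::'a))\<^sup>2))) \<partial>lborel)
        \<le> ennreal (t powr (?p / 2 - 1)) * ennreal (sqrt (pi / t) ^ DIM('a) * min 1 (real DIM('a) / (2 * t)))"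
        by (intro mult_left_mono nn_integral_one_minus_gauss_le True) auto
      also have "\<dots> = ennreal (sqrt pi ^ DIM('a)) * ennreal (t powr (r - 1) * min 1 (real DIM('a) / 2 / t))"
        using True by (simp add: ennreal_mult[symmetric] powr_sqrt_combine)
      finally show ?thesis using True by simp
    qed simp
  qed
  also have "\<dots> = ennreal (sqrt pi ^ DIM('a)) * (\<integral>\<^sup>+t. ennreal (t powr (r - 1) * min 1 (real DIM('a) / 2 / t))
    * indicator {0<..} t \<partial>lborel)"
    by (rule nn_integral_cmult) measurable
  finally have "(\<integral>\<^sup>+h. ennreal (min 1 ((norm (h::'a))\<^sup>2) / norm h powr ?p) \<partial>lborel)
    \<le> 3 * (ennreal (1 / Gamma (?p / 2)) * (ennreal (sqrt pi ^ DIM('a)) *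
       (\<integral>\<^sup>+t. ennreal (t powr (r - 1) * min 1 (real DIM('a) / 2 / t)) * indicator {0<..} t \<partial>lborel)))"
    by (simp add: mult_left_mono)
  also have "\<dots> < \<infinity>"
    using nn_integral_powr_min_finite[OF r, of "real DIM('a) / 2"] by (simp add: ennreal_mult_less_top)
  finally show ?thesis .
qed

text \<open>Subordination leaves an integral in \<open>t\<close> that depends on
  \<open>\<zeta>\<close> through \<open>(norm \<zeta>)\<^sup>2 / t\<close> only. The scaling
  \<open>t = (norm \<zeta>)\<^sup>2 * u\<close> extracts the power of \<open>norm \<zeta>\<close>
  and leaves the number \<open>J\<close>, which has to be shown finite and positive.\<close>

lemma ex_kernel_const:
  fixes r :: real
  assumes r: "0 < r" "r < 1"
  shows "\<exists>A>0. \<forall>\<zeta>::'a::euclidean_space.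
    (\<integral>\<^sup>+h. ennreal ((1 - cos (h \<bullet> \<zeta>)) / norm h powr (real DIM('a) + 2 * r)) \<partial>lborel)
      = ennreal (A * norm \<zeta> powr (2 * r))"
proof -
  let ?p = "real DIM('a) + 2 * r"
  have p: "0 < ?p" using r by (simp add: add_nonneg_pos)
  have G: "0 < Gamma (?p / 2)" using p by (intro Gamma_real_pos) auto
  let ?j = "\<lambda>u. ennreal (u powr (r - 1) * (1 - exp (- (1 / (4 * u))))) * indicator {0<..} u"
  define J where "J = (\<integral>\<^sup>+u. ?j u \<partial>lborel)"
  have Jfin: "J < \<infinity>"
  proof -
    have "J \<le> (\<integral>\<^sup>+u. ennreal (u powr (r - 1) * min 1 (1 / 4 / u)) * indicator {0<..} u \<partial>lborel)"
      unfolding J_def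
    proof (intro nn_integral_mono mult_right_mono ennreal_leI mult_left_mono)
      fix u :: real
      show "1 - exp (- (1 / (4 * u))) \<le> min 1 (1 / 4 / u)"
        using exp_ge_add_one_self[of "- (1 / (4 * u))"] by simp
    qed auto
    also have "\<dots> < \<infinity>" by (rule nn_integral_powr_min_finite[OF r]) simp
    finally show ?thesis .
  qed
  have Jpos: "0 < J"
  proof -
    \<comment> \<open>Both factors of the integrand decrease in \<open>u\<close>, so their values at
      \<open>u = 2\<close> bound it from below on an interval of length one.\<close>
    let ?c = "2 powr (r - 1) * (1 - exp (- (1 / 8)))"
    have "0 < ennreal ?c" by simp
    also have "ennreal ?c = (\<integral>\<^sup>+u. ennreal ?c * indicator {1..2::real} u \<partial>lborel)"
      by (subst nn_integral_cmult_indicator) auto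
    also have "\<dots> \<le> J"
      unfolding J_def
    proof (intro nn_integral_mono)
      fix u :: real
      show "ennreal ?c * indicator {1..2} u \<le> ?j u"
      proof (cases "u \<in> {1..2}")
        case True
        have "?c \<le> u powr (r - 1) * (1 - exp (- (1 / (4 * u))))"
        proof (intro mult_mono)
          show "2 powr (r - 1) \<le> u powr (r - 1)" using True r by (intro powr_mono2') auto
          have "1 / 8 \<le> 1 / (4 * u)" using True by (intro divide_left_mono) auto
          then show "1 - exp (- (1 / 8)) \<le> 1 - exp (- (1 / (4 * u)))" by simp
        qed auto
        then show ?thesis using True by (simp add: ennreal_leI)
      qed simp
    qed
    finally show ?thesis .
  qed
  obtain j where j: "J = ennreal j" "0 < j" using Jfin Jpos by (cases J) auto
  define A where "A = 1 / Gamma (?p / 2) * sqrt pi ^ DIM('a) * j"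
  have A: "0 < A" using G j by (simp add: A_def)
  have "(\<integral>\<^sup>+h. ennreal ((1 - cos (h \<bullet> \<zeta>)) / norm h powr ?p) \<partial>lborel)
    = ennreal (A * norm \<zeta> powr (2 * r))" for \<zeta> :: 'a
  proof (cases "\<zeta> = 0")
    case False
    let ?b = "(norm \<zeta>)\<^sup>2"
    have b: "0 < ?b" using False by simp
    have "(\<integral>\<^sup>+h. ennreal ((1 - cos (h \<bullet> \<zeta>)) / norm h powr ?p) \<partial>lborel)
      = ennreal (1 / Gamma (?p / 2)) * (\<integral>\<^sup>+t. ennreal (t powr (?p / 2 - 1)) *
        (\<integral>\<^sup>+h. ennreal ((1 - cos (h \<bullet> \<zeta>)) * exp (- (t * (norm (h::'a))\<^sup>2))) \<partial>lborel)
          * indicator {0<..} t \<partial>lborel)"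
      by (rule nn_integral_kernel_subordination[OF _ _ p]) auto
    also have "(\<integral>\<^sup>+t. ennreal (t powr (?p / 2 - 1)) *
        (\<integral>\<^sup>+h. ennreal ((1 - cos (h \<bullet> \<zeta>)) * exp (- (t * (norm (h::'a))\<^sup>2))) \<partial>lborel)
          * indicator {0<..} t \<partial>lborel)
      = (\<integral>\<^sup>+t. ennreal (sqrt pi ^ DIM('a)) * (ennreal (t powr (r - 1) * (1 - exp (- (?b / (4 * t)))))
        * indicator {0<..} t) \<partial>lborel)"
    proof (intro nn_integral_cong)
      fix t :: real
      show "ennreal (t powr (?p / 2 - 1)) *
          (\<integral>\<^sup>+h. ennreal ((1 - cos (h \<bullet> \<zeta>)) * exp (- (t * (norm (h::'a))\<^sup>2))) \<partial>lborel) * indicator {0<..} t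
        = ennreal (sqrt pi ^ DIM('a)) * (ennreal (t powr (r - 1) * (1 - exp (- (?b / (4 * t)))))
          * indicator {0<..} t)"
      proof (cases "0 < t")
        case True
        then show ?thesis
          by (simp add: nn_integral_one_minus_cos_gauss ennreal_mult[symmetric] powr_sqrt_combine)
      qed simp
    qed
    also have "\<dots> = ennreal (sqrt pi ^ DIM('a)) * (\<integral>\<^sup>+t. ennreal (t powr (r - 1) * (1 - exp (- (?b / (4
      * t))))) * indicator {0<..} t \<partial>lborel)"
      by (rule nn_integral_cmult) measurable
    also have "(\<integral>\<^sup>+t. ennreal (t powr (r - 1) * (1 - exp (- (?b / (4 * t))))) * indicator {0<..} t \<partial>lborel)
       = ennreal ?b * (\<integral>\<^sup>+u. ennreal (?b powr (r - 1)) * ?j u \<partial>lborel)"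
    proof -
      have "(\<integral>\<^sup>+t. ennreal (t powr (r - 1) * (1 - exp (- (?b / (4 * t))))) * indicator {0<..} t \<partial>lborel)
       = ennreal \<bar>?b\<bar> * (\<integral>\<^sup>+u. ennreal ((0 + ?b * u) powr (r - 1) * (1 - exp (- (?b / (4 * (0 + ?b * u))))))
         * indicator {0<..} (0 + ?b * u) \<partial>lborel)"
        using b by (intro nn_integral_real_affine) auto
      also have "(\<integral>\<^sup>+u. ennreal ((0 + ?b * u) powr (r - 1) * (1 - exp (- (?b / (4 * (0 + ?b * u))))))
        * indicator {0<..} (0 + ?b * u) \<partial>lborel)
         = (\<integral>\<^sup>+u. ennreal (?b powr (r - 1)) * ?j u \<partial>lborel)"
      proof (intro nn_integral_cong)
        fix u :: real
        show "ennreal ((0 + ?b * u) powr (r - 1) * (1 - exp (- (?b / (4 * (0 + ?b * u))))))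
          * indicator {0<..} (0 + ?b * u)
          = ennreal (?b powr (r - 1)) * ?j u"
        proof (cases "0 < u")
          case True
          have "?b / (4 * (?b * u)) = 1 / (4 * u)" using b True by simp
          moreover have "(?b * u) powr (r - 1) = ?b powr (r - 1) * u powr (r - 1)" using b True
            by (simp add: powr_mult)
          ultimately show ?thesis using True b
            by (simp add: ennreal_mult[symmetric] mult.assoc)
        next
          case False
          then show ?thesis using b by (simp add: zero_less_mult_iff)
        qed
      qed
      finally show ?thesis using b by simp
    qed
    also have "(\<integral>\<^sup>+u. ennreal (?b powr (r - 1)) * ?j u \<partial>lborel) = ennreal (?b powr (r - 1)) * J"
      unfolding J_def by (rule nn_integral_cmult) measurable
    also have "ennreal (1 / Gamma (?p / 2)) * (ennreal (sqrt pi ^ DIM('a)) * (ennreal ?b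
      * (ennreal (?b powr (r - 1)) * J)))
      = ennreal (A * (?b * ?b powr (r - 1)))"
      unfolding j A_def using G j(2) by (simp add: ennreal_mult[symmetric] mult_ac)
    also have "?b * ?b powr (r - 1) = norm \<zeta> powr (2 * r)"
    proof -
      have "?b * ?b powr (r - 1) = ?b powr r" using b by (simp add: powr_diff)
      also have "\<dots> = (norm \<zeta> powr 2) powr r" using False by (simp add: powr_numeral)
      also have "\<dots> = norm \<zeta> powr (2 * r)" by (rule powr_powr)
      finally show ?thesis .
    qed
    finally show ?thesis .
  qed simp
  then show ?thesis using A by blast
qed

section \<open>The Gagliardo seminorm\<close>

lemma
  fixes f :: "'a::euclidean_space \<Rightarrow> 'b::{banach, second_countable_topology}"
  assumes [measurable]: "f \<in> borel_measurable borel"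
  shows integral_lborel_translate: "(LINT x|lborel. f (c + x)) = (LINT x|lborel. f x)"
    and integrable_lborel_translate: "integrable lborel (\<lambda>x. f (c + x)) \<longleftrightarrow> integrable lborel f"
proof -
  show "(LINT x|lborel. f (c + x)) = (LINT x|lborel. f x)"
    by (subst (2) lborel_distr_plus[symmetric, of c]) (simp add: integral_distr)
  show "integrable lborel (\<lambda>x. f (c + x)) \<longleftrightarrow> integrable lborel f"
    by (subst (2) lborel_distr_plus[symmetric, of c]) (simp add: integrable_distr_eq)
qed

lemma fourier_integral_translate:
  fixes f :: "'a::euclidean_space \<Rightarrow> complex"
  assumes [measurable]: "f \<in> borel_measurable borel"
  shows "fourier_integral (\<lambda>x. f (c + x)) \<zeta> = cis (c \<bullet> \<zeta>) * fourier_integral f \<zeta>"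
proof -
  have eq: "f (c + x) * cis (- (x \<bullet> \<zeta>)) = cis (c \<bullet> \<zeta>) * (f (c + x) * cis (- ((c + x) \<bullet> \<zeta>)))" for x
  proof -
    have "cis (- (x \<bullet> \<zeta>)) = cis (c \<bullet> \<zeta>) * cis (- ((c + x) \<bullet> \<zeta>))"
      by (simp add: cis_mult inner_add_left)
    then show ?thesis by (simp add: mult_ac)
  qed
  have "(LINT x|lborel. f (c + x) * cis (- (x \<bullet> \<zeta>))) = cis (c \<bullet> \<zeta>) * (LINT x|lborel. f x * cis (- (x \<bullet> \<zeta>)))"
    unfolding eq integral_mult_right_zero
    by (subst integral_lborel_translate[of "\<lambda>x. f x * cis (- (x \<bullet> \<zeta>))" c]) auto
  then show ?thesis by (simp add: fourier_integral_lborel)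
qed

lemma
  fixes f :: "'a::euclidean_space \<Rightarrow> 'b::{banach, second_countable_topology}"
  assumes [measurable]: "f \<in> borel_measurable borel"
  shows nsq_translate: "nsq lborel (\<lambda>x. f (c + x)) = nsq lborel f"
    and l2_translate: "l2 lborel (\<lambda>x. f (c + x)) \<longleftrightarrow> l2 lborel f"
  unfolding nsq_def l2_def
  using integral_lborel_translate[of "\<lambda>x. (norm (f x))\<^sup>2" c] integrable_lborel_translate[of "\<lambda>x. (norm (f
    x))\<^sup>2" c]
  by simp_all

lemma l12_translate:
  assumes f: "l12 f"
  shows "l12 (\<lambda>x. f (c + x))"
proof -
  have [measurable]: "f \<in> borel_measurable borel" using f by (auto simp: l12_def)
  show ?thesis using f by (simp add: l12_def l2_translate integrable_lborel_translate)
qed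

lemma bfourier_translate:
  assumes f: "l2 lborel f"
  shows "AE \<zeta> in lborel. bfourier (\<lambda>x. f (c + x)) \<zeta> = cis (c \<bullet> \<zeta>) * bfourier f \<zeta>"
proof (rule bfourier_unique[where F="\<lambda>n x. truncate n f (c + x)"])
  have [measurable]: "f \<in> borel_measurable borel" using f by (simp add: l2_def)
  have [measurable]: "bfourier f \<in> borel_measurable borel" by (rule bfourier_measurable[OF f])
  show "l2 lborel (\<lambda>x. f (c + x))" using f by (simp add: l2_translate)
  show "l2 lborel (\<lambda>\<zeta>. cis (c \<bullet> \<zeta>) * bfourier f \<zeta>)"
    by (rule l2_bound[OF l2_bfourier[OF f]]) (auto simp: norm_mult)
  show "l12 (\<lambda>x. truncate n f (c + x))" for n by (rule l12_translate[OF l12_truncate[OF f]])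
  have "nsq lborel (\<lambda>x. truncate n f (c + x) - f (c + x)) = nsq lborel (\<lambda>x. truncate n f x - f x)" for n
    by (rule nsq_translate[of "\<lambda>x. truncate n f x - f x" c]) measurable
  then show "(\<lambda>n. nsq lborel (\<lambda>x. truncate n f (c + x) - f (c + x))) \<longlonglongrightarrow> 0"
    using nsq_truncate_tendsto[OF f] by simp
  have "norm (fourier_integral (\<lambda>x. truncate n f (c + x)) \<zeta> - cis (c \<bullet> \<zeta>) * bfourier f \<zeta>)
      = norm (fourier_integral (truncate n f) \<zeta> - bfourier f \<zeta>)" for n \<zeta>
  proof -
    have "fourier_integral (\<lambda>x. truncate n f (c + x)) \<zeta> - cis (c \<bullet> \<zeta>) * bfourier f \<zeta>
      = cis (c \<bullet> \<zeta>) * (fourier_integral (truncate n f) \<zeta> - bfourier f \<zeta>)"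
      by (simp add: fourier_integral_translate right_diff_distrib)
    then show ?thesis by (simp add: norm_mult)
  qed
  then show "(\<lambda>n. nsq lborel (\<lambda>\<zeta>. fourier_integral (\<lambda>x. truncate n f (c + x)) \<zeta> - cis (c \<bullet> \<zeta>)
    * bfourier f \<zeta>)) \<longlonglongrightarrow> 0"
    using nsq_truncate_diff_tendsto[OF f] by (simp add: nsq_def)
qed

text \<open>
  The value of the integral of \<open>1 - cos (h \<bullet> \<zeta>)\<close> against the kernel at a unit vector; its
  reciprocal is the normalization constant of the fractional Laplacian.
\<close>

definition kernel_const :: "'a::euclidean_space itself \<Rightarrow> real \<Rightarrow> real" where
  "kernel_const _ r = (SOME A. A > 0 \<and> (\<forall>\<zeta>::'a.
    (\<integral>\<^sup>+h. ennreal ((1 - cos (h \<bullet> \<zeta>)) / norm h powr (real DIM('a) + 2 * r)) \<partial>lborel)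
      = ennreal (A * norm \<zeta> powr (2 * r))))"

lemma
  assumes r: "0 < r" "r < 1"
  shows kernel_const_pos: "0 < kernel_const TYPE('a::euclidean_space) r"
    and nn_integral_kernel_cos: "(\<integral>\<^sup>+h. ennreal ((1 - cos (h \<bullet> \<zeta>)) / norm h powr (real DIM('a) + 2
      * r)) \<partial>lborel)
      = ennreal (kernel_const TYPE('a) r * norm (\<zeta>::'a) powr (2 * r))"
proof -
  let ?P = "\<lambda>A. A > 0 \<and> (\<forall>\<zeta>::'a.
    (\<integral>\<^sup>+h. ennreal ((1 - cos (h \<bullet> \<zeta>)) / norm h powr (real DIM('a) + 2 * r)) \<partial>lborel)
      = ennreal (A * norm \<zeta> powr (2 * r)))"
  have "\<exists>A. ?P A" using ex_kernel_const[OF r, where 'a='a] by auto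
  then have "?P (kernel_const TYPE('a) r)" unfolding kernel_const_def by (rule someI_ex)
  then show "0 < kernel_const TYPE('a) r"
    "(\<integral>\<^sup>+h. ennreal ((1 - cos (h \<bullet> \<zeta>)) / norm h powr (real DIM('a) + 2 * r)) \<partial>lborel)
      = ennreal (kernel_const TYPE('a) r * norm (\<zeta>::'a) powr (2 * r))" by auto
qed

text \<open>For a fixed increment \<open>h\<close>, Plancherel turns the difference into the
  multiplier \<open>|cis (h \<bullet> \<zeta>) - 1|\<^sup>2 = 2 * (1 - cos (h \<bullet>
  \<zeta>))\<close>, and integration over \<open>h\<close> against the kernel gives
  \<open>kernel_const\<close>. Nonnegative integrals allow both exchanges of order without prior
  finiteness.\<close>

lemma nn_integral_gagliardo:
  fixes u :: "'a::euclidean_space \<Rightarrow> real"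
  assumes r: "0 < r" "r < 1" and u: "l2 lborel u"
  shows "(\<integral>\<^sup>+y. (\<integral>\<^sup>+x. ennreal ((u x - u y)\<^sup>2 / dist x y powr (real DIM('a) + 2 * r)) \<partial>lborel) \<partial>lborel)
    = (\<integral>\<^sup>+\<zeta>. ennreal (2 * kernel_const TYPE('a) r * (norm \<zeta> powr (2 * r)
      * (norm (bfourier (\<lambda>x. complex_of_real (u x)) \<zeta>))\<^sup>2)) \<partial>lborel)"
proof -
  let ?p = "real DIM('a) + 2 * r" and ?A = "kernel_const TYPE('a) r"
  let ?c = "\<lambda>x. complex_of_real (u x)"
  let ?F = "bfourier ?c"
  have um[measurable]: "u \<in> borel_measurable borel" using u by (simp add: l2_def)
  have c: "l2 lborel ?c" by (rule l2_bound[OF u]) auto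
  have [measurable]: "?F \<in> borel_measurable borel" by (rule bfourier_measurable[OF c])
  have inner: "(\<integral>\<^sup>+y. ennreal ((u (y + h) - u y)\<^sup>2) \<partial>lborel)
    = (\<integral>\<^sup>+\<zeta>. ennreal (2 * (1 - cos (h \<bullet> \<zeta>)) * (norm (?F \<zeta>))\<^sup>2) \<partial>lborel)" for h
  proof -
    let ?d = "\<lambda>x. ?c (h + x) - ?c x"
    have ch: "l2 lborel (\<lambda>x. ?c (h + x))" using c by (subst l2_translate) auto
    have d: "l2 lborel ?d" by (rule l2_diff[OF ch c])
    have "(\<integral>\<^sup>+y. ennreal ((u (y + h) - u y)\<^sup>2) \<partial>lborel) = (\<integral>\<^sup>+y. ennreal ((norm (?d y))\<^sup>2) \<partial>lborel)"
      by (intro nn_integral_cong) (simp add: add.commute flip: of_real_diff)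
    also have "\<dots> = (\<integral>\<^sup>+\<zeta>. ennreal ((norm (bfourier ?d \<zeta>))\<^sup>2) \<partial>lborel)"
      by (simp add: nn_integral_nsq[OF d] nn_integral_nsq[OF l2_bfourier[OF d]] nsq_bfourier[OF d])
    also have "\<dots> = (\<integral>\<^sup>+\<zeta>. ennreal (2 * (1 - cos (h \<bullet> \<zeta>)) * (norm (?F \<zeta>))\<^sup>2) \<partial>lborel)"
    proof (rule nn_integral_cong_AE)
      show "AE \<zeta> in lborel. ennreal ((norm (bfourier ?d \<zeta>))\<^sup>2)
        = ennreal (2 * (1 - cos (h \<bullet> \<zeta>)) * (norm (?F \<zeta>))\<^sup>2)"
        using bfourier_diff[OF ch c] bfourier_translate[OF c, of h]
      proof eventually_elim
        case (elim \<zeta>)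
        have "bfourier ?d \<zeta> = (cis (h \<bullet> \<zeta>) - 1) * ?F \<zeta>" unfolding elim by (simp add: left_diff_distrib)
        moreover have "(norm (cis (h \<bullet> \<zeta>) - 1))\<^sup>2 = 2 * (1 - cos (h \<bullet> \<zeta>))"
          by (simp add: cmod_power2 power2_diff sin_squared_eq)
        ultimately show ?case by (simp add: norm_mult power_mult_distrib)
      qed
    qed
    finally show ?thesis .
  qed
  have "(\<integral>\<^sup>+y. (\<integral>\<^sup>+x. ennreal ((u x - u y)\<^sup>2 / dist x y powr ?p) \<partial>lborel) \<partial>lborel)
    = (\<integral>\<^sup>+y. (\<integral>\<^sup>+h. ennreal ((u (y + h) - u y)\<^sup>2 / norm h powr ?p) \<partial>lborel) \<partial>lborel)"
  proof (rule nn_integral_cong)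
    fix y
    show "(\<integral>\<^sup>+x. ennreal ((u x - u y)\<^sup>2 / dist x y powr ?p) \<partial>lborel)
      = (\<integral>\<^sup>+h. ennreal ((u (y + h) - u y)\<^sup>2 / norm h powr ?p) \<partial>lborel)"
      by (subst nn_integral_lborel_translate[symmetric, where c=y]) (auto simp: dist_norm)
  qed
  also have "\<dots> = (\<integral>\<^sup>+h. (\<integral>\<^sup>+y. ennreal ((u (y + h) - u y)\<^sup>2 / norm h powr ?p) \<partial>lborel) \<partial>lborel)"
    by (rule lborel_pair.Fubini') measurable
  also have "\<dots> = (\<integral>\<^sup>+h. ennreal (1 / norm h powr ?p) * (\<integral>\<^sup>+y. ennreal ((u (y + h) - u y)\<^sup>2) \<partial>lborel) \<partial>lborel)"
  proof (rule nn_integral_cong)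
    fix h
    have "ennreal ((u (y + h) - u y)\<^sup>2 / norm h powr ?p)
      = ennreal (1 / norm h powr ?p) * ennreal ((u (y + h) - u y)\<^sup>2)" for y
      by (simp flip: ennreal_mult)
    then show "(\<integral>\<^sup>+y. ennreal ((u (y + h) - u y)\<^sup>2 / norm h powr ?p) \<partial>lborel)
      = ennreal (1 / norm h powr ?p) * (\<integral>\<^sup>+y. ennreal ((u (y + h) - u y)\<^sup>2) \<partial>lborel)"
      by (simp add: nn_integral_cmult)
  qed
  also have "\<dots> = (\<integral>\<^sup>+h. (\<integral>\<^sup>+\<zeta>. ennreal (2 * (norm (?F \<zeta>))\<^sup>2) * ennreal ((1 - cos (h \<bullet> \<zeta>))
    / norm h powr ?p) \<partial>lborel) \<partial>lborel)"
    unfolding inner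
  proof (rule nn_integral_cong)
    fix h :: 'a
    have "ennreal (1 / norm h powr ?p) * ennreal (2 * (1 - cos (h \<bullet> \<zeta>)) * (norm (?F \<zeta>))\<^sup>2)
      = ennreal (2 * (norm (?F \<zeta>))\<^sup>2) * ennreal ((1 - cos (h \<bullet> \<zeta>)) / norm h powr ?p)" for \<zeta>
      by (simp flip: ennreal_mult add: mult_ac)
    then show "ennreal (1 / norm h powr ?p) * (\<integral>\<^sup>+\<zeta>. ennreal (2 * (1 - cos (h \<bullet> \<zeta>))
      * (norm (?F \<zeta>))\<^sup>2) \<partial>lborel)
      = (\<integral>\<^sup>+\<zeta>. ennreal (2 * (norm (?F \<zeta>))\<^sup>2) * ennreal ((1 - cos (h \<bullet> \<zeta>)) / norm h powr ?p) \<partial>lborel)"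
      by (subst nn_integral_cmult[symmetric]) auto
  qed
  also have "\<dots> = (\<integral>\<^sup>+\<zeta>. (\<integral>\<^sup>+h. ennreal (2 * (norm (?F \<zeta>))\<^sup>2) * ennreal ((1 - cos (h \<bullet> \<zeta>))
    / norm h powr ?p) \<partial>lborel) \<partial>lborel)"
    by (rule lborel_pair.Fubini') measurable
  also have "\<dots> = (\<integral>\<^sup>+\<zeta>. ennreal (2 * ?A * (norm \<zeta> powr (2 * r) * (norm (?F \<zeta>))\<^sup>2)) \<partial>lborel)"
  proof (rule nn_integral_cong)
    fix \<zeta> :: 'a
    have "(\<integral>\<^sup>+h. ennreal (2 * (norm (?F \<zeta>))\<^sup>2) * ennreal ((1 - cos (h \<bullet> \<zeta>)) / norm h powr ?p) \<partial>lborel)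
      = ennreal (2 * (norm (?F \<zeta>))\<^sup>2) * ennreal (?A * norm \<zeta> powr (2 * r))"
      by (subst nn_integral_cmult) (auto simp: nn_integral_kernel_cos[OF r])
    also have "\<dots> = ennreal (2 * ?A * (norm \<zeta> powr (2 * r) * (norm (?F \<zeta>))\<^sup>2))"
      using kernel_const_pos[OF r, where 'a='a] by (simp flip: ennreal_mult add: mult_ac)
    finally show "(\<integral>\<^sup>+h. ennreal (2 * (norm (?F \<zeta>))\<^sup>2) * ennreal ((1 - cos (h \<bullet> \<zeta>)) / norm h powr ?p) \<partial>lborel)
      = ennreal (2 * ?A * (norm \<zeta> powr (2 * r) * (norm (?F \<zeta>))\<^sup>2))" .
  qed
  finally show ?thesis .
qed

text \<open>Completeness of \<open>lebesgue\<close>. The inner integral of the Gagliardo seminorm is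
  known only to agree almost everywhere with a measurable function of \<open>y\<close>, and its
  measurability is obtained here.\<close>

lemma borel_measurable_lebesgue_AE:
  fixes f g :: "'a::euclidean_space \<Rightarrow> 'b::topological_space"
  assumes [measurable]: "g \<in> borel_measurable lebesgue" and ae: "AE x in lebesgue. f x = g x"
  shows "f \<in> borel_measurable lebesgue"
proof (rule measurableI)
  fix A :: "'b set" assume A[measurable]: "A \<in> sets borel"
  \<comment> \<open>The set where \<open>f\<close> and \<open>g\<close> disagree about
    \<open>A\<close> is null, hence measurable; membership of \<open>f x\<close> is recovered from
    it and from membership of \<open>g x\<close>.\<close>
  have "AE x in lborel. \<not> (f x \<in> A \<longleftrightarrow> g x \<notin> A)"
    using ae unfolding AE_completion_iff by eventually_elim auto
  then have 1[measurable]: "Measurable.pred lebesgue (\<lambda>x. f x \<in> A \<longleftrightarrow> g x \<notin> A)"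
    by (rule sets_completion_AE)
  have "Measurable.pred lebesgue (\<lambda>x. g x \<in> A)" by measurable
  then have "Measurable.pred lebesgue (\<lambda>x. (f x \<in> A \<longleftrightarrow> g x \<notin> A) \<longleftrightarrow> g x \<notin> A)" by measurable
  also have "(\<lambda>x. (f x \<in> A \<longleftrightarrow> g x \<notin> A) \<longleftrightarrow> g x \<notin> A) = (\<lambda>x. f x \<in> A)" by auto
  finally show "f -` A \<inter> space lebesgue \<in> sets lebesgue" by (simp add: pred_def vimage_def)
qed simp

text \<open>The transform lives on a Borel representative \<open>u\<close> of \<open>v\<close>. In
  the inner integral \<open>v\<close> may be replaced by \<open>u\<close> only for \<open>y\<close>
  with \<open>v y = u y\<close>; these are almost all \<open>y\<close>, which suffices for the outer
  integral.\<close>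

lemma gagliardo_seminorm:
  fixes v :: "'a::euclidean_space \<Rightarrow> real"
  assumes r: "0 < r" "r < 1" and v: "square_integrable v"
    and fin: "integrable lborel (\<lambda>\<zeta>. norm \<zeta> powr (2 * r) * (norm (rfourier v \<zeta>))\<^sup>2)"
  shows "(LINT y|lebesgue. LINT x|lebesgue. (v x - v y)\<^sup>2 / dist x y powr (real DIM('a) + 2 * r))
    = 2 * kernel_const TYPE('a) r * (LINT \<zeta>|lborel. norm \<zeta> powr (2 * r) * (norm (rfourier v \<zeta>))\<^sup>2)"
proof -
  let ?p = "real DIM('a) + 2 * r" and ?A = "kernel_const TYPE('a) r"
  define u where "u = borel_rep v"
  have u: "l2 lborel u" unfolding u_def by (rule l2_borel_rep[OF v])
  have um[measurable]: "u \<in> borel_measurable borel" using u by (simp add: l2_def)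
  have vm[measurable]: "v \<in> borel_measurable lebesgue" by (rule square_integrable_measurable[OF v])
  have vu: "AE x in lebesgue. v x = u x" unfolding u_def by (rule borel_rep(2)[OF vm])
  have [measurable]: "u \<in> borel_measurable lebesgue" by (rule measurable_completion) simp
  have A: "0 < ?A" by (rule kernel_const_pos[OF r])
  have dm[measurable]: "(\<lambda>x. dist x y powr ?p) \<in> borel_measurable lebesgue" for y :: 'a
    by (rule measurable_completion) measurable
  define I where "I y = (LINT x|lborel. (u x - u y)\<^sup>2 / dist x y powr ?p)" for y
  have Im[measurable]: "I \<in> borel_measurable borel"
    unfolding I_def by (intro lborel.borel_measurable_lebesgue_integral) measurable
  have vI: "(LINT x|lebesgue. (v x - v y)\<^sup>2 / dist x y powr ?p) = I y" if "v y = u y" for y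
  proof -
    have "(LINT x|lebesgue. (v x - v y)\<^sup>2 / dist x y powr ?p)
      = (LINT x|lebesgue. (u x - u y)\<^sup>2 / dist x y powr ?p)"
    proof (rule integral_cong_AE)
      show "AE x in lebesgue. (v x - v y)\<^sup>2 / dist x y powr ?p = (u x - u y)\<^sup>2 / dist x y powr ?p"
        using vu by eventually_elim (simp add: that)
    qed measurable
    also have "\<dots> = I y" unfolding I_def by (rule integral_completion) measurable
    finally show ?thesis .
  qed
  have ae: "AE y in lebesgue. (LINT x|lebesgue. (v x - v y)\<^sup>2 / dist x y powr ?p) = I y"
    using vu by eventually_elim (rule vI)
  have Il: "I \<in> borel_measurable lebesgue" by (rule measurable_completion) simp
  have "(LINT y|lebesgue. LINT x|lebesgue. (v x - v y)\<^sup>2 / dist x y powr ?p) = (LINT y|lebesgue. I y)"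
    by (rule integral_cong_AE[OF borel_measurable_lebesgue_AE[OF Il ae] Il ae])
  also have "\<dots> = (LINT y|lborel. I y)" by (rule integral_completion) simp
  also have "\<dots> = enn2real (\<integral>\<^sup>+y. ennreal (I y) \<partial>lborel)"
    by (rule integral_eq_nn_integral) (auto simp: I_def intro: integral_nonneg_AE)
  also have "(\<integral>\<^sup>+y. ennreal (I y) \<partial>lborel) = ennreal (2 * ?A * (LINT \<zeta>|lborel. norm \<zeta> powr (2 * r)
    * (norm (rfourier v \<zeta>))\<^sup>2))"
  proof -
  have D: "(\<integral>\<^sup>+y. (\<integral>\<^sup>+x. ennreal ((u x - u y)\<^sup>2 / dist x y powr ?p) \<partial>lborel) \<partial>lborel)
      = ennreal (2 * ?A * (LINT \<zeta>|lborel. norm \<zeta> powr (2 * r) * (norm (rfourier v \<zeta>))\<^sup>2))"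
      unfolding nn_integral_gagliardo[OF r u] unfolding u_def rfourier_def[symmetric]
      using fin A by (subst nn_integral_eq_integral) auto
  have "(\<integral>\<^sup>+y. ennreal (I y) \<partial>lborel) = (\<integral>\<^sup>+y. (\<integral>\<^sup>+x. ennreal ((u x - u y)\<^sup>2
    / dist x y powr ?p) \<partial>lborel) \<partial>lborel)"
  proof -
    \<comment> \<open>A Bochner integral takes the default value 0 where its integrand is not
      integrable, so \<open>I y\<close> agrees with the nonnegative integral only where the latter
      is finite. Finiteness of the double integral in \<open>D\<close> gives this for almost every
      \<open>y\<close>.\<close>
    have "AE y in lborel. (\<integral>\<^sup>+x. ennreal ((u x - u y)\<^sup>2 / dist x y powr ?p) \<partial>lborel) \<noteq> \<infinity>"
      using D by (intro nn_integral_PInf_AE) auto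
    then show ?thesis
    proof (intro nn_integral_cong_AE, eventually_elim)
      case (elim y)
      have "integrable lborel (\<lambda>x. (u x - u y)\<^sup>2 / dist x y powr ?p)"
        using elim by (intro integrableI_bounded) (auto simp: less_top[symmetric])
      then show ?case unfolding I_def by (intro nn_integral_eq_integral[symmetric]) auto
    qed
  qed
  with D show ?thesis by simp
  qed
  also have "enn2real \<dots> = 2 * ?A * (LINT \<zeta>|lborel. norm \<zeta> powr (2 * r) * (norm (rfourier v \<zeta>))\<^sup>2)"
    using A by (intro enn2real_ennreal mult_nonneg_nonneg integral_nonneg_AE) auto
  finally show ?thesis .
qed

section \<open>Schwartz functions\<close>

lemma one_plus_power_le:
  fixes t :: real
  assumes "0 \<le> t"
  shows "(1 + t) ^ m \<le> 2 ^ m * (1 + t ^ m)"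
proof -
  have "(1 + t) ^ m \<le> (2 * max 1 t) ^ m" using assms by (intro power_mono) auto
  also have "\<dots> = 2 ^ m * (max 1 t) ^ m" by (simp add: power_mult_distrib)
  also have "(max 1 t) ^ m \<le> 1 + t ^ m" using assms by (cases "1 \<le> t") (auto simp: max_def)
  finally show ?thesis by simp
qed

text \<open>The powers \<open>0\<close> and \<open>m\<close> suffice, because
  \<open>(1 + t) ^ m \<le> 2 ^ m * (1 + t ^ m)\<close>.\<close>

lemma rapid_decay_bound:
  fixes g :: "'a::real_normed_vector \<Rightarrow> real"
  assumes "\<And>N::nat. bounded (range (\<lambda>x. norm x ^ N * g x))"
  obtains C where "0 \<le> C" "\<And>x. \<bar>g x\<bar> \<le> C / (1 + norm x) ^ m"
proof -
  obtain B0 where B0: "\<And>x. \<bar>norm x ^ 0 * g x\<bar> \<le> B0"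
    using assms[of 0] by (auto simp: bounded_iff)
  obtain Bm where Bm: "\<And>x. \<bar>norm x ^ m * g x\<bar> \<le> Bm"
    using assms[of m] by (auto simp: bounded_iff)
  have "\<bar>g x\<bar> \<le> (2 ^ m * (B0 + Bm)) / (1 + norm x) ^ m" for x
  proof -
    have "(1 + norm x) ^ m * \<bar>g x\<bar> \<le> (2 ^ m * (1 + norm x ^ m)) * \<bar>g x\<bar>"
      by (intro mult_right_mono one_plus_power_le) auto
    also have "\<dots> = 2 ^ m * (\<bar>norm x ^ 0 * g x\<bar> + \<bar>norm x ^ m * g x\<bar>)"
      by (simp add: abs_mult algebra_simps)
    also have "\<dots> \<le> 2 ^ m * (B0 + Bm)" by (intro mult_left_mono add_mono B0 Bm) auto
    finally have "\<bar>g x\<bar> * (1 + norm x) ^ m \<le> 2 ^ m * (B0 + Bm)" by (simp only: mult.commute)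
    moreover have "0 < (1 + norm x) ^ m" by (simp add: add_pos_nonneg)
    ultimately show ?thesis by (simp only: pos_le_divide_eq)
  qed
  moreover have "0 \<le> 2 ^ m * (B0 + Bm)"
    using order_trans[OF abs_ge_zero B0] order_trans[OF abs_ge_zero Bm] by simp
  ultimately show thesis by (rule that[rotated])
qed

text \<open>\<open>DIM('a) + 1\<close> is the least integer exponent for which this weight is
  integrable.\<close>

definition decay_weight :: "'a::euclidean_space \<Rightarrow> real" where
  "decay_weight x = 1 / (1 + norm x) ^ (DIM('a) + 1)"

lemma decay_weight_pos: "0 < decay_weight x"
  by (simp add: decay_weight_def add_pos_nonneg)

lemma decay_weight_le_1: "decay_weight (x::'a::euclidean_space) \<le> 1"
proof -
  define X where "X = (1 + norm x) ^ (DIM('a) + 1)"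
  have "1 \<le> X" unfolding X_def by (rule one_le_power) simp
  then show ?thesis unfolding decay_weight_def X_def[symmetric] by simp
qed

lemma decay_weight_measurable [measurable]: "decay_weight \<in> borel_measurable borel"
  unfolding decay_weight_def by measurable

text \<open>Taylor remainders are evaluated at intermediate points \<open>x + z\<close>; this brings
  their bounds back to the weight at \<open>x\<close>.\<close>

lemma decay_weight_shift:
  fixes x z :: "'a::euclidean_space"
  assumes "norm z \<le> 1"
  shows "decay_weight (x + z) \<le> 2 ^ (DIM('a) + 1) * decay_weight x"
proof -
  have "norm x \<le> norm (x + z) + norm z" using norm_triangle_ineq4[of "x + z" z] by simp
  then have "1 + norm x \<le> 2 * (1 + norm (x + z))" using assms norm_ge_zero[of "x + z"] unfolding distrib_left
    by linarith
  then have "(1 + norm x) ^ (DIM('a) + 1) \<le> (2 * (1 + norm (x + z))) ^ (DIM('a) + 1)"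
    by (intro power_mono) auto
  also have "\<dots> = 2 ^ (DIM('a) + 1) * (1 + norm (x + z)) ^ (DIM('a) + 1)" by (rule power_mult_distrib)
  finally have le: "(1 + norm x) ^ (DIM('a) + 1) \<le> 2 ^ (DIM('a) + 1) * (1 + norm (x + z)) ^ (DIM('a) + 1)" .
  have "X \<le> c * Y \<Longrightarrow> 0 < X \<Longrightarrow> 0 < Y \<Longrightarrow> 1 / Y \<le> c * (1 / X)" for X Y c :: real
    by (simp add: field_simps)
  from this[OF le] show ?thesis unfolding decay_weight_def
    by (simp only: add_pos_nonneg zero_less_power zero_less_one norm_ge_zero)
qed

text \<open>Outside the unit ball the weight lies below the kernel of
  \<open>kernel_min_finite\<close> with \<open>r = 1/2\<close>, whose exponent is exactly
  \<open>DIM('a) + 1\<close>; inside it is at most 1.\<close>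

lemma integrable_decay_weight: "integrable lborel (decay_weight :: 'a::euclidean_space \<Rightarrow> real)"
proof (rule integrableI_bounded)
  let ?p = "real DIM('a) + 2 * (1/2)"
  have le: "norm (decay_weight x) \<le> min 1 ((norm x)\<^sup>2) / norm x powr ?p + indicator (ball 0 1) x" for x :: 'a
  proof (cases "norm x < 1")
    case True
    have "norm (decay_weight x) \<le> 0 + 1"
      using decay_weight_pos[of x] decay_weight_le_1[of x] by simp
    also have "\<dots> \<le> min 1 ((norm x)\<^sup>2) / norm x powr ?p + indicator (ball 0 1) x"
      using True by (intro add_mono) auto
    finally show ?thesis .
  next
    case False
    have "norm x powr ?p = norm x ^ (DIM('a) + 1)"
      using False by (subst powr_realpow[symmetric]) (auto simp: add.commute)
    moreover have "1 / (1 + norm x) ^ (DIM('a) + 1) \<le> 1 / norm x ^ (DIM('a) + 1)"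
      using False by (intro divide_left_mono power_mono mult_pos_pos zero_less_power) auto
    moreover have "1 \<le> (norm x)\<^sup>2" using False by (simp add: one_le_power)
    ultimately show ?thesis using False decay_weight_pos[of x] by (simp add: decay_weight_def)
  qed
  have "(\<integral>\<^sup>+x. ennreal (norm (decay_weight (x::'a))) \<partial>lborel)
     \<le> (\<integral>\<^sup>+x. ennreal (min 1 ((norm (x::'a))\<^sup>2) / norm x powr ?p) + indicator (ball 0 1) x \<partial>lborel)"
  proof (intro nn_integral_mono)
    fix x :: 'a
    have "ennreal (norm (decay_weight x)) \<le> ennreal (min 1 ((norm x)\<^sup>2) / norm x powr ?p
      + indicator (ball 0 1) x)"
      by (intro ennreal_leI le)
    also have "\<dots> = ennreal (min 1 ((norm x)\<^sup>2) / norm x powr ?p) + indicator (ball 0 1) x"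
      by (subst ennreal_plus) (auto simp: indicator_def)
    finally show "ennreal (norm (decay_weight x)) \<le> ennreal (min 1 ((norm x)\<^sup>2) / norm x powr ?p)
      + indicator (ball 0 1) x" .
  qed
  also have "\<dots> = (\<integral>\<^sup>+x. ennreal (min 1 ((norm (x::'a))\<^sup>2) / norm x powr ?p) \<partial>lborel)
    + emeasure lborel (ball (0::'a) 1)"
    by (subst nn_integral_add) (auto intro!: borel_measurable_indicator)
  also have "\<dots> < \<infinity>"
    using kernel_min_finite[of "1/2", where 'a='a] emeasure_lborel_ball_finite[of "0::'a" 1] by simp
  finally show "(\<integral>\<^sup>+x. ennreal (norm (decay_weight (x::'a))) \<partial>lborel) < \<infinity>" .
qed simp

text \<open>The sign is that of the negative Laplacian, so that the Fourier multiplier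
  \<open>2 * (1 - cos (h \<bullet> \<zeta>))\<close> is nonnegative.\<close>

definition second_diff :: "('a::euclidean_space \<Rightarrow> real) \<Rightarrow> 'a \<Rightarrow> 'a \<Rightarrow> real" where
  "second_diff \<eta> h x = 2 * \<eta> x - \<eta> (x + h) - \<eta> (x - h)"

context
  fixes \<eta> :: "'a::euclidean_space \<Rightarrow> real"
  assumes \<eta>: "schwartz \<eta>"
begin

lemma schwartz_partial:
  assumes "set bs \<subseteq> Basis"
  shows "partial_derivs bs \<eta> differentiable (at x)" "bounded (range (\<lambda>x. norm x ^ N * partial_derivs bs \<eta> x))"
  using \<eta> assms unfolding schwartz_def by (auto simp: in_lists_conv_set)

lemma partial_derivs_has_derivative:
  assumes "set bs \<subseteq> Basis"
  shows "(partial_derivs bs \<eta> has_derivative (\<lambda>h. \<Sum>b\<in>Basis. (h \<bullet> b) * partial_derivs (b # bs) \<eta> x)) (at x)"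
proof -
  let ?g = "partial_derivs bs \<eta>"
  have d: "(?g has_derivative frechet_derivative ?g (at x)) (at x)"
    using schwartz_partial(1)[OF assms] frechet_derivative_works by blast
  then interpret bounded_linear "frechet_derivative ?g (at x)" by (rule has_derivative_bounded_linear)
  have "frechet_derivative ?g (at x) h = (\<Sum>b\<in>Basis. (h \<bullet> b) * partial_derivs (b # bs) \<eta> x)" for h
  proof -
    have "frechet_derivative ?g (at x) (\<Sum>b\<in>Basis. (h \<bullet> b) *\<^sub>R b)
      = (\<Sum>b\<in>Basis. (h \<bullet> b) * frechet_derivative ?g (at x) b)"
      by (simp add: sum scaleR)
    then show ?thesis by (simp add: euclidean_representation partial_derivs_def)
  qed
  then show ?thesis using d by (metis (no_types, lifting) ext)
qed

lemma partial_derivs_along_line: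
  assumes "set bs \<subseteq> Basis"
  shows "((\<lambda>t. partial_derivs bs \<eta> (x + t *\<^sub>R h)) has_real_derivative
     (\<Sum>b\<in>Basis. (h \<bullet> b) * partial_derivs (b # bs) \<eta> (x + t *\<^sub>R h))) (at t)"
proof -
  have "((\<lambda>t. x + t *\<^sub>R h) has_derivative (\<lambda>s. s *\<^sub>R h)) (at t)"
    by (auto intro!: derivative_eq_intros)
  from has_derivative_compose[OF this partial_derivs_has_derivative[OF assms]]
  have "((\<lambda>t. partial_derivs bs \<eta> (x + t *\<^sub>R h)) has_derivative
     (\<lambda>s. \<Sum>b\<in>Basis. ((s *\<^sub>R h) \<bullet> b) * partial_derivs (b # bs) \<eta> (x + t *\<^sub>R h))) (at t)" .
  then show ?thesis
    unfolding has_field_derivative_def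
    by (rule has_derivative_eq_rhs) (simp add: fun_eq_iff sum_distrib_left sum_distrib_right mult_ac)
qed

lemma schwartz_continuous: "continuous_on UNIV \<eta>"
  using schwartz_partial(1)[of "[]"]
  by (auto simp: partial_derivs_def continuous_on_eq_continuous_at intro:
    differentiable_imp_continuous_within)

lemma schwartz_measurable: "\<eta> \<in> borel_measurable borel"
  by (rule borel_measurable_continuous_onI[OF schwartz_continuous])

lemma schwartz_decay: "\<exists>C\<ge>0. \<forall>x. \<bar>\<eta> x\<bar> \<le> C * decay_weight x"
proof -
  have "\<And>N. bounded (range (\<lambda>x. norm x ^ N * \<eta> x))"
    using schwartz_partial(2)[of "[]"] by (simp add: partial_derivs_def)
  then obtain C where "0 \<le> C" "\<And>x. \<bar>\<eta> x\<bar> \<le> C / (1 + norm x) ^ (DIM('a) + 1)"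
    by (rule rapid_decay_bound[where m="DIM('a) + 1"]) blast
  then show ?thesis unfolding decay_weight_def by auto
qed

lemma schwartz_second_decay:
  "\<exists>C\<ge>0. \<forall>b\<in>Basis. \<forall>b'\<in>Basis. \<forall>x. \<bar>partial_derivs [b', b] \<eta> x\<bar> \<le> C * decay_weight x"
proof -
  have "\<exists>C\<ge>0. \<forall>x. \<bar>partial_derivs [b', b] \<eta> x\<bar> \<le> C * decay_weight x" if "b \<in> Basis" "b' \<in> Basis" for b b'
  proof -
    have "\<And>N. bounded (range (\<lambda>x. norm x ^ N * partial_derivs [b', b] \<eta> x))"
      using schwartz_partial(2)[of "[b', b]"] that by simp
    then obtain C where "0 \<le> C" "\<And>x. \<bar>partial_derivs [b', b] \<eta> x\<bar> \<le> C / (1 + norm x) ^ (DIM('a) + 1)"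
      by (rule rapid_decay_bound[where m="DIM('a) + 1"]) blast
    then show ?thesis unfolding decay_weight_def by auto
  qed
  then obtain C where C: "\<And>b b'. b \<in> Basis \<Longrightarrow> b' \<in> Basis \<Longrightarrow> 0 \<le> C b b' \<and> (\<forall>x. \<bar>partial_derivs [b', b] \<eta> x\<bar>
    \<le> C b b' * decay_weight x)"
    by metis
  let ?K = "\<Sum>b\<in>Basis. \<Sum>b'\<in>Basis. C b b'"
  have "C b b' \<le> ?K" if "b \<in> Basis" "b' \<in> Basis" for b b'
  proof -
    have "C b b' \<le> (\<Sum>b'\<in>Basis. C b b')" using that C by (intro member_le_sum) auto
    also have "\<dots> \<le> ?K" using that C by (intro member_le_sum[of b Basis "\<lambda>b. \<Sum>b'\<in>Basis. C b b'"]) (auto intro: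
      sum_nonneg)
    finally show ?thesis .
  qed
  then have "\<bar>partial_derivs [b', b] \<eta> x\<bar> \<le> ?K * decay_weight x" if "b \<in> Basis" "b' \<in> Basis" for b b' x
    using C[OF that] mult_right_mono[of "C b b'" ?K "decay_weight x"] that less_imp_le[OF decay_weight_pos[of
      x]]
    by (meson order_trans)
  moreover have "0 \<le> ?K" using C by (intro sum_nonneg) auto
  ultimately show ?thesis by blast
qed

text \<open>The even function \<open>f t = \<eta> (x + t *\<^sub>R h) + \<eta> (x - t *\<^sub>R
  h)\<close> has derivative zero at \<open>t = 0\<close>, so two applications of the mean value
  theorem reduce its increment to second derivatives at an intermediate point.\<close>

lemma second_diff_small: "\<exists>K\<ge>0. \<forall>h x. norm h \<le> 1 \<longrightarrow> \<bar>second_diff \<eta> h x\<bar> \<le> K * (norm h)\<^sup>2 * decay_weight x"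
proof -
  obtain C where C: "0 \<le> C" "\<And>b b' x. b \<in> Basis \<Longrightarrow> b' \<in> Basis \<Longrightarrow> \<bar>partial_derivs [b', b] \<eta> x\<bar>
    \<le> C * decay_weight x"
    using schwartz_second_decay by auto
  let ?d = "real DIM('a)" and ?e = "2 ^ (DIM('a) + 1) :: real"
  let ?K = "?d * ?d * (2 * (C * ?e))"
  have "\<bar>second_diff \<eta> h x\<bar> \<le> ?K * (norm h)\<^sup>2 * decay_weight x" if h: "norm h \<le> 1" for h x
  proof -
    define f where "f t = \<eta> (x + t *\<^sub>R h) + \<eta> (x + t *\<^sub>R (- h))" for t :: real
    define f1 where "f1 t = (\<Sum>b\<in>Basis. (h \<bullet> b) * (partial_derivs [b] \<eta> (x + t *\<^sub>R h) - partial_derivs [b] \<eta> (x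
      + t *\<^sub>R (- h))))" for t :: real
    define f2 where "f2 t = (\<Sum>b\<in>Basis. (h \<bullet> b) * (\<Sum>b'\<in>Basis. (h \<bullet> b') * (partial_derivs [b', b] \<eta> (x
      + t *\<^sub>R h) + partial_derivs [b', b] \<eta> (x + t *\<^sub>R (- h)))))" for t :: real
    have e: "partial_derivs [] \<eta> = \<eta>" by (simp add: partial_derivs_def)
    have d1: "(f has_real_derivative f1 t) (at t)" for t
      unfolding f_def f1_def
      using DERIV_add[OF partial_derivs_along_line[of "[]" x h t, unfolded e] partial_derivs_along_line[of
        "[]" x "- h" t, unfolded e]]
      by (simp add: sum_subtractf right_diff_distrib sum_negf)
    have d2: "(f1 has_real_derivative f2 t) (at t)" for t
    proof -
      have "((\<lambda>t. partial_derivs [b] \<eta> (x + t *\<^sub>R h) - partial_derivs [b] \<eta> (x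
        + t *\<^sub>R (- h))) has_real_derivative
          (\<Sum>b'\<in>Basis. (h \<bullet> b') * (partial_derivs [b', b] \<eta> (x + t *\<^sub>R h) + partial_derivs [b', b] \<eta> (x
            + t *\<^sub>R (- h))))) (at t)"
        if "b \<in> Basis" for b
        using DERIV_diff[OF partial_derivs_along_line[of "[b]" x h t] partial_derivs_along_line[of "[b]" x "-
          h" t]] that
        by (simp add: sum.distrib distrib_left sum_negf)
      then show ?thesis unfolding f1_def f2_def by (intro DERIV_sum DERIV_cmult) auto
    qed
    have b2: "\<bar>f2 t\<bar> \<le> ?K * (norm h)\<^sup>2 * decay_weight x" if t: "0 \<le> t" "t \<le> 1" for t
    proof -
      have th: "norm (t *\<^sub>R h) \<le> 1" "norm (t *\<^sub>R (- h)) \<le> 1" using t h by (auto simp: mult_le_one)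
      have pb: "\<bar>partial_derivs [b', b] \<eta> (x + t *\<^sub>R h) + partial_derivs [b', b] \<eta> (x + t *\<^sub>R (- h))\<bar>
        \<le> 2 * (C * ?e) * decay_weight x"
        if "b \<in> Basis" "b' \<in> Basis" for b b'
      proof -
        have "\<bar>partial_derivs [b', b] \<eta> (x + z)\<bar> \<le> C * ?e * decay_weight x" if "norm z \<le> 1" for z
        proof -
          have "\<bar>partial_derivs [b', b] \<eta> (x + z)\<bar> \<le> C * decay_weight (x + z)" by (rule C(2)) fact+
          also have "\<dots> \<le> C * (?e * decay_weight x)" by (intro mult_left_mono decay_weight_shift that C)
          finally show ?thesis by (simp only: mult.assoc)
        qed
        from this[OF th(1)] this[OF th(2)] show ?thesis by linarith
      qed
      have hb: "\<bar>h \<bullet> b\<bar> \<le> norm h" if "b \<in> Basis" for b using that by (rule Basis_le_norm)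
      have "\<bar>f2 t\<bar> \<le> (\<Sum>b\<in>(Basis::'a set). norm h * (\<Sum>b'\<in>(Basis::'a set). norm h * (2 * (C * ?e)
        * decay_weight x)))"
        unfolding f2_def
        by (intro order_trans[OF sum_abs] sum_mono, unfold abs_mult, intro mult_mono hb order_trans[OF
          sum_abs] sum_mono, assumption,
            unfold abs_mult, intro mult_mono hb pb) auto
      also have "\<dots> = ?K * (norm h)\<^sup>2 * decay_weight x" by (simp add: power2_eq_square)
      finally show ?thesis .
    qed
    obtain z where z: "0 < z" "z < 1" "f 1 - f 0 = f1 z" using MVT2[of 0 1 f f1] d1 by auto
    obtain y where y: "0 < y" "y < z" "f1 z - f1 0 = z * f2 y" using MVT2[of 0 z f1 f2] d2 z by auto
    have "f1 0 = 0" by (simp add: f1_def)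
    moreover have "second_diff \<eta> h x = - (f 1 - f 0)" by (simp add: second_diff_def f_def)
    ultimately have "\<bar>second_diff \<eta> h x\<bar> = z * \<bar>f2 y\<bar>" using z y by (simp add: abs_mult)
    also have "\<dots> \<le> 1 * \<bar>f2 y\<bar>" using z by (intro mult_right_mono) auto
    also have "\<dots> \<le> ?K * (norm h)\<^sup>2 * decay_weight x" using b2[of y] y z by simp
    finally show ?thesis .
  qed
  moreover have "0 \<le> ?K" using C by simp
  ultimately show ?thesis by blast
qed

lemma schwartz_l12: "l12 (\<lambda>x. complex_of_real (\<eta> x))"
proof -
  note [measurable] = schwartz_measurable
  obtain C where C: "0 \<le> C" "\<And>x. \<bar>\<eta> x\<bar> \<le> C * decay_weight x" using schwartz_decay by auto
  have i: "integrable lborel \<eta>"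
    by (rule Bochner_Integration.integrable_bound[OF integrable_mult_right[OF integrable_decay_weight, of C]])
       (use C order_trans[OF _ abs_ge_self] in auto)
  have "integrable lborel (\<lambda>x. (\<eta> x)\<^sup>2)"
  proof (rule Bochner_Integration.integrable_bound[OF integrable_mult_right[OF i, of C]])
    have "(\<eta> x)\<^sup>2 \<le> \<bar>C * \<eta> x\<bar>" for x
    proof -
      have "\<bar>\<eta> x\<bar> \<le> C" using C(2)[of x] mult_left_mono[OF decay_weight_le_1[of x] C(1)] by simp
      then have "\<bar>\<eta> x\<bar> * \<bar>\<eta> x\<bar> \<le> C * \<bar>\<eta> x\<bar>" by (intro mult_right_mono) auto
      then show ?thesis using C(1) by (simp add: power2_eq_square abs_mult)
    qed
    then show "AE x in lborel. norm ((\<eta> x)\<^sup>2) \<le> norm (C * \<eta> x)" by simp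
  qed simp
  with i show ?thesis by (simp add: l12_def l2_def)
qed

lemma schwartz_integrable: "integrable lborel \<eta>"
  using schwartz_l12 by (simp add: l12_def complex_of_real_integrable_eq)

text \<open>Taylor's estimate serves for \<open>norm h \<le> 1\<close> and the triangle inequality
  beyond. The pointwise bound makes the integral over \<open>h\<close> converge for each
  \<open>x\<close>; the \<open>L1\<close> bound makes it converge jointly in \<open>h\<close> and
  \<open>x\<close>, as Fubini requires.\<close>

lemma second_diff_bounds:
  "\<exists>K\<ge>0. (\<forall>h x. \<bar>second_diff \<eta> h x\<bar> \<le> K * min 1 ((norm h)\<^sup>2)) \<and>
     (\<forall>h. integrable lborel (second_diff \<eta> h) \<and> (LINT x|lborel. \<bar>second_diff \<eta> h x\<bar>)
       \<le> K * min 1 ((norm h)\<^sup>2))"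
proof -
  note [measurable] = schwartz_measurable
  obtain K where K: "0 \<le> K" "\<And>h x. norm h \<le> 1 \<Longrightarrow> \<bar>second_diff \<eta> h x\<bar> \<le> K * (norm h)\<^sup>2 * decay_weight x"
    using second_diff_small by auto
  obtain C where C: "0 \<le> C" "\<And>x. \<bar>\<eta> x\<bar> \<le> C * decay_weight x" using schwartz_decay by auto
  let ?w = "LINT x|lborel. decay_weight (x::'a)" and ?n = "LINT x|lborel. \<bar>\<eta> x\<bar>"
  have w: "0 \<le> ?w" using less_imp_le[OF decay_weight_pos] by (intro integral_nonneg_AE) auto
  have n: "0 \<le> ?n" by (intro integral_nonneg_AE) auto
  let ?M = "K + K * ?w + 4 * C + 4 * ?n"
  have M: "0 \<le> ?M" using K C w n by simp
  have ab: "\<bar>\<eta> x\<bar> \<le> C" for x using C(2)[of x] mult_left_mono[OF decay_weight_le_1[of x] C(1)] by simp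
  have sup: "\<bar>second_diff \<eta> h x\<bar> \<le> ?M * min 1 ((norm h)\<^sup>2)" for h x
  proof (cases "norm h \<le> 1")
    case True
    then have m: "min 1 ((norm h)\<^sup>2) = (norm h)\<^sup>2" using power_le_one[of "norm h" 2]
      by (simp add: min_absorb2)
    have "\<bar>second_diff \<eta> h x\<bar> \<le> K * (norm h)\<^sup>2 * decay_weight x" by (rule K(2)[OF True])
    also have "\<dots> \<le> K * (norm h)\<^sup>2 * 1" using K(1) by (intro mult_left_mono decay_weight_le_1) auto
    also have "\<dots> \<le> ?M * (norm h)\<^sup>2" using K C w n by (simp add: mult_right_mono)
    finally show ?thesis unfolding m .
  next
    case False
    then have m: "min 1 ((norm h)\<^sup>2) = 1" by (simp add: min_def)
    have "\<bar>second_diff \<eta> h x\<bar> \<le> 4 * C" using ab[of x] ab[of "x + h"] ab[of "x - h"] unfolding second_diff_def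
      by linarith
    then show ?thesis using m K C w n by (simp add: add_increasing add_increasing2)
  qed
  have tr: "integrable lborel (\<lambda>x. \<eta> (x + h))" "(LINT x|lborel. \<bar>\<eta> (x + h)\<bar>) = ?n" for h
    using schwartz_integrable integrable_lborel_translate[of \<eta> h] integral_lborel_translate[of "\<lambda>x. \<bar>\<eta> x\<bar>" h]
    by (simp_all add: add.commute)
  have i: "integrable lborel (second_diff \<eta> h)" for h
    unfolding second_diff_def using tr(1)[of h] tr(1)[of "- h"] schwartz_integrable by simp
  have L1: "(LINT x|lborel. \<bar>second_diff \<eta> h x\<bar>) \<le> ?M * min 1 ((norm h)\<^sup>2)" for h
  proof (cases "norm h \<le> 1")
    case True
    then have m: "min 1 ((norm h)\<^sup>2) = (norm h)\<^sup>2" using power_le_one[of "norm h" 2]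
      by (simp add: min_absorb2)
    have "(LINT x|lborel. \<bar>second_diff \<eta> h x\<bar>) \<le> (LINT x|lborel. K * (norm h)\<^sup>2 * decay_weight (x::'a))"
      using i[of h] integrable_decay_weight[where 'a='a] by (intro integral_mono K(2)[OF True]) auto
    also have "\<dots> = K * ?w * (norm h)\<^sup>2" by simp
    also have "\<dots> \<le> ?M * (norm h)\<^sup>2" using K C w n by (intro mult_right_mono) auto
    finally show ?thesis unfolding m .
  next
    case False
    then have m: "min 1 ((norm h)\<^sup>2) = 1" by (simp add: min_def)
    have "(LINT x|lborel. \<bar>second_diff \<eta> h x\<bar>) \<le> (LINT x|lborel. 2 * \<bar>\<eta> x\<bar> + \<bar>\<eta> (x + h)\<bar> + \<bar>\<eta> (x + - h)\<bar>)"
    proof (intro integral_mono)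
      show "\<bar>second_diff \<eta> h x\<bar> \<le> 2 * \<bar>\<eta> x\<bar> + \<bar>\<eta> (x + h)\<bar> + \<bar>\<eta> (x + - h)\<bar>" for x
        unfolding second_diff_def by simp
    qed (use i[of h] tr(1)[of h] tr(1)[of "- h"] schwartz_integrable in auto)
    also have "\<dots> = 4 * ?n"
      using tr(1)[of h] tr(1)[of "- h"] tr(2)[of h] tr(2)[of "- h"] schwartz_integrable by simp
    finally show ?thesis using m K C w n by (simp add: add_increasing add_increasing2)
  qed
  show ?thesis using M sup i L1 by blast
qed

end

section \<open>The principal value integral\<close>

lemma integrable_kernel_min:
  assumes r: "0 < r" "r < 1"
  shows "integrable lborel (\<lambda>h::'a::euclidean_space. min 1 ((norm h)\<^sup>2) / norm h powr (real DIM('a) + 2 * r))"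
  using kernel_min_finite[OF r, where 'a='a] by (intro integrableI_bounded) auto

lemma integral_kernel_cos:
  fixes \<zeta> :: "'a::euclidean_space"
  assumes r: "0 < r" "r < 1"
  shows "(LINT h|lborel. (1 - cos (h \<bullet> \<zeta>)) / norm h powr (real DIM('a) + 2 * r))
    = kernel_const TYPE('a) r * norm \<zeta> powr (2 * r)"
proof -
  have "(LINT h|lborel. (1 - cos (h \<bullet> \<zeta>)) / norm h powr (real DIM('a) + 2 * r))
      = enn2real (\<integral>\<^sup>+h. ennreal ((1 - cos (h \<bullet> \<zeta>)) / norm h powr (real DIM('a) + 2 * r)) \<partial>lborel)"
    by (rule integral_eq_nn_integral) auto
  then show ?thesis using kernel_const_pos[OF r, where 'a='a] by (simp add: nn_integral_kernel_cos[OF r])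
qed

text \<open>
  The principal value integral in symmetrized form: the second difference is of order \<open>|h|\<^sup>2\<close>, so
  that the integral converges absolutely.
\<close>

definition pv_operator :: "real \<Rightarrow> ('a::euclidean_space \<Rightarrow> real) \<Rightarrow> 'a \<Rightarrow> real" where
  "pv_operator r \<eta> x = (LINT h|lborel. second_diff \<eta> h x / norm h powr (real DIM('a) + 2 * r)) / 2"

context
  fixes \<eta> :: "'a::euclidean_space \<Rightarrow> real" and r :: real
  assumes \<eta>: "schwartz \<eta>" and r: "0 < r" "r < 1"
begin

lemma kernel_second_diff_pair_measurable:
  "(\<lambda>(h, x). second_diff \<eta> h x / norm h powr (real DIM('a) + 2 * r)) \<in> borel_measurable (lborel \<Otimes>\<^sub>M lborel)"
proof -
  have [measurable]: "\<eta> \<in> borel_measurable borel" by (rule schwartz_measurable[OF \<eta>])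
  show ?thesis unfolding second_diff_def by measurable
qed

lemma integrable_kernel_second_diff:
  "integrable lborel (\<lambda>h. second_diff \<eta> h x / norm h powr (real DIM('a) + 2 * r))"
proof -
  have [measurable]: "\<eta> \<in> borel_measurable borel" by (rule schwartz_measurable[OF \<eta>])
  obtain K where K: "0 \<le> K" "\<And>h x. \<bar>second_diff \<eta> h x\<bar> \<le> K * min 1 ((norm h)\<^sup>2)"
    using second_diff_bounds[OF \<eta>] by auto
  show ?thesis
  proof (rule Bochner_Integration.integrable_bound[OF integrable_mult_right[OF integrable_kernel_min[OF r], of
    K]])
    show "AE h in lborel. norm (second_diff \<eta> h x / norm h powr (real DIM('a) + 2 * r))
        \<le> norm (K * (min 1 ((norm h)\<^sup>2) / norm h powr (real DIM('a) + 2 * r)))"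
    proof (intro always_eventually allI)
      fix h :: 'a
      have "\<bar>second_diff \<eta> h x\<bar> / norm h powr (real DIM('a) + 2 * r)
        \<le> (K * min 1 ((norm h)\<^sup>2)) / norm h powr (real DIM('a) + 2 * r)"
        by (intro divide_right_mono K) auto
      then show "norm (second_diff \<eta> h x / norm h powr (real DIM('a) + 2 * r))
        \<le> norm (K * (min 1 ((norm h)\<^sup>2) / norm h powr (real DIM('a) + 2 * r)))"
        using K(1) by (simp add: abs_mult)
    qed
    show "(\<lambda>h. second_diff \<eta> h x / norm h powr (real DIM('a) + 2 * r)) \<in> borel_measurable lborel"
      unfolding second_diff_def by measurable
  qed
qed

lemma integrable_kernel_second_diff_pair:
  "integrable (lborel \<Otimes>\<^sub>M lborel) (\<lambda>(h, x). second_diff \<eta> h x / norm h powr (real DIM('a) + 2 * r))"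
proof (rule lborel_pair.Fubini_integrable)
  let ?p = "real DIM('a) + 2 * r"
  have [measurable]: "\<eta> \<in> borel_measurable borel" by (rule schwartz_measurable[OF \<eta>])
  obtain K where K: "0 \<le> K" "\<And>h. integrable lborel (second_diff \<eta> h)"
     "\<And>h. (LINT x|lborel. \<bar>second_diff \<eta> h x\<bar>) \<le> K * min 1 ((norm h)\<^sup>2)"
    using second_diff_bounds[OF \<eta>] by auto
  show "AE h in lborel. integrable lborel (\<lambda>x. case (h, x) of (h, x) \<Rightarrow> second_diff \<eta> h x / norm h powr ?p)"
    using K(2) by auto
  have eq: "(LINT x|lborel. norm (case (h, x) of (h, x) \<Rightarrow> second_diff \<eta> h x / norm h powr ?p))
     = (LINT x|lborel. \<bar>second_diff \<eta> h x\<bar>) / norm h powr ?p" for h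
    by simp
  show "integrable lborel (\<lambda>h. LINT x|lborel. norm (case (h, x) of (h, x) \<Rightarrow> second_diff \<eta> h x
    / norm h powr ?p))"
    unfolding eq
  proof (rule Bochner_Integration.integrable_bound[OF integrable_mult_right[OF integrable_kernel_min[OF r], of
    K]])
    show "(\<lambda>h. (LINT x|lborel. \<bar>second_diff \<eta> h x\<bar>) / norm h powr ?p) \<in> borel_measurable lborel"
      unfolding second_diff_def by measurable
    show "AE h in lborel. norm ((LINT x|lborel. \<bar>second_diff \<eta> h x\<bar>) / norm h powr ?p)
        \<le> norm (K * (min 1 ((norm h)\<^sup>2) / norm h powr ?p))"
    proof (intro always_eventually allI)
      fix h :: 'a
      have "(LINT x|lborel. \<bar>second_diff \<eta> h x\<bar>) / norm h powr ?p \<le> (K * min 1 ((norm h)\<^sup>2)) / norm h powr ?p"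
        by (intro divide_right_mono K) auto
      moreover have "0 \<le> (LINT x|lborel. \<bar>second_diff \<eta> h x\<bar>)" by (intro integral_nonneg_AE) auto
      ultimately show "norm ((LINT x|lborel. \<bar>second_diff \<eta> h x\<bar>) / norm h powr ?p)
        \<le> norm (K * (min 1 ((norm h)\<^sup>2) / norm h powr ?p))"
        using K(1) by (simp add: abs_mult)
    qed
  qed
qed (rule kernel_second_diff_pair_measurable)

lemma pv_operator_measurable: "pv_operator r \<eta> \<in> borel_measurable borel"
proof -
  have [measurable]: "\<eta> \<in> borel_measurable borel" by (rule schwartz_measurable[OF \<eta>])
  show ?thesis unfolding pv_operator_def second_diff_def by measurable
qed

lemma pv_operator_bounded: "\<exists>B\<ge>0. \<forall>x. \<bar>pv_operator r \<eta> x\<bar> \<le> B"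
proof -
  let ?p = "real DIM('a) + 2 * r"
  obtain K where K: "0 \<le> K" "\<And>h x. \<bar>second_diff \<eta> h x\<bar> \<le> K * min 1 ((norm h)\<^sup>2)"
    using second_diff_bounds[OF \<eta>] by auto
  let ?W = "LINT h|lborel. K * (min 1 ((norm (h::'a))\<^sup>2) / norm h powr ?p)"
  have "\<bar>LINT h|lborel. second_diff \<eta> h x / norm h powr ?p\<bar> \<le> ?W" for x
  proof -
    have "\<bar>LINT h|lborel. second_diff \<eta> h x / norm h powr ?p\<bar>
      \<le> (LINT h|lborel. \<bar>second_diff \<eta> h x / norm h powr ?p\<bar>)"
      by (rule integral_abs_bound)
    also have "\<dots> \<le> ?W"
    proof (rule integral_mono)
      show "integrable lborel (\<lambda>h. \<bar>second_diff \<eta> h x / norm h powr ?p\<bar>)"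
        using integrable_kernel_second_diff by (rule integrable_abs)
      show "integrable lborel (\<lambda>h::'a. K * (min 1 ((norm h)\<^sup>2) / norm h powr ?p))"
        by (rule integrable_mult_right[OF integrable_kernel_min[OF r]])
      fix h
      have "\<bar>second_diff \<eta> h x\<bar> / norm h powr ?p \<le> (K * min 1 ((norm h)\<^sup>2)) / norm h powr ?p"
        by (intro divide_right_mono K) auto
      then show "\<bar>second_diff \<eta> h x / norm h powr ?p\<bar> \<le> K * (min 1 ((norm h)\<^sup>2) / norm h powr ?p)"
        by simp
    qed
    finally show ?thesis .
  qed
  then have W: "\<bar>LINT h|lborel. second_diff \<eta> h x / norm h powr ?p\<bar> \<le> \<bar>?W\<bar>" for x
    by (rule order_trans) (rule abs_ge_self)
  have "\<bar>pv_operator r \<eta> x\<bar> \<le> \<bar>?W\<bar>" for x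
  proof -
    have "\<bar>X / 2\<bar> \<le> \<bar>X\<bar>" for X :: real by simp
    from order_trans[OF this W] show ?thesis unfolding pv_operator_def .
  qed
  then show ?thesis by (intro exI[of _ "\<bar>?W\<bar>"] conjI allI abs_ge_zero)
qed

lemma integrable_pv_operator: "integrable lborel (pv_operator r \<eta>)"
  unfolding pv_operator_def
  using lborel_pair.integrable_snd[OF integrable_kernel_second_diff_pair] by simp

text \<open>A bounded integrable function is square integrable. Membership in \<open>l12\<close>
  means that the \<open>L2\<close> transform is the Fourier integral, which Fubini can
  evaluate.\<close>

lemma pv_operator_l12: "l12 (\<lambda>x. complex_of_real (pv_operator r \<eta> x))"
proof -
  note [measurable] = pv_operator_measurable
  obtain B where B: "0 \<le> B" "\<And>x. \<bar>pv_operator r \<eta> x\<bar> \<le> B" using pv_operator_bounded by auto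
  have "integrable lborel (\<lambda>x. (pv_operator r \<eta> x)\<^sup>2)"
  proof (rule Bochner_Integration.integrable_bound[OF integrable_mult_right[OF integrable_pv_operator, of B]])
    have "(pv_operator r \<eta> x)\<^sup>2 \<le> \<bar>B * pv_operator r \<eta> x\<bar>" for x
    proof -
      have "\<bar>pv_operator r \<eta> x\<bar> * \<bar>pv_operator r \<eta> x\<bar> \<le> B * \<bar>pv_operator r \<eta> x\<bar>"
        using B(2) by (intro mult_right_mono) auto
      then show ?thesis using B(1) by (simp add: power2_eq_square abs_mult)
    qed
    then show "AE x in lborel. norm ((pv_operator r \<eta> x)\<^sup>2) \<le> norm (B * pv_operator r \<eta> x)" by simp
  qed measurable
  with integrable_pv_operator show ?thesis by (simp add: l12_def l2_def)
qed

lemma fourier_integral_second_diff: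
  "fourier_integral (\<lambda>x. complex_of_real (second_diff \<eta> h x)) \<zeta>
    = complex_of_real (2 * (1 - cos (h \<bullet> \<zeta>))) * fourier_integral (\<lambda>x. complex_of_real (\<eta> x)) \<zeta>"
proof -
  let ?c = "\<lambda>x. complex_of_real (\<eta> x)"
  have [measurable]: "\<eta> \<in> borel_measurable borel" by (rule schwartz_measurable[OF \<eta>])
  have i: "integrable lborel ?c" using schwartz_l12[OF \<eta>] by (simp add: l12_def)
  have t: "integrable lborel (\<lambda>x. ?c (h + x))" "integrable lborel (\<lambda>x. ?c (- h + x))"
    using i by (subst integrable_lborel_translate; simp)+
  have i2: "integrable lborel (\<lambda>x. 2 * ?c x)" using i by (rule integrable_mult_right)
  have i1: "integrable lborel (\<lambda>x. 2 * ?c x - ?c (h + x))" using i2 t(1)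
    by (rule Bochner_Integration.integrable_diff)
  have tr: "fourier_integral (\<lambda>x. ?c (v + x)) \<zeta> = cis (v \<bullet> \<zeta>) * fourier_integral ?c \<zeta>" for v
    by (rule fourier_integral_translate) measurable
  have "(\<lambda>x. complex_of_real (second_diff \<eta> h x)) = (\<lambda>x. (2 * ?c x - ?c (h + x)) - ?c (- h + x))"
    by (simp add: second_diff_def fun_eq_iff add.commute)
  then have "fourier_integral (\<lambda>x. complex_of_real (second_diff \<eta> h x)) \<zeta>
    = 2 * fourier_integral ?c \<zeta> - cis (h \<bullet> \<zeta>) * fourier_integral ?c \<zeta> - cis ((- h) \<bullet> \<zeta>)
      * fourier_integral ?c \<zeta>"
    by (simp only: fourier_integral_diff[OF i1 t(2)] fourier_integral_diff[OF i2 t(1)] fourier_integral_scale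
      tr)
  also have "\<dots> = (2 - (cis (h \<bullet> \<zeta>) + cis (- (h \<bullet> \<zeta>)))) * fourier_integral ?c \<zeta>"
    by (simp add: algebra_simps)
  also have "cis (h \<bullet> \<zeta>) + cis (- (h \<bullet> \<zeta>)) = complex_of_real (2 * cos (h \<bullet> \<zeta>))"
    by (simp add: complex_eq_iff)
  finally show ?thesis by (simp add: algebra_simps)
qed

text \<open>Fubini takes the Fourier integral inside the integral over \<open>h\<close>, where the
  second difference becomes a multiplier; integrating that multiplier against the kernel is
  \<open>integral_kernel_cos\<close>. The half in \<open>pv_operator\<close> cancels the factor
  2.\<close>

lemma fourier_integral_pv_operator:
  "fourier_integral (\<lambda>x. complex_of_real (pv_operator r \<eta> x)) \<zeta>
    = complex_of_real (kernel_const TYPE('a) r * norm \<zeta> powr (2 * r))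
      * fourier_integral (\<lambda>x. complex_of_real (\<eta> x)) \<zeta>"
proof -
  let ?p = "real DIM('a) + 2 * r" and ?C = "fconst TYPE('a)"
  let ?F = "fourier_integral (\<lambda>x. complex_of_real (\<eta> x)) \<zeta>"
  have [measurable]: "\<eta> \<in> borel_measurable borel" by (rule schwartz_measurable[OF \<eta>])
  have sm: "(\<lambda>x. complex_of_real (second_diff \<eta> h x)) \<in> borel_measurable borel" for h
    unfolding second_diff_def by measurable
  let ?f = "\<lambda>h x. complex_of_real (second_diff \<eta> h x / norm h powr ?p) * cis (- (x \<bullet> \<zeta>))"
  have fi: "integrable (lborel \<Otimes>\<^sub>M lborel) (\<lambda>(h, x). ?f h x)"
  proof (rule Bochner_Integration.integrable_bound[OF integrable_kernel_second_diff_pair])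
    show "(\<lambda>(h, x). ?f h x) \<in> borel_measurable (lborel \<Otimes>\<^sub>M lborel)"
      unfolding second_diff_def by measurable
  qed (auto simp: norm_mult norm_divide split_beta')
  have "fourier_integral (\<lambda>x. complex_of_real (pv_operator r \<eta> x)) \<zeta>
    = ?C *\<^sub>R (LINT x|lborel. (LINT h|lborel. ?f h x) / 2)"
  proof -
    have "complex_of_real (pv_operator r \<eta> x) * cis (- (x \<bullet> \<zeta>)) = (LINT h|lborel. ?f h x) / 2" for x
      unfolding pv_operator_def by (simp only: integral_mult_left_zero integral_complex_of_real) simp
    moreover have "(\<lambda>x. complex_of_real (pv_operator r \<eta> x)) \<in> borel_measurable borel"
      using pv_operator_measurable by measurable
    ultimately show ?thesis by (simp only: fourier_integral_lborel)
  qed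
  also have "\<dots> = ?C *\<^sub>R ((LINT x|lborel. LINT h|lborel. ?f h x) / 2)"
    by simp
  also have "(LINT x|lborel. LINT h|lborel. ?f h x) = (LINT h|lborel. LINT x|lborel. ?f h x)"
    by (rule lborel_pair.Fubini_integral[OF fi])
  also have "?C *\<^sub>R ((LINT h|lborel. LINT x|lborel. ?f h x) / 2)
    = (LINT h|lborel. ?C *\<^sub>R (LINT x|lborel. ?f h x)) / 2"
    by simp
  also have "(LINT h|lborel. ?C *\<^sub>R (LINT x|lborel. ?f h x))
    = (LINT h|lborel. complex_of_real (2 * ((1 - cos (h \<bullet> \<zeta>)) / norm h powr ?p)) * ?F)"
  proof (intro Bochner_Integration.integral_cong refl)
    fix h :: 'a
    have "?f h x = complex_of_real (1 / norm h powr ?p) * (complex_of_real (second_diff \<eta> h x)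
      * cis (- (x \<bullet> \<zeta>)))" for x
      by simp
    then have "?C *\<^sub>R (LINT x|lborel. ?f h x) = complex_of_real (1 / norm h powr ?p)
      * (?C *\<^sub>R (LINT x|lborel. complex_of_real (second_diff \<eta> h x) * cis (- (x \<bullet> \<zeta>))))"
      by (simp only: integral_mult_right_zero mult_scaleR_right)
    also have "\<dots> = complex_of_real (1 / norm h powr ?p)
      * fourier_integral (\<lambda>x. complex_of_real (second_diff \<eta> h x)) \<zeta>"
      by (simp only: fourier_integral_lborel[OF sm])
    also have "\<dots> = complex_of_real (2 * ((1 - cos (h \<bullet> \<zeta>)) / norm h powr ?p)) * ?F"
      unfolding fourier_integral_second_diff by simp
    finally show "?C *\<^sub>R (LINT x|lborel. ?f h x) = complex_of_real (2 * ((1 - cos (h \<bullet> \<zeta>)) / norm h powr ?p))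
      * ?F" .
  qed
  also have "\<dots> = complex_of_real (2 * (kernel_const TYPE('a) r * norm \<zeta> powr (2 * r))) * ?F"
    unfolding integral_mult_left_zero integral_complex_of_real integral_mult_right_zero integral_kernel_cos[OF
      r] ..
  finally show ?thesis by simp
qed

lemma frac_laplacian_schwartz:
  "AE x in lebesgue. frac_laplacian r \<eta> x = (1 / kernel_const TYPE('a) r) * pv_operator r \<eta> x"
proof -
  let ?A = "kernel_const TYPE('a) r"
  define g where "g x = (1 / ?A) * pv_operator r \<eta> x" for x
  have A: "0 < ?A" by (rule kernel_const_pos[OF r])
  have gc: "(\<lambda>x. complex_of_real (g x)) = (\<lambda>x. complex_of_real (1 / ?A)
    * complex_of_real (pv_operator r \<eta> x))"
    by (simp add: g_def)
  have g12: "l12 (\<lambda>x. complex_of_real (g x))" unfolding gc by (rule l12_scale[OF pv_operator_l12])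
  have \<eta>12: "l12 (\<lambda>x. complex_of_real (\<eta> x))" by (rule schwartz_l12[OF \<eta>])
  have l2g: "l2 lborel g" and l2\<eta>: "l2 lborel \<eta>"
    using g12 \<eta>12 schwartz_measurable[OF \<eta>] borel_measurable_times[OF borel_measurable_const
      pv_operator_measurable]
    unfolding l12_def l2_def g_def by (simp_all only: norm_of_real real_norm_def measurable_lborel2)
  note sg = rfourier_borel[OF l2g] and s\<eta> = rfourier_borel[OF l2\<eta>]
  have ae: "AE \<zeta> in lborel. rfourier g \<zeta> = complex_of_real (norm \<zeta> powr (2 * r)) * rfourier \<eta> \<zeta>"
    unfolding sg(2) s\<eta>(2)
    using bfourier_l12[OF g12] bfourier_l12[OF \<eta>12]
  proof eventually_elim
    case (elim \<zeta>)
    show ?case unfolding elim unfolding gc fourier_integral_scale fourier_integral_pv_operator using A by simp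
  qed
  have [measurable]: "rfourier \<eta> \<in> borel_measurable borel" by (rule rfourier_measurable[OF s\<eta>(1)])
  \<comment> \<open>Square integrability of the symbol times \<open>rfourier \<eta>\<close> is read
    off from \<open>g\<close>, whose transform it is almost everywhere.\<close>
  have l: "l2 lborel (\<lambda>\<zeta>. complex_of_real (norm \<zeta> powr (2 * r)) * rfourier \<eta> \<zeta>)"
    by (rule l2_bound[OF l2_rfourier[OF sg(1)]]) (use ae in \<open>auto elim: eventually_mono\<close>)
  have "AE \<zeta> in lborel. rfourier (frac_laplacian r \<eta>) \<zeta> = rfourier g \<zeta>"
    using rfourier_frac_laplacian[OF s\<eta>(1) l] ae by eventually_elim simp
  then show ?thesis
    using rfourier_inj[OF square_integrable_frac_laplacian[OF s\<eta>(1) l] sg(1)] unfolding g_def by simp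
qed

text \<open>The excluded ball is symmetric about \<open>x\<close>, so averaging over
  \<open>h\<close> and \<open>- h\<close> leaves the truncated integral unchanged and replaces the
  first difference by half the second one. The latter is absolutely integrable against the kernel,
  and dominated convergence applies.\<close>

lemma pv_operator_limit:
  "((\<lambda>\<epsilon>. LINT y:{y. \<epsilon> < dist x y}|lebesgue. (\<eta> x - \<eta> y) / dist x y powr (real DIM('a) + 2 * r))
     \<longlongrightarrow> pv_operator r \<eta> x) (at_right 0)"
proof -
  let ?p = "real DIM('a) + 2 * r"
  have [measurable]: "\<eta> \<in> borel_measurable borel" by (rule schwartz_measurable[OF \<eta>])
  obtain C where C: "0 \<le> C" "\<And>x. \<bar>\<eta> x\<bar> \<le> C * decay_weight x" using schwartz_decay[OF \<eta>] by auto
  have ab: "\<bar>\<eta> x\<bar> \<le> C" for x using C(2)[of x] mult_left_mono[OF decay_weight_le_1[of x] C(1)] by simp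
  define T where "T e h = indicator {h. e < norm h} h * (second_diff \<eta> h x / norm h powr ?p / 2)" for e
    and h :: 'a
  have eq: "(LINT y:{y. e < dist x y}|lebesgue. (\<eta> x - \<eta> y) / dist x y powr ?p)
    = (LINT h|lborel. T e h)" if e: "0 < e" for e
  proof -
    define q where "q h = indicator {h. e < norm h} h * ((\<eta> x - \<eta> (x + h)) / norm h powr ?p)" for h
    have qm[measurable]: "q \<in> borel_measurable borel" unfolding q_def by measurable
    \<comment> \<open>The first difference is at most \<open>2 * C\<close>, and for
      \<open>e < norm h\<close> the quotient
      \<open>min 1 ((norm h)\<^sup>2) / min 1 (e\<^sup>2)\<close> is at least 1. This inserts the
      integrable kernel at the price of a constant depending on \<open>e\<close>.\<close>
    have qi: "integrable lborel q"
    proof (rule Bochner_Integration.integrable_bound[OF integrable_mult_right[OF integrable_kernel_min[OF r],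
      of "2 * C / min 1 (e\<^sup>2)"]])
      show "AE h in lborel. norm (q h) \<le> norm (2 * C / min 1 (e\<^sup>2) * (min 1 ((norm h)\<^sup>2) / norm h powr ?p))"
      proof (intro always_eventually allI)
        fix h :: 'a
        show "norm (q h) \<le> norm (2 * C / min 1 (e\<^sup>2) * (min 1 ((norm h)\<^sup>2) / norm h powr ?p))"
        proof (cases "e < norm h")
          case True
          have m: "0 < min 1 (e\<^sup>2)" "min 1 (e\<^sup>2) \<le> min 1 ((norm h)\<^sup>2)"
            using e True power_mono[of e "norm h" 2] by (auto intro: min.coboundedI2)
          have cancel: "a = a / b * b" if "0 < b" for a b :: real using that by simp
          have "\<bar>\<eta> x - \<eta> (x + h)\<bar> \<le> 2 * C" using ab[of x] ab[of "x + h"] by linarith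
          also have "2 * C = 2 * C / min 1 (e\<^sup>2) * min 1 (e\<^sup>2)" by (rule cancel[OF m(1)])
          also have "\<dots> \<le> 2 * C / min 1 (e\<^sup>2) * min 1 ((norm h)\<^sup>2)"
            using m C by (intro mult_left_mono divide_nonneg_pos) auto
          finally have "\<bar>\<eta> x - \<eta> (x + h)\<bar> / norm h powr ?p
            \<le> (2 * C / min 1 (e\<^sup>2) * min 1 ((norm h)\<^sup>2)) / norm h powr ?p"
            by (intro divide_right_mono) auto
          moreover have "norm (q h) = \<bar>\<eta> x - \<eta> (x + h)\<bar> / norm h powr ?p" using True by (simp add: q_def)
          ultimately show ?thesis unfolding real_norm_def times_divide_eq_right
            by (metis order_trans abs_ge_self)
        qed (simp add: q_def)
      qed
    qed measurable
    have "(LINT y:{y. e < dist x y}|lebesgue. (\<eta> x - \<eta> y) / dist x y powr ?p)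
       = (LINT y|lebesgue. indicator {y. e < dist x y} y *\<^sub>R ((\<eta> x - \<eta> y) / dist x y powr ?p))"
      by (simp add: set_lebesgue_integral_def)
    also have "\<dots> = (LINT y|lborel. indicator {y. e < dist x y} y *\<^sub>R ((\<eta> x - \<eta> y) / dist x y powr ?p))"
      by (rule integral_completion) measurable
    also have "\<dots> = (LINT h|lborel. indicator {y. e
      < dist x y} (x + h) *\<^sub>R ((\<eta> x - \<eta> (x + h)) / dist x (x + h) powr ?p))"
      by (rule integral_lborel_translate[symmetric]) measurable
    also have "\<dots> = (LINT h|lborel. q h)"
      unfolding q_def by (intro Bochner_Integration.integral_cong refl) (auto simp: indicator_def dist_norm)
    finally have 1: "(LINT y:{y. e < dist x y}|lebesgue. (\<eta> x - \<eta> y) / dist x y powr ?p)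
      = (LINT h|lborel. q h)" .
    have dm: "distr lborel borel uminus = (lborel :: 'a measure)"
      by (subst (2) lborel_affine[of "-1" 0]) (simp_all add: density_1)
    have 2: "(LINT h|lborel. q (- h)) = (LINT h|lborel. q h)" "integrable lborel (\<lambda>h. q (- h))"
      using integral_distr[of uminus lborel borel q] integrable_distr_eq[of uminus lborel borel q] qi
        by (simp_all add: dm)
    have "T e h = q h / 2 + q (- h) / 2" for h
      unfolding T_def q_def second_diff_def by (simp add: indicator_def add_divide_distrib[symmetric]
        diff_divide_distrib[symmetric])
    then have "(LINT h|lborel. T e h) = (LINT h|lborel. q h)"
      using qi 2 by simp
    with 1 show ?thesis by simp
  qed
  \<comment> \<open>The radius is written as \<open>inverse n\<close> with real \<open>n\<close>
    tending to infinity, the form in which dominated convergence is available for a continuous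
    parameter.\<close>
  have lim: "((\<lambda>n. LINT h|lborel. T (inverse n) h) \<longlongrightarrow> (LINT h|lborel. second_diff \<eta> h x / norm h powr ?p
    / 2)) at_top"
  proof (rule integral_dominated_convergence_at_top[where w="\<lambda>h. \<bar>second_diff \<eta> h x / norm h powr ?p / 2\<bar>"])
    show "integrable lborel (\<lambda>h. \<bar>second_diff \<eta> h x / norm h powr ?p / 2\<bar>)"
      using integrable_kernel_second_diff by (intro integrable_abs integrable_divide)
    show "\<forall>\<^sub>F i in at_top. AE h in lborel. norm (T (inverse i) h) \<le> \<bar>second_diff \<eta> h x / norm h powr ?p / 2\<bar>"
      unfolding T_def by (intro always_eventually allI AE_I2) (auto simp: indicator_def)
    show "AE h in lborel. ((\<lambda>i. T (inverse i) h) \<longlongrightarrow> second_diff \<eta> h x / norm h powr ?p / 2) at_top"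
    proof (rule AE_mp[OF AE_lborel_singleton[of 0]], intro AE_I2 impI)
      fix h :: 'a assume h: "h \<noteq> 0"
      have "((inverse :: real \<Rightarrow> real) \<longlongrightarrow> 0) at_top" by (rule tendsto_inverse_0_at_top[OF filterlim_ident])
      then have "\<forall>\<^sub>F i in at_top. inverse i < norm h" using h by (intro order_tendstoD) auto
      then have "\<forall>\<^sub>F i in at_top. T (inverse i) h = second_diff \<eta> h x / norm h powr ?p / 2"
        by eventually_elim (simp add: T_def)
      then show "((\<lambda>i. T (inverse i) h) \<longlongrightarrow> second_diff \<eta> h x / norm h powr ?p / 2) at_top"
        by (rule tendsto_eventually)
    qed
    show "T (inverse i) \<in> borel_measurable lborel" for i unfolding T_def second_diff_def by measurable
    show "(\<lambda>h. second_diff \<eta> h x / norm h powr ?p / 2) \<in> borel_measurable lborel" unfolding second_diff_def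
      by measurable
  qed
  have "((\<lambda>e. LINT h|lborel. T e h) \<longlongrightarrow> pv_operator r \<eta> x) (at_right 0)"
    unfolding filterlim_at_right_to_top using lim unfolding pv_operator_def integral_divide_zero .
  moreover have "\<forall>\<^sub>F e in at_right 0. (LINT h|lborel. T e h) = (LINT y:{y. e
    < dist x y}|lebesgue. (\<eta> x - \<eta> y) / dist x y powr ?p)"
    using eventually_at_right_less[of "0::real"] by eventually_elim (simp add: eq)
  ultimately show ?thesis using Lim_transform_eventually by fast
qed

end

section \<open>The normalization constant\<close>

lemma real_polynomial_function_derivative:
  fixes p :: "'a::euclidean_space \<Rightarrow> real"
  assumes "real_polynomial_function p"
  shows "\<exists>D. (\<forall>x. (p has_derivative D x) (at x)) \<and> (\<forall>b. real_polynomial_function (\<lambda>x. D x b))"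
  using assms
proof induct
  case (linear f)
  then show ?case
    by (intro exI[of _ "\<lambda>x. f"]) (auto intro: bounded_linear_imp_has_derivative)
next
  case (const c)
  then show ?case by (intro exI[of _ "\<lambda>x h. 0"]) auto
next
  case (add f g)
  then obtain D1 D2 where "\<forall>x. (f has_derivative D1 x) (at x)" "\<forall>b. real_polynomial_function (\<lambda>x. D1 x b)"
    "\<forall>x. (g has_derivative D2 x) (at x)" "\<forall>b. real_polynomial_function (\<lambda>x. D2 x b)" by blast
  then show ?case
    by (intro exI[of _ "\<lambda>x h. D1 x h + D2 x h"]) (auto intro: has_derivative_add)
next
  case (mult f g)
  then obtain D1 D2 where "\<forall>x. (f has_derivative D1 x) (at x)" "\<forall>b. real_polynomial_function (\<lambda>x. D1 x b)"
    "\<forall>x. (g has_derivative D2 x) (at x)" "\<forall>b. real_polynomial_function (\<lambda>x. D2 x b)" by blast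
  with mult(1,3) show ?case
    by (intro exI[of _ "\<lambda>x h. f x * D2 x h + D1 x h * g x"] conjI allI has_derivative_mult
        real_polynomial_function.intros(3,4)) blast+
qed

lemma real_polynomial_function_growth:
  fixes p :: "'a::euclidean_space \<Rightarrow> real"
  assumes "real_polynomial_function p"
  shows "\<exists>C n. 0 \<le> C \<and> (\<forall>x. \<bar>p x\<bar> \<le> C * (1 + norm x) ^ n)"
  using assms
proof induct
  case (linear f)
  obtain K where K: "\<And>x. norm (f x) \<le> norm x * K" "0 \<le> K"
    using bounded_linear.nonneg_bounded[OF linear] by auto
  have "\<bar>f x\<bar> \<le> K * (1 + norm x) ^ 1" for x
    using K(1)[of x] K(2) by (simp add: distrib_left mult.commute)
  then show ?case using K(2) by blast
next
  case (const c)
  have "\<bar>c\<bar> \<le> \<bar>c\<bar> * (1 + norm x) ^ 0" for x :: 'a by simp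
  then show ?case by (meson abs_ge_zero)
next
  case (add f g)
  then obtain C n D m where C: "0 \<le> C" "\<And>x. \<bar>f x\<bar> \<le> C * (1 + norm x) ^ n"
    and D: "0 \<le> D" "\<And>x. \<bar>g x\<bar> \<le> D * (1 + norm x) ^ m" by blast
  have "\<bar>f x + g x\<bar> \<le> (C + D) * (1 + norm x) ^ max n m" for x
  proof -
    have "\<bar>f x + g x\<bar> \<le> C * (1 + norm x) ^ n + D * (1 + norm x) ^ m"
      using C(2)[of x] D(2)[of x] by linarith
    also have "\<dots> \<le> C * (1 + norm x) ^ max n m + D * (1 + norm x) ^ max n m"
      using C D by (intro add_mono mult_left_mono power_increasing) auto
    finally show ?thesis by (simp add: distrib_right)
  qed
  then show ?case using C D by (meson add_nonneg_nonneg)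
next
  case (mult f g)
  then obtain C n D m where C: "0 \<le> C" "\<And>x. \<bar>f x\<bar> \<le> C * (1 + norm x) ^ n"
    and D: "0 \<le> D" "\<And>x. \<bar>g x\<bar> \<le> D * (1 + norm x) ^ m" by blast
  have "\<bar>f x * g x\<bar> \<le> (C * D) * (1 + norm x) ^ (n + m)" for x
  proof -
    have "\<bar>f x\<bar> * \<bar>g x\<bar> \<le> (C * (1 + norm x) ^ n) * (D * (1 + norm x) ^ m)"
      by (intro mult_mono C D mult_nonneg_nonneg) auto
    then show ?thesis by (simp add: abs_mult power_add mult_ac)
  qed
  then show ?case using C D by (meson mult_nonneg_nonneg)
qed

text \<open>
  The constant in the principal value formula is unique as soon as one Schwartz function has a
  nonzero principal value integral; a Gaussian serves as this witness.
\<close>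

definition gaussian :: "'a::euclidean_space \<Rightarrow> real" where
  "gaussian x = exp (- (x \<bullet> x / 2))"

lemma gaussian_has_derivative: "(gaussian has_derivative (\<lambda>h. - (x \<bullet> h) * gaussian x)) (at x)"
proof -
  have "((\<lambda>x. exp (- (x \<bullet> x / 2))) has_derivative (\<lambda>h. exp (- (x \<bullet> x / 2)) * - ((x \<bullet> h + h \<bullet> x) / 2))) (at x)"
    by (auto intro!: derivative_eq_intros)
  then show ?thesis unfolding gaussian_def[abs_def]
    by (rule has_derivative_eq_rhs) (simp add: fun_eq_iff inner_commute mult.commute)
qed

text \<open>Polynomial growth is absorbed by \<open>(1 + t / m) ^ m \<le> exp t\<close>, and
  completing the square bounds \<open>exp t * exp (- (t\<^sup>2 / 2))\<close> by
  \<open>exp (1 / 2)\<close>. The successor in \<open>m\<close> keeps the divisor positive.\<close>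

lemma poly_gaussian_bounded:
  assumes "real_polynomial_function p"
  shows "bounded (range (\<lambda>x::'a::euclidean_space. norm x ^ N * (p x * gaussian x)))"
proof -
  obtain C n where C: "0 \<le> C" "\<And>x. \<bar>p x\<bar> \<le> C * (1 + norm x) ^ n"
    using real_polynomial_function_growth[OF assms] by blast
  define m where "m = Suc (N + n)"
  have m: "0 < m" by (simp add: m_def)
  have "norm (norm x ^ N * (p x * gaussian x)) \<le> C * (real m ^ m * exp (1 / 2))" for x
  proof -
    let ?t = "norm x"
    have "(1 + ?t) ^ (N + n) \<le> (1 + ?t) ^ m" by (intro power_increasing) (auto simp: m_def)
    also have "\<dots> \<le> (real m * (1 + ?t / real m)) ^ m"
      using m by (intro power_mono) (auto simp: distrib_left)
    also have "\<dots> = real m ^ m * (1 + ?t / real m) ^ m" by (rule power_mult_distrib)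
    also have "\<dots> \<le> real m ^ m * exp ?t"
      using m by (intro mult_left_mono exp_ge_one_plus_x_over_n_power_n) (auto intro: order_trans[of _ 0])
    finally have 1: "(1 + ?t) ^ (N + n) \<le> real m ^ m * exp ?t" .
    have "?t - ?t\<^sup>2 / 2 \<le> 1 / 2" using zero_le_power2[of "?t - 1"] by (simp add: power2_diff)
    then have 2: "exp ?t * gaussian x \<le> exp (1 / 2)"
      by (simp add: gaussian_def exp_add[symmetric] power2_norm_eq_inner)
    have "norm (norm x ^ N * (p x * gaussian x)) = ?t ^ N * \<bar>p x\<bar> * gaussian x"
      by (simp add: abs_mult gaussian_def)
    also have "\<dots> \<le> (1 + ?t) ^ N * (C * (1 + ?t) ^ n) * gaussian x"
      by (intro mult_right_mono mult_mono power_mono C) (auto simp: gaussian_def)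
    also have "\<dots> = C * ((1 + ?t) ^ (N + n) * gaussian x)" by (simp add: power_add mult_ac)
    also have "\<dots> \<le> C * ((real m ^ m * exp ?t) * gaussian x)"
      using 1 C(1) by (intro mult_left_mono mult_right_mono) (auto simp: gaussian_def)
    also have "\<dots> = C * (real m ^ m * (exp ?t * gaussian x))" by simp
    also have "\<dots> \<le> C * (real m ^ m * exp (1 / 2))"
      using 2 C(1) by (intro mult_left_mono) auto
    finally show ?thesis .
  qed
  then show ?thesis unfolding bounded_iff by blast
qed

lemma poly_gaussian_has_derivative:
  assumes D: "\<And>x. (p has_derivative D x) (at x)"
  shows "((\<lambda>x::'a::euclidean_space. p x * gaussian x) has_derivative (\<lambda>h. (D x h - p x * (x \<bullet> h))
    * gaussian x)) (at x)"
  using has_derivative_mult[OF D[of x] gaussian_has_derivative[of x]]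
  by (rule has_derivative_eq_rhs) (simp add: fun_eq_iff algebra_simps)

text \<open>Polynomials times the Gaussian are closed under partial derivatives, so the Schwartz
  conditions for all orders reduce to one differentiability and one growth statement.\<close>

lemma partial_derivs_gaussian:
  assumes "set bs \<subseteq> Basis"
  shows "\<exists>p. real_polynomial_function p \<and> partial_derivs bs (gaussian :: 'a::euclidean_space \<Rightarrow> real)
    = (\<lambda>x. p x * gaussian x)"
  using assms
proof (induct bs)
  case Nil
  have "real_polynomial_function (\<lambda>x::'a. 1)" by (rule real_polynomial_function.intros(2))
  then show ?case by (intro exI[of _ "\<lambda>x. 1"]) (simp add: partial_derivs_def)
next
  case (Cons b bs)
  then obtain p where p: "real_polynomial_function p" "partial_derivs bs (gaussian :: 'a \<Rightarrow> real)
    = (\<lambda>x. p x * gaussian x)" by auto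
  obtain D where D: "\<And>x. (p has_derivative D x) (at x)" "\<And>b. real_polynomial_function (\<lambda>x. D x b)"
    using real_polynomial_function_derivative[OF p(1)] by blast
  have "partial_derivs (b # bs) gaussian x = (D x b - p x * (x \<bullet> b)) * gaussian x" for x
  proof -
    have "partial_derivs (b # bs) gaussian x = frechet_derivative (partial_derivs bs gaussian) (at x) b"
      by (simp add: partial_derivs_def)
    then show ?thesis unfolding p(2) frechet_derivative_at[OF poly_gaussian_has_derivative[OF D(1)],
      symmetric] .
  qed
  moreover have "real_polynomial_function (\<lambda>x. D x b - p x * (x \<bullet> b))"
  proof -
    have "real_polynomial_function (\<lambda>x. D x b + (- 1) * (p x * (x \<bullet> b)))"
      by (intro real_polynomial_function.intros D p(1) bounded_linear_inner_left)
    then show ?thesis by simp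
  qed
  ultimately show ?case by (intro exI[of _ "\<lambda>x. D x b - p x * (x \<bullet> b)"]) auto
qed

lemma schwartz_gaussian: "schwartz (gaussian :: 'a::euclidean_space \<Rightarrow> real)"
  unfolding schwartz_def
proof (intro ballI conjI allI)
  fix bs :: "'a list" assume "bs \<in> lists Basis"
  then have "set bs \<subseteq> Basis" by (auto simp: in_lists_conv_set)
  from partial_derivs_gaussian[OF this]
  obtain p where p: "real_polynomial_function p" "partial_derivs bs (gaussian :: 'a \<Rightarrow> real)
    = (\<lambda>x. p x * gaussian x)" by blast
  obtain D where D: "\<And>x. (p has_derivative D x) (at x)"
    using real_polynomial_function_derivative[OF p(1)] by blast
  show "partial_derivs bs gaussian differentiable (at x)" for x :: 'a
    unfolding p(2) differentiable_def using poly_gaussian_has_derivative[OF D] by blast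
  show "bounded (range (\<lambda>x. norm x ^ N * partial_derivs bs gaussian (x::'a)))" for N
    unfolding p(2) by (rule poly_gaussian_bounded[OF p(1)])
qed

text \<open>Existence joins \<open>frac_laplacian_schwartz\<close>, an identity almost everywhere,
  to \<open>pv_operator_limit\<close>, which holds at every point.\<close>

lemma frac_laplacian_const_eq:
  assumes r: "0 < r" "r < 1"
  shows "frac_laplacian_const TYPE('a::euclidean_space) r = 1 / kernel_const TYPE('a) r"
  unfolding frac_laplacian_const_def
proof (rule the_equality)
  show "\<forall>\<eta> :: 'a \<Rightarrow> real. schwartz \<eta> \<longrightarrow> (AE x in lebesgue. \<exists>pv.
      ((\<lambda>\<epsilon>. LINT y:{y. \<epsilon> < dist x y}|lebesgue. (\<eta> x - \<eta> y) / dist x y powr (real DIM('a) + 2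
        * r)) \<longlongrightarrow> pv) (at_right 0) \<and>
      frac_laplacian r \<eta> x = 1 / kernel_const TYPE('a) r * pv)"
  proof (intro allI impI)
    fix \<eta> :: "'a \<Rightarrow> real" assume \<eta>: "schwartz \<eta>"
    show "AE x in lebesgue. \<exists>pv.
      ((\<lambda>\<epsilon>. LINT y:{y. \<epsilon> < dist x y}|lebesgue. (\<eta> x - \<eta> y) / dist x y powr (real DIM('a) + 2
        * r)) \<longlongrightarrow> pv) (at_right 0) \<and>
      frac_laplacian r \<eta> x = 1 / kernel_const TYPE('a) r * pv"
      using frac_laplacian_schwartz[OF \<eta> r]
    proof eventually_elim
      case (elim x)
      then show ?case using pv_operator_limit[OF \<eta> r, of x] by blast
    qed
  qed
next
  fix c
  assume c: "\<forall>\<eta> :: 'a \<Rightarrow> real. schwartz \<eta> \<longrightarrow> (AE x in lebesgue. \<exists>pv.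
      ((\<lambda>\<epsilon>. LINT y:{y. \<epsilon> < dist x y}|lebesgue. (\<eta> x - \<eta> y) / dist x y powr (real DIM('a) + 2
        * r)) \<longlongrightarrow> pv) (at_right 0) \<and>
      frac_laplacian r \<eta> x = c * pv)"
  let ?G = "gaussian :: 'a \<Rightarrow> real" and ?A = "kernel_const TYPE('a) r"
  note G = schwartz_gaussian[where 'a='a]
  have A: "0 < ?A" by (rule kernel_const_pos[OF r])
  note c[rule_format, OF G]
  then have ae: "AE x in lebesgue. c * pv_operator r ?G x = 1 / ?A * pv_operator r ?G x"
    using frac_laplacian_schwartz[OF G r]
  proof eventually_elim
    case (elim x)
    then obtain pv where "((\<lambda>\<epsilon>. LINT y:{y. \<epsilon> < dist x y}|lebesgue. (?G x - ?G y) / dist x y powr (real DIM('a)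
      + 2 * r)) \<longlongrightarrow> pv) (at_right 0)"
      and pv: "frac_laplacian r ?G x = c * pv" by blast
    then have "pv = pv_operator r ?G x"
      using pv_operator_limit[OF G r, of x] by (intro tendsto_unique[OF trivial_limit_at_right_real])
    then show ?case using pv elim(2) by simp
  qed
  show "c = 1 / ?A"
  proof (rule ccontr)
    \<comment> \<open>Two different constants force the principal value of the Gaussian to vanish
      almost everywhere. Its transform is that of the Gaussian times a symbol that is positive off
      the origin, so by Plancherel the Gaussian itself would vanish.\<close>
    assume "c \<noteq> 1 / ?A"
    with ae have "AE x in lebesgue. pv_operator r ?G x = 0" by (simp only: mult_cancel_right simp_thms)
    then have "fourier_integral (\<lambda>x. complex_of_real (pv_operator r ?G x)) \<zeta>
      = fourier_integral (\<lambda>x. 0) \<zeta>" for \<zeta>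
      using pv_operator_measurable[OF G r]
      by (intro fourier_integral_cong_AE measurable_completion) (auto elim: eventually_mono)
    then have "fourier_integral (\<lambda>x. complex_of_real (pv_operator r ?G x)) \<zeta> = 0" for \<zeta>
      by (simp add: fourier_integral_def)
    then have z: "fourier_integral (\<lambda>x. complex_of_real (?G x)) \<zeta> = 0" if "\<zeta> \<noteq> 0" for \<zeta>
      using that A unfolding fourier_integral_pv_operator[OF G r] by simp blast
    note g12 = schwartz_l12[OF G]
    have "AE \<zeta> in lborel. fourier_integral (\<lambda>x. complex_of_real (?G x)) \<zeta> = 0"
      using AE_lborel_singleton[of "0::'a"] by eventually_elim (rule z)
    then have "nsq lborel (\<lambda>x. complex_of_real (?G x)) = 0"
      using nsq_eq_0_iff[OF l2_fourier_integral[OF g12]] nsq_fourier_integral[OF g12] by simp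
    moreover have "l2 lborel (\<lambda>x. complex_of_real (?G x))" using g12 by (simp add: l12_def)
    ultimately have "AE x in lborel. complex_of_real (?G x) = 0" by (simp add: nsq_eq_0_iff)
    then have "AE x in (lborel :: 'a measure). False" by (simp add: gaussian_def)
    then show False using AE_iff_measurable[of UNIV "lborel :: 'a measure" "\<lambda>x. False"]
      emeasure_lborel_UNIV[where 'a='a]
      by simp
  qed
qed

section \<open>The error of the sinc quadrature approximation\<close>

lemma sobolev_mono:
  assumes v: "v \<in> sobolev q" and "p \<le> q"
  shows "v \<in> sobolev p"
proof -
  have sv: "square_integrable v" by (rule sobolev_square_integrable[OF v])
  have [measurable]: "rfourier v \<in> borel_measurable borel" by (rule rfourier_measurable[OF sv])
  have "integrable lborel (\<lambda>\<zeta>. (1 + (norm \<zeta>)\<^sup>2) powr p * (norm (rfourier v \<zeta>))\<^sup>2)"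
    by (rule Bochner_Integration.integrable_bound[of _ "\<lambda>\<zeta>. (1 + (norm \<zeta>)\<^sup>2) powr q
      * (norm (rfourier v \<zeta>))\<^sup>2"])
       (use v assms(2) in \<open>auto simp: sobolev_iff abs_mult intro!: mult_right_mono powr_mono\<close>)
  then show ?thesis using sv by (simp add: sobolev_iff)
qed

lemma nsq_weight:
  "nsq lborel (\<lambda>\<zeta>. complex_of_real (norm \<zeta> powr r) * f \<zeta>)
    = (LINT \<zeta>|lborel. norm \<zeta> powr (2 * r) * (norm (f \<zeta>))\<^sup>2)"
  unfolding nsq_def
proof (intro Bochner_Integration.integral_cong refl)
  fix \<zeta> :: 'a
  have "norm \<zeta> powr (2 * r) = (norm \<zeta> powr r)\<^sup>2" by (simp add: power2_eq_square powr_add[symmetric])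
  then show "(norm (complex_of_real (norm \<zeta> powr r) * f \<zeta>))\<^sup>2 = norm \<zeta> powr (2 * r) * (norm (f \<zeta>))\<^sup>2"
    by (simp add: norm_mult power_mult_distrib)
qed

text \<open>Both branches of the norm are reduced to one homogeneous weight. For
  \<open>r < 1\<close> there is equality, since \<open>frac_laplacian_const / 2\<close> cancels
  \<open>2 * kernel_const\<close>; for \<open>r \<ge> 1\<close> the weight
  \<open>(1 + (norm \<zeta>)\<^sup>2) powr r\<close> dominates.\<close>

lemma tilde_sobolev_norm_ge:
  fixes D :: "'a::euclidean_space set"
  assumes r: "0 < r" and \<phi>: "\<phi> \<in> tilde_sobolev D r"
  shows "sqrt (nsq lborel (\<lambda>\<zeta>. complex_of_real (norm \<zeta> powr r) * rfourier (zero_ext D \<phi>) \<zeta>))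
    \<le> tilde_sobolev_norm D r \<phi>"
proof -
  let ?v = "zero_ext D \<phi>"
  have v: "?v \<in> sobolev r" using \<phi> by (simp add: tilde_sobolev_def)
  note sv = sobolev_square_integrable[OF v]
  have i: "integrable lborel (\<lambda>\<zeta>. norm \<zeta> powr (2 * r) * (norm (rfourier ?v \<zeta>))\<^sup>2)"
    using integrable_sobolev_weight[OF v] r by simp
  show ?thesis
  proof (cases "r < 1")
    case True
    have A: "0 < kernel_const TYPE('a) r" by (rule kernel_const_pos[OF r True])
    show ?thesis
      using True A unfolding tilde_sobolev_norm_def gagliardo_seminorm[OF r True sv i]
        frac_laplacian_const_eq[OF r True] nsq_weight
      by simp
  next
    case False
    have "(LINT \<zeta>|lborel. norm \<zeta> powr (2 * r) * (norm (rfourier ?v \<zeta>))\<^sup>2)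
      \<le> (LINT \<zeta>|lborel. (1 + (norm \<zeta>)\<^sup>2) powr r * (norm (rfourier ?v \<zeta>))\<^sup>2)"
    proof (intro integral_mono i mult_right_mono)
      show "integrable lborel (\<lambda>\<zeta>. (1 + (norm \<zeta>)\<^sup>2) powr r * (norm (rfourier ?v \<zeta>))\<^sup>2)"
        using v by (simp add: sobolev_iff)
      show "norm \<zeta> powr (2 * r) \<le> (1 + (norm \<zeta>)\<^sup>2) powr r" for \<zeta> :: 'a
        using norm_powr_le[of "2 * r" "2 * r" \<zeta>] r by simp
    qed auto
    then show ?thesis using False unfolding tilde_sobolev_norm_def nsq_weight sobolev_norm_eq[OF sv]
      by simp
  qed
qed

theorem theorem5p1:
  fixes D :: "'a::euclidean_space set"
    and s \<dd> k \<delta> :: real and Nm Np :: nat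
    and \<eta> \<theta> :: "'a \<Rightarrow> real"
  assumes "polygonal_lipschitz_domain D"
    and "0 < s" "s < 1"
    and "0 < \<dd>" "\<dd> < pi"
    and "0 < k"
    and "0 < Nm" "0 < Np"
    and "s < \<delta>" "\<delta> \<le> 2 - s"
    and "\<theta> \<in> tilde_sobolev D s"
    and "\<eta> \<in> tilde_sobolev D \<delta>"
  shows "\<bar>bilinear_form D s \<eta> \<theta> - sinc_form D s k Nm Np \<eta> \<theta>\<bar>
    \<le> 2 * strip_const \<dd> / (\<delta> - s) *
        (2 / (exp (2 * pi * \<dd> / k) - 1) + exp ((s - \<delta>) * real Np * k / 2)) *
        tilde_sobolev_norm D \<delta> \<eta> * tilde_sobolev_norm D s \<theta>
    + strip_const \<dd> / s *
        (2 / (exp (2 * pi * \<dd> / k) - 1) + exp (- s * real Nm * k)) *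
        norm_on D \<eta> * norm_on D \<theta>"
proof -
  note s = assms(2,3) and d = assms(4,5) and k = assms(6) and \<delta> = assms(9,10)
  let ?e = "zero_ext D \<eta>" and ?t = "zero_ext D \<theta>"
  have e: "?e \<in> sobolev \<delta>" and t: "?t \<in> sobolev s" using assms(11,12) by (auto simp: tilde_sobolev_def)
  have es: "?e \<in> sobolev s" using sobolev_mono[OF e] \<delta> by simp
  note se = sobolev_square_integrable[OF e] and st = sobolev_square_integrable[OF t]
  let ?E = "rfourier ?e" and ?T = "rfourier ?t"
  note [measurable] = rfourier_measurable[OF se] rfourier_measurable[OF st]
  define P where "P \<zeta> = Re (?E \<zeta> * cnj (?T \<zeta>))" for \<zeta>
  have [measurable]: "P \<in> borel_measurable borel" unfolding P_def by measurable
  have Pn: "\<bar>P \<zeta>\<bar> \<le> norm (?E \<zeta>) * norm (?T \<zeta>)" for \<zeta>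
    using abs_Re_le_cmod[of "?E \<zeta> * cnj (?T \<zeta>)"] unfolding P_def norm_mult complex_mod_cnj .
  let ?Ed = "\<lambda>\<zeta>. complex_of_real (norm \<zeta> powr \<delta>) * ?E \<zeta>" and ?Es
    = "\<lambda>\<zeta>. complex_of_real (norm \<zeta> powr s) * ?E \<zeta>"
    and ?Ts = "\<lambda>\<zeta>. complex_of_real (norm \<zeta> powr s) * ?T \<zeta>"
  have l: "l2 lborel ?Ed" "l2 lborel ?Es" "l2 lborel ?Ts" "l2 lborel ?E" "l2 lborel ?T"
    using l2_sobolev_weight[OF e] l2_sobolev_weight[OF es] l2_sobolev_weight[OF t] s \<delta> l2_rfourier[OF se]
      l2_rfourier[OF st]
    by auto
  have i0: "integrable lborel (\<lambda>\<zeta>. norm (?E \<zeta>) * norm (?T \<zeta>))"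
    using integrable_norm[OF integrable_l2_mult[OF l(4,5)]] by (simp add: norm_mult)
  have iB: "integrable lborel (\<lambda>\<zeta>. norm \<zeta> powr (2 * s) * P \<zeta>)"
  proof (rule Bochner_Integration.integrable_bound[OF integrable_norm[OF integrable_l2_mult[OF l(2,3)]]])
    have "norm \<zeta> powr (2 * s) * \<bar>P \<zeta>\<bar> \<le> norm (?Es \<zeta> * ?Ts \<zeta>)" for \<zeta> :: 'a
    proof -
      have "norm \<zeta> powr (2 * s) = norm \<zeta> powr s * norm \<zeta> powr s" by (simp add: powr_add[symmetric])
      then show ?thesis using mult_left_mono[OF Pn[of \<zeta>], of "norm \<zeta> powr (2 * s)"]
        by (simp add: norm_mult mult_ac)
    qed
    then show "AE \<zeta> in lborel. norm (norm \<zeta> powr (2 * s) * P \<zeta>) \<le> norm (norm (?Es \<zeta> * ?Ts \<zeta>))"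
      by (simp add: abs_mult)
  qed measurable
  let ?y = "\<lambda>j::int. real_of_int j * k"
  have bal: "exp (s * y) * ((exp (- y / 2))\<^sup>2 * (norm \<zeta>)\<^sup>2 / (1 + (exp (- y / 2))\<^sup>2 * (norm \<zeta>)\<^sup>2))
    = balakrishnan s ((norm \<zeta>)\<^sup>2) y" for y and \<zeta> :: 'a
  proof -
    have "(exp (- y / 2))\<^sup>2 = exp (- y)" by (simp add: power2_eq_square exp_add[symmetric])
    then have ee: "(exp (- y / 2))\<^sup>2 = 1 / exp y" by (simp only: exp_minus inverse_eq_divide)
    have "0 < exp y + (norm \<zeta>)\<^sup>2" by (simp add: add_pos_nonneg)
    then show ?thesis unfolding ee balakrishnan_def by (simp add: field_simps)
  qed
  have bal_bound: "0 \<le> balakrishnan s ((norm \<zeta>)\<^sup>2) y" "balakrishnan s ((norm \<zeta>)\<^sup>2) y \<le> exp (s * y)" for y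
    and \<zeta> :: 'a
  proof -
    show "0 \<le> balakrishnan s ((norm \<zeta>)\<^sup>2) y" unfolding balakrishnan_def by (intro divide_nonneg_nonneg) auto
    have "(norm \<zeta>)\<^sup>2 / (exp y + (norm \<zeta>)\<^sup>2) \<le> 1" by (simp add: divide_le_eq_1 add_pos_nonneg)
    then have "exp (s * y) * ((norm \<zeta>)\<^sup>2 / (exp y + (norm \<zeta>)\<^sup>2)) \<le> exp (s * y) * 1"
      by (intro mult_left_mono) auto
    then show "balakrishnan s ((norm \<zeta>)\<^sup>2) y \<le> exp (s * y)" by (simp add: balakrishnan_def)
  qed
  have bm[measurable]: "(\<lambda>\<zeta>::'a. balakrishnan s ((norm \<zeta>)\<^sup>2) y) \<in> borel_measurable borel" for y
    unfolding balakrishnan_def by measurable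
  have iS: "integrable lborel (\<lambda>\<zeta>. balakrishnan s ((norm \<zeta>)\<^sup>2) y * P \<zeta>)" for y
  proof (rule Bochner_Integration.integrable_bound[OF integrable_mult_right[OF i0, of "exp (s * y)"]])
    have "balakrishnan s ((norm \<zeta>)\<^sup>2) y * \<bar>P \<zeta>\<bar> \<le> exp (s * y) * (norm (?E \<zeta>) * norm (?T \<zeta>))" for \<zeta>
      by (intro mult_mono bal_bound Pn) auto
    then show "AE \<zeta> in lborel. norm (balakrishnan s ((norm \<zeta>)\<^sup>2) y * P \<zeta>)
      \<le> norm (exp (s * y) * (norm (?E \<zeta>) * norm (?T \<zeta>)))"
      using bal_bound(1) by (simp add: abs_mult)
  qed measurable
  have inner: "exp (s * y) * inner_on D (w_fun ?e (exp (- y / 2))) \<theta>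
    = (LINT \<zeta>|lborel. balakrishnan s ((norm \<zeta>)\<^sup>2) y * P \<zeta>)" for y
    unfolding inner_on_w_fun[OF se st exp_gt_zero] bal[symmetric] P_def integral_mult_right_zero[symmetric]
    by (simp only: mult.assoc)
  \<comment> \<open>This is half of the constant \<open>c\<^sub>s\<close> in
    \<open>sinc_form\<close>, the normalizing factor of Balakrishnan's formula.\<close>
  let ?q = "sin (pi * s) / pi"
  define S where "S \<zeta> = k * (\<Sum>j = - int Nm..int Np. balakrishnan s ((norm \<zeta>)\<^sup>2) (?y j))" for \<zeta> :: 'a
  have sinc: "sinc_form D s k Nm Np \<eta> \<theta> = (LINT \<zeta>|lborel. ?q * S \<zeta> * P \<zeta>)"
  proof -
    have "sinc_form D s k Nm Np \<eta> \<theta> = ?q * k * (\<Sum>j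
      = - int Nm..int Np. LINT \<zeta>|lborel. balakrishnan s ((norm \<zeta>)\<^sup>2) (?y j) * P \<zeta>)"
      unfolding sinc_form_def Let_def inner by simp
    also have "(\<Sum>j = - int Nm..int Np. LINT \<zeta>|lborel. balakrishnan s ((norm \<zeta>)\<^sup>2) (?y j) * P \<zeta>)
      = (LINT \<zeta>|lborel. (\<Sum>j = - int Nm..int Np. balakrishnan s ((norm \<zeta>)\<^sup>2) (?y j) * P \<zeta>))"
      by (rule Bochner_Integration.integral_sum[symmetric]) (rule iS)
    finally show ?thesis unfolding S_def integral_mult_right_zero[symmetric]
      by (simp only: sum_distrib_right mult.assoc)
  qed
  have iSS: "integrable lborel (\<lambda>\<zeta>. ?q * S \<zeta> * P \<zeta>)"
  proof -
    have "integrable lborel (\<lambda>\<zeta>. ?q * k * (\<Sum>j = - int Nm..int Np. balakrishnan s ((norm \<zeta>)\<^sup>2) (?y j) * P \<zeta>))"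
      by (intro integrable_mult_right Bochner_Integration.integrable_sum iS)
    then show ?thesis unfolding S_def by (simp only: sum_distrib_right mult.assoc)
  qed
  define M where "M = 2 / (exp (2 * pi * \<dd> / k) - 1)"
  define B1 where "B1 = 2 * strip_const \<dd> / (\<delta> - s) * (M + exp ((s - \<delta>) * real Np * k / 2))"
  define B2 where "B2 = strip_const \<dd> / s * (M + exp (- s * real Nm * k))"
  have M: "0 \<le> M" using k d by (simp add: M_def)
  have B: "0 \<le> B1" "0 \<le> B2"
    using strip_const_ge_1[OF d] M s \<delta> unfolding B1_def B2_def
      by (auto intro!: mult_nonneg_nonneg add_nonneg_nonneg)
  \<comment> \<open>The weight of exponent \<open>s + \<delta>\<close> is split so that
    \<open>\<delta>\<close> goes with \<open>\<eta>\<close> and \<open>s\<close> with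
    \<open>\<theta>\<close>. The origin is excluded because \<open>symbol_error\<close> requires
    \<open>0 < l\<close>; it is a null set.\<close>
  have sym: "\<bar>norm \<zeta> powr (2 * s) - ?q * S \<zeta>\<bar> \<le> B1 * (norm \<zeta> powr \<delta> * norm \<zeta> powr s)
    + B2" if "\<zeta> \<noteq> 0" for \<zeta> :: 'a
  proof -
    have p: "((norm \<zeta>)\<^sup>2) powr a = norm \<zeta> powr (2 * a)" for a
    proof -
      have "(norm \<zeta>)\<^sup>2 = norm \<zeta> powr 2" using that by (simp add: powr_numeral)
      then show ?thesis by (simp only: powr_powr)
    qed
    have "norm \<zeta> powr (2 * ((s + \<delta>) / 2)) = norm \<zeta> powr \<delta> * norm \<zeta> powr s"
      by (simp add: powr_add[symmetric] add.commute del: distrib_left_numeral)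
    then show ?thesis
      using symbol_error[OF s d k \<delta>, of "(norm \<zeta>)\<^sup>2" Nm Np] that unfolding S_def B1_def B2_def M_def p by simp
  qed
  have "\<bar>bilinear_form D s \<eta> \<theta> - sinc_form D s k Nm Np \<eta> \<theta>\<bar>
    = \<bar>LINT \<zeta>|lborel. (norm \<zeta> powr (2 * s) - ?q * S \<zeta>) * P \<zeta>\<bar>"
    unfolding bilinear_form_rfourier[OF es t s(1)] sinc P_def[symmetric] left_diff_distrib
    using Bochner_Integration.integral_diff[OF iB iSS] by simp
  also have "\<dots> \<le> (LINT \<zeta>|lborel. \<bar>(norm \<zeta> powr (2 * s) - ?q * S \<zeta>) * P \<zeta>\<bar>)"
    by (rule integral_abs_bound)
  also have "\<dots> \<le> (LINT \<zeta>|lborel. B1 * (norm (?Ed \<zeta>) * norm (?Ts \<zeta>)) + B2 * (norm (?E \<zeta>) * norm (?T \<zeta>)))"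
  proof (rule integral_mono_AE)
    show "integrable lborel (\<lambda>\<zeta>. \<bar>(norm \<zeta> powr (2 * s) - ?q * S \<zeta>) * P \<zeta>\<bar>)"
      unfolding left_diff_distrib by (intro integrable_abs Bochner_Integration.integrable_diff iB iSS)
    have "integrable lborel (\<lambda>\<zeta>. norm (?Ed \<zeta>) * norm (?Ts \<zeta>))"
      using integrable_norm[OF integrable_l2_mult[OF l(1,3)]] by (simp only: norm_mult)
    then show "integrable lborel (\<lambda>\<zeta>. B1 * (norm (?Ed \<zeta>) * norm (?Ts \<zeta>)) + B2 * (norm (?E \<zeta>) * norm (?T \<zeta>)))"
      using i0 by (intro Bochner_Integration.integrable_add integrable_mult_right)
    show "AE \<zeta> in lborel. \<bar>(norm \<zeta> powr (2 * s) - ?q * S \<zeta>) * P \<zeta>\<bar>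
        \<le> B1 * (norm (?Ed \<zeta>) * norm (?Ts \<zeta>)) + B2 * (norm (?E \<zeta>) * norm (?T \<zeta>))"
      using AE_lborel_singleton[of "0::'a"]
    proof eventually_elim
      case (elim \<zeta>)
      have "\<bar>(norm \<zeta> powr (2 * s) - ?q * S \<zeta>) * P \<zeta>\<bar>
        \<le> (B1 * (norm \<zeta> powr \<delta> * norm \<zeta> powr s) + B2) * (norm (?E \<zeta>) * norm (?T \<zeta>))"
        unfolding abs_mult using B by (intro mult_mono sym elim Pn) auto
      also have "\<dots> = B1 * (norm (?Ed \<zeta>) * norm (?Ts \<zeta>)) + B2 * (norm (?E \<zeta>) * norm (?T \<zeta>))"
        by (simp add: norm_mult algebra_simps)
      finally show ?case .
    qed
  qed
  also have "\<dots> = B1 * (LINT \<zeta>|lborel. norm (?Ed \<zeta>) * norm (?Ts \<zeta>)) + B2 * (LINT \<zeta>|lborel. norm (?E \<zeta>)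
    * norm (?T \<zeta>))"
  proof -
    have "integrable lborel (\<lambda>\<zeta>. norm (?Ed \<zeta>) * norm (?Ts \<zeta>))"
      using integrable_norm[OF integrable_l2_mult[OF l(1,3)]] by (simp only: norm_mult)
    then show ?thesis using i0 by (subst Bochner_Integration.integral_add) auto
  qed
  also have "\<dots> \<le> B1 * (sqrt (nsq lborel ?Ed) * sqrt (nsq lborel ?Ts)) + B2 * (sqrt (nsq lborel ?E)
    * sqrt (nsq lborel ?T))"
    by (intro add_mono mult_left_mono integral_norm_mult_le l B)
  also have "\<dots> \<le> B1 * (tilde_sobolev_norm D \<delta> \<eta> * tilde_sobolev_norm D s \<theta>) + B2 * (norm_on D \<eta>
    * norm_on D \<theta>)"
    unfolding norm_on_eq[OF se] norm_on_eq[OF st]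
  proof (intro add_right_mono mult_left_mono mult_mono B)
    show "sqrt (nsq lborel ?Ed) \<le> tilde_sobolev_norm D \<delta> \<eta>"
      using s \<delta> assms(12) by (intro tilde_sobolev_norm_ge) auto
    \<comment> \<open>Nonnegativity of the norm is inherited from its lower bound.\<close>
    then show "0 \<le> tilde_sobolev_norm D \<delta> \<eta>" by (rule order_trans[rotated]) simp
    show "sqrt (nsq lborel ?Ts) \<le> tilde_sobolev_norm D s \<theta>"
      using s assms(11) by (intro tilde_sobolev_norm_ge) auto
  qed simp
  finally show ?thesis unfolding B1_def B2_def M_def by (simp only: mult.assoc)
qed

end
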